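(* Let $f$ satisfy $(H_f)$ (as written out in the context), let $u:[0,T]\to\mathbb R$ be continuous and deterministic, and let $\xi$ be a square-integrable $\mathcal F_T$-measurable random variable with $\mathbb E[\xi]\ge u_T$. Then the BSDE with linear mean reflection $$Y_t=\xi+\int_t^T f(s,Y_s,Z_s)\,ds-\int_t^T Z_s\cdot dB_s+K_T-K_t,\qquad \mathbb E[Y_t]\ge u_t,\qquad 0\le t\le T,$$ has a unique deterministic square integrable flat solution, i.e. there is a unique triple $(Y,Z,K)\in\mathcal S^2\times\mathcal H^2\times\mathcal A^2_D$ satisfying $Y_t=\xi+\int_t^T f(s,Y_s,Z_s)\,ds-\int_t^T Z_s\cdot dB_s+K_T-K_t$ and $\mathbb E[Y_t]\ge u_t$ for all $0\le t\le T$, together with $\int_0^T(\mathbb E[Y_t]-u_t)\,dK_t=0$.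
   Context: $T>0$ is finite; $(\Omega,\mathcal F,\mathbb P)$ is a complete probability space carrying a $d$-dimensional standard Brownian motion $B=(B_t)_{0\le t\le T}$, with usual augmented filtration $\{\mathcal F_t\}_{0\le t\le T}$. $\mathcal S^2$: real-valued adapted continuous processes $Y$ with $\mathbb E[\sup_{0\le t\le T}|Y_t|^2]<\infty$. $\mathcal H^2$: predictable $\mathbb R^d$-valued processes $Z$ with $\mathbb E[\int_0^T|Z_s|^2ds]<\infty$. $\mathcal A^2$: nondecreasing processes $K\in\mathcal S^2$ with $K_0=0$; $\mathcal A^2_D$: the deterministic elements of $\mathcal A^2$. Uniqueness is understood in these spaces (indistinguishability for $Y$ and $K$, $d\mathbb P\otimes dt$-a.e. equality for $Z$). $(H_f)$: $f:\Omega\times[0,T]\times\mathbb R\times\mathbb R^d\to\mathbb R$ is measurable with respect to $\mathcal P\otimes\mathcal B(\mathbb R)\otimes\mathcal B(\mathbb R^d)$, $\mathcal P$ being the progressive $\sigma$-algebra on $\Omega\times[0,T]$; there is $\lambda\ge0$ such that $\mathbb P$-a.s., for all $t\in[0,T]$ and all $y,p\in\mathbb R$, $z,q\in\mathbb R^d$, $|f(t,y,z)-f(t,p,q)|\le\lambda(|y-p|+|z-q|)$; and $\mathbb E[\int_0^T|f(t,0,0)|^2dt]<\infty$. *)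

theory Defs
  imports "HOL-Probability.Probability"
begin

definition natural_filtration ::
  "'a measure \<Rightarrow> (real \<Rightarrow> 'a \<Rightarrow> 'b::topological_space) \<Rightarrow> real \<Rightarrow> 'a measure" where
  "natural_filtration M B t =
     sigma (space M) (\<Union>s\<in>{0..t}. {B s -` A \<inter> space M | A. A \<in> sets borel})"

definition augmented_filtration ::
  "'a measure \<Rightarrow> (real \<Rightarrow> 'a \<Rightarrow> 'b::topological_space) \<Rightarrow> real \<Rightarrow> 'a measure" where
  "augmented_filtration M B t =
     sigma (space M) (sets (natural_filtration M B t) \<union> null_sets M)"

definition standard_brownian_motion ::
  "'a measure \<Rightarrow> real \<Rightarrow> (real \<Rightarrow> 'a \<Rightarrow> real ^ 'd) \<Rightarrow> bool" where
  "standard_brownian_motion M T B \<longleftrightarrow>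
     (\<forall>t\<in>{0..T}. B t \<in> borel_measurable M) \<and>
     (AE \<omega> in M. B 0 \<omega> = 0) \<and>
     (AE \<omega> in M. continuous_on {0..T} (\<lambda>t. B t \<omega>)) \<and>
     (\<forall>s t. 0 \<le> s \<and> s < t \<and> t \<le> T \<longrightarrow>
        distributed M lborel (\<lambda>\<omega>. B t \<omega> - B s \<omega>)
          (\<lambda>x. ennreal (\<Prod>i\<in>UNIV. normal_density 0 (sqrt (t - s)) (x $ i))) \<and>
        prob_space.indep_set M (sets (natural_filtration M B s))
          {(\<lambda>\<omega>. B t \<omega> - B s \<omega>) -` A \<inter> space M | A. A \<in> sets borel})"

definition progressive_algebra ::
  "'a measure \<Rightarrow> (real \<Rightarrow> 'a measure) \<Rightarrow> real \<Rightarrow> ('a \<times> real) measure" where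
  "progressive_algebra M F T = sigma (space M \<times> {0..T})
     {A. A \<subseteq> space M \<times> {0..T} \<and>
         (\<forall>t\<in>{0..T}. A \<inter> (space M \<times> {0..t}) \<in> sets (F t \<Otimes>\<^sub>M restrict_space borel {0..t}))}"

definition predictable_algebra ::
  "'a measure \<Rightarrow> (real \<Rightarrow> 'a measure) \<Rightarrow> real \<Rightarrow> ('a \<times> real) measure" where
  "predictable_algebra M F T = sigma (space M \<times> {0..T})
     ({A \<times> {0} | A. A \<in> sets (F 0)} \<union>
      {A \<times> {s<..t} | A s t. 0 \<le> s \<and> s < t \<and> t \<le> T \<and> A \<in> sets (F s)})"

definition adapted_process ::
  "(real \<Rightarrow> 'a measure) \<Rightarrow> real \<Rightarrow> (real \<Rightarrow> 'a \<Rightarrow> real) \<Rightarrow> bool" where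
  "adapted_process F T X \<longleftrightarrow> (\<forall>t\<in>{0..T}. X t \<in> borel_measurable (F t))"

definition continuous_process ::
  "'a measure \<Rightarrow> real \<Rightarrow> (real \<Rightarrow> 'a \<Rightarrow> real) \<Rightarrow> bool" where
  "continuous_process M T X \<longleftrightarrow> (\<forall>\<omega>\<in>space M. continuous_on {0..T} (\<lambda>t. X t \<omega>))"

(* Processes are total functions of a real time variable; only their values on [0,T] matter. *)

definition S2 ::
  "'a measure \<Rightarrow> (real \<Rightarrow> 'a measure) \<Rightarrow> real \<Rightarrow> (real \<Rightarrow> 'a \<Rightarrow> real) set" where
  "S2 M F T = {Y. adapted_process F T Y \<and> continuous_process M T Y \<and>
     (\<integral>\<^sup>+\<omega>. (SUP t\<in>{0..T}. ennreal (\<bar>Y t \<omega>\<bar>\<^sup>2)) \<partial>M) < \<infinity>}"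

definition H2 ::
  "'a measure \<Rightarrow> (real \<Rightarrow> 'a measure) \<Rightarrow> real \<Rightarrow> (real \<Rightarrow> 'a \<Rightarrow> real ^ 'd) set" where
  "H2 M F T = {Z. (\<lambda>(\<omega>, t). Z t \<omega>) \<in> borel_measurable (predictable_algebra M F T) \<and>
     (\<integral>\<^sup>+\<omega>. (\<integral>\<^sup>+s\<in>{0..T}. ennreal ((norm (Z s \<omega>))\<^sup>2) \<partial>lborel) \<partial>M) < \<infinity>}"

definition A2 ::
  "'a measure \<Rightarrow> (real \<Rightarrow> 'a measure) \<Rightarrow> real \<Rightarrow> (real \<Rightarrow> 'a \<Rightarrow> real) set" where
  "A2 M F T = {K \<in> S2 M F T. \<forall>\<omega>\<in>space M. mono_on {0..T} (\<lambda>t. K t \<omega>) \<and> K 0 \<omega> = 0}"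

definition A2_D ::
  "'a measure \<Rightarrow> (real \<Rightarrow> 'a measure) \<Rightarrow> real \<Rightarrow> (real \<Rightarrow> real) set" where
  "A2_D M F T = {K. (\<lambda>t \<omega>. K t) \<in> A2 M F T}"

(* (n, \<tau>, \<phi>) encodes the simple process  \<Sum>i<n. \<phi> i * 1_(\<tau> i, \<tau> (i+1)]. *)

definition simple_integrand ::
  "'a measure \<Rightarrow> (real \<Rightarrow> 'a measure) \<Rightarrow> real \<Rightarrow> nat \<Rightarrow> (nat \<Rightarrow> real) \<Rightarrow>
   (nat \<Rightarrow> 'a \<Rightarrow> real ^ 'd) \<Rightarrow> bool" where
  "simple_integrand M F T n \<tau> \<phi> \<longleftrightarrow>
     0 \<le> \<tau> 0 \<and> \<tau> n \<le> T \<and> (\<forall>i<n. \<tau> i < \<tau> (Suc i)) \<and>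
     (\<forall>i<n. \<phi> i \<in> borel_measurable (F (\<tau> i)) \<and>
            (\<exists>C. \<forall>\<omega>\<in>space M. norm (\<phi> i \<omega>) \<le> C))"

definition simple_process ::
  "nat \<Rightarrow> (nat \<Rightarrow> real) \<Rightarrow> (nat \<Rightarrow> 'a \<Rightarrow> real ^ 'd) \<Rightarrow> real \<Rightarrow> 'a \<Rightarrow> real ^ 'd" where
  "simple_process n \<tau> \<phi> s \<omega> = (\<Sum>i<n. indicat_real {\<tau> i<..\<tau> (Suc i)} s *\<^sub>R \<phi> i \<omega>)"

definition simple_ito_integral ::
  "(real \<Rightarrow> 'a \<Rightarrow> real ^ 'd) \<Rightarrow> nat \<Rightarrow> (nat \<Rightarrow> real) \<Rightarrow> (nat \<Rightarrow> 'a \<Rightarrow> real ^ 'd) \<Rightarrow>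
   real \<Rightarrow> 'a \<Rightarrow> real" where
  "simple_ito_integral B n \<tau> \<phi> t \<omega> =
     (\<Sum>i<n. \<phi> i \<omega> \<bullet> (B (min (\<tau> (Suc i)) t) \<omega> - B (min (\<tau> i) t) \<omega>))"

(* X is a continuous version of the process (\<integral>_0^t Z_s . dB_s) for t in [0,T]: the mean-square
   limit of the integrals of simple processes approximating Z.  It is determined by Z up to
   indistinguishability. *)

definition has_ito_integral ::
  "'a measure \<Rightarrow> (real \<Rightarrow> 'a measure) \<Rightarrow> real \<Rightarrow> (real \<Rightarrow> 'a \<Rightarrow> real ^ 'd) \<Rightarrow>
   (real \<Rightarrow> 'a \<Rightarrow> real ^ 'd) \<Rightarrow> (real \<Rightarrow> 'a \<Rightarrow> real) \<Rightarrow> bool" where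
  "has_ito_integral M F T B Z X \<longleftrightarrow>
     adapted_process F T X \<and> continuous_process M T X \<and>
     (\<exists>n \<tau> \<phi>.
        (\<forall>k. simple_integrand M F T (n k) (\<tau> k) (\<phi> k)) \<and>
        ((\<lambda>k. \<integral>\<^sup>+\<omega>. (\<integral>\<^sup>+s\<in>{0..T}.
            ennreal ((norm (simple_process (n k) (\<tau> k) (\<phi> k) s \<omega> - Z s \<omega>))\<^sup>2) \<partial>lborel) \<partial>M)
          \<longlonglongrightarrow> 0) \<and>
        (\<forall>t\<in>{0..T}.
          (\<lambda>k. \<integral>\<^sup>+\<omega>. ennreal (\<bar>simple_ito_integral B (n k) (\<tau> k) (\<phi> k) t \<omega> - X t \<omega>\<bar>\<^sup>2) \<partial>M)
            \<longlonglongrightarrow> 0))"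

definition standard_generator ::
  "'a measure \<Rightarrow> (real \<Rightarrow> 'a measure) \<Rightarrow> real \<Rightarrow>
   ('a \<Rightarrow> real \<Rightarrow> real \<Rightarrow> real ^ 'd \<Rightarrow> real) \<Rightarrow> bool" where
  "standard_generator M F T f \<longleftrightarrow>
     (\<lambda>((\<omega>, t), y, z). f \<omega> t y z) \<in>
       borel_measurable (progressive_algebra M F T \<Otimes>\<^sub>M (borel \<Otimes>\<^sub>M borel)) \<and>
     (\<exists>L\<ge>0. AE \<omega> in M. \<forall>t\<in>{0..T}. \<forall>y p z q.
        \<bar>f \<omega> t y z - f \<omega> t p q\<bar> \<le> L * (\<bar>y - p\<bar> + norm (z - q))) \<and>
     (\<integral>\<^sup>+\<omega>. (\<integral>\<^sup>+t\<in>{0..T}. ennreal (\<bar>f \<omega> t 0 0\<bar>\<^sup>2) \<partial>lborel) \<partial>M) < \<infinity>"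

definition mean_reflected_solution ::
  "'a measure \<Rightarrow> (real \<Rightarrow> 'a measure) \<Rightarrow> real \<Rightarrow> (real \<Rightarrow> 'a \<Rightarrow> real ^ 'd) \<Rightarrow>
   ('a \<Rightarrow> real \<Rightarrow> real \<Rightarrow> real ^ 'd \<Rightarrow> real) \<Rightarrow> (real \<Rightarrow> real) \<Rightarrow> ('a \<Rightarrow> real) \<Rightarrow>
   (real \<Rightarrow> 'a \<Rightarrow> real) \<Rightarrow> (real \<Rightarrow> 'a \<Rightarrow> real ^ 'd) \<Rightarrow> (real \<Rightarrow> real) \<Rightarrow> bool" where
  "mean_reflected_solution M F T B f u \<xi> Y Z K \<longleftrightarrow>
     Y \<in> S2 M F T \<and> Z \<in> H2 M F T \<and> K \<in> A2_D M F T \<and>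
     (\<exists>X. has_ito_integral M F T B Z X \<and>
       (AE \<omega> in M. \<forall>t\<in>{0..T}.
          Y t \<omega> = \<xi> \<omega> + (LINT s:{t..T}|lborel. f \<omega> s (Y s \<omega>) (Z s \<omega>))
                  - (X T \<omega> - X t \<omega>) + K T - K t)) \<and>
     (\<forall>t\<in>{0..T}. integral\<^sup>L M (Y t) \<ge> u t)"

(* interval_measure needs a nondecreasing right-continuous function on the whole line, hence K is
   extended from [0,T] by the constants K 0 and K T, which adds no mass outside [0,T]. *)

definition flatness_condition ::
  "'a measure \<Rightarrow> real \<Rightarrow> (real \<Rightarrow> real) \<Rightarrow> (real \<Rightarrow> 'a \<Rightarrow> real) \<Rightarrow> (real \<Rightarrow> real) \<Rightarrow> bool" where
  "flatness_condition M T u Y K \<longleftrightarrow>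
     (LINT t:{0..T}|interval_measure (\<lambda>t. K (max 0 (min T t))). integral\<^sup>L M (Y t) - u t) = 0"

end

theory Submission
  imports Defs
begin

text \<open>
  When the drift is a given process \<open>C\<close>, the equation splits. Martingale representation of
  \<open>\<xi> + \<integral>\<^sub>0 C\<close> gives the solution \<open>(y, Z)\<close> without reflection. As \<open>K\<close> is deterministic, the
  constraint only concerns \<open>h t = E (y t)\<close>, and the backward Skorokhod problem for \<open>h\<close> is solved by
  \<open>K T - K t = (SUP s\<in>{t..T}. max 0 (u s - h s))\<close>. This defines a map \<open>C \<mapsto> f (Y, Z)\<close>, which is a
  contraction on the square-integrable progressive processes for the weight \<open>exp (\<beta> t)\<close> with \<open>\<beta>\<close>
  large; its fixed point is the solution.

  The stability estimate behind the contraction needs no Ito formula: for the difference \<open>\<delta>\<close> of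
  two unreflected solutions, with drift difference \<open>D\<close> and integrand difference \<open>V\<close>, squaring
  \<open>\<delta> t + \<integral>\<^sub>t V dB = \<integral>\<^sub>t D\<close>, orthogonality of martingale increments and Fubini give
  \<open>E |\<delta> t|^2 + E \<integral>\<^sub>t |V|^2 = 2 E \<integral>\<^sub>t D \<delta>\<close>.

  Martingale representation is obtained by showing that \<open>exp (\<i> l (B t - B s))\<close>, cut into small
  increments, is a limit of stochastic integrals up to centred independent remainders of second
  order; trigonometric functions of \<open>B\<close> then generate the filtration.
\<close>

section \<open>Square-integrable functions\<close>

text \<open>The unknown of the fixed point is the drift process, not \<open>(Y, Z)\<close>: drifts
  form one closed subspace of an L2 space, so completeness of that space is all the iteration uses,
  and the solution map may pick any solution because every estimate concerns arbitrary solutions.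
  The obstacle specific to mean reflection is that \<open>K\<close> is controlled only through
  means: for two drivers, the difference of the remaining pushes at time t is at most the supremum,
  over times after t, of the difference of the unreflected means. An L2 norm in time does not
  control such a supremum, so the energy estimate is also used at each fixed time. Multiplied by the
  weight, this pointwise bound is of order 1/\<beta>, and integrating it over the horizon costs a
  factor \<open>T\<close>; \<beta> is therefore chosen in terms of \<open>T\<close>, and the
  contraction holds on all of \<open>{0..T}\<close> at once. The martingale property is expressed as
  orthogonality of \<open>X T - X t\<close> to every square-integrable \<open>F t\<close>-measurable
  variable: simple integrals have it by independence, and it survives L2 limits.\<close>

definition square_integrable :: "'a measure \<Rightarrow> ('a \<Rightarrow> 'b::euclidean_space) \<Rightarrow> bool" where
  "square_integrable M f \<longleftrightarrow> f \<in> borel_measurable M \<and> integrable M (\<lambda>x. (norm (f x))\<^sup>2)"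

text \<open>The Bochner integral of a non-integrable function is 0, so the value is meaningful only
  for \<open>square_integrable\<close> functions. Functions are not identified almost everywhere;
  norm zero yields an AE equation.\<close>

definition l2_norm :: "'a measure \<Rightarrow> ('a \<Rightarrow> 'b::euclidean_space) \<Rightarrow> real" where
  "l2_norm M f = sqrt (\<integral>x. (norm (f x))\<^sup>2 \<partial>M)"

lemma square_integrableD:
  assumes "square_integrable M f"
  shows "f \<in> borel_measurable M" "integrable M (\<lambda>x. (norm (f x))\<^sup>2)"
  using assms by (auto simp: square_integrable_def)

lemma square_integrable_iff_nn_integral:
  "square_integrable M f \<longleftrightarrow>
     f \<in> borel_measurable M \<and> (\<integral>\<^sup>+x. ennreal ((norm (f x))\<^sup>2) \<partial>M) < \<infinity>"
  unfolding square_integrable_def integrable_iff_bounded by auto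

lemma l2_norm_nonneg [simp]: "0 \<le> l2_norm M f"
  by (simp add: l2_norm_def)

lemma l2_norm_power2: "(l2_norm M f)\<^sup>2 = (\<integral>x. (norm (f x))\<^sup>2 \<partial>M)"
  by (simp add: l2_norm_def)

lemma nn_integral_l2_norm:
  assumes "square_integrable M f"
  shows "(\<integral>\<^sup>+x. ennreal ((norm (f x))\<^sup>2) \<partial>M) = ennreal ((l2_norm M f)\<^sup>2)"
  unfolding l2_norm_power2
  by (rule nn_integral_eq_integral) (use square_integrableD[OF assms] in auto)

lemma square_integrable_bound:
  fixes f :: "'a \<Rightarrow> 'b::euclidean_space" and g :: "'a \<Rightarrow> 'c::euclidean_space"
  assumes "square_integrable M g" "f \<in> borel_measurable M" "AE x in M. norm (f x) \<le> norm (g x)"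
  shows "square_integrable M f" "l2_norm M f \<le> l2_norm M g"
proof -
  have ae: "AE x in M. (norm (f x))\<^sup>2 \<le> (norm (g x))\<^sup>2"
    using assms(3) by eventually_elim (simp add: power_mono)
  show *: "square_integrable M f"
    unfolding square_integrable_def
    using assms(2) ae
    by (auto intro!: Bochner_Integration.integrable_bound[OF square_integrableD(2)[OF assms(1)]])
  show "l2_norm M f \<le> l2_norm M g"
    unfolding l2_norm_def
    using integral_mono_AE[OF square_integrableD(2)[OF *] square_integrableD(2)[OF assms(1)] ae] by simp
qed

lemma square_integrable_inner:
  assumes "square_integrable M f" "square_integrable M g"
  shows "integrable M (\<lambda>x. f x \<bullet> g x)"
proof (rule Bochner_Integration.integrable_bound)
  show "integrable M (\<lambda>x. (norm (f x))\<^sup>2 + (norm (g x))\<^sup>2)"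
    by (intro Bochner_Integration.integrable_add integrable_mult_right integrable_const square_integrableD(2) assms)
  show "(\<lambda>x. f x \<bullet> g x) \<in> borel_measurable M"
    using assms by (auto dest!: square_integrableD(1))
  have "\<bar>f x \<bullet> g x\<bar> \<le> (norm (f x))\<^sup>2 + (norm (g x))\<^sup>2" for x
  proof -
    have "\<bar>f x \<bullet> g x\<bar> \<le> norm (f x) * norm (g x)" by (rule Cauchy_Schwarz_ineq2)
    moreover have "0 \<le> norm (f x) * norm (g x)" by simp
    ultimately show ?thesis
      using sum_squares_bound[of "norm (f x)" "norm (g x)"] by linarith
  qed
  then show "AE x in M. norm (f x \<bullet> g x) \<le> norm ((norm (f x))\<^sup>2 + (norm (g x))\<^sup>2)" by auto
qed

lemma square_integrable_mult:
  fixes f g :: "'a \<Rightarrow> real"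
  assumes "square_integrable M f" "square_integrable M g"
  shows "integrable M (\<lambda>x. f x * g x)"
  using square_integrable_inner[OF assms] by simp

lemma square_integrable_scaleR:
  assumes "square_integrable M f"
  shows "square_integrable M (\<lambda>x. c *\<^sub>R f x)" "l2_norm M (\<lambda>x. c *\<^sub>R f x) = \<bar>c\<bar> * l2_norm M f"
  using assms by (auto simp: square_integrable_def l2_norm_def power_mult_distrib real_sqrt_mult)

lemma square_integrable_cmult:
  fixes f :: "'a \<Rightarrow> real"
  assumes "square_integrable M f"
  shows "square_integrable M (\<lambda>x. c * f x)" "l2_norm M (\<lambda>x. c * f x) = \<bar>c\<bar> * l2_norm M f"
  using square_integrable_scaleR[OF assms, of c] by auto

lemma square_integrable_uminus:
  assumes "square_integrable M f"
  shows "square_integrable M (\<lambda>x. - f x)"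
  using assms by (auto simp: square_integrable_def)

lemma norm_add_squared_le: "(norm (x + y))\<^sup>2 \<le> 2 * (norm x)\<^sup>2 + 2 * (norm y)\<^sup>2"
  for x y :: "'b::real_normed_vector"
proof -
  have "(norm (x + y))\<^sup>2 \<le> (norm x + norm y)\<^sup>2" by (simp add: power_mono norm_triangle_ineq)
  also have "\<dots> \<le> 2 * (norm x)\<^sup>2 + 2 * (norm y)\<^sup>2"
    using sum_squares_bound[of "norm x" "norm y"] by (simp add: power2_sum)
  finally show ?thesis .
qed

lemma square_integrable_add:
  assumes "square_integrable M f" "square_integrable M g"
  shows "square_integrable M (\<lambda>x. f x + g x)"
  unfolding square_integrable_def
proof
  show [measurable]: "(\<lambda>x. f x + g x) \<in> borel_measurable M"
    using assms by (auto dest!: square_integrableD(1))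
  show "integrable M (\<lambda>x. (norm (f x + g x))\<^sup>2)"
  proof (rule Bochner_Integration.integrable_bound)
    show "integrable M (\<lambda>x. 2 * (norm (f x))\<^sup>2 + 2 * (norm (g x))\<^sup>2)"
      by (intro Bochner_Integration.integrable_add integrable_mult_right integrable_const square_integrableD(2) assms)
  qed (auto simp: norm_add_squared_le)
qed

lemma square_integrable_diff:
  assumes "square_integrable M f" "square_integrable M g"
  shows "square_integrable M (\<lambda>x. f x - g x)"
  using square_integrable_add[OF assms(1) square_integrable_uminus[OF assms(2)]] by simp

lemma square_integrable_zero [simp]: "square_integrable M (\<lambda>x. 0)"
  by (simp add: square_integrable_def)

lemma square_integrable_sum:
  assumes "\<And>i. i \<in> I \<Longrightarrow> square_integrable M (f i)"
  shows "square_integrable M (\<lambda>x. \<Sum>i\<in>I. f i x)"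
  using assms by (induction I rule: infinite_finite_induct) (auto intro: square_integrable_add)

lemma square_integrable_cong_AE:
  assumes "square_integrable M f" "g \<in> borel_measurable M" "AE x in M. f x = g x"
  shows "square_integrable M g" "l2_norm M g = l2_norm M f"
proof -
  have 1: "AE x in M. norm (g x) \<le> norm (f x)" using assms(3) by auto
  show *: "square_integrable M g" by (rule square_integrable_bound(1)[OF assms(1,2) 1])
  have 2: "AE x in M. norm (f x) \<le> norm (g x)" using assms(3) by auto
  show "l2_norm M g = l2_norm M f"
    using square_integrable_bound(2)[OF assms(1,2) 1]
      square_integrable_bound(2)[OF * square_integrableD(1)[OF assms(1)] 2] by simp
qed

lemma (in finite_measure) square_integrable_bounded:
  assumes "f \<in> borel_measurable M" "\<And>x. x \<in> space M \<Longrightarrow> norm (f x) \<le> C"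
  shows "square_integrable M f"
  unfolding square_integrable_def
proof
  have [measurable]: "f \<in> borel_measurable M" by fact
  show "integrable M (\<lambda>x. (norm (f x))\<^sup>2)"
    by (rule integrable_const_bound[of _ "C\<^sup>2"]) (auto intro!: AE_I2 power_mono assms)
qed (fact assms)

lemma (in finite_measure) square_integrable_integrable:
  fixes f :: "'a \<Rightarrow> 'b::euclidean_space"
  assumes "square_integrable M f"
  shows "integrable M f"
proof (rule Bochner_Integration.integrable_bound)
  show "integrable M (\<lambda>x. 1 + (norm (f x))\<^sup>2)" by (intro Bochner_Integration.integrable_add integrable_mult_right integrable_const square_integrableD(2) assms)
  have "norm (f x) \<le> 1 + (norm (f x))\<^sup>2" for x
    using sum_squares_bound[of 1 "norm (f x)"] norm_ge_zero[of "f x"] unfolding one_power2 by linarith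
  then show "AE x in M. norm (f x) \<le> norm (1 + (norm (f x))\<^sup>2)" by auto
qed (use assms in \<open>auto dest: square_integrableD\<close>)

lemma (in finite_measure) square_integrable_const [simp]: "square_integrable M (\<lambda>x. c)"
  by (rule square_integrable_bounded[of _ "norm c"]) auto

lemma square_integrable_mult_bounded:
  fixes f :: "'a \<Rightarrow> real" and g :: "'a \<Rightarrow> 'b::euclidean_space"
  assumes "square_integrable M g" "f \<in> borel_measurable M" "\<And>x. x \<in> space M \<Longrightarrow> \<bar>f x\<bar> \<le> C"
  shows "square_integrable M (\<lambda>x. f x *\<^sub>R g x)"
proof (rule square_integrable_bound(1)[OF square_integrable_scaleR(1)[OF assms(1), of C]])
  have "norm (f x *\<^sub>R g x) \<le> norm (C *\<^sub>R g x)" if "x \<in> space M" for x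
    using assms(3)[OF that] by (simp add: mult_right_mono)
  then show "AE x in M. norm (f x *\<^sub>R g x) \<le> norm (C *\<^sub>R g x)" by auto
qed (use assms in \<open>auto dest!: square_integrableD(1)\<close>)

lemma l2_norm_eq_0_iff:
  assumes "square_integrable M f"
  shows "l2_norm M f = 0 \<longleftrightarrow> (AE x in M. f x = 0)"
  unfolding l2_norm_def real_sqrt_eq_zero_cancel_iff
  using integral_nonneg_eq_0_iff_AE[OF square_integrableD(2)[OF assms]] by simp

lemma power2_norm_add: "(norm (x + y))\<^sup>2 = (norm x)\<^sup>2 + 2 * (x \<bullet> y) + (norm y)\<^sup>2"
  for x y :: "'b::real_inner"
  by (simp add: power2_norm_eq_inner inner_add inner_commute)

lemma l2_norm_add_power2:
  assumes "square_integrable M f" "square_integrable M g"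
  shows "(l2_norm M (\<lambda>x. f x + g x))\<^sup>2
    = (l2_norm M f)\<^sup>2 + 2 * (\<integral>x. f x \<bullet> g x \<partial>M) + (l2_norm M g)\<^sup>2"
  unfolding l2_norm_power2 power2_norm_add
  using square_integrableD(2)[OF assms(1)] square_integrableD(2)[OF assms(2)] square_integrable_inner[OF assms] by simp

lemma integral_Cauchy_Schwarz:
  assumes f: "square_integrable M f" and g: "square_integrable M g"
  shows "\<bar>\<integral>x. f x \<bullet> g x \<partial>M\<bar> \<le> l2_norm M f * l2_norm M g"
proof (cases "l2_norm M g = 0")
  case True
  then have "AE x in M. g x = 0" using l2_norm_eq_0_iff[OF g] by simp
  then have "AE x in M. f x \<bullet> g x = 0" by eventually_elim simp
  then show ?thesis using True integral_eq_zero_AE by fastforce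
next
  case False
  define b where "b = (\<integral>x. f x \<bullet> g x \<partial>M)"
  define c where "c = (l2_norm M g)\<^sup>2"
  have c: "c > 0" using False by (simp add: c_def)
  \<comment> \<open>The coefficient \<open>- (b / c)\<close> minimises the quadratic polynomial
    \<open>s \<mapsto> (l2_norm M (\<lambda>x. f x + s *\<^sub>R g x))\<^sup>2\<close>.\<close>
  have "0 \<le> (l2_norm M (\<lambda>x. f x + (- (b / c)) *\<^sub>R g x))\<^sup>2" by simp
  also have "\<dots> = (l2_norm M f)\<^sup>2 + 2 * (- (b/c) * b) + (b/c)\<^sup>2 * c"
    unfolding l2_norm_add_power2[OF f square_integrable_scaleR(1)[OF g]]
      square_integrable_scaleR(2)[OF g]
    by (simp add: power_mult_distrib power_divide b_def c_def)
  also have "\<dots> = (l2_norm M f)\<^sup>2 - b\<^sup>2 / c" using c by (simp add: power2_eq_square)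
  finally have "b\<^sup>2 \<le> (l2_norm M f)\<^sup>2 * c" using c by (simp add: field_simps)
  then have "b\<^sup>2 \<le> (l2_norm M f * l2_norm M g)\<^sup>2" by (simp add: c_def power_mult_distrib)
  then show ?thesis unfolding b_def[symmetric]
    by (metis abs_le_square_iff abs_of_nonneg l2_norm_nonneg mult_nonneg_nonneg)
qed

lemma l2_norm_triangle:
  assumes "square_integrable M f" "square_integrable M g"
  shows "l2_norm M (\<lambda>x. f x + g x) \<le> l2_norm M f + l2_norm M g"
proof (rule power2_le_imp_le)
  show "(l2_norm M (\<lambda>x. f x + g x))\<^sup>2 \<le> (l2_norm M f + l2_norm M g)\<^sup>2"
    using l2_norm_add_power2[OF assms] integral_Cauchy_Schwarz[OF assms]
    by (simp add: power2_sum)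
qed simp

lemma l2_norm_minus [simp]: "l2_norm M (\<lambda>x. - f x) = l2_norm M f"
  by (simp add: l2_norm_def)

lemma l2_norm_minus_commute: "l2_norm M (\<lambda>x. f x - g x) = l2_norm M (\<lambda>x. g x - f x)"
  by (simp add: l2_norm_def norm_minus_commute)

lemma l2_norm_triangle_diff:
  assumes "square_integrable M f" "square_integrable M g"
  shows "\<bar>l2_norm M f - l2_norm M g\<bar> \<le> l2_norm M (\<lambda>x. f x - g x)"
proof -
  note d = square_integrable_diff[OF assms]
  have 1: "l2_norm M f \<le> l2_norm M (\<lambda>x. f x - g x) + l2_norm M g"
    using l2_norm_triangle[OF d assms(2)] by simp
  have 2: "l2_norm M g \<le> l2_norm M (\<lambda>x. f x - g x) + l2_norm M f"
    using l2_norm_triangle[OF square_integrable_uminus[OF d] assms(1)] l2_norm_minus_commute[of M f g] by simp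
  show ?thesis using 1 2 by linarith
qed

lemma l2_norm_dist_triangle:
  assumes "square_integrable M f" "square_integrable M g" "square_integrable M h"
  shows "l2_norm M (\<lambda>x. f x - h x) \<le> l2_norm M (\<lambda>x. f x - g x) + l2_norm M (\<lambda>x. g x - h x)"
  using l2_norm_triangle[OF square_integrable_diff[OF assms(1,2)] square_integrable_diff[OF assms(2,3)]]
  by simp

lemma tendsto_l2_norm:
  assumes "\<And>n. square_integrable M (f n)" "square_integrable M g"
    and "(\<lambda>n. l2_norm M (\<lambda>x. f n x - g x)) \<longlonglongrightarrow> 0"
  shows "(\<lambda>n. l2_norm M (f n)) \<longlonglongrightarrow> l2_norm M g"
proof (rule LIM_zero_cancel, rule tendsto_rabs_zero_cancel, rule Lim_null_comparison[OF _ assms(3)])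
  show "\<forall>\<^sub>F n in sequentially. norm \<bar>l2_norm M (f n) - l2_norm M g\<bar> \<le> l2_norm M (\<lambda>x. f n x - g x)"
    using l2_norm_triangle_diff[OF assms(1,2)] by simp
qed

lemma tendsto_integral_inner:
  assumes "\<And>n. square_integrable M (f n)" "square_integrable M g" "square_integrable M h"
    and "(\<lambda>n. l2_norm M (\<lambda>x. f n x - g x)) \<longlonglongrightarrow> 0"
  shows "(\<lambda>n. \<integral>x. h x \<bullet> f n x \<partial>M) \<longlonglongrightarrow> (\<integral>x. h x \<bullet> g x \<partial>M)"
proof (rule LIM_zero_cancel, rule tendsto_rabs_zero_cancel, rule Lim_null_comparison)
  show "(\<lambda>n. l2_norm M h * l2_norm M (\<lambda>x. f n x - g x)) \<longlonglongrightarrow> 0"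
    using tendsto_mult_right_zero[OF assms(4)] by simp
  show "\<forall>\<^sub>F n in sequentially. norm \<bar>(\<integral>x. h x \<bullet> f n x \<partial>M) - (\<integral>x. h x \<bullet> g x \<partial>M)\<bar>
    \<le> l2_norm M h * l2_norm M (\<lambda>x. f n x - g x)"
  proof (rule always_eventually, rule)
    fix n
    have "(\<integral>x. h x \<bullet> f n x \<partial>M) - (\<integral>x. h x \<bullet> g x \<partial>M) = (\<integral>x. h x \<bullet> (f n x - g x) \<partial>M)"
      unfolding inner_diff_right
      by (rule Bochner_Integration.integral_diff[symmetric])
        (auto intro!: square_integrable_inner assms)
    then show "norm \<bar>(\<integral>x. h x \<bullet> f n x \<partial>M) - (\<integral>x. h x \<bullet> g x \<partial>M)\<bar>
      \<le> l2_norm M h * l2_norm M (\<lambda>x. f n x - g x)"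
      using integral_Cauchy_Schwarz[OF assms(3) square_integrable_diff[OF assms(1,2)]] by simp
  qed
qed

section \<open>Almost sure limits and completeness of L2\<close>

lemma l2_norm_Fatou:
  fixes f :: "nat \<Rightarrow> 'a \<Rightarrow> 'b::euclidean_space"
  assumes "\<And>n. square_integrable M (f n)" "g \<in> borel_measurable M"
    and lim: "AE x in M. (\<lambda>n. f n x) \<longlonglongrightarrow> g x" and bd: "\<And>n. l2_norm M (f n) \<le> C" 
  shows "square_integrable M g" "l2_norm M g \<le> C"
proof -
  have C: "C \<ge> 0" using bd[of 0] l2_norm_nonneg order_trans by blast
  have "(\<integral>\<^sup>+x. ennreal ((norm (g x))\<^sup>2) \<partial>M) = (\<integral>\<^sup>+x. liminf (\<lambda>n. ennreal ((norm (f n x))\<^sup>2)) \<partial>M)"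
  proof (rule nn_integral_cong_AE, use lim in eventually_elim)
    fix x assume "(\<lambda>n. f n x) \<longlonglongrightarrow> g x"
    then have "(\<lambda>n. ennreal ((norm (f n x))\<^sup>2)) \<longlonglongrightarrow> ennreal ((norm (g x))\<^sup>2)"
      by (intro tendsto_intros)
    from lim_imp_Liminf[OF _ this] show "ennreal ((norm (g x))\<^sup>2) = liminf (\<lambda>n. ennreal ((norm (f n x))\<^sup>2))"
      by (simp add: lim_imp_Liminf)
  qed
  also have "\<dots> \<le> liminf (\<lambda>n. \<integral>\<^sup>+x. ennreal ((norm (f n x))\<^sup>2) \<partial>M)"
    by (rule nn_integral_liminf) (use assms(1) in \<open>auto dest: square_integrableD\<close>)
  also have "\<dots> \<le> ennreal (C\<^sup>2)"
    unfolding nn_integral_l2_norm[OF assms(1)]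
    by (rule Liminf_le) (auto intro!: always_eventually ennreal_leI power_mono bd)
  finally have le: "(\<integral>\<^sup>+x. ennreal ((norm (g x))\<^sup>2) \<partial>M) \<le> ennreal (C\<^sup>2)" .
  show *: "square_integrable M g"
    unfolding square_integrable_iff_nn_integral using assms(2) le by (auto simp: le_less_trans)
  have "ennreal ((l2_norm M g)\<^sup>2) \<le> ennreal (C\<^sup>2)" using le nn_integral_l2_norm[OF *] by simp
  then have "(l2_norm M g)\<^sup>2 \<le> C\<^sup>2" by (simp add: ennreal_le_iff)
  then show "l2_norm M g \<le> C" using C power2_le_imp_le by blast
qed

text \<open>The factors \<open>2 ^ k\<close> turn the bounds \<open>C * (1/4) ^ k\<close> into the
  summable \<open>C * (1/2) ^ k\<close>, so the series of \<open>2 ^ k * a k\<close> has finite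
  integral and is finite almost everywhere; its value is \<open>D\<close>. With squared increments
  as \<open>a k\<close> this gives almost sure convergence of a fast L2 Cauchy sequence, and with
  squared suprema of paths it gives uniform convergence.\<close>

lemma nn_integral_fast_Cauchy:
  fixes a :: "nat \<Rightarrow> 'a \<Rightarrow> ennreal"
  assumes [measurable]: "\<And>k. a k \<in> borel_measurable M"
    and le: "\<And>k. (\<integral>\<^sup>+x. (a k x) \<partial>M) \<le> ennreal (C * (1/4) ^ k)" and C: "C \<ge> 0"
  shows "AE x in M. \<exists>D\<ge>0. \<forall>k. a k x \<le> ennreal (D * (1/2) ^ k)"
proof -
  have "(\<integral>\<^sup>+x. (\<Sum>k. ennreal (2 ^ k) * a k x) \<partial>M) = (\<Sum>k. ennreal (2 ^ k) * (\<integral>\<^sup>+x. a k x \<partial>M))"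
    by (subst nn_integral_suminf) (auto simp: nn_integral_cmult)
  also have "\<dots> \<le> (\<Sum>k. ennreal (C * (1/2) ^ k))"
  proof (rule suminf_le)
    fix k
    have "ennreal (2 ^ k) * (\<integral>\<^sup>+x. a k x \<partial>M) \<le> ennreal (2 ^ k) * ennreal (C * (1/4) ^ k)"
      by (rule mult_left_mono[OF le]) simp
    also have "\<dots> = ennreal (2 ^ k * (C * (1/4) ^ k))" using C by (simp add: ennreal_mult)
    also have "2 ^ k * (C * (1/4) ^ k) = C * (1/2 :: real) ^ k"
      by (simp add: power_divide power_mult_distrib[symmetric] field_simps)
    finally show "ennreal (2 ^ k) * (\<integral>\<^sup>+x. a k x \<partial>M) \<le> ennreal (C * (1/2) ^ k)" .
  qed auto
  also have "\<dots> = ennreal (\<Sum>k. C * (1/2) ^ k)"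
    by (rule suminf_ennreal2) (use C in auto)
  also have "\<dots> < \<infinity>" by simp
  finally have "AE x in M. (\<Sum>k. ennreal (2 ^ k) * a k x) \<noteq> \<infinity>"
    by (intro nn_integral_PInf_AE) auto
  then show ?thesis
  proof eventually_elim
    case (elim x)
    define D where "D = enn2real (\<Sum>k. ennreal (2 ^ k) * a k x)"
    have D: "ennreal D = (\<Sum>k. ennreal (2 ^ k) * a k x)" using elim by (simp add: D_def top.not_eq_extremum)
    have "a k x \<le> ennreal (D * (1/2) ^ k)" for k
    proof -
      have "ennreal (2 ^ k) * a k x \<le> ennreal D"
        unfolding D using sum_le_suminf[of "\<lambda>k. ennreal (2 ^ k) * a k x" "{k}"] by simp
      then have "ennreal ((1/2) ^ k) * (ennreal (2 ^ k) * a k x) \<le> ennreal ((1/2) ^ k) * ennreal D"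
        by (rule mult_left_mono) simp
      moreover have "ennreal ((1/2) ^ k) * (ennreal (2 ^ k) * a k x) = a k x"
        by (simp add: mult.assoc[symmetric] ennreal_mult[symmetric] power_divide)
      ultimately show ?thesis
        by (simp add: ennreal_mult[symmetric] D_def mult.commute)
    qed
    then show ?case by (intro exI[of _ D]) (auto simp: D_def)
  qed
qed

lemma summable_sqrt_geometric: "summable (\<lambda>k. sqrt (D * (1/2) ^ k))"
proof -
  have "summable (\<lambda>k. sqrt D * (sqrt (1/2)) ^ k)"
    by (intro summable_mult summable_geometric) (auto simp: real_sqrt_divide)
  then show ?thesis by (simp add: real_sqrt_mult real_sqrt_power)
qed

text \<open>The square root appears because \<open>nn_integral_fast_Cauchy\<close> is applied to
  squared increments; the bounds are still geometric, with ratio \<open>sqrt (1/2)\<close>.\<close>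

lemma convergent_fast_Cauchy:
  fixes s :: "nat \<Rightarrow> 'b::banach"
  assumes "\<And>k. norm (s (Suc k) - s k) \<le> sqrt (D * (1/2) ^ k)"
  shows "convergent s"
proof -
  have "summable (\<lambda>k. s (Suc k) - s k)"
    by (rule summable_comparison_test'[OF summable_sqrt_geometric[of D], of 0]) (use assms in auto)
  then have "convergent (\<lambda>n. \<Sum>k<n. s (Suc k) - s k)" by (simp add: summable_iff_convergent)
  then have "convergent (\<lambda>n. (s n - s 0) + s 0)"
    unfolding sum_lessThan_telescope by (intro convergent_add convergent_const)
  then show ?thesis by simp
qed

lemma l2_norm_fast_Cauchy:
  fixes f :: "nat \<Rightarrow> 'a \<Rightarrow> 'b::euclidean_space"
  assumes "\<And>k. square_integrable M (f k)" "C \<ge> 0"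
    and "\<And>k. l2_norm M (\<lambda>x. f (Suc k) x - f k x) \<le> C * (1/2) ^ k"
  shows "l2_norm M (\<lambda>x. f (n + m) x - f n x) \<le> 2 * C * (1/2) ^ n"
proof -
  have "l2_norm M (\<lambda>x. f (n + m) x - f n x) \<le> 2 * C * (1/2) ^ n - 2 * C * (1/2) ^ (n + m)"
  proof (induction m)
    case 0 then show ?case by (simp add: l2_norm_def)
  next
    case (Suc m)
    have "l2_norm M (\<lambda>x. f (n + Suc m) x - f n x)
        \<le> l2_norm M (\<lambda>x. f (Suc (n + m)) x - f (n + m) x) + l2_norm M (\<lambda>x. f (n + m) x - f n x)"
      using l2_norm_dist_triangle[OF assms(1) assms(1) assms(1)] by simp
    also have "\<dots> \<le> C * (1/2) ^ (n + m) + (2 * C * (1/2) ^ n - 2 * C * (1/2) ^ (n + m))"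
      by (intro add_mono assms Suc)
    also have "\<dots> = 2 * C * (1/2) ^ n - 2 * C * (1/2) ^ (n + Suc m)" by simp
    finally show ?case .
  qed
  also have "\<dots> \<le> 2 * C * (1/2) ^ n" using assms(2) by simp
  finally show ?thesis .
qed

text \<open>Completeness with a limit measurable for the smaller algebra \<open>N\<close>. This
  keeps limits of predictable integrands predictable and limits of progressive drivers progressive,
  while norms are taken in the larger measure space.\<close>

lemma Riesz_Fischer:
  fixes f :: "nat \<Rightarrow> 'a \<Rightarrow> 'b::euclidean_space"
  assumes sub: "subalgebra M N" and meas: "\<And>k. f k \<in> borel_measurable N"
    and sq: "\<And>k. square_integrable M (f k)" and C: "C \<ge> 0"
    and le: "\<And>k. l2_norm M (\<lambda>x. f (Suc k) x - f k x) \<le> C * (1/2) ^ k"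
  obtains g where "g \<in> borel_measurable N" "square_integrable M g"
    "AE x in M. (\<lambda>k. f k x) \<longlonglongrightarrow> g x" "(\<lambda>k. l2_norm M (\<lambda>x. f k x - g x)) \<longlonglongrightarrow> 0"
proof -
  \<comment> \<open>\<open>lim\<close> is total and its measurability holds without convergence, so
    \<open>g\<close> is \<open>N\<close>-measurable before convergence is known, and it is known
    only almost everywhere.\<close>
  define g where "g = (\<lambda>x. lim (\<lambda>k. f k x))"
  have g: "g \<in> borel_measurable N" unfolding g_def by (rule borel_measurable_lim_metric[OF meas])
  then have gM: "g \<in> borel_measurable M" by (rule measurable_from_subalg[OF sub])
  have "AE x in M. \<exists>D\<ge>0. \<forall>k. ennreal ((norm (f (Suc k) x - f k x))\<^sup>2) \<le> ennreal (D * (1/2) ^ k)"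
  proof (rule nn_integral_fast_Cauchy[where C="C\<^sup>2"])
    fix k
    show "(\<lambda>x. ennreal ((norm (f (Suc k) x - f k x))\<^sup>2)) \<in> borel_measurable M"
      using square_integrableD(1)[OF sq] by measurable
    have "(\<integral>\<^sup>+x. ennreal ((norm (f (Suc k) x - f k x))\<^sup>2) \<partial>M)
       = ennreal ((l2_norm M (\<lambda>x. f (Suc k) x - f k x))\<^sup>2)"
      by (rule nn_integral_l2_norm) (intro square_integrable_diff sq)
    also have "\<dots> \<le> ennreal ((C * (1/2) ^ k)\<^sup>2)"
      by (intro ennreal_leI power_mono le) simp
    also have "(C * (1/2) ^ k)\<^sup>2 = C\<^sup>2 * (1/4 :: real) ^ k"
      by (simp add: power_mult_distrib power_divide power2_eq_square power_mult_distrib[symmetric])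
    finally show "(\<integral>\<^sup>+x. ennreal ((norm (f (Suc k) x - f k x))\<^sup>2) \<partial>M) \<le> ennreal (C\<^sup>2 * (1/4) ^ k)" .
  qed simp
  then have lim: "AE x in M. (\<lambda>k. f k x) \<longlonglongrightarrow> g x"
  proof eventually_elim
    case (elim x)
    then obtain D where D: "D \<ge> 0" "\<And>k. (norm (f (Suc k) x - f k x))\<^sup>2 \<le> D * (1/2) ^ k"
      by (auto simp: ennreal_le_iff)
    have "convergent (\<lambda>k. f k x)"
      by (rule convergent_fast_Cauchy[of _ D]) (metis D(2) real_le_rsqrt)
    then show ?case unfolding g_def by (simp add: convergent_LIMSEQ_iff)
  qed
  have bd: "square_integrable M (\<lambda>x. g x - f n x) \<and> l2_norm M (\<lambda>x. g x - f n x) \<le> 2 * C * (1/2) ^ n" for n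
  proof (intro conjI)
    have 1: "square_integrable M (\<lambda>x. f (n + m) x - f n x)" for m
      by (intro square_integrable_diff sq)
    have 2: "(\<lambda>x. g x - f n x) \<in> borel_measurable M" using gM square_integrableD(1)[OF sq] by measurable
    have 3: "AE x in M. (\<lambda>m. f (n + m) x - f n x) \<longlonglongrightarrow> g x - f n x"
      using lim
    proof eventually_elim
      case (elim x)
      then have "(\<lambda>m. f (n + m) x) \<longlonglongrightarrow> g x" using LIMSEQ_ignore_initial_segment[of "\<lambda>m. f m x" "g x" n]
        by (simp add: add.commute)
      then show ?case by (intro tendsto_intros)
    qed
    show "square_integrable M (\<lambda>x. g x - f n x)"
      by (rule l2_norm_Fatou(1)[OF 1 2 3 l2_norm_fast_Cauchy[OF sq C le]])
    show "l2_norm M (\<lambda>x. g x - f n x) \<le> 2 * C * (1/2) ^ n"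
      by (rule l2_norm_Fatou(2)[OF 1 2 3 l2_norm_fast_Cauchy[OF sq C le]])
  qed
  have gs: "square_integrable M g"
    using square_integrable_add[OF conjunct1[OF bd[of 0]] sq[of 0]] by simp
  have "(\<lambda>k. l2_norm M (\<lambda>x. f k x - g x)) \<longlonglongrightarrow> 0"
  proof (rule Lim_null_comparison)
    show "\<forall>\<^sub>F k in sequentially. norm (l2_norm M (\<lambda>x. f k x - g x)) \<le> 2 * C * (1/2) ^ k"
      using bd by (simp add: l2_norm_minus_commute)
    show "(\<lambda>k. 2 * C * (1/2::real) ^ k) \<longlonglongrightarrow> 0"
      by (intro tendsto_mult_right_zero LIMSEQ_power_zero) simp
  qed
  with g gs lim that show thesis by blast
qed

section \<open>Brownian motion and its augmented filtration\<close>

lemma char_normal_density: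
  assumes "\<sigma> > 0"
  shows "(CLINT x|lborel. normal_density 0 \<sigma> x *\<^sub>R iexp (c * x)) = exp (- (\<sigma>\<^sup>2 * c\<^sup>2) / 2)"
proof -
  have "(CLINT x|lborel. normal_density 0 \<sigma> x *\<^sub>R iexp (c * x))
      = \<bar>\<sigma>\<bar> *\<^sub>R (CLINT x|lborel. normal_density 0 \<sigma> (0 + \<sigma> * x) *\<^sub>R iexp (c * (0 + \<sigma> * x)))"
    by (rule lborel_integral_real_affine) (use assms in auto)
  also have "\<dots> = (CLINT x|lborel. \<sigma> *\<^sub>R (normal_density 0 \<sigma> (\<sigma> * x) *\<^sub>R iexp (c * (\<sigma> * x))))"
    unfolding integral_scaleR_right using assms by simp
  also have "\<dots> = (CLINT x|lborel. std_normal_density x *\<^sub>R iexp ((c * \<sigma>) * x))"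
  proof (rule Bochner_Integration.integral_cong[OF refl])
    fix x
    have "\<sigma> * normal_density 0 \<sigma> (\<sigma> * x) = std_normal_density x"
      using assms by (simp add: normal_density_def power_mult_distrib real_sqrt_mult)
    then show "\<sigma> *\<^sub>R (normal_density 0 \<sigma> (\<sigma> * x) *\<^sub>R iexp (c * (\<sigma> * x)))
        = std_normal_density x *\<^sub>R iexp ((c * \<sigma>) * x)"
      by (simp add: mult.assoc)
  qed
  also have "\<dots> = char std_normal_distribution (c * \<sigma>)"
    unfolding char_def by (subst integral_density) auto
  also have "\<dots> = exp (- (\<sigma>\<^sup>2 * c\<^sup>2) / 2)"
    by (simp add: char_std_normal_distribution power_mult_distrib mult.commute)
  finally show ?thesis .
qed

lemma bij_betw_axis_Basis: "bij_betw (\<lambda>i. axis i (1::real)) UNIV (Basis :: (real ^ 'd::finite) set)"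
  unfolding bij_betw_def
  by (auto simp: Basis_vec_def inj_on_def axis_eq_axis)

text \<open>Lebesgue measure on the vector space is the image of the product over the basis, and
  both the density and the exponential factor along coordinates; the integral becomes a product of
  one-dimensional characteristic functions.\<close>

lemma char_product_normal_density:
  fixes l :: "real ^ 'd::finite"
  assumes "\<sigma> > 0"
  shows "(CLINT x|lborel. (\<Prod>i\<in>UNIV. normal_density 0 \<sigma> (x $ i)) *\<^sub>R iexp (l \<bullet> x))
    = exp (- (\<sigma>\<^sup>2 * (norm l)\<^sup>2) / 2)"
proof -
  interpret product_sigma_finite "\<lambda>b::real^'d. lborel :: real measure" by standard
  define g where "g b = (\<lambda>x. normal_density 0 \<sigma> x *\<^sub>R iexp ((l \<bullet> b) * x))" for b :: "real^'d"
  have [measurable]: "(\<lambda>f. \<Sum>b\<in>Basis. f b *\<^sub>R b) \<in> borel_measurable (Pi\<^sub>M Basis (\<lambda>b::real^'d. (lborel::real measure)))"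
    by measurable
  have int: "integrable lborel (g b)" for b
    unfolding g_def
    by (rule Bochner_Integration.integrable_bound[OF integrable_normal_density[OF assms, of 0]]) auto
  have eq: "(\<Prod>i\<in>UNIV. normal_density 0 \<sigma> ((\<Sum>b\<in>Basis. f b *\<^sub>R b) $ i)) *\<^sub>R iexp (l \<bullet> (\<Sum>b\<in>Basis. f b *\<^sub>R b))
      = (\<Prod>b\<in>Basis. g b (f b))" for f :: "real^'d \<Rightarrow> real"
  proof -
    have "(\<Sum>b\<in>Basis. f b *\<^sub>R b) $ i = f (axis i 1)" for i
    proof -
      have "(\<Sum>b\<in>Basis. f b *\<^sub>R b) $ i = (\<Sum>b\<in>Basis. f b *\<^sub>R b) \<bullet> axis i 1"
        by (simp add: cart_eq_inner_axis)
      also have "\<dots> = f (axis i 1)" by (rule inner_sum_left_Basis) (simp add: axis_in_Basis_iff)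
      finally show ?thesis .
    qed
    then have "(\<Prod>i\<in>UNIV. normal_density 0 \<sigma> ((\<Sum>b\<in>Basis. f b *\<^sub>R b) $ i))
        = (\<Prod>b\<in>Basis. normal_density 0 \<sigma> (f b))"
      using prod.reindex_bij_betw[OF bij_betw_axis_Basis, of "\<lambda>b. normal_density 0 \<sigma> (f b)"] by simp
    moreover have "iexp (l \<bullet> (\<Sum>b\<in>Basis. f b *\<^sub>R b)) = (\<Prod>b\<in>Basis. iexp ((l \<bullet> b) * f b))"
      by (simp add: inner_sum_right exp_sum[symmetric] sum_distrib_left mult.commute)
    ultimately show ?thesis by (simp add: g_def prod.distrib scaleR_conv_of_real)
  qed
  have "(CLINT x|lborel. (\<Prod>i\<in>UNIV. normal_density 0 \<sigma> (x $ i)) *\<^sub>R iexp (l \<bullet> x))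
      = (CLINT f|Pi\<^sub>M Basis (\<lambda>b::real^'d. (lborel::real measure)). (\<Prod>b\<in>Basis. g b (f b)))"
    unfolding eq[symmetric] by (subst lborel_eq, subst integral_distr) auto
  also have "\<dots> = (\<Prod>b\<in>Basis. integral\<^sup>L lborel (g b))"
    by (rule product_integral_prod) (use int in auto)
  also have "\<dots> = (\<Prod>b\<in>Basis. complex_of_real (exp (- (\<sigma>\<^sup>2 * (l \<bullet> b)\<^sup>2) / 2)))"
    by (rule prod.cong[OF refl], unfold g_def, rule char_normal_density[OF assms])
  also have "\<dots> = complex_of_real (exp (\<Sum>b\<in>Basis. - (\<sigma>\<^sup>2 * (l \<bullet> b)\<^sup>2) / 2))"
    by (simp add: exp_sum)
  also have "(\<Sum>b\<in>Basis. - (\<sigma>\<^sup>2 * (l \<bullet> b)\<^sup>2) / 2) = - (\<sigma>\<^sup>2 * (norm l)\<^sup>2) / 2"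
  proof -
    have "(norm l)\<^sup>2 = (\<Sum>b\<in>Basis. (l \<bullet> b)\<^sup>2)"
      unfolding power2_norm_eq_inner
      by (subst euclidean_inner) (simp add: power2_eq_square)
    then show ?thesis by (simp add: sum_distrib_left sum_divide_distrib sum_negf)
  qed
  finally show ?thesis .
qed

locale brownian = prob_space M for M :: "'a measure" +
  fixes T :: real and B :: "real \<Rightarrow> 'a \<Rightarrow> real ^ 'd::finite" and F :: "real \<Rightarrow> 'a measure"
  assumes T_pos: "T > 0" and complete: "complete_measure M"
    and BM: "standard_brownian_motion M T B" and F_def: "F = augmented_filtration M B"
begin

lemma space_F [simp]: "space (F t) = space M"
  by (simp add: F_def augmented_filtration_def space_measure_of_conv)

lemma space_natural [simp]: "space (natural_filtration M B t) = space M"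
  by (simp add: natural_filtration_def space_measure_of_conv)

lemma sets_natural:
  "sets (natural_filtration M B t)
    = sigma_sets (space M) (\<Union>s\<in>{0..t}. {B s -` A \<inter> space M | A. A \<in> sets borel})"
  unfolding natural_filtration_def by (rule sets_measure_of) auto

lemma sets_F: "sets (F t) = sigma_sets (space M) (sets (natural_filtration M B t) \<union> null_sets M)"
  unfolding F_def augmented_filtration_def
  by (rule sets_measure_of) (use sets.sets_into_space[of _ "natural_filtration M B t"]
      sets.sets_into_space[of _ M] in \<open>auto simp: null_sets_def\<close>)

lemma B_measurable [measurable]: "0 \<le> t \<Longrightarrow> t \<le> T \<Longrightarrow> B t \<in> borel_measurable M"
  using BM by (auto simp: standard_brownian_motion_def)

lemma natural_sub: "t \<le> T \<Longrightarrow> sets (natural_filtration M B t) \<subseteq> sets M"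
  unfolding sets_natural by (rule sets.sigma_sets_subset) (auto intro!: measurable_sets B_measurable)

lemma sets_F_sub: "t \<le> T \<Longrightarrow> sets (F t) \<subseteq> sets M"
  unfolding sets_F by (rule sets.sigma_sets_subset) (use natural_sub in \<open>auto simp: null_sets_def\<close>)

lemma subalgebra_F: "t \<le> T \<Longrightarrow> subalgebra M (F t)"
  by (simp add: subalgebra_def sets_F_sub)

lemma measurable_F_imp: "f \<in> measurable (F t) N \<Longrightarrow> t \<le> T \<Longrightarrow> f \<in> measurable M N"
  by (rule measurable_from_subalg[OF subalgebra_F])

lemma sets_F_mono: "s \<le> t \<Longrightarrow> sets (F s) \<subseteq> sets (F t)"
  unfolding sets_F sets_natural
  by (intro sigma_sets_mono' Un_mono order_refl UN_mono) auto

lemma measurable_F_mono: "f \<in> measurable (F s) N \<Longrightarrow> s \<le> t \<Longrightarrow> f \<in> measurable (F t) N"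
  by (rule measurable_from_subalg[of "F t" "F s"]) (auto simp: subalgebra_def dest: sets_F_mono)

lemma null_sets_F: "N \<in> null_sets M \<Longrightarrow> N \<in> sets (F t)"
  unfolding sets_F by (rule sigma_sets.Basic) auto

lemma natural_in_F: "A \<in> sets (natural_filtration M B t) \<Longrightarrow> A \<in> sets (F t)"
  unfolding sets_F by (rule sigma_sets.Basic) auto

lemma null_sets_subset_complete: "N \<in> null_sets M \<Longrightarrow> A \<subseteq> N \<Longrightarrow> A \<in> null_sets M"
  using complete_measure.complete2[OF complete] by blast

lemma B_measurable_natural: "0 \<le> s \<Longrightarrow> s \<le> t \<Longrightarrow> B s \<in> borel_measurable (natural_filtration M B t)"
  by (rule measurableI) (auto simp: sets_natural intro!: sigma_sets.Basic bexI[of _ s], blast)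

lemma B_measurable_F: "0 \<le> s \<Longrightarrow> s \<le> t \<Longrightarrow> B s \<in> borel_measurable (F t)"
  by (rule measurable_from_subalg[OF _ B_measurable_natural])
     (auto simp: subalgebra_def intro: natural_in_F)

text \<open>Every \<open>F t\<close> contains all null sets, and by completeness all their subsets.
  Processes can therefore be redefined on a null set of paths, for instance to make every path
  continuous, without losing adaptedness.\<close>

lemma measurable_F_cong_AE:
  assumes f: "f \<in> measurable (F t) N" and ae: "AE \<omega> in M. f \<omega> = g \<omega>"
    and g: "\<And>\<omega>. \<omega> \<in> space M \<Longrightarrow> g \<omega> \<in> space N"
  shows "g \<in> measurable (F t) N"
proof (rule measurableI)
  fix A assume A: "A \<in> sets N"
  obtain E where E: "{\<omega> \<in> space M. f \<omega> \<noteq> g \<omega>} \<subseteq> E" "E \<in> null_sets M"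
    using ae unfolding eventually_ae_filter by auto
  have "g -` A \<inter> space (F t) = ((f -` A \<inter> space (F t)) - E) \<union> (g -` A \<inter> E \<inter> space M)"
    using E(1) by auto
  also have "\<dots> \<in> sets (F t)"
  proof (intro sets.Un sets.Diff measurable_sets[OF f A])
    show "E \<in> sets (F t)" by (rule null_sets_F[OF E(2)])
    show "g -` A \<inter> E \<inter> space M \<in> sets (F t)"
      by (rule null_sets_F, rule null_sets_subset_complete[OF E(2)]) auto
  qed
  finally show "g -` A \<inter> space (F t) \<in> sets (F t)" .
qed (use g in simp)

text \<open>Augmentation changes events only by null sets. The events with such an approximation are
  closed under complements and countable unions, and they contain the generators.\<close>

lemma sets_F_natural_approx:
  assumes "A \<in> sets (F t)" "t \<le> T"
  shows "\<exists>A'\<in>sets (natural_filtration M B t). (A - A') \<union> (A' - A) \<in> null_sets M"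
proof -
  have "A \<in> sigma_sets (space M) (sets (natural_filtration M B t) \<union> null_sets M)"
    using assms(1) sets_F by simp
  then show ?thesis
  proof induction
    case (Basic A)
    then show ?case by (auto intro: bexI[of _ A] bexI[of _ "{}"])
  next
    case Empty
    then show ?case by (auto intro: bexI[of _ "{}"])
  next
    case (Compl A)
    then obtain A' where A': "A' \<in> sets (natural_filtration M B t)" "(A - A') \<union> (A' - A) \<in> null_sets M" by auto
    show ?case
      by (rule bexI[of _ "space M - A'"])
        (use A' in \<open>auto intro: null_sets_subset_complete[OF A'(2)] sets.compl_sets[of _ "natural_filtration M B t", simplified]\<close>)
  next
    case (Union A)
    then obtain A' where A': "\<And>i. A' i \<in> sets (natural_filtration M B t)"
      "\<And>i. (A i - A' i) \<union> (A' i - A i) \<in> null_sets M" by metis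
    then have "(\<Union>i. (A i - A' i) \<union> (A' i - A i)) \<in> null_sets M" by auto
    then show ?case
      by (intro bexI[of _ "\<Union>i. A' i"]) (use A' in \<open>auto intro: null_sets_subset_complete\<close>)
  qed
qed

section \<open>Independence, law and moments of Brownian increments\<close>

lemma increment_indep:
  assumes "0 \<le> s" "s < t" "t \<le> T"
  shows "indep_set (sets (F s)) {(\<lambda>\<omega>. B t \<omega> - B s \<omega>) -` A \<inter> space M | A. A \<in> sets borel}"
proof (rule indep_setI)
  have st: "s \<le> T" "0 \<le> t" using assms by auto
  have [measurable]: "B t \<in> borel_measurable M" "B s \<in> borel_measurable M" using assms st by auto
  show "sets (F s) \<subseteq> events" by (rule sets_F_sub[OF st(1)])
  show 2: "{(\<lambda>\<omega>. B t \<omega> - B s \<omega>) -` A \<inter> space M |A. A \<in> sets borel} \<subseteq> events"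
    by (auto intro!: measurable_sets[of _ M borel])
  fix a b assume a: "a \<in> sets (F s)" and b: "b \<in> {(\<lambda>\<omega>. B t \<omega> - B s \<omega>) -` A \<inter> space M |A. A \<in> sets borel}"
  obtain a' where a': "a' \<in> sets (natural_filtration M B s)" "(a - a') \<union> (a' - a) \<in> null_sets M"
    using sets_F_natural_approx[OF a st(1)] by auto
  have [measurable]: "a \<in> events" "a' \<in> events" "b \<in> events"
    using a a' b 2 sets_F_sub[OF st(1)] natural_sub[OF st(1)] by auto
  have ae: "AE \<omega> in M. \<omega> \<in> a \<longleftrightarrow> \<omega> \<in> a'"
    using AE_not_in[OF a'(2)] by eventually_elim auto
  have "prob (a \<inter> b) = prob (a' \<inter> b)"
    by (rule finite_measure_eq_AE) (use ae in auto)
  also have "\<dots> = prob a' * prob b"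
    using BM assms a'(1) b indep_setD unfolding standard_brownian_motion_def by blast
  also have "prob a' = prob a"
    by (rule finite_measure_eq_AE) (use ae in auto)
  finally show "prob (a \<inter> b) = prob a * prob b" .
qed

text \<open>\<open>indep_var\<close> speaks of generated algebras, \<open>increment_indep\<close> of
  preimages of Borel sets. Both families of preimages are closed under intersection, so independence
  extends from them to the algebras they generate.\<close>

lemma increment_indep_var:
  fixes G :: "'a \<Rightarrow> 'b::topological_space" and h :: "real ^ 'd \<Rightarrow> 'b"
  assumes "0 \<le> s" "s < t" "t \<le> T" and G: "G \<in> borel_measurable (F s)" and h [measurable]: "h \<in> borel_measurable borel"
  shows "indep_var borel G borel (\<lambda>\<omega>. h (B t \<omega> - B s \<omega>))"
  unfolding indep_var_eq
proof (intro conjI)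
  have st: "s \<le> T" "0 \<le> t" using assms by auto
  have [measurable]: "B t \<in> borel_measurable M" "B s \<in> borel_measurable M" using assms st by auto
  show "random_variable borel G" by (rule measurable_F_imp[OF G st(1)])
  show "random_variable borel (\<lambda>\<omega>. h (B t \<omega> - B s \<omega>))" by measurable
  let ?S = "{(\<lambda>\<omega>. B t \<omega> - B s \<omega>) -` A \<inter> space M | A. A \<in> sets borel}"
  have 1: "{G -` A \<inter> space M |A. A \<in> sets borel} \<subseteq> sets (F s)"
    using measurable_sets[OF G] by auto
  have 2: "{(\<lambda>\<omega>. h (B t \<omega> - B s \<omega>)) -` A \<inter> space M |A. A \<in> sets borel} \<subseteq> ?S"
  proof safe
    fix A :: "'b set" assume A: "A \<in> sets borel"
    show "\<exists>A'. (\<lambda>\<omega>. h (B t \<omega> - B s \<omega>)) -` A \<inter> space M = (\<lambda>\<omega>. B t \<omega> - B s \<omega>) -` A' \<inter> space M \<and> A' \<in> sets borel"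
      by (intro exI[of _ "h -` A \<inter> space borel"]) (use measurable_sets[OF h A] in auto)
  qed
  have "indep_set {G -` A \<inter> space M |A. A \<in> sets borel} {(\<lambda>\<omega>. h (B t \<omega> - B s \<omega>)) -` A \<inter> space M |A. A \<in> sets borel}"
    using increment_indep[OF assms(1-3)] unfolding indep_set_def
    by (rule indep_sets_mono_sets) (use 1 2 in \<open>auto split: bool.split\<close>)
  then show "indep_set (sigma_sets (space M) {G -` A \<inter> space M |A. A \<in> sets borel})
     (sigma_sets (space M) {(\<lambda>\<omega>. h (B t \<omega> - B s \<omega>)) -` A \<inter> space M |A. A \<in> sets borel})"
  proof (rule indep_set_sigma_sets)
    show "Int_stable {G -` A \<inter> space M |A. A \<in> sets borel}"
      unfolding Int_stable_def
    proof safe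
      fix A A' :: "'b set" assume "A \<in> sets borel" "A' \<in> sets borel"
      then show "\<exists>C. (G -` A \<inter> space M) \<inter> (G -` A' \<inter> space M) = G -` C \<inter> space M \<and> C \<in> sets borel"
        by (intro exI[of _ "A \<inter> A'"]) auto
    qed
    show "Int_stable {(\<lambda>\<omega>. h (B t \<omega> - B s \<omega>)) -` A \<inter> space M |A. A \<in> sets borel}"
      unfolding Int_stable_def
    proof safe
      fix A A' :: "'b set" assume "A \<in> sets borel" "A' \<in> sets borel"
      then show "\<exists>C. ((\<lambda>\<omega>. h (B t \<omega> - B s \<omega>)) -` A \<inter> space M) \<inter> ((\<lambda>\<omega>. h (B t \<omega> - B s \<omega>)) -` A' \<inter> space M)
         = (\<lambda>\<omega>. h (B t \<omega> - B s \<omega>)) -` C \<inter> space M \<and> C \<in> sets borel"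
        by (intro exI[of _ "A \<inter> A'"]) auto
    qed
  qed
qed

lemma expectation_mult_increment:
  fixes G :: "'a \<Rightarrow> 'b::{real_normed_field,banach,second_countable_topology}"
  assumes "0 \<le> s" "s < t" "t \<le> T" and "G \<in> borel_measurable (F s)" and "h \<in> borel_measurable borel"
    and "integrable M G" "integrable M (\<lambda>\<omega>. h (B t \<omega> - B s \<omega>))"
  shows "integrable M (\<lambda>\<omega>. G \<omega> * h (B t \<omega> - B s \<omega>))"
    and "(\<integral>\<omega>. G \<omega> * h (B t \<omega> - B s \<omega>) \<partial>M) = (\<integral>\<omega>. G \<omega> \<partial>M) * (\<integral>\<omega>. h (B t \<omega> - B s \<omega>) \<partial>M)"
  using indep_var_integrable[OF increment_indep_var[OF assms(1-5)] assms(6,7)]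
    indep_var_lebesgue_integral[OF increment_indep_var[OF assms(1-5)] assms(6,7)] by auto

lemma char_increment:
  assumes "0 \<le> s" "s < t" "t \<le> T"
  shows "(CLINT \<omega>|M. iexp (l \<bullet> (B t \<omega> - B s \<omega>))) = exp (- ((t - s) * (norm l)\<^sup>2) / 2)"
proof -
  have st: "s \<le> T" "0 \<le> t" using assms by auto
  have [measurable]: "B t \<in> borel_measurable M" "B s \<in> borel_measurable M" using assms st by auto
  have D: "distributed M lborel (\<lambda>\<omega>. B t \<omega> - B s \<omega>)
      (\<lambda>x. ennreal (\<Prod>i\<in>UNIV. normal_density 0 (sqrt (t - s)) (x $ i)))"
    using BM assms unfolding standard_brownian_motion_def by blast
  have "(CLINT \<omega>|M. iexp (l \<bullet> (B t \<omega> - B s \<omega>))) = (CLINT x|distr M lborel (\<lambda>\<omega>. B t \<omega> - B s \<omega>). iexp (l \<bullet> x))"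
    by (subst integral_distr) auto
  also have "\<dots> = (CLINT x|lborel. (\<Prod>i\<in>UNIV. normal_density 0 (sqrt (t - s)) (x $ i)) *\<^sub>R iexp (l \<bullet> x))"
    unfolding distributed_distr_eq_density[OF D]
    by (subst integral_density) (auto intro!: prod_nonneg)
  also have "\<dots> = exp (- ((t - s) * (norm l)\<^sup>2) / 2)"
    using char_product_normal_density[of "sqrt (t - s)" l] assms by simp
  finally show ?thesis .
qed

text \<open>The characteristic function of the projection at \<open>r\<close> is that of the
  increment at \<open>r *\<^sub>R l\<close>, which is Gaussian; uniqueness then reduces scalar
  moments of a vector increment to those of a one-dimensional normal law. The condition
  \<open>l \<noteq> 0\<close> keeps this law nondegenerate.\<close>

lemma increment_distr:
  assumes "0 \<le> s" "s < t" "t \<le> T" "l \<noteq> 0"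
  shows "distr M borel (\<lambda>\<omega>. l \<bullet> (B t \<omega> - B s \<omega>)) = density lborel (normal_density 0 (norm l * sqrt (t - s)))"
proof (rule Levy_uniqueness)
  have st: "s \<le> T" "0 \<le> t" using assms by auto
  have [measurable]: "B t \<in> borel_measurable M" "B s \<in> borel_measurable M" using assms st by auto
  have pos: "norm l * sqrt (t - s) > 0" using assms by simp
  show "real_distribution (distr M borel (\<lambda>\<omega>. l \<bullet> (B t \<omega> - B s \<omega>)))" by simp
  show "real_distribution (density lborel (normal_density 0 (norm l * sqrt (t - s))))"
    using prob_space_normal_density[OF pos] by (simp add: real_distribution_def real_distribution_axioms_def)
  show "char (distr M borel (\<lambda>\<omega>. l \<bullet> (B t \<omega> - B s \<omega>))) = char (density lborel (normal_density 0 (norm l * sqrt (t - s))))"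
  proof
    fix r
    have "char (distr M borel (\<lambda>\<omega>. l \<bullet> (B t \<omega> - B s \<omega>))) r = (CLINT \<omega>|M. iexp ((r *\<^sub>R l) \<bullet> (B t \<omega> - B s \<omega>)))"
      unfolding char_def by (subst integral_distr) auto
    also have "\<dots> = exp (- ((norm l * sqrt (t - s))\<^sup>2 * r\<^sup>2) / 2)"
      unfolding char_increment[OF assms(1-3)] using assms
      by (simp add: power_mult_distrib mult_ac)
    also have "\<dots> = char (density lborel (normal_density 0 (norm l * sqrt (t - s)))) r"
      unfolding char_normal_density[OF pos, symmetric] char_def
      by (subst integral_density) auto
    finally show "char (distr M borel (\<lambda>\<omega>. l \<bullet> (B t \<omega> - B s \<omega>))) r
      = char (density lborel (normal_density 0 (norm l * sqrt (t - s)))) r" .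
  qed
qed

text \<open>The first two moments feed orthogonality and isometry of simple integrals; the fourth
  bounds the second-order remainder of exponentials in the martingale representation.\<close>

lemma increment_moment:
  assumes "0 \<le> s" "s < t" "t \<le> T"
  shows "integrable M (\<lambda>\<omega>. (l \<bullet> (B t \<omega> - B s \<omega>)) ^ k)"
    and "(\<integral>\<omega>. l \<bullet> (B t \<omega> - B s \<omega>) \<partial>M) = 0"
    and "(\<integral>\<omega>. (l \<bullet> (B t \<omega> - B s \<omega>))\<^sup>2 \<partial>M) = (norm l)\<^sup>2 * (t - s)"
    and "(\<integral>\<omega>. (l \<bullet> (B t \<omega> - B s \<omega>)) ^ 4 \<partial>M) = 3 * ((norm l)\<^sup>2 * (t - s))\<^sup>2"
proof -
  have st: "s \<le> T" "0 \<le> t" using assms by auto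
  have [measurable]: "B t \<in> borel_measurable M" "B s \<in> borel_measurable M" using assms st by auto
  have "integrable M (\<lambda>\<omega>. (l \<bullet> (B t \<omega> - B s \<omega>)) ^ k) \<and> (\<integral>\<omega>. l \<bullet> (B t \<omega> - B s \<omega>) \<partial>M) = 0
    \<and> (\<integral>\<omega>. (l \<bullet> (B t \<omega> - B s \<omega>))\<^sup>2 \<partial>M) = (norm l)\<^sup>2 * (t - s)
    \<and> (\<integral>\<omega>. (l \<bullet> (B t \<omega> - B s \<omega>)) ^ 4 \<partial>M) = 3 * ((norm l)\<^sup>2 * (t - s))\<^sup>2"
  \<comment> \<open>For \<open>l = 0\<close> the projection has no density, so this case is settled
    directly.\<close>
  proof (cases "l = 0")
    case True
    have "integrable M (\<lambda>\<omega>. (0::real) ^ k)" by simp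
    then show ?thesis using True by simp
  next
    case False
    define \<sigma> where "\<sigma> = norm l * sqrt (t - s)"
    have \<sigma>: "\<sigma> > 0" using False assms by (simp add: \<sigma>_def)
    have \<sigma>2: "\<sigma>\<^sup>2 = (norm l)\<^sup>2 * (t - s)" using assms by (simp add: \<sigma>_def power_mult_distrib)
    note D = increment_distr[OF assms False, folded \<sigma>_def]
    have "integrable (density lborel (normal_density 0 \<sigma>)) (\<lambda>x. x ^ k)"
      by (subst integrable_density) (use integrable_normal_moment[OF \<sigma>, of 0 k] in auto)
    then have 1: "integrable M (\<lambda>\<omega>. (l \<bullet> (B t \<omega> - B s \<omega>)) ^ k)"
      unfolding D[symmetric] by (subst (asm) integrable_distr_eq) auto
    have 2: "(\<integral>\<omega>. (l \<bullet> (B t \<omega> - B s \<omega>)) ^ j \<partial>M) = (\<integral>x. normal_density 0 \<sigma> x * x ^ j \<partial>lborel)" for j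
    proof -
      have "(\<integral>\<omega>. (l \<bullet> (B t \<omega> - B s \<omega>)) ^ j \<partial>M) = (\<integral>x. x ^ j \<partial>density lborel (normal_density 0 \<sigma>))"
        unfolding D[symmetric] by (subst integral_distr) auto
      also have "\<dots> = (\<integral>x. normal_density 0 \<sigma> x * x ^ j \<partial>lborel)"
        by (subst integral_density) auto
      finally show ?thesis .
    qed
    show ?thesis
      using 1 2[of 1] 2[of 2] 2[of 4] integral_normal_moment_odd[OF \<sigma>, of 0 0]
        integral_normal_moment_even[OF \<sigma>, of 0 1] integral_normal_moment_even[OF \<sigma>, of 0 2]
      unfolding \<sigma>2[symmetric] using \<sigma>
      by (simp add: fact_numeral power_divide power2_eq_square field_simps)
  qed
  then show "integrable M (\<lambda>\<omega>. (l \<bullet> (B t \<omega> - B s \<omega>)) ^ k)"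
    and "(\<integral>\<omega>. l \<bullet> (B t \<omega> - B s \<omega>) \<partial>M) = 0"
    and "(\<integral>\<omega>. (l \<bullet> (B t \<omega> - B s \<omega>))\<^sup>2 \<partial>M) = (norm l)\<^sup>2 * (t - s)"
    and "(\<integral>\<omega>. (l \<bullet> (B t \<omega> - B s \<omega>)) ^ 4 \<partial>M) = 3 * ((norm l)\<^sup>2 * (t - s))\<^sup>2"
    by auto
qed

section \<open>Predictable and progressive processes\<close>

text \<open>Restricting the space to \<open>{0..T}\<close>, and not merely the mass, makes
  \<open>Q\<close> live on the same set as \<open>Prog\<close> and \<open>Pred\<close>, as
  \<open>subalgebra\<close> demands. It also makes \<open>L\<close> and \<open>Q\<close> finite
  measures.\<close>

abbreviation L :: "real measure" where "L \<equiv> restrict_space lborel {0..T}"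

abbreviation Q :: "('a \<times> real) measure" where "Q \<equiv> M \<Otimes>\<^sub>M L"

abbreviation Prog :: "('a \<times> real) measure" where "Prog \<equiv> progressive_algebra M F T"

abbreviation Pred :: "('a \<times> real) measure" where "Pred \<equiv> predictable_algebra M F T"

lemma space_L: "space L = {0..T}"
  by (simp add: space_restrict_space)

lemma finite_measure_L: "finite_measure L"
  by (rule finite_measureI) (use T_pos in \<open>simp add: emeasure_restrict_space space_L\<close>)

lemma measure_L: "measure L {0..T} = T"
  using T_pos by (simp add: measure_restrict_space)

lemma pair_sigma_finite_Q: "pair_sigma_finite M L"
proof -
  interpret L: finite_measure L by (rule finite_measure_L)
  show ?thesis by standard
qed

lemma finite_measure_Q: "finite_measure Q"
proof -
  interpret L: finite_measure L by (rule finite_measure_L)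
  show ?thesis by (rule finite_measure_pair_measure[OF L.finite_measure_axioms finite_measure_axioms])
qed

lemma space_Q: "space Q = space M \<times> {0..T}"
  by (simp add: space_pair_measure space_L)

lemma borel_in_L: "A \<in> sets borel \<Longrightarrow> A \<subseteq> {0..T} \<Longrightarrow> A \<in> sets L"
  by (auto simp: sets_restrict_space_iff)

lemma space_Pred [simp]: "space Pred = space M \<times> {0..T}"
  by (simp add: predictable_algebra_def space_measure_of_conv)

lemma space_Prog [simp]: "space Prog = space M \<times> {0..T}"
  by (simp add: progressive_algebra_def space_measure_of_conv)

lemma sets_Pred: "sets Pred = sigma_sets (space M \<times> {0..T}) ({A \<times> {0} | A. A \<in> sets (F 0)} \<union>
      {A \<times> {s<..t} | A s t. 0 \<le> s \<and> s < t \<and> t \<le> T \<and> A \<in> sets (F s)})"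
  unfolding predictable_algebra_def
  by (rule sets_measure_of) (use T_pos in \<open>auto dest!: sets.sets_into_space\<close>)

lemma sets_Prog_aux: "sets Prog = sigma_sets (space M \<times> {0..T}) {A. A \<subseteq> space M \<times> {0..T} \<and>
         (\<forall>t\<in>{0..T}. A \<inter> (space M \<times> {0..t}) \<in> sets (F t \<Otimes>\<^sub>M restrict_space borel {0..t}))}"
  unfolding progressive_algebra_def by (rule sets_measure_of) auto

text \<open>The generating family is itself closed under complements and countable unions, so
  membership in the generated algebra is the defining condition.\<close>

lemma sets_Prog:
  "A \<in> sets Prog \<longleftrightarrow> A \<subseteq> space M \<times> {0..T} \<and>
     (\<forall>t\<in>{0..T}. A \<inter> (space M \<times> {0..t}) \<in> sets (F t \<Otimes>\<^sub>M restrict_space borel {0..t}))"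
proof
  assume "A \<in> sets Prog"
  then have "A \<in> sigma_sets (space M \<times> {0..T}) {A. A \<subseteq> space M \<times> {0..T} \<and>
         (\<forall>t\<in>{0..T}. A \<inter> (space M \<times> {0..t}) \<in> sets (F t \<Otimes>\<^sub>M restrict_space borel {0..t}))}"
    by (simp add: sets_Prog_aux)
  then show "A \<subseteq> space M \<times> {0..T} \<and>
     (\<forall>t\<in>{0..T}. A \<inter> (space M \<times> {0..t}) \<in> sets (F t \<Otimes>\<^sub>M restrict_space borel {0..t}))"
  proof induction
    case (Compl A)
    have "(space M \<times> {0..T} - A) \<inter> (space M \<times> {0..t}) \<in> sets (F t \<Otimes>\<^sub>M restrict_space borel {0..t})"
      if t: "t \<in> {0..T}" for t
    proof -
      have "(space M \<times> {0..T} - A) \<inter> (space M \<times> {0..t})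
          = space (F t \<Otimes>\<^sub>M restrict_space borel {0..t}) - (A \<inter> (space M \<times> {0..t}))"
        using t by (auto simp: space_pair_measure space_restrict_space)
      then show ?thesis using Compl t by auto
    qed
    then show ?case by auto
  next
    case (Union A)
    have "(\<Union>i. A i) \<inter> (space M \<times> {0..t}) \<in> sets (F t \<Otimes>\<^sub>M restrict_space borel {0..t})"
      if t: "t \<in> {0..T}" for t
    proof -
      have "(\<Union>i. A i) \<inter> (space M \<times> {0..t}) = (\<Union>i. A i \<inter> (space M \<times> {0..t}))" by auto
      moreover have "(\<Union>i. A i \<inter> (space M \<times> {0..t})) \<in> sets (F t \<Otimes>\<^sub>M restrict_space borel {0..t})"
        using Union t by (intro sets.countable_UN) auto
      ultimately show ?thesis by simp
    qed
    then show ?case using Union by auto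
  qed auto
qed (auto simp: sets_Prog_aux)

lemma sets_pair_F_mono:
  assumes "t \<le> T"
  shows "sets (F t \<Otimes>\<^sub>M N) \<subseteq> sets (M \<Otimes>\<^sub>M N)"
  unfolding sets_pair_measure
  by (simp, rule sigma_sets_mono') (use sets_F_sub[OF assms] in auto)

text \<open>The defining condition of a progressive set at the final time \<open>T\<close> already
  places it in the product algebra.\<close>

lemma subalgebra_Prog: "subalgebra Q Prog"
proof -
  have "A \<in> sets Q" if "A \<in> sets Prog" for A
  proof -
    have 1: "A \<subseteq> space M \<times> {0..T}" "A \<inter> (space M \<times> {0..T}) \<in> sets (F T \<Otimes>\<^sub>M restrict_space borel {0..T})"
      using that T_pos unfolding sets_Prog by auto
    have "sets (F T \<Otimes>\<^sub>M restrict_space borel {0..T}) \<subseteq> sets (M \<Otimes>\<^sub>M restrict_space borel {0..T})"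
      by (rule sets_pair_F_mono) simp
    also have "\<dots> = sets Q"
      by (rule sets_pair_measure_cong[OF refl]) (rule sets_restrict_space_cong[OF sets_lborel[symmetric]])
    finally have "A \<inter> (space M \<times> {0..T}) \<in> sets Q" using 1(2) by (rule subsetD)
    then show ?thesis using 1(1) by (simp add: Int_absorb2)
  qed
  then show ?thesis by (auto simp: subalgebra_def space_Q)
qed

lemma Prog_rectangle:
  assumes "A \<in> sets (F a)" "I \<in> sets borel" "I \<subseteq> {a..T}" "0 \<le> a"
  shows "A \<times> I \<in> sets Prog"
  unfolding sets_Prog
proof safe
  fix \<omega> t assume "\<omega> \<in> A" "t \<in> I"
  then show "\<omega> \<in> space M" "t \<in> {0..T}" using assms sets.sets_into_space[OF assms(1)] by auto
next
  fix t assume t: "t \<in> {0..T}"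
  show "A \<times> I \<inter> space M \<times> {0..t} \<in> sets (F t \<Otimes>\<^sub>M restrict_space borel {0..t})"
  proof (cases "a \<le> t")
    case True
    have "A \<times> I \<inter> space M \<times> {0..t} = A \<times> (I \<inter> {0..t})"
      using sets.sets_into_space[OF assms(1)] by auto
    also have "\<dots> \<in> sets (F t \<Otimes>\<^sub>M restrict_space borel {0..t})"
      by (rule pair_measureI) (use assms sets_F_mono[OF True] in \<open>auto simp: sets_restrict_space_iff\<close>)
    finally show ?thesis .
  next
    case False
    then have "A \<times> I \<inter> space M \<times> {0..t} = {}" using assms by auto
    then show ?thesis by simp
  qed
qed

lemma Pred_subset_Prog: "sets Pred \<subseteq> sets Prog"
proof -
  have "sets Pred \<subseteq> sigma_sets (space Prog) (sets Prog)"
    unfolding sets_Pred space_Prog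
  proof (rule sigma_sets_mono', safe)
    fix A assume "A \<in> sets (F 0)"
    then show "A \<times> {0} \<in> sets Prog" by (rule Prog_rectangle) (use T_pos in auto)
  next
    fix A s t assume "0 \<le> s" "s < t" "t \<le> T" "A \<in> sets (F s)"
    then show "A \<times> {s<..t} \<in> sets Prog" by (intro Prog_rectangle[of A s]) auto
  qed
  then show ?thesis unfolding sets.sigma_sets_eq .
qed

lemma subalgebra_Pred_Prog: "subalgebra Prog Pred"
  by (simp add: subalgebra_def Pred_subset_Prog)

lemma subalgebra_Pred: "subalgebra Q Pred"
  using subalgebra_Prog Pred_subset_Prog by (auto simp: subalgebra_def space_Q)

text \<open>The algebra \<open>N\<close> is kept abstract so that one argument serves
  \<open>Pred\<close> and \<open>Prog\<close>: a preimage is a rectangle, together with everything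
  outside the strip over \<open>I\<close> when \<open>0 \<in> A\<close>.\<close>

lemma measurable_indicator_scaleR:
  fixes G :: "'a \<Rightarrow> 'b::{real_normed_vector, second_countable_topology}"
  assumes sp: "space N = space M \<times> {0..T}" and G: "G \<in> borel_measurable (F a)"
    and rect: "\<And>A. A \<in> sets (F a) \<Longrightarrow> A \<times> I \<in> sets N"
  shows "(\<lambda>(\<omega>, s). indicat_real I s *\<^sub>R G \<omega>) \<in> borel_measurable N"
proof (rule measurableI)
  fix A :: "'b set" assume A: "A \<in> sets borel"
  have 1: "(G -` A \<inter> space M) \<times> I \<in> sets N"
    using rect measurable_sets[OF G A] by simp
  have 2: "space M \<times> I \<in> sets N" using rect[of "space M"] sets.top[of "F a"] by simp
  have "(\<lambda>(\<omega>, s). indicat_real I s *\<^sub>R G \<omega>) -` A \<inter> space N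
      = ((G -` A \<inter> space M) \<times> I) \<union> (if 0 \<in> A then space N - space M \<times> I else {})"
    using sets.sets_into_space[OF 1] sets.sets_into_space[OF 2]
    by (auto simp: indicator_def of_bool_def sp split: if_splits)
  also have "\<dots> \<in> sets N" using 1 2 by auto
  finally show "(\<lambda>(\<omega>, s). indicat_real I s *\<^sub>R G \<omega>) -` A \<inter> space N \<in> sets N" .
qed simp

lemma predictable_indicator:
  fixes G :: "'a \<Rightarrow> 'b::{real_normed_vector, second_countable_topology}"
  assumes "G \<in> borel_measurable (F a)" "0 \<le> a" "a < b" "b \<le> T"
  shows "(\<lambda>(\<omega>, s). indicat_real {a<..b} s *\<^sub>R G \<omega>) \<in> borel_measurable Pred"
proof (rule measurable_indicator_scaleR[OF _ assms(1)])
  fix A assume "A \<in> sets (F a)"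
  then show "A \<times> {a<..b} \<in> sets Pred"
    unfolding sets_Pred using assms(2-4) by (intro sigma_sets.Basic) auto
qed simp

lemma progressive_indicator:
  fixes G :: "'a \<Rightarrow> 'b::{real_normed_vector, second_countable_topology}"
  assumes "G \<in> borel_measurable (F a)" "0 \<le> a" "I \<in> sets borel" "I \<subseteq> {a..T}"
  shows "(\<lambda>(\<omega>, s). indicat_real I s *\<^sub>R G \<omega>) \<in> borel_measurable Prog"
  by (rule measurable_indicator_scaleR[OF _ assms(1)]) (use assms in \<open>auto intro: Prog_rectangle\<close>)

lemma progressive_section:
  assumes "C \<in> measurable Prog N" "t \<in> {0..T}"
  shows "(\<lambda>\<omega>. C (\<omega>, t)) \<in> measurable (F t) N"
    and "(\<lambda>x. C x) \<in> measurable (F t \<Otimes>\<^sub>M restrict_space borel {0..t}) N"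
proof -
  show 1: "(\<lambda>x. C x) \<in> measurable (F t \<Otimes>\<^sub>M restrict_space borel {0..t}) N"
  proof (rule measurableI)
    fix x assume "x \<in> space (F t \<Otimes>\<^sub>M restrict_space borel {0..t})"
    then show "C x \<in> space N" using assms
      by (intro measurable_space[OF assms(1)]) (auto simp: space_pair_measure space_restrict_space)
  next
    fix A assume "A \<in> sets N"
    then have "C -` A \<inter> space Prog \<in> sets Prog" by (rule measurable_sets[OF assms(1)])
    then have "C -` A \<inter> space Prog \<inter> (space M \<times> {0..t}) \<in> sets (F t \<Otimes>\<^sub>M restrict_space borel {0..t})"
      using assms(2) unfolding sets_Prog by blast
    moreover have "C -` A \<inter> space Prog \<inter> (space M \<times> {0..t}) = C -` A \<inter> space (F t \<Otimes>\<^sub>M restrict_space borel {0..t})"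
      using assms(2) by (auto simp: space_pair_measure space_restrict_space)
    ultimately show "(\<lambda>x. C x) -` A \<inter> space (F t \<Otimes>\<^sub>M restrict_space borel {0..t}) \<in> sets (F t \<Otimes>\<^sub>M restrict_space borel {0..t})"
      by simp
  qed
  have "(\<lambda>\<omega>. (\<omega>, t)) \<in> measurable (F t) (F t \<Otimes>\<^sub>M restrict_space borel {0..t})"
    by (rule measurable_Pair2') (use assms(2) in \<open>auto simp: space_restrict_space\<close>)
  then show "(\<lambda>\<omega>. C (\<omega>, t)) \<in> measurable (F t) N"
    by (rule measurable_compose[OF _ 1])
qed

lemma progressive_continuous:
  fixes X :: "real \<Rightarrow> 'a \<Rightarrow> real"
  assumes ad: "adapted_process F T X" and cont: "continuous_process M T X"
  shows "(\<lambda>(\<omega>, s). X s \<omega>) \<in> borel_measurable Prog"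
proof -
  define h where "h n = T / real (Suc n)" for n
  have h: "h n > 0" "real (Suc n) * h n = T" for n using T_pos by (simp_all add: h_def)
  define I where "I n k = {real k * h n ..< (real k + 1) * h n} \<inter> {0..T}" for n k
  \<comment> \<open>The index \<open>Suc n\<close> is included because cells are closed on the left:
    the point \<open>s = T\<close> falls in the cell starting at \<open>T\<close>.\<close>
  define Y where "Y n = (\<lambda>(\<omega>, s). \<Sum>k\<le>Suc n. indicat_real (I n k) s *\<^sub>R X (real k * h n) \<omega>)" for n
  have Ym: "Y n \<in> borel_measurable Prog" for n
  proof -
    have "(\<lambda>x. \<Sum>k\<le>Suc n. (case x of (\<omega>, s) \<Rightarrow> indicat_real (I n k) s *\<^sub>R X (real k * h n) \<omega>)) \<in> borel_measurable Prog"
    proof (rule borel_measurable_sum)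
      fix k assume k: "k \<in> {..Suc n}"
      have "real k * h n \<le> real (Suc n) * h n" using k h(1)[of n] by (intro mult_right_mono) auto
      then have kT: "real k * h n \<in> {0..T}" using h(1)[of n] h(2)[of n] by auto
      show "(\<lambda>(\<omega>, s). indicat_real (I n k) s *\<^sub>R X (real k * h n) \<omega>) \<in> borel_measurable Prog"
        by (rule progressive_indicator[where a="real k * h n"])
          (use kT ad in \<open>auto simp: adapted_process_def I_def\<close>)
    qed
    then show ?thesis by (simp add: Y_def case_prod_unfold)
  qed
  have Yeq: "Y n (\<omega>, s) = X (real (nat \<lfloor>s / h n\<rfloor>) * h n) \<omega>" if "s \<in> {0..T}" for n \<omega> s
  proof -
    define k0 where "k0 = nat \<lfloor>s / h n\<rfloor>"
    have pos: "s / h n \<ge> 0" using that h(1)[of n] by simp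
    have k0: "real k0 \<le> s / h n" "s / h n < real k0 + 1" using pos unfolding k0_def by linarith+
    have "s / h n \<le> real (Suc n)" using that h[of n] by (simp add: field_simps)
    then have "real k0 \<le> real (Suc n)" using k0(1) by linarith
    then have k0n: "k0 \<in> {..Suc n}" by simp
    have "indicat_real (I n k) s = (if k = k0 then 1 else 0)" for k
    proof -
      have "s \<in> I n k \<longleftrightarrow> real k \<le> s / h n \<and> s / h n < real k + 1"
        using that h(1)[of n] by (simp add: I_def field_simps)
      also have "\<dots> \<longleftrightarrow> k = k0" using k0 by auto
      finally show ?thesis by (simp add: indicator_def)
    qed
    then have "Y n (\<omega>, s) = (\<Sum>k\<le>Suc n. (if k = k0 then 1 else 0) *\<^sub>R X (real k * h n) \<omega>)"
      unfolding Y_def prod.case by (simp only:)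
    also have "\<dots> = (\<Sum>k\<le>Suc n. if k = k0 then X (real k * h n) \<omega> else 0)"
      by (rule sum.cong) auto
    also have "\<dots> = X (real k0 * h n) \<omega>" using k0n by (subst sum.delta) auto
    finally show ?thesis by (simp add: k0_def)
  qed
  have lim: "(\<lambda>n. Y n x) \<longlonglongrightarrow> (case x of (\<omega>, s) \<Rightarrow> X s \<omega>)" if x_in: "x \<in> space Prog" for x
  proof -
    obtain \<omega> s where x: "x = (\<omega>, s)" "\<omega> \<in> space M" "s \<in> {0..T}" using x_in by (cases x) auto
    have c: "continuous_on {0..T} (\<lambda>t. X t \<omega>)" using cont x by (simp add: continuous_process_def)
    define r where "r n = real (nat \<lfloor>s / h n\<rfloor>) * h n" for n
    have fl: "real (nat \<lfloor>s / h n\<rfloor>) = of_int \<lfloor>s / h n\<rfloor>" for n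
      using x h(1)[of n] by simp
    have r: "s - h n \<le> r n" "r n \<le> s" "0 \<le> r n" for n
    proof -
      have fl': "s / h n - 1 \<le> of_int \<lfloor>s / h n\<rfloor>" "of_int \<lfloor>s / h n\<rfloor> \<le> s / h n" by linarith+
      have "(s / h n - 1) * h n \<le> r n" "r n \<le> (s / h n) * h n"
        unfolding r_def fl by (rule mult_right_mono[OF fl'(1)] mult_right_mono[OF fl'(2)], use h(1)[of n] in simp)+
      then show "s - h n \<le> r n" "r n \<le> s" using h(1)[of n] by (auto simp: left_diff_distrib)
      show "0 \<le> r n" using h(1)[of n] by (simp add: r_def)
    qed
    have "h \<longlonglongrightarrow> 0" unfolding h_def by (intro LIMSEQ_Suc[of "\<lambda>n. T / real n"] lim_const_over_n)
    then have "(\<lambda>n. s - h n) \<longlonglongrightarrow> s" by (auto intro!: tendsto_eq_intros)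
    then have "r \<longlonglongrightarrow> s"
      by (rule tendsto_sandwich[rotated 2, OF _ tendsto_const]) (use r in auto)
    then have "(\<lambda>n. X (r n) \<omega>) \<longlonglongrightarrow> X s \<omega>"
      by (rule continuous_on_tendsto_compose[OF c]) (use x r in \<open>auto intro!: always_eventually order_trans[OF r(2)]\<close>)
    then show ?thesis using Yeq x by (simp add: r_def)
  qed
  show ?thesis by (rule borel_measurable_LIMSEQ_metric[OF Ym lim])
qed

end

section \<open>Integrals of simple processes\<close>

text \<open>The partition \<open>\<rho>\<close> refines an interval whose ends are its nodes of
  index \<open>p\<close> and \<open>q\<close>; summing over the fine cells inside recovers the
  coarse increment of \<open>g\<close>. Below, \<open>g\<close> is an indicator for the integrand
  and a stopped Brownian path for the integral.\<close>

lemma sum_indicator_telescope: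
  fixes \<rho> :: "nat \<Rightarrow> real" and g :: "real \<Rightarrow> 'b::real_vector"
  assumes mono: "strict_mono_on {..m} \<rho>" and pq: "p \<le> q" "q \<le> m"
  shows "(\<Sum>k<m. indicat_real {\<rho> p<..\<rho> q} (\<rho> (Suc k)) *\<^sub>R (g (\<rho> (Suc k)) - g (\<rho> k))) = g (\<rho> q) - g (\<rho> p)"
proof -
  have less: "\<rho> i < \<rho> j \<longleftrightarrow> i < j" if "i \<le> m" "j \<le> m" for i j
    using strict_mono_on_less[OF mono] that by simp
  have le: "\<rho> i \<le> \<rho> j \<longleftrightarrow> i \<le> j" if "i \<le> m" "j \<le> m" for i j
    using strict_mono_on_less_eq[OF mono] that by simp
  have "(\<Sum>k<m. indicat_real {\<rho> p<..\<rho> q} (\<rho> (Suc k)) *\<^sub>R (g (\<rho> (Suc k)) - g (\<rho> k)))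
      = (\<Sum>k\<in>{..<m}. if k \<in> {p..<q} then g (\<rho> (Suc k)) - g (\<rho> k) else 0)"
  proof (rule sum.cong)
    fix k assume "k \<in> {..<m}"
    then have "\<rho> p < \<rho> (Suc k) \<longleftrightarrow> p \<le> k" "\<rho> (Suc k) \<le> \<rho> q \<longleftrightarrow> k < q"
      using less[of p "Suc k"] le[of "Suc k" q] pq by auto
    then show "indicat_real {\<rho> p<..\<rho> q} (\<rho> (Suc k)) *\<^sub>R (g (\<rho> (Suc k)) - g (\<rho> k))
       = (if k \<in> {p..<q} then g (\<rho> (Suc k)) - g (\<rho> k) else 0)"
      by (simp add: indicator_def)
  qed simp
  also have "\<dots> = (\<Sum>k\<in>{..<m} \<inter> {p..<q}. g (\<rho> (Suc k)) - g (\<rho> k))"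
    by (subst sum.inter_restrict) auto
  also have "{..<m} \<inter> {p..<q} = {p..<q}" using pq by auto
  also have "(\<Sum>k\<in>{p..<q}. g (\<rho> (Suc k)) - g (\<rho> k)) = g (\<rho> q) - g (\<rho> p)"
    by (rule sum_Suc_diff'[OF pq(1)])
  finally show ?thesis .
qed

context brownian
begin

text \<open>A relation between integrand and integral that hides the partition and the coefficients.
  Pairs in it are closed under linear operations and truncation, which is how simple integrals are
  handled from here on.\<close>

definition simple_ito :: "(real \<Rightarrow> 'a \<Rightarrow> real ^ 'd) \<Rightarrow> (real \<Rightarrow> 'a \<Rightarrow> real) \<Rightarrow> bool" where
  "simple_ito Z X \<longleftrightarrow> (\<exists>n \<tau> \<phi>. simple_integrand M F T n \<tau> \<phi> \<and>
     Z = simple_process n \<tau> \<phi> \<and> X = simple_ito_integral B n \<tau> \<phi>)"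

lemma simple_integrandD:
  assumes "simple_integrand M F T n \<tau> \<phi>"
  shows "strict_mono_on {..n} \<tau>" "\<And>i. i \<le> n \<Longrightarrow> \<tau> i \<in> {0..T}"
    "\<And>i. i < n \<Longrightarrow> \<phi> i \<in> borel_measurable (F (\<tau> i))"
    "\<And>i. i < n \<Longrightarrow> \<exists>C. \<forall>\<omega>\<in>space M. norm (\<phi> i \<omega>) \<le> C"
proof -
  have a: "0 \<le> \<tau> 0" "\<tau> n \<le> T" "\<And>i. i < n \<Longrightarrow> \<tau> i < \<tau> (Suc i)"
    using assms by (auto simp: simple_integrand_def)
  have less: "\<tau> i < \<tau> j" if "i < j" "j \<le> n" for i j
    using that
  proof (induction j)
    case (Suc j)
    then show ?case using a(3)[of j] by (cases "i = j") auto
  qed simp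
  then show "strict_mono_on {..n} \<tau>" by (auto simp: strict_mono_on_def)
  show "\<tau> i \<in> {0..T}" if "i \<le> n" for i
    using a less[of 0 i] less[of i n] that by (cases "i = 0"; cases "i = n") auto
  show "\<phi> i \<in> borel_measurable (F (\<tau> i))" "\<exists>C. \<forall>\<omega>\<in>space M. norm (\<phi> i \<omega>) \<le> C" if "i < n" for i
    using assms that by (auto simp: simple_integrand_def)
qed

text \<open>On a fine cell, open on the left, the process is constant, so its value at the right end
  \<open>\<rho> (Suc k)\<close> is the new coefficient. That value is
  \<open>F (\<rho> k)\<close>-measurable: a coarse node below \<open>\<rho> (Suc k)\<close> is
  itself a fine node, hence at most \<open>\<rho> k\<close>.\<close>

lemma simple_integrand_refine:
  assumes si: "simple_integrand M F T n \<tau> \<phi>"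
    and m: "strict_mono_on {..m} \<rho>" "\<And>i. i \<le> m \<Longrightarrow> \<rho> i \<in> {0..T}" and sub: "\<tau> ` {..n} \<subseteq> \<rho> ` {..m}"
  defines "\<psi> \<equiv> \<lambda>k. simple_process n \<tau> \<phi> (\<rho> (Suc k))"
  shows "simple_integrand M F T m \<rho> \<psi>"
    and "simple_process m \<rho> \<psi> = simple_process n \<tau> \<phi>"
    and "simple_ito_integral B m \<rho> \<psi> = simple_ito_integral B n \<tau> \<phi>"
proof -
  note S = simple_integrandD[OF si]
  have less: "\<rho> i < \<rho> j \<longleftrightarrow> i < j" if "i \<le> m" "j \<le> m" for i j
    using strict_mono_on_less[OF m(1)] that by simp
  have ex: "\<exists>p q. p \<le> q \<and> q \<le> m \<and> \<rho> p = \<tau> i \<and> \<rho> q = \<tau> (Suc i)" if i: "i < n" for i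
  proof -
    have "\<tau> i \<in> \<rho> ` {..m}" "\<tau> (Suc i) \<in> \<rho> ` {..m}" using sub i by auto
    then obtain p q where pq: "p \<le> m" "q \<le> m" "\<rho> p = \<tau> i" "\<rho> q = \<tau> (Suc i)"
      by (metis atMost_iff imageE)
    moreover have "\<tau> i < \<tau> (Suc i)" using si i by (simp add: simple_integrand_def)
    ultimately have "p < q" using less[of p q] by simp
    then show ?thesis using pq by (intro exI[of _ p] exI[of _ q]) auto
  qed
  show "simple_integrand M F T m \<rho> \<psi>"
    unfolding simple_integrand_def
  proof (intro conjI allI impI)
    show "0 \<le> \<rho> 0" "\<rho> m \<le> T" using m(2)[of 0] m(2)[of m] by auto
    fix k assume k: "k < m"
    show "\<rho> k < \<rho> (Suc k)" using less[of k "Suc k"] k by simp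
    show "\<psi> k \<in> borel_measurable (F (\<rho> k))"
      unfolding \<psi>_def simple_process_def
    proof (rule borel_measurable_sum)
      fix i assume i: "i \<in> {..<n}"
      show "(\<lambda>\<omega>. indicat_real {\<tau> i<..\<tau> (Suc i)} (\<rho> (Suc k)) *\<^sub>R \<phi> i \<omega>) \<in> borel_measurable (F (\<rho> k))"
      proof (cases "\<tau> i < \<rho> (Suc k)")
        case True
        have "\<tau> i \<in> \<rho> ` {..m}" using sub i by auto
        then obtain p where p: "p \<le> m" "\<rho> p = \<tau> i" by (metis atMost_iff imageE)
        then have "p \<le> k" using True less[of p "Suc k"] k by auto
        then have "\<tau> i \<le> \<rho> k" using p less[of p k] k by (cases "p = k") auto
        then have "\<phi> i \<in> borel_measurable (F (\<rho> k))" using S(3) i measurable_F_mono by blast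
        then show ?thesis by measurable
      qed (simp add: indicator_def)
    qed
    obtain C where C: "\<And>i \<omega>. i < n \<Longrightarrow> \<omega> \<in> space M \<Longrightarrow> norm (\<phi> i \<omega>) \<le> C i" using S(4) by metis
    show "\<exists>C. \<forall>\<omega>\<in>space M. norm (\<psi> k \<omega>) \<le> C"
    proof (intro exI ballI)
      fix \<omega> assume w: "\<omega> \<in> space M"
      have "norm (\<psi> k \<omega>) \<le> (\<Sum>i<n. norm (indicat_real {\<tau> i<..\<tau> (Suc i)} (\<rho> (Suc k)) *\<^sub>R \<phi> i \<omega>))"
        unfolding \<psi>_def simple_process_def by (rule norm_sum)
      also have "\<dots> \<le> (\<Sum>i<n. C i)"
      proof (rule sum_mono)
        fix i assume "i \<in> {..<n}"
        then have "norm (\<phi> i \<omega>) \<le> C i" using C w by simp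
        moreover have "0 \<le> C i" using calculation norm_ge_zero order_trans by blast
        ultimately show "norm (indicat_real {\<tau> i<..\<tau> (Suc i)} (\<rho> (Suc k)) *\<^sub>R \<phi> i \<omega>) \<le> C i"
          by (cases "\<rho> (Suc k) \<in> {\<tau> i<..\<tau> (Suc i)}") simp_all
      qed
      finally show "norm (\<psi> k \<omega>) \<le> (\<Sum>i<n. C i)" .
    qed
  qed
  show "simple_process m \<rho> \<psi> = simple_process n \<tau> \<phi>"
  proof (intro ext)
    fix s :: real and \<omega> :: 'a
    \<comment> \<open>With this \<open>g\<close>, the increment over a cell is the indicator that
      \<open>s\<close> lies in the cell, so equality of integrands is the same telescoping as
      equality of integrals.\<close>
    define g where "g x = indicat_real {s..} x" for x
    have g: "indicat_real {\<rho> k<..\<rho> (Suc k)} s = g (\<rho> (Suc k)) - g (\<rho> k)" if "k < m" for k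
      using less[of k "Suc k"] that by (auto simp: g_def indicator_def)
    have "simple_process m \<rho> \<psi> s \<omega>
      = (\<Sum>k<m. \<Sum>i<n. (indicat_real {\<tau> i<..\<tau> (Suc i)} (\<rho> (Suc k)) * (g (\<rho> (Suc k)) - g (\<rho> k))) *\<^sub>R \<phi> i \<omega>)"
      unfolding simple_process_def[of m] \<psi>_def
      by (rule sum.cong) (simp_all only: g lessThan_iff simple_process_def scaleR_sum_right scaleR_scaleR mult.commute)
    also have "\<dots> = (\<Sum>i<n. (\<Sum>k<m. indicat_real {\<tau> i<..\<tau> (Suc i)} (\<rho> (Suc k)) *\<^sub>R (g (\<rho> (Suc k)) - g (\<rho> k))) *\<^sub>R \<phi> i \<omega>)"
      by (subst sum.swap) (simp only: scaleR_sum_left real_scaleR_def)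
    also have "\<dots> = (\<Sum>i<n. indicat_real {\<tau> i<..\<tau> (Suc i)} s *\<^sub>R \<phi> i \<omega>)"
    proof (rule sum.cong[OF refl])
      fix i assume "i \<in> {..<n}"
      then have "i < n" by simp
      from ex[OF this] obtain p q where pq: "p \<le> q" "q \<le> m" "\<rho> p = \<tau> i" "\<rho> q = \<tau> (Suc i)" by blast
      have "(\<Sum>k<m. indicat_real {\<tau> i<..\<tau> (Suc i)} (\<rho> (Suc k)) *\<^sub>R (g (\<rho> (Suc k)) - g (\<rho> k))) = g (\<tau> (Suc i)) - g (\<tau> i)"
        using sum_indicator_telescope[OF m(1) pq(1,2), of g] pq(3,4) by simp
      also have "\<dots> = indicat_real {\<tau> i<..\<tau> (Suc i)} s"
      proof -
        have "\<tau> i < \<tau> (Suc i)" using si \<open>i \<in> {..<n}\<close> by (auto simp: simple_integrand_def)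
        then show ?thesis by (auto simp: g_def indicator_def)
      qed
      finally show "(\<Sum>k<m. indicat_real {\<tau> i<..\<tau> (Suc i)} (\<rho> (Suc k)) *\<^sub>R (g (\<rho> (Suc k)) - g (\<rho> k))) *\<^sub>R \<phi> i \<omega>
         = indicat_real {\<tau> i<..\<tau> (Suc i)} s *\<^sub>R \<phi> i \<omega>" by simp
    qed
    finally show "simple_process m \<rho> \<psi> s \<omega> = simple_process n \<tau> \<phi> s \<omega>" by (simp add: simple_process_def)
  qed
  show "simple_ito_integral B m \<rho> \<psi> = simple_ito_integral B n \<tau> \<phi>"
  proof (intro ext)
    fix t :: real and \<omega> :: 'a
    define g where "g x = B (min x t) \<omega>" for x
    have "simple_ito_integral B m \<rho> \<psi> t \<omega>
      = (\<Sum>k<m. \<Sum>i<n. \<phi> i \<omega> \<bullet> (indicat_real {\<tau> i<..\<tau> (Suc i)} (\<rho> (Suc k)) *\<^sub>R (g (\<rho> (Suc k)) - g (\<rho> k))))"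
      unfolding simple_ito_integral_def \<psi>_def g_def simple_process_def
      by (rule sum.cong) (simp_all add: inner_sum_left)
    also have "\<dots> = (\<Sum>i<n. \<phi> i \<omega> \<bullet> (\<Sum>k<m. indicat_real {\<tau> i<..\<tau> (Suc i)} (\<rho> (Suc k)) *\<^sub>R (g (\<rho> (Suc k)) - g (\<rho> k))))"
      by (subst sum.swap) (simp add: inner_sum_right)
    also have "\<dots> = (\<Sum>i<n. \<phi> i \<omega> \<bullet> (g (\<tau> (Suc i)) - g (\<tau> i)))"
    proof (rule sum.cong[OF refl])
      fix i assume "i \<in> {..<n}"
      then have "i < n" by simp
      from ex[OF this] obtain p q where pq: "p \<le> q" "q \<le> m" "\<rho> p = \<tau> i" "\<rho> q = \<tau> (Suc i)" by blast
      show "\<phi> i \<omega> \<bullet> (\<Sum>k<m. indicat_real {\<tau> i<..\<tau> (Suc i)} (\<rho> (Suc k)) *\<^sub>R (g (\<rho> (Suc k)) - g (\<rho> k))) = \<phi> i \<omega> \<bullet> (g (\<tau> (Suc i)) - g (\<tau> i))"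
        using sum_indicator_telescope[OF m(1) pq(1,2), of g] pq(3,4) by simp
    qed
    finally show "simple_ito_integral B m \<rho> \<psi> t \<omega> = simple_ito_integral B n \<tau> \<phi> t \<omega>"
      by (simp add: simple_ito_integral_def g_def)
  qed
qed

lemma strict_mono_on_sorted_list_of_set:
  assumes "finite D"
  shows "strict_mono_on {..card D - 1} (\<lambda>k. sorted_list_of_set D ! k)"
proof (rule strict_mono_onI)
  fix i j assume ij: "i \<in> {..card D - 1}" "j \<in> {..card D - 1}" "i < j"
  then have "j < length (sorted_list_of_set D)" by simp
  then show "sorted_list_of_set D ! i < sorted_list_of_set D ! j"
    using sorted_wrt_nth_less[OF strict_sorted_list_of_set ij(3)] by simp
qed

text \<open>The sorted union of both sets of nodes refines each of them; over one partition,
  integrands add coefficientwise.\<close>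

lemma simple_ito_common_partition:
  assumes "simple_integrand M F T n \<tau> \<phi>" "simple_integrand M F T n' \<tau>' \<phi>'"
  obtains m \<rho> \<psi> \<psi>' where "simple_integrand M F T m \<rho> \<psi>" "simple_integrand M F T m \<rho> \<psi>'"
    "simple_process m \<rho> \<psi> = simple_process n \<tau> \<phi>" "simple_ito_integral B m \<rho> \<psi> = simple_ito_integral B n \<tau> \<phi>"
    "simple_process m \<rho> \<psi>' = simple_process n' \<tau>' \<phi>'" "simple_ito_integral B m \<rho> \<psi>' = simple_ito_integral B n' \<tau>' \<phi>'"
proof -
  define D where "D = \<tau> ` {..n} \<union> \<tau>' ` {..n'}"
  define \<rho> where "\<rho> k = sorted_list_of_set D ! k" for k
  define m where "m = card D - 1"
  have D: "finite D" "D \<noteq> {}" "D \<subseteq> {0..T}"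
    using simple_integrandD(2)[OF assms(1)] simple_integrandD(2)[OF assms(2)] by (auto simp: D_def)
  then have len: "length (sorted_list_of_set D) = Suc m"
    by (simp add: m_def card_gt_0_iff)
  have set: "\<rho> ` {..m} = D"
  proof -
    have "\<rho> ` {..m} = (!) (sorted_list_of_set D) ` {..<length (sorted_list_of_set D)}"
      unfolding len \<rho>_def by (simp add: lessThan_Suc_atMost)
    also have "\<dots> = set (sorted_list_of_set D)" by (auto simp: set_conv_nth)
    finally show ?thesis using D by simp
  qed
  have mono: "strict_mono_on {..m} \<rho>"
    unfolding \<rho>_def m_def by (rule strict_mono_on_sorted_list_of_set[OF D(1)])
  have in_T: "\<rho> i \<in> {0..T}" if "i \<le> m" for i using set that D(3) by auto
  show thesis
    by (rule that[OF simple_integrand_refine(1)[OF assms(1) mono in_T] simple_integrand_refine(1)[OF assms(2) mono in_T]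
          simple_integrand_refine(2,3)[OF assms(1) mono in_T] simple_integrand_refine(2,3)[OF assms(2) mono in_T]])
      (auto simp: set D_def)
qed

lemma simple_ito_add:
  assumes "simple_ito Z X" "simple_ito Z' X'"
  shows "simple_ito (\<lambda>s \<omega>. Z s \<omega> + Z' s \<omega>) (\<lambda>t \<omega>. X t \<omega> + X' t \<omega>)"
proof -
  obtain n \<tau> \<phi> n' \<tau>' \<phi>' where 1: "simple_integrand M F T n \<tau> \<phi>" "simple_integrand M F T n' \<tau>' \<phi>'"
    "Z = simple_process n \<tau> \<phi>" "X = simple_ito_integral B n \<tau> \<phi>"
    "Z' = simple_process n' \<tau>' \<phi>'" "X' = simple_ito_integral B n' \<tau>' \<phi>'"
    using assms unfolding simple_ito_def by blast
  obtain m \<rho> \<psi> \<psi>' where 2: "simple_integrand M F T m \<rho> \<psi>" "simple_integrand M F T m \<rho> \<psi>'"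
    "simple_process m \<rho> \<psi> = Z" "simple_ito_integral B m \<rho> \<psi> = X"
    "simple_process m \<rho> \<psi>' = Z'" "simple_ito_integral B m \<rho> \<psi>' = X'"
    unfolding 1(3-6) using simple_ito_common_partition[OF 1(1,2)] .
  have "simple_integrand M F T m \<rho> (\<lambda>k \<omega>. \<psi> k \<omega> + \<psi>' k \<omega>)"
    unfolding simple_integrand_def
  proof (intro conjI allI impI)
    fix i assume i: "i < m"
    show "(\<lambda>\<omega>. \<psi> i \<omega> + \<psi>' i \<omega>) \<in> borel_measurable (F (\<rho> i))"
      using simple_integrandD(3)[OF 2(1) i] simple_integrandD(3)[OF 2(2) i] by measurable
    obtain C C' where "\<forall>\<omega>\<in>space M. norm (\<psi> i \<omega>) \<le> C" "\<forall>\<omega>\<in>space M. norm (\<psi>' i \<omega>) \<le> C'"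
      using simple_integrandD(4)[OF 2(1) i] simple_integrandD(4)[OF 2(2) i] by auto
    then show "\<exists>C. \<forall>\<omega>\<in>space M. norm (\<psi> i \<omega> + \<psi>' i \<omega>) \<le> C"
      by (intro exI[of _ "C + C'"]) (auto intro: norm_triangle_mono)
  qed (use 2(1) in \<open>auto simp: simple_integrand_def\<close>)
  moreover have "(\<lambda>s \<omega>. Z s \<omega> + Z' s \<omega>) = simple_process m \<rho> (\<lambda>k \<omega>. \<psi> k \<omega> + \<psi>' k \<omega>)"
    unfolding 2(3)[symmetric] 2(5)[symmetric] by (intro ext) (simp add: simple_process_def scaleR_add_right sum.distrib)
  moreover have "(\<lambda>t \<omega>. X t \<omega> + X' t \<omega>) = simple_ito_integral B m \<rho> (\<lambda>k \<omega>. \<psi> k \<omega> + \<psi>' k \<omega>)"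
    unfolding 2(4)[symmetric] 2(6)[symmetric] by (intro ext) (simp add: simple_ito_integral_def inner_add_left sum.distrib)
  ultimately show ?thesis unfolding simple_ito_def by blast
qed

lemma simple_ito_scale:
  assumes "simple_ito Z X"
  shows "simple_ito (\<lambda>s \<omega>. c *\<^sub>R Z s \<omega>) (\<lambda>t \<omega>. c * X t \<omega>)"
proof -
  obtain n \<tau> \<phi> where 1: "simple_integrand M F T n \<tau> \<phi>" "Z = simple_process n \<tau> \<phi>" "X = simple_ito_integral B n \<tau> \<phi>"
    using assms unfolding simple_ito_def by blast
  have "simple_integrand M F T n \<tau> (\<lambda>k \<omega>. c *\<^sub>R \<phi> k \<omega>)"
    unfolding simple_integrand_def
  proof (intro conjI allI impI)
    fix i assume i: "i < n"
    show "(\<lambda>\<omega>. c *\<^sub>R \<phi> i \<omega>) \<in> borel_measurable (F (\<tau> i))"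
      using simple_integrandD(3)[OF 1(1) i] by measurable
    obtain C where "\<forall>\<omega>\<in>space M. norm (\<phi> i \<omega>) \<le> C" using simple_integrandD(4)[OF 1(1) i] by auto
    then show "\<exists>C. \<forall>\<omega>\<in>space M. norm (c *\<^sub>R \<phi> i \<omega>) \<le> C"
      by (intro exI[of _ "\<bar>c\<bar> * C"]) (auto intro: mult_left_mono)
  qed (use 1(1) in \<open>auto simp: simple_integrand_def\<close>)
  moreover have "(\<lambda>s \<omega>. c *\<^sub>R Z s \<omega>) = simple_process n \<tau> (\<lambda>k \<omega>. c *\<^sub>R \<phi> k \<omega>)"
    unfolding 1(2) by (intro ext) (simp only: simple_process_def scaleR_sum_right scaleR_scaleR mult.commute)
  moreover have "(\<lambda>t \<omega>. c * X t \<omega>) = simple_ito_integral B n \<tau> (\<lambda>k \<omega>. c *\<^sub>R \<phi> k \<omega>)"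
    unfolding 1(3) by (intro ext) (simp add: simple_ito_integral_def sum_distrib_left)
  ultimately show ?thesis unfolding simple_ito_def by blast
qed

lemma simple_ito_diff:
  assumes "simple_ito Z X" "simple_ito Z' X'"
  shows "simple_ito (\<lambda>s \<omega>. Z s \<omega> - Z' s \<omega>) (\<lambda>t \<omega>. X t \<omega> - X' t \<omega>)"
  using simple_ito_add[OF assms(1) simple_ito_scale[OF assms(2), of "-1"]] by simp

lemma simple_ito_zero: "simple_ito (\<lambda>s \<omega>. 0) (\<lambda>t \<omega>. 0)"
  unfolding simple_ito_def
  by (rule exI[of _ 0], rule exI[of _ "\<lambda>_. 0"], rule exI[of _ "\<lambda>_ _. 0"])
    (use T_pos in \<open>auto simp: simple_integrand_def simple_process_def simple_ito_integral_def fun_eq_iff\<close>)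

lemma simple_ito_elem:
  assumes "0 \<le> a" "a < b" "b \<le> T" "\<phi> \<in> borel_measurable (F a)" "\<And>\<omega>. \<omega> \<in> space M \<Longrightarrow> norm (\<phi> \<omega>) \<le> C"
  shows "simple_ito (\<lambda>s \<omega>. indicat_real {a<..b} s *\<^sub>R \<phi> \<omega>) (\<lambda>t \<omega>. \<phi> \<omega> \<bullet> (B (min b t) \<omega> - B (min a t) \<omega>))"
  unfolding simple_ito_def
  by (rule exI[of _ 1], rule exI[of _ "\<lambda>i. if i = 0 then a else b"], rule exI[of _ "\<lambda>_. \<phi>"])
    (use assms in \<open>auto simp: simple_integrand_def simple_process_def simple_ito_integral_def fun_eq_iff\<close>)

lemma simple_ito_sum:
  assumes "\<And>i. i \<in> I \<Longrightarrow> simple_ito (Z i) (X i)" "finite I"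
  shows "simple_ito (\<lambda>s \<omega>. \<Sum>i\<in>I. Z i s \<omega>) (\<lambda>t \<omega>. \<Sum>i\<in>I. X i t \<omega>)"
  using assms(2,1) by induction (auto intro: simple_ito_zero simple_ito_add)

text \<open>The increment of an integral after time t is the integral of the integrand cut off
  before t. Facts about terminal values, the isometry above all, thereby extend to increments. A
  cell that straddles t is shortened to start at \<open>max t (\<tau> i)\<close>, where its
  coefficient is still measurable.\<close>

lemma simple_ito_truncate:
  assumes "simple_ito Z X" and t: "t \<in> {0..T}"
  shows "simple_ito (\<lambda>s \<omega>. indicat_real {t<..} s *\<^sub>R Z s \<omega>) (\<lambda>r \<omega>. X r \<omega> - X (min t r) \<omega>)"
proof -
  obtain n \<tau> \<phi> where 1: "simple_integrand M F T n \<tau> \<phi>" "Z = simple_process n \<tau> \<phi>" "X = simple_ito_integral B n \<tau> \<phi>"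
    using assms unfolding simple_ito_def by blast
  note S = simple_integrandD[OF 1(1)]
  have elem: "simple_ito (\<lambda>s \<omega>. indicat_real {t<..} s *\<^sub>R indicat_real {\<tau> i<..\<tau> (Suc i)} s *\<^sub>R \<phi> i \<omega>)
      (\<lambda>r \<omega>. \<phi> i \<omega> \<bullet> (B (min (\<tau> (Suc i)) r) \<omega> - B (min (\<tau> i) r) \<omega>)
         - \<phi> i \<omega> \<bullet> (B (min (\<tau> (Suc i)) (min t r)) \<omega> - B (min (\<tau> i) (min t r)) \<omega>))" (is "simple_ito ?Z ?X") if i: "i < n" for i
  proof (cases "t < \<tau> (Suc i)")
    case True
    let ?a = "max t (\<tau> i)"
    have lt: "\<tau> i < \<tau> (Suc i)" using 1(1) i by (simp add: simple_integrand_def)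
    obtain C where C: "\<And>\<omega>. \<omega> \<in> space M \<Longrightarrow> norm (\<phi> i \<omega>) \<le> C" using S(4)[OF i] by auto
    have "simple_ito (\<lambda>s \<omega>. indicat_real {?a<..\<tau> (Suc i)} s *\<^sub>R \<phi> i \<omega>)
      (\<lambda>r \<omega>. \<phi> i \<omega> \<bullet> (B (min (\<tau> (Suc i)) r) \<omega> - B (min ?a r) \<omega>))"
      by (rule simple_ito_elem[OF _ _ _ _ C])
        (use True lt t S(2)[of i] S(2)[of "Suc i"] i in \<open>auto intro: measurable_F_mono[OF S(3)[OF i]]\<close>)
    moreover have "(\<lambda>s \<omega>. indicat_real {?a<..\<tau> (Suc i)} s *\<^sub>R \<phi> i \<omega>) = ?Z"
      by (auto simp: fun_eq_iff indicator_def)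
    moreover have "(\<lambda>r \<omega>. \<phi> i \<omega> \<bullet> (B (min (\<tau> (Suc i)) r) \<omega> - B (min ?a r) \<omega>)) = ?X"
    proof (intro ext)
      fix r \<omega>
      have a: "min (\<tau> (Suc i)) (min t r) = min t r" using True by auto
      have b: "(min ?a r = min t r \<and> min (\<tau> i) r = min (\<tau> i) (min t r)) \<or>
         (min ?a r = min (\<tau> i) r \<and> min (\<tau> i) (min t r) = min t r)"
        by (auto simp: min_def max_def)
      show "\<phi> i \<omega> \<bullet> (B (min (\<tau> (Suc i)) r) \<omega> - B (min ?a r) \<omega>) =
        \<phi> i \<omega> \<bullet> (B (min (\<tau> (Suc i)) r) \<omega> - B (min (\<tau> i) r) \<omega>)
         - \<phi> i \<omega> \<bullet> (B (min (\<tau> (Suc i)) (min t r)) \<omega> - B (min (\<tau> i) (min t r)) \<omega>)"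
        unfolding a using b by (auto simp: inner_diff_right)
    qed
    ultimately show ?thesis by simp
  next
    case False
    have lt: "\<tau> i < \<tau> (Suc i)" using 1(1) i by (simp add: simple_integrand_def)
    have "?Z = (\<lambda>s \<omega>. 0)" using False by (auto simp: fun_eq_iff indicator_def)
    moreover have "?X = (\<lambda>r \<omega>. 0)"
    proof (intro ext)
      fix r \<omega>
      have "min (\<tau> (Suc i)) (min t r) = min (\<tau> (Suc i)) r" "min (\<tau> i) (min t r) = min (\<tau> i) r"
        using False lt by (auto simp: min_def)
      then show "?X r \<omega> = 0" by simp
    qed
    ultimately show ?thesis using simple_ito_zero by simp
  qed
  have "simple_ito (\<lambda>s \<omega>. \<Sum>i<n. indicat_real {t<..} s *\<^sub>R indicat_real {\<tau> i<..\<tau> (Suc i)} s *\<^sub>R \<phi> i \<omega>)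
      (\<lambda>r \<omega>. \<Sum>i<n. \<phi> i \<omega> \<bullet> (B (min (\<tau> (Suc i)) r) \<omega> - B (min (\<tau> i) r) \<omega>)
         - \<phi> i \<omega> \<bullet> (B (min (\<tau> (Suc i)) (min t r)) \<omega> - B (min (\<tau> i) (min t r)) \<omega>))"
    by (rule simple_ito_sum) (use elem in auto)
  then show ?thesis
    unfolding 1(2,3) simple_process_def simple_ito_integral_def scaleR_sum_right sum_subtractf[symmetric] .
qed

end

section \<open>Orthogonality and isometry of simple integrals\<close>

lemma borel_measurable_vec_nth':
  "f \<in> borel_measurable N \<Longrightarrow> (\<lambda>x. f x $ i) \<in> borel_measurable N" for f :: "'a \<Rightarrow> real ^ 'd::finite"
  by (rule measurable_compose[of f N borel]) auto

context brownian
begin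

sublocale Lm: finite_measure L by (rule finite_measure_L)
sublocale Qp: pair_sigma_finite M L by (rule pair_sigma_finite_Q)
sublocale Qm: finite_measure Q by (rule finite_measure_Q)

lemma component_eq_axis: "x $ i = axis i 1 \<bullet> x" for x :: "real ^ 'd"
  by (simp add: cart_eq_inner_axis inner_commute)

lemma increment_component:
  assumes "0 \<le> s" "s < t" "t \<le> T"
  shows "integrable M (\<lambda>\<omega>. (B t \<omega> - B s \<omega>) $ i)" "(\<integral>\<omega>. (B t \<omega> - B s \<omega>) $ i \<partial>M) = 0"
    "integrable M (\<lambda>\<omega>. (B t \<omega> - B s \<omega>) $ i * (B t \<omega> - B s \<omega>) $ j)"
    "(\<integral>\<omega>. (B t \<omega> - B s \<omega>) $ i * (B t \<omega> - B s \<omega>) $ j \<partial>M) = (if i = j then t - s else 0)"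
proof -
  let ?D = "\<lambda>\<omega>. B t \<omega> - B s \<omega>"
  show "integrable M (\<lambda>\<omega>. ?D \<omega> $ i)" "(\<integral>\<omega>. ?D \<omega> $ i \<partial>M) = 0"
    using increment_moment(1)[OF assms, of "axis i 1" 1] increment_moment(2)[OF assms, of "axis i 1"]
    by (simp_all only: component_eq_axis[symmetric] power_one_right)
  have sq: "integrable M (\<lambda>\<omega>. (l \<bullet> ?D \<omega>)\<^sup>2)" "(\<integral>\<omega>. (l \<bullet> ?D \<omega>)\<^sup>2 \<partial>M) = (norm l)\<^sup>2 * (t - s)" for l
    using increment_moment(1,3)[OF assms, of l] by blast+
  \<comment> \<open>Polarisation: mixed moments of coordinates follow from second moments of scalar
    projections.\<close>
  have eq: "?D \<omega> $ i * ?D \<omega> $ j = (((axis i 1 + axis j 1) \<bullet> ?D \<omega>)\<^sup>2 - (axis i 1 \<bullet> ?D \<omega>)\<^sup>2 - (axis j 1 \<bullet> ?D \<omega>)\<^sup>2) / 2" for \<omega>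
    unfolding inner_add_left component_eq_axis[symmetric] by (simp add: power2_sum)
  show "integrable M (\<lambda>\<omega>. ?D \<omega> $ i * ?D \<omega> $ j)"
    unfolding eq by (intro integrable_divide_zero Bochner_Integration.integrable_diff sq)
  have "(\<integral>\<omega>. ?D \<omega> $ i * ?D \<omega> $ j \<partial>M) = ((norm (axis i 1 + axis j 1 :: real ^ 'd))\<^sup>2 * (t - s)
      - (norm (axis i 1 :: real ^ 'd))\<^sup>2 * (t - s) - (norm (axis j 1 :: real ^ 'd))\<^sup>2 * (t - s)) / 2"
    unfolding eq by (simp add: sq del: power2_norm_eq_inner)
  also have "(norm (axis i 1 + axis j 1 :: real ^ 'd))\<^sup>2 = (if i = j then 4 else 2)"
    by (simp add: power2_norm_eq_inner inner_add inner_axis_axis)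
  finally show "(\<integral>\<omega>. ?D \<omega> $ i * ?D \<omega> $ j \<partial>M) = (if i = j then t - s else 0)" by (simp split: if_splits)
qed

lemma inner_eq_sum: "x \<bullet> y = (\<Sum>i\<in>UNIV. x $ i * y $ i)" for x y :: "real ^ 'd"
  by (simp add: inner_vec_def)

lemma square_integrable_component:
  fixes f :: "'a \<Rightarrow> real ^ 'd"
  assumes "\<And>i. square_integrable N (\<lambda>x. f x $ i)"
  shows "square_integrable N f"
proof -
  have "square_integrable N (\<lambda>x. \<Sum>i\<in>UNIV. f x $ i *\<^sub>R (axis i 1 :: real ^ 'd))"
  proof (rule square_integrable_sum)
    fix i
    show "square_integrable N (\<lambda>x. f x $ i *\<^sub>R (axis i 1 :: real ^ 'd))"
      by (rule square_integrable_bound(1)[OF assms[of i]]) (use square_integrableD(1)[OF assms[of i]] in auto)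
  qed
  moreover have "(\<Sum>i\<in>UNIV. v $ i *\<^sub>R axis i 1) = v" for v :: "real ^ 'd"
    by (simp add: vec_eq_iff axis_def if_distrib[of "\<lambda>x. _ * x"] cong: if_cong)
  ultimately show ?thesis by simp
qed

lemma increment_square_integrable:
  assumes "0 \<le> s" "s < t" "t \<le> T"
  shows "square_integrable M (\<lambda>\<omega>. B t \<omega> - B s \<omega>)"
  by (rule square_integrable_component, unfold square_integrable_def)
    (use increment_component[OF assms] in \<open>auto simp: power2_eq_square intro: borel_measurable_integrable\<close>)

text \<open>Coordinatewise, \<open>\<phi> $ i\<close> times \<open>G\<close> is
  \<open>F s\<close>-measurable and integrable, hence independent of the centred increment. This is
  the source of every martingale property below.\<close>

lemma orthogonal_increment:
  assumes s: "0 \<le> s" "s < t" "t \<le> T" and G: "G \<in> borel_measurable (F s)" "square_integrable M G"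
    and \<phi>: "\<phi> \<in> borel_measurable (F s)" "\<And>\<omega>. \<omega> \<in> space M \<Longrightarrow> norm (\<phi> \<omega>) \<le> C"
  shows "integrable M (\<lambda>\<omega>. G \<omega> * (\<phi> \<omega> \<bullet> (B t \<omega> - B s \<omega>)))"
    "(\<integral>\<omega>. G \<omega> * (\<phi> \<omega> \<bullet> (B t \<omega> - B s \<omega>)) \<partial>M) = 0"
proof -
  note inc = increment_component[OF s]
  have eq: "G \<omega> * (\<phi> \<omega> \<bullet> (B t \<omega> - B s \<omega>)) = (\<Sum>i\<in>UNIV. (\<phi> \<omega> $ i *\<^sub>R G \<omega>) * (B t \<omega> - B s \<omega>) $ i)" for \<omega>
    by (simp add: inner_eq_sum sum_distrib_left mult_ac)
  have m: "(\<lambda>\<omega>. \<phi> \<omega> $ i *\<^sub>R G \<omega>) \<in> borel_measurable (F s)" for i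
    using G(1) \<phi>(1) by (intro borel_measurable_scaleR borel_measurable_vec_nth')
  have \<phi>M: "\<phi> \<in> borel_measurable M" using measurable_F_imp[OF \<phi>(1)] s by simp
  have int: "integrable M (\<lambda>\<omega>. \<phi> \<omega> $ i *\<^sub>R G \<omega>)" for i
    by (rule square_integrable_integrable, rule square_integrable_mult_bounded[OF G(2), where C=C])
      (use \<phi>(2) component_le_norm_cart order_trans borel_measurable_vec_nth'[OF \<phi>M] in blast)+
  note E = expectation_mult_increment[OF s m _ int inc(1), OF borel_measurable_nth]
  show "integrable M (\<lambda>\<omega>. G \<omega> * (\<phi> \<omega> \<bullet> (B t \<omega> - B s \<omega>)))"
    unfolding eq by (rule Bochner_Integration.integrable_sum) (rule E(1))
  show "(\<integral>\<omega>. G \<omega> * (\<phi> \<omega> \<bullet> (B t \<omega> - B s \<omega>)) \<partial>M) = 0"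
    unfolding eq by (subst Bochner_Integration.integral_sum) (simp_all only: E inc(2) mult_zero_right sum.neutral_const)
qed

text \<open>In the double sum over coordinates, products of coefficients separate from products of
  increments by independence; the off-diagonal moments vanish and the diagonal ones are
  \<open>t - s\<close>.\<close>

lemma isometry_increment:
  assumes s: "0 \<le> s" "s < t" "t \<le> T" 
    and \<phi>: "\<phi> \<in> borel_measurable (F s)" "\<And>\<omega>. \<omega> \<in> space M \<Longrightarrow> norm (\<phi> \<omega>) \<le> C"
  shows "square_integrable M (\<lambda>\<omega>. \<phi> \<omega> \<bullet> (B t \<omega> - B s \<omega>))"
    "(\<integral>\<omega>. (\<phi> \<omega> \<bullet> (B t \<omega> - B s \<omega>))\<^sup>2 \<partial>M) = (t - s) * (\<integral>\<omega>. (norm (\<phi> \<omega>))\<^sup>2 \<partial>M)"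
proof -
  note inc = increment_component[OF s]
  have [measurable]: "\<phi> \<in> borel_measurable M" using measurable_F_imp[OF \<phi>(1)] s by simp
  have Dm [measurable]: "(\<lambda>\<omega>. B t \<omega> - B s \<omega>) \<in> borel_measurable M"
    using square_integrableD(1)[OF increment_square_integrable[OF s]] .
  show "square_integrable M (\<lambda>\<omega>. \<phi> \<omega> \<bullet> (B t \<omega> - B s \<omega>))"
  proof (rule square_integrable_bound(1)[OF square_integrable_scaleR(1)[OF increment_square_integrable[OF s], of C]])
    show "(\<lambda>\<omega>. \<phi> \<omega> \<bullet> (B t \<omega> - B s \<omega>)) \<in> borel_measurable M" by measurable
    have "norm (\<phi> \<omega> \<bullet> (B t \<omega> - B s \<omega>)) \<le> norm (C *\<^sub>R (B t \<omega> - B s \<omega>))" if "\<omega> \<in> space M" for \<omega>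
    proof -
      have "norm (\<phi> \<omega> \<bullet> (B t \<omega> - B s \<omega>)) \<le> norm (\<phi> \<omega>) * norm (B t \<omega> - B s \<omega>)"
        using Cauchy_Schwarz_ineq2 by simp
      also have "\<dots> \<le> \<bar>C\<bar> * norm (B t \<omega> - B s \<omega>)"
        using \<phi>(2)[OF that] by (intro mult_right_mono) auto
      finally show ?thesis by simp
    qed
    then show "AE \<omega> in M. norm (\<phi> \<omega> \<bullet> (B t \<omega> - B s \<omega>)) \<le> norm (C *\<^sub>R (B t \<omega> - B s \<omega>))" by auto
  qed
  have eq: "(\<phi> \<omega> \<bullet> (B t \<omega> - B s \<omega>))\<^sup>2
    = (\<Sum>i\<in>UNIV. \<Sum>j\<in>UNIV. (\<phi> \<omega> $ i * \<phi> \<omega> $ j) * ((B t \<omega> - B s \<omega>) $ i * (B t \<omega> - B s \<omega>) $ j))" for \<omega>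
    unfolding power2_eq_square inner_eq_sum sum_product by (simp add: mult_ac)
  have m: "(\<lambda>\<omega>. \<phi> \<omega> $ i * \<phi> \<omega> $ j) \<in> borel_measurable (F s)" for i j
    using \<phi>(1) by (intro borel_measurable_times borel_measurable_vec_nth')
  have cb: "\<bar>\<phi> \<omega> $ i\<bar> \<le> C" if "\<omega> \<in> space M" for \<omega> i
    using component_le_norm_cart \<phi>(2)[OF that] order_trans by blast
  have int: "integrable M (\<lambda>\<omega>. \<phi> \<omega> $ i * \<phi> \<omega> $ j)" for i j
  proof (rule integrable_const_bound[of _ "C * C"])
    show "AE \<omega> in M. norm (\<phi> \<omega> $ i * \<phi> \<omega> $ j) \<le> C * C"
      using cb by (auto simp: abs_mult intro!: mult_mono intro: order_trans[OF abs_ge_zero])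
    show "(\<lambda>\<omega>. \<phi> \<omega> $ i * \<phi> \<omega> $ j) \<in> borel_measurable M"
      by (intro borel_measurable_times borel_measurable_vec_nth') fact+
  qed
  have h: "(\<lambda>x::real^'d. x $ i * x $ j) \<in> borel_measurable borel" for i j by measurable
  note E = expectation_mult_increment[OF s m h int inc(3)]
  have "(\<integral>\<omega>. (\<phi> \<omega> \<bullet> (B t \<omega> - B s \<omega>))\<^sup>2 \<partial>M)
      = (\<Sum>i\<in>UNIV. \<Sum>j\<in>UNIV. (\<integral>\<omega>. \<phi> \<omega> $ i * \<phi> \<omega> $ j \<partial>M) * (if i = j then t - s else 0))"
    unfolding eq
    by (subst Bochner_Integration.integral_sum, rule Bochner_Integration.integrable_sum, rule E(1),
        rule sum.cong[OF refl], subst Bochner_Integration.integral_sum, rule E(1))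
      (simp only: E(2) inc(4))
  also have "\<dots> = (\<Sum>i\<in>UNIV. (\<integral>\<omega>. \<phi> \<omega> $ i * \<phi> \<omega> $ i \<partial>M) * (t - s))"
    by (simp add: if_distrib[of "\<lambda>x. _ * x"] cong: if_cong)
  also have "\<dots> = (t - s) * (\<integral>\<omega>. (\<Sum>i\<in>UNIV. \<phi> \<omega> $ i * \<phi> \<omega> $ i) \<partial>M)"
    by (subst Bochner_Integration.integral_sum) (simp_all add: int sum_distrib_left mult.commute)
  finally show "(\<integral>\<omega>. (\<phi> \<omega> \<bullet> (B t \<omega> - B s \<omega>))\<^sup>2 \<partial>M) = (t - s) * (\<integral>\<omega>. (norm (\<phi> \<omega>))\<^sup>2 \<partial>M)"
    by (simp add: power2_norm_eq_inner inner_eq_sum)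
qed

lemma simple_itoE:
  assumes "simple_ito Z X"
  obtains n \<tau> \<phi> C where "simple_integrand M F T n \<tau> \<phi>" "Z = simple_process n \<tau> \<phi>"
    "X = simple_ito_integral B n \<tau> \<phi>" "\<And>i \<omega>. i < n \<Longrightarrow> \<omega> \<in> space M \<Longrightarrow> norm (\<phi> i \<omega>) \<le> C i"
proof -
  obtain n \<tau> \<phi> where 1: "simple_integrand M F T n \<tau> \<phi>" "Z = simple_process n \<tau> \<phi>" "X = simple_ito_integral B n \<tau> \<phi>"
    using assms unfolding simple_ito_def by blast
  obtain C where "\<And>i \<omega>. i < n \<Longrightarrow> \<omega> \<in> space M \<Longrightarrow> norm (\<phi> i \<omega>) \<le> C i"
    using simple_integrandD(4)[OF 1(1)] by metis
  then show thesis using that 1 by blast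
qed

lemma simple_ito_0: "simple_ito Z X \<Longrightarrow> X 0 \<omega> = 0"
proof (erule simple_itoE)
  fix n \<tau> \<phi> assume 1: "simple_integrand M F T n \<tau> \<phi>" "X = simple_ito_integral B n \<tau> \<phi>"
  have "min (\<tau> i) 0 = 0" if "i \<le> n" for i using simple_integrandD(2)[OF 1(1) that] by simp
  then show "X 0 \<omega> = 0" unfolding 1(2) simple_ito_integral_def by (intro sum.neutral) simp
qed

lemma simple_ito_adapted:
  assumes "simple_ito Z X" "t \<in> {0..T}"
  shows "X t \<in> borel_measurable (F t)"
proof -
  obtain n \<tau> \<phi> C where 1: "simple_integrand M F T n \<tau> \<phi>" "X = simple_ito_integral B n \<tau> \<phi>"
    using assms(1) by (rule simple_itoE) blast
  show ?thesis
    unfolding 1(2) simple_ito_integral_def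
  proof (rule borel_measurable_sum)
    fix i assume "i \<in> {..<n}"
    then have i: "i < n" by simp
    have \<tau>: "\<tau> i < \<tau> (Suc i)" "0 \<le> \<tau> i" using 1(1) simple_integrandD(2)[OF 1(1), of i] i
      by (auto simp: simple_integrand_def)
    show "(\<lambda>\<omega>. \<phi> i \<omega> \<bullet> (B (min (\<tau> (Suc i)) t) \<omega> - B (min (\<tau> i) t) \<omega>)) \<in> borel_measurable (F t)"
    proof (cases "\<tau> i \<le> t")
      case True
      have [measurable]: "\<phi> i \<in> borel_measurable (F t)"
        by (rule measurable_F_mono[OF simple_integrandD(3)[OF 1(1) i] True])
      have [measurable]: "B (min (\<tau> (Suc i)) t) \<in> borel_measurable (F t)" "B (min (\<tau> i) t) \<in> borel_measurable (F t)"
        using \<tau> assms(2) by (auto intro!: B_measurable_F)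
      show ?thesis by measurable
    next
      case False
      then show ?thesis using \<tau> by (simp add: min_absorb2)
    qed
  qed
qed

lemma simple_ito_continuous:
  assumes "simple_ito Z X"
  shows "AE \<omega> in M. continuous_on {0..T} (\<lambda>t. X t \<omega>)"
proof -
  obtain n \<tau> \<phi> C where 1: "simple_integrand M F T n \<tau> \<phi>" "X = simple_ito_integral B n \<tau> \<phi>"
    using assms(1) by (rule simple_itoE) blast
  have "AE \<omega> in M. continuous_on {0..T} (\<lambda>t. B t \<omega>)"
    using BM by (simp add: standard_brownian_motion_def)
  then show ?thesis
  proof eventually_elim
    case (elim \<omega>)
    have "continuous_on {0..T} (\<lambda>t. B (min c t) \<omega>)" if "0 \<le> c" for c
      by (rule continuous_on_compose2[OF elim]) (use that in \<open>auto intro!: continuous_intros\<close>)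
    then show ?case
      unfolding 1(2) simple_ito_integral_def
      by (intro continuous_intros) (use simple_integrandD(2)[OF 1(1)] in auto)
  qed
qed

lemma simple_ito_predictable:
  assumes "simple_ito Z X"
  shows "(\<lambda>(\<omega>, s). Z s \<omega>) \<in> borel_measurable Pred" "square_integrable Q (\<lambda>(\<omega>, s). Z s \<omega>)"
proof -
  obtain n \<tau> \<phi> C where 1: "simple_integrand M F T n \<tau> \<phi>" "Z = simple_process n \<tau> \<phi>"
    "\<And>i \<omega>. i < n \<Longrightarrow> \<omega> \<in> space M \<Longrightarrow> norm (\<phi> i \<omega>) \<le> C i"
    using assms(1) by (rule simple_itoE) blast
  have eq: "(\<lambda>(\<omega>, s). Z s \<omega>) = (\<lambda>x. \<Sum>i<n. (case x of (\<omega>, s) \<Rightarrow> indicat_real {\<tau> i<..\<tau> (Suc i)} s *\<^sub>R \<phi> i \<omega>))"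
    unfolding 1(2) simple_process_def by (simp add: fun_eq_iff)
  have el: "(\<lambda>(\<omega>, s). indicat_real {\<tau> i<..\<tau> (Suc i)} s *\<^sub>R \<phi> i \<omega>) \<in> borel_measurable Pred" if "i < n" for i
    using simple_integrandD(2)[OF 1(1)] that 1(1)
    by (intro predictable_indicator simple_integrandD(3)[OF 1(1)]) (auto simp: simple_integrand_def)
  show 2: "(\<lambda>(\<omega>, s). Z s \<omega>) \<in> borel_measurable Pred"
    unfolding eq by (rule borel_measurable_sum) (use el in auto)
  show "square_integrable Q (\<lambda>(\<omega>, s). Z s \<omega>)"
  proof (rule Qm.square_integrable_bounded)
    show "(\<lambda>(\<omega>, s). Z s \<omega>) \<in> borel_measurable Q" by (rule measurable_from_subalg[OF subalgebra_Pred 2])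
    fix x assume "x \<in> space Q"
    then have w: "fst x \<in> space M" by (auto simp: space_Q)
    have "norm (case x of (\<omega>, s) \<Rightarrow> Z s \<omega>) \<le> (\<Sum>i<n. norm (case x of (\<omega>, s) \<Rightarrow> indicat_real {\<tau> i<..\<tau> (Suc i)} s *\<^sub>R \<phi> i \<omega>))"
      unfolding fun_cong[OF eq] by (rule norm_sum)
    also have "\<dots> \<le> (\<Sum>i<n. \<bar>C i\<bar>)"
    proof (rule sum_mono)
      fix i assume "i \<in> {..<n}"
      then have "norm (\<phi> i (fst x)) \<le> \<bar>C i\<bar>" using 1(3)[of i "fst x"] w by auto
      then show "norm (case x of (\<omega>, s) \<Rightarrow> indicat_real {\<tau> i<..\<tau> (Suc i)} s *\<^sub>R \<phi> i \<omega>) \<le> \<bar>C i\<bar>"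
        by (cases "snd x \<in> {\<tau> i<..\<tau> (Suc i)}") (simp_all add: case_prod_beta)
    qed
    finally show "norm (case x of (\<omega>, s) \<Rightarrow> Z s \<omega>) \<le> (\<Sum>i<n. \<bar>C i\<bar>)" .
  qed
qed

lemma integral_Q_indicator:
  fixes g :: "'a \<Rightarrow> real"
  assumes "integrable M g" "0 \<le> a" "a \<le> b" "b \<le> T"
  shows "integrable Q (\<lambda>(\<omega>, s). indicat_real {a<..b} s * g \<omega>)"
    "(\<integral>x. (case x of (\<omega>, s) \<Rightarrow> indicat_real {a<..b} s * g \<omega>) \<partial>Q) = (b - a) * (\<integral>\<omega>. g \<omega> \<partial>M)"
proof -
  have [measurable]: "{a<..b} \<in> sets L" using assms by (intro borel_in_L) auto
  have [measurable]: "g \<in> borel_measurable M" using assms by auto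
  have mL: "measure L {a<..b} = b - a" using assms by (subst measure_restrict_space) auto
  have "integrable Q (\<lambda>x. (\<lambda>s. indicat_real {a<..b} s) (snd x) *\<^sub>R (g \<circ> fst) x)"
  proof (rule Bochner_Integration.integrable_bound)
    show i: "integrable Q (\<lambda>x. g (fst x))"
    proof (rule Qp.Fubini_integrable)
      show "AE x in M. integrable L (\<lambda>y. g (fst (x, y)))" by simp
      show "integrable M (\<lambda>x. LINT y|L. norm (g (fst (x, y))))" using assms(1) by simp
    qed measurable
    show "(\<lambda>x. indicat_real {a<..b} (snd x) *\<^sub>R (g \<circ> fst) x) \<in> borel_measurable Q"
      unfolding comp_def by measurable
    show "AE x in Q. norm (indicat_real {a<..b} (snd x) *\<^sub>R (g \<circ> fst) x) \<le> norm (g (fst x))"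
      by (auto simp: indicator_def)
  qed
  then show i: "integrable Q (\<lambda>(\<omega>, s). indicat_real {a<..b} s * g \<omega>)"
    by (simp add: case_prod_unfold)
  have "(\<integral>x. (case x of (\<omega>, s) \<Rightarrow> indicat_real {a<..b} s * g \<omega>) \<partial>Q)
      = (\<integral>\<omega>. (\<integral>s. indicat_real {a<..b} s * g \<omega> \<partial>L) \<partial>M)"
    using Qp.integral_fst'[OF i] by simp
  also have "\<dots> = (b - a) * (\<integral>\<omega>. g \<omega> \<partial>M)"
  proof -
    have "{a<..b} \<inter> {0..T} = {a<..b}" using assms by auto
    then show ?thesis by (simp add: mL)
  qed
  finally show "(\<integral>x. (case x of (\<omega>, s) \<Rightarrow> indicat_real {a<..b} s * g \<omega>) \<partial>Q) = (b - a) * (\<integral>\<omega>. g \<omega> \<partial>M)" .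
qed

text \<open>Induction on the number of cells. Measurability with respect to
  \<open>F (\<tau> n)\<close> is carried along because it makes the sum so far orthogonal to the
  next term, and then second moments add.\<close>

lemma simple_ito_isometry_aux:
  assumes "simple_integrand M F T n \<tau> \<phi>"
  shows "simple_ito_integral B n \<tau> \<phi> T \<in> borel_measurable (F (\<tau> n))
    \<and> square_integrable M (simple_ito_integral B n \<tau> \<phi> T)
    \<and> (\<integral>\<omega>. (simple_ito_integral B n \<tau> \<phi> T \<omega>)\<^sup>2 \<partial>M) = (\<integral>x. (case x of (\<omega>, s) \<Rightarrow> (norm (simple_process n \<tau> \<phi> s \<omega>))\<^sup>2) \<partial>Q)"
  using assms
proof (induction n)
  case 0
  have "simple_ito_integral B 0 \<tau> \<phi> T = (\<lambda>\<omega>. 0)" "simple_process 0 \<tau> \<phi> = (\<lambda>s \<omega>. 0)"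
    by (auto simp: simple_ito_integral_def simple_process_def fun_eq_iff)
  then show ?case by (simp add: case_prod_beta)
next
  case (Suc n)
  note S = simple_integrandD[OF Suc.prems]
  have lt: "\<tau> n < \<tau> (Suc n)" using Suc.prems by (simp add: simple_integrand_def)
  have in_T: "\<tau> n \<in> {0..T}" "\<tau> (Suc n) \<in> {0..T}" using S(2) by auto
  have si: "simple_integrand M F T n \<tau> \<phi>"
    using Suc.prems in_T unfolding simple_integrand_def by auto
  note IH = Suc.IH[OF si]
  obtain C where C: "\<And>\<omega>. \<omega> \<in> space M \<Longrightarrow> norm (\<phi> n \<omega>) \<le> C" using S(4)[of n] by auto
  let ?D = "\<lambda>\<omega>. \<phi> n \<omega> \<bullet> (B (\<tau> (Suc n)) \<omega> - B (\<tau> n) \<omega>)"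
  let ?I = "simple_ito_integral B n \<tau> \<phi> T"
  let ?Z = "simple_process n \<tau> \<phi>"
  note t = _ lt _
  have 0: "0 \<le> \<tau> n" "\<tau> (Suc n) \<le> T" using in_T by auto
  have eq: "simple_ito_integral B (Suc n) \<tau> \<phi> T = (\<lambda>\<omega>. ?I \<omega> + ?D \<omega>)"
    using in_T by (simp add: simple_ito_integral_def fun_eq_iff min_absorb1)
  have \<phi>: "\<phi> n \<in> borel_measurable (F (\<tau> n))" using S(3) by simp
  note O = orthogonal_increment[OF 0(1) lt 0(2) conjunct1[OF IH] conjunct1[OF conjunct2[OF IH]] \<phi> C]
  note I = isometry_increment[OF 0(1) lt 0(2) \<phi> C]
  have m1: "simple_ito_integral B (Suc n) \<tau> \<phi> T \<in> borel_measurable (F (\<tau> (Suc n)))"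
    unfolding eq
    by (intro borel_measurable_add borel_measurable_inner borel_measurable_diff B_measurable_F
        measurable_F_mono[OF conjunct1[OF IH]] measurable_F_mono[OF \<phi>]) (use lt in_T in auto)
  have sq: "square_integrable M (simple_ito_integral B (Suc n) \<tau> \<phi> T)"
    unfolding eq by (intro square_integrable_add I(1)) (use IH in auto)
  have 2: "(\<integral>\<omega>. (simple_ito_integral B (Suc n) \<tau> \<phi> T \<omega>)\<^sup>2 \<partial>M)
      = (\<integral>\<omega>. (?I \<omega>)\<^sup>2 \<partial>M) + (\<tau> (Suc n) - \<tau> n) * (\<integral>\<omega>. (norm (\<phi> n \<omega>))\<^sup>2 \<partial>M)"
    unfolding eq using l2_norm_add_power2[OF conjunct1[OF conjunct2[OF IH]] I(1)] O(2) I(2)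
    by (simp add: l2_norm_power2)
  \<comment> \<open>Cells are disjoint: on the last one the earlier part of the process vanishes, so
    the square splits without a cross term.\<close>
  have eqZ: "(norm (simple_process (Suc n) \<tau> \<phi> s \<omega>))\<^sup>2
      = (norm (?Z s \<omega>))\<^sup>2 + indicat_real {\<tau> n<..\<tau> (Suc n)} s * (norm (\<phi> n \<omega>))\<^sup>2" for s \<omega>
  proof (cases "s \<in> {\<tau> n<..\<tau> (Suc n)}")
    case True
    have "?Z s \<omega> = 0" unfolding simple_process_def
    proof (rule sum.neutral, rule)
      fix i assume "i \<in> {..<n}"
      then have "\<tau> (Suc i) \<le> \<tau> n" using strict_mono_on_leD[OF S(1), of "Suc i" n] by auto
      then show "indicat_real {\<tau> i<..\<tau> (Suc i)} s *\<^sub>R \<phi> i \<omega> = 0" using True by (auto simp: indicator_def)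
    qed
    then show ?thesis using True by (simp add: simple_process_def)
  qed (simp add: simple_process_def)
  have sI: "simple_ito ?Z (simple_ito_integral B n \<tau> \<phi>)" using si by (auto simp: simple_ito_def)
  have iZ: "integrable Q (\<lambda>(\<omega>, s). (norm (?Z s \<omega>))\<^sup>2)"
    using square_integrableD(2)[OF simple_ito_predictable(2)[OF sI]] by (simp add: case_prod_unfold)
  have "\<phi> n \<in> borel_measurable M" using measurable_F_imp[OF \<phi>] in_T by simp
  then have i\<phi>: "integrable M (\<lambda>\<omega>. (norm (\<phi> n \<omega>))\<^sup>2)"
    using square_integrableD(2)[OF square_integrable_bounded[OF _ C]] by simp
  note J = integral_Q_indicator[OF i\<phi>, of "\<tau> n" "\<tau> (Suc n)"]
  have "(\<integral>x. (case x of (\<omega>, s) \<Rightarrow> (norm (simple_process (Suc n) \<tau> \<phi> s \<omega>))\<^sup>2) \<partial>Q)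
      = (\<integral>x. (case x of (\<omega>, s) \<Rightarrow> (norm (?Z s \<omega>))\<^sup>2) + (case x of (\<omega>, s) \<Rightarrow> indicat_real {\<tau> n<..\<tau> (Suc n)} s * (norm (\<phi> n \<omega>))\<^sup>2) \<partial>Q)"
    unfolding eqZ by (simp add: case_prod_beta)
  also have "\<dots> = (\<integral>x. (case x of (\<omega>, s) \<Rightarrow> (norm (?Z s \<omega>))\<^sup>2) \<partial>Q) + (\<tau> (Suc n) - \<tau> n) * (\<integral>\<omega>. (norm (\<phi> n \<omega>))\<^sup>2 \<partial>M)"
    using lt in_T J by (subst Bochner_Integration.integral_add[OF iZ]) auto
  finally show ?case using m1 sq 2 IH by simp
qed

lemma simple_ito_isometry:
  assumes "simple_ito Z X"
  shows "square_integrable M (X T)" "l2_norm M (X T) = l2_norm Q (\<lambda>(\<omega>, s). Z s \<omega>)"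
proof -
  obtain n \<tau> \<phi> C where 1: "simple_integrand M F T n \<tau> \<phi>" "Z = simple_process n \<tau> \<phi>" "X = simple_ito_integral B n \<tau> \<phi>"
    using assms(1) by (rule simple_itoE) blast
  show "square_integrable M (X T)" "l2_norm M (X T) = l2_norm Q (\<lambda>(\<omega>, s). Z s \<omega>)"
    using simple_ito_isometry_aux[OF 1(1)] unfolding 1 l2_norm_def by (auto simp: case_prod_beta)
qed

text \<open>Each cell contributes the part of its increment after t. Its coefficient and
  \<open>G\<close> are both known at the start \<open>max t (\<tau> i)\<close> of that part, so its
  mean against \<open>G\<close> is zero.\<close>

lemma simple_ito_orthogonal:
  assumes "simple_ito Z X" and t: "t \<in> {0..T}" and G: "G \<in> borel_measurable (F t)" "square_integrable M G"
  shows "(\<integral>\<omega>. G \<omega> * (X T \<omega> - X t \<omega>) \<partial>M) = 0"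
proof -
  obtain n \<tau> \<phi> C where 1: "simple_integrand M F T n \<tau> \<phi>" "X = simple_ito_integral B n \<tau> \<phi>"
    "\<And>i \<omega>. i < n \<Longrightarrow> \<omega> \<in> space M \<Longrightarrow> norm (\<phi> i \<omega>) \<le> C i"
    using assms(1) by (rule simple_itoE) blast
  define e where "e i \<omega> = \<phi> i \<omega> \<bullet> (B (min (\<tau> (Suc i)) T) \<omega> - B (min (\<tau> i) T) \<omega>)
     - \<phi> i \<omega> \<bullet> (B (min (\<tau> (Suc i)) t) \<omega> - B (min (\<tau> i) t) \<omega>)" for i \<omega>
  have e: "integrable M (\<lambda>\<omega>. G \<omega> * e i \<omega>) \<and> (\<integral>\<omega>. G \<omega> * e i \<omega> \<partial>M) = 0" if "i < n" for i
  proof -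
    have \<tau>: "\<tau> i < \<tau> (Suc i)" "0 \<le> \<tau> i" "\<tau> (Suc i) \<le> T"
      using 1(1) simple_integrandD(2)[OF 1(1), of i] simple_integrandD(2)[OF 1(1), of "Suc i"] that
      by (auto simp: simple_integrand_def)
    show ?thesis
    proof (cases "t < \<tau> (Suc i)")
      case False
      then have "e i = (\<lambda>\<omega>. 0)" using \<tau> t by (auto simp: e_def fun_eq_iff min_absorb1)
      then show ?thesis by simp
    next
      case True
      let ?a = "max t (\<tau> i)"
      have eq: "e i \<omega> = \<phi> i \<omega> \<bullet> (B (\<tau> (Suc i)) \<omega> - B ?a \<omega>)" for \<omega>
      proof -
        have "(?a = t \<and> min (\<tau> i) t = \<tau> i) \<or> (?a = \<tau> i \<and> min (\<tau> i) t = t)" by (auto simp: min_def max_def)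
        then show ?thesis using True \<tau> t by (auto simp: e_def inner_diff_right min_absorb1 min_absorb2)
      qed
      show ?thesis unfolding eq
        using orthogonal_increment[of ?a "\<tau> (Suc i)" G "\<phi> i" "C i"] True \<tau> t G(2) 1(3)[OF that]
          measurable_F_mono[OF G(1), of ?a] measurable_F_mono[OF simple_integrandD(3)[OF 1(1) that], of ?a]
        by auto
    qed
  qed
  have "(\<integral>\<omega>. G \<omega> * (X T \<omega> - X t \<omega>) \<partial>M) = (\<integral>\<omega>. (\<Sum>i<n. G \<omega> * e i \<omega>) \<partial>M)"
    unfolding 1(2) simple_ito_integral_def e_def by (simp add: sum_distrib_left sum_subtractf[symmetric])
  also have "\<dots> = 0" by (subst Bochner_Integration.integral_sum) (use e in auto)
  finally show ?thesis .
qed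

text \<open>\<open>X t\<close> is the terminal value minus the increment after t, and the latter is
  the terminal value of the truncated integral.\<close>

lemma simple_ito_square_integrable:
  assumes "simple_ito Z X" "t \<in> {0..T}"
  shows "square_integrable M (X t)"
proof -
  have "square_integrable M (\<lambda>\<omega>. X T \<omega> - X (min t T) \<omega>)"
    by (rule simple_ito_isometry(1)[OF simple_ito_truncate[OF assms]])
  from square_integrable_diff[OF simple_ito_isometry(1)[OF assms(1)] this]
  show ?thesis using assms(2) by (simp add: min_absorb1)
qed

end

section \<open>Doob's inequality\<close>

fun running_max :: "(nat \<Rightarrow> real) \<Rightarrow> nat \<Rightarrow> real" where
  "running_max s 0 = s 0"
| "running_max s (Suc n) = max (running_max s n) (s (Suc n))"

lemma running_max_ge: "i \<le> n \<Longrightarrow> s i \<le> running_max s n"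
  by (induction n) (auto simp: le_Suc_eq max.coboundedI1)

lemma running_max_le_sum: "(\<And>i. 0 \<le> s i) \<Longrightarrow> running_max s n \<le> (\<Sum>i\<le>n. s i)"
  by (induction n) (auto simp: add_increasing add_increasing2 sum_nonneg)

text \<open>
  The sum has nonnegative expectation when \<open>s\<close> is the absolute value of a martingale; this is how
  the inequality becomes Doob's.
\<close>

lemma pathwise_doob:
  assumes "\<And>i. 0 \<le> s i"
  shows "(running_max s n)\<^sup>2 + 4 * (\<Sum>i<n. running_max s i * (s (Suc i) - s i)) \<le> 4 * (s n)\<^sup>2"
proof -
  \<comment> \<open>This is the form preserved by the induction. When a new maximum occurs it comes
    down to \<open>2 a b \<le> a\<^sup>2 + b\<^sup>2\<close>; a further quadratic estimate then
    replaces the product on the right by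
    \<open>(running_max s n)\<^sup>2 / 4 + (s n)\<^sup>2\<close>.\<close>
  have "(running_max s n)\<^sup>2 / 2 + (\<Sum>i<n. running_max s i * (s (Suc i) - s i)) \<le> running_max s n * s n"
  proof (induction n)
    case 0
    then show ?case by (simp add: power2_eq_square)
  next
    case (Suc n)
    show ?case
    proof (cases "s (Suc n) \<le> running_max s n")
      case True
      then show ?thesis using Suc by (simp add: max_absorb1 algebra_simps)
    next
      case False
      have "running_max s n * s (Suc n) \<le> (s (Suc n))\<^sup>2 / 2 + (running_max s n)\<^sup>2 / 2"
        using sum_squares_bound[of "s (Suc n)" "running_max s n"] mult.commute[of "s (Suc n)" "running_max s n"]
        by linarith
      then show ?thesis using Suc False by (simp add: max_absorb2 algebra_simps power2_eq_square)
    qed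
  qed
  moreover have "running_max s n * s n \<le> (running_max s n)\<^sup>2 / 4 + (s n)\<^sup>2"
  proof -
    have "0 \<le> (running_max s n / 2 - s n)\<^sup>2" by simp
    then show ?thesis by (simp add: power2_diff power_divide)
  qed
  ultimately show ?thesis by linarith
qed

context brownian
begin

text \<open>Orthogonality to all square-integrable \<open>F t\<close>-measurable variables says that
  the conditional expectation of \<open>X T\<close> given \<open>F t\<close> is \<open>X t\<close>.
  Only increments up to \<open>T\<close> are mentioned; the others are differences of two of
  these.\<close>

definition square_martingale :: "(real \<Rightarrow> 'a \<Rightarrow> real) \<Rightarrow> bool" where
  "square_martingale X \<longleftrightarrow> (\<forall>t\<in>{0..T}. X t \<in> borel_measurable (F t) \<and> square_integrable M (X t)) \<and>
     (\<forall>t\<in>{0..T}. \<forall>G. G \<in> borel_measurable (F t) \<longrightarrow> square_integrable M G \<longrightarrow>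
        (\<integral>\<omega>. G \<omega> * (X T \<omega> - X t \<omega>) \<partial>M) = 0)"

lemma simple_ito_square_martingale: "simple_ito Z X \<Longrightarrow> square_martingale X"
  unfolding square_martingale_def
  using simple_ito_adapted simple_ito_square_integrable simple_ito_orthogonal by blast

lemma square_martingaleD:
  assumes "square_martingale X"
  shows "t \<in> {0..T} \<Longrightarrow> X t \<in> borel_measurable (F t)" "t \<in> {0..T} \<Longrightarrow> square_integrable M (X t)"
    "0 \<le> t \<Longrightarrow> t \<le> r \<Longrightarrow> r \<le> T \<Longrightarrow> G \<in> borel_measurable (F t) \<Longrightarrow> square_integrable M G \<Longrightarrow>
      (\<integral>\<omega>. G \<omega> * (X r \<omega> - X t \<omega>) \<partial>M) = 0"
proof -
  show sq: "t \<in> {0..T} \<Longrightarrow> square_integrable M (X t)" for t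
    using assms by (auto simp: square_martingale_def)
  show "t \<in> {0..T} \<Longrightarrow> X t \<in> borel_measurable (F t)"
    using assms by (auto simp: square_martingale_def)
  assume t: "0 \<le> t" "t \<le> r" "r \<le> T" and G: "G \<in> borel_measurable (F t)" "square_integrable M G"
  have o: "(\<integral>\<omega>. G \<omega> * (X T \<omega> - X t \<omega>) \<partial>M) = 0" "(\<integral>\<omega>. G \<omega> * (X T \<omega> - X r \<omega>) \<partial>M) = 0"
    using assms t G measurable_F_mono[OF G(1) t(2)] by (auto simp: square_martingale_def)
  have i: "integrable M (\<lambda>\<omega>. G \<omega> * (X T \<omega> - X t \<omega>))" "integrable M (\<lambda>\<omega>. G \<omega> * (X T \<omega> - X r \<omega>))"
    using t T_pos by (auto intro!: square_integrable_mult G square_integrable_diff sq)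
  have "(\<integral>\<omega>. G \<omega> * (X r \<omega> - X t \<omega>) \<partial>M) = (\<integral>\<omega>. G \<omega> * (X T \<omega> - X t \<omega>) - G \<omega> * (X T \<omega> - X r \<omega>) \<partial>M)"
    by (simp add: algebra_simps)
  also have "\<dots> = 0" using i o by simp
  finally show "(\<integral>\<omega>. G \<omega> * (X r \<omega> - X t \<omega>) \<partial>M) = 0" .
qed

text \<open>The pathwise inequality is integrated along \<open>|X|\<close>. Each summand has
  nonnegative mean, since an increment of \<open>|X|\<close> is at least \<open>sgn\<close> of the
  old value times the increment of \<open>X\<close>, and the latter has mean zero against any
  variable known before.\<close>

lemma doob_discrete:
  assumes X: "square_martingale X" and t: "\<And>i. i \<le> n \<Longrightarrow> t i \<in> {0..T}" "\<And>i. i < n \<Longrightarrow> t i \<le> t (Suc i)" "t n = T"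
  shows "(\<lambda>\<omega>. running_max (\<lambda>i. \<bar>X (t i) \<omega>\<bar>) n) \<in> borel_measurable M"
    "(\<integral>\<^sup>+\<omega>. ennreal ((running_max (\<lambda>i. \<bar>X (t i) \<omega>\<bar>) n)\<^sup>2) \<partial>M) \<le> ennreal (4 * (l2_norm M (X T))\<^sup>2)"
proof -
  let ?m = "\<lambda>i \<omega>. running_max (\<lambda>i. \<bar>X (t i) \<omega>\<bar>) i"
  have sq: "square_integrable M (X (t i))" and ad: "X (t i) \<in> borel_measurable (F (t i))" if "i \<le> n" for i
    using square_martingaleD(1,2)[OF X t(1)[OF that]] by auto
  have mF: "?m i \<in> borel_measurable (F (t i))" if "i \<le> n" for i
    using that
  proof (induction i)
    case 0
    then show ?case using ad[of 0] by simp
  next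
    case (Suc i)
    have "?m i \<in> borel_measurable (F (t (Suc i)))"
      by (rule measurable_F_mono[OF Suc.IH]) (use Suc t(2) in auto)
    then show ?case using ad[OF Suc.prems] by simp
  qed
  have mM: "?m i \<in> borel_measurable M" if "i \<le> n" for i
    using measurable_F_imp[OF mF[OF that]] t(1)[OF that] by simp
  show "?m n \<in> borel_measurable M" by (rule mM) simp
  have abs_sq: "square_integrable M (\<lambda>\<omega>. \<bar>X (t i) \<omega>\<bar>)" if "i \<le> n" for i
    using sq[OF that] by (auto simp: square_integrable_def)
  have m0: "0 \<le> ?m i \<omega>" for i \<omega>
    using running_max_ge[of 0 i "\<lambda>i. \<bar>X (t i) \<omega>\<bar>"] by (meson abs_ge_zero le0 order_trans)
  have msq: "square_integrable M (?m i)" if "i \<le> n" for i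
  proof (rule square_integrable_bound(1))
    show "square_integrable M (\<lambda>\<omega>. \<Sum>j\<le>i. \<bar>X (t j) \<omega>\<bar>)"
      by (rule square_integrable_sum) (use that in \<open>auto intro: abs_sq\<close>)
    show "AE \<omega> in M. norm (?m i \<omega>) \<le> norm (\<Sum>j\<le>i. \<bar>X (t j) \<omega>\<bar>)"
      using m0 running_max_le_sum[of "\<lambda>i. \<bar>X (t i) _\<bar>"] by (auto simp: sum_nonneg)
  qed (rule mM[OF that])
  have pos: "0 \<le> (\<integral>\<omega>. ?m i \<omega> * (\<bar>X (t (Suc i)) \<omega>\<bar> - \<bar>X (t i) \<omega>\<bar>) \<partial>M)"
    and int: "integrable M (\<lambda>\<omega>. ?m i \<omega> * (\<bar>X (t (Suc i)) \<omega>\<bar> - \<bar>X (t i) \<omega>\<bar>))" if "i < n" for i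
  proof -
    have i: "i \<le> n" "Suc i \<le> n" using that by auto
    \<comment> \<open>The test variable for the martingale property: known at \<open>t i\<close>,
      and square integrable because the running maximum is bounded by a finite sum of the
      \<open>|X (t j)|\<close>.\<close>
    let ?G = "\<lambda>\<omega>. sgn (X (t i) \<omega>) *\<^sub>R ?m i \<omega>"
    have G: "?G \<in> borel_measurable (F (t i))"
      using ad[OF i(1)] mF[OF i(1)] unfolding sgn_if by measurable
    have Gsq: "square_integrable M ?G"
      by (rule square_integrable_mult_bounded[OF msq[OF i(1)], where C=1])
        (use square_integrableD(1)[OF sq[OF i(1)]] in \<open>auto simp: sgn_if\<close>)
    show int: "integrable M (\<lambda>\<omega>. ?m i \<omega> * (\<bar>X (t (Suc i)) \<omega>\<bar> - \<bar>X (t i) \<omega>\<bar>))"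
      by (intro square_integrable_mult msq square_integrable_diff abs_sq i)
    have "0 = (\<integral>\<omega>. ?G \<omega> * (X (t (Suc i)) \<omega> - X (t i) \<omega>) \<partial>M)"
      by (rule square_martingaleD(3)[OF X _ _ _ G Gsq, symmetric]) (use t(1)[OF i(1)] t(1)[OF i(2)] t(2)[OF that] in auto)
    also have "\<dots> \<le> (\<integral>\<omega>. ?m i \<omega> * (\<bar>X (t (Suc i)) \<omega>\<bar> - \<bar>X (t i) \<omega>\<bar>) \<partial>M)"
    proof (rule integral_mono)
      show "integrable M (\<lambda>\<omega>. ?G \<omega> * (X (t (Suc i)) \<omega> - X (t i) \<omega>))"
        by (intro square_integrable_mult Gsq square_integrable_diff sq i)
      show "integrable M (\<lambda>\<omega>. ?m i \<omega> * (\<bar>X (t (Suc i)) \<omega>\<bar> - \<bar>X (t i) \<omega>\<bar>))" by (rule int)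
      fix \<omega>
      have "sgn (X (t i) \<omega>) * (X (t (Suc i)) \<omega> - X (t i) \<omega>) \<le> \<bar>X (t (Suc i)) \<omega>\<bar> - \<bar>X (t i) \<omega>\<bar>"
        by (auto simp: sgn_if)
      then have "?m i \<omega> * (sgn (X (t i) \<omega>) * (X (t (Suc i)) \<omega> - X (t i) \<omega>)) \<le> ?m i \<omega> * (\<bar>X (t (Suc i)) \<omega>\<bar> - \<bar>X (t i) \<omega>\<bar>)"
        by (rule mult_left_mono) (rule m0)
      then show "?G \<omega> * (X (t (Suc i)) \<omega> - X (t i) \<omega>) \<le> ?m i \<omega> * (\<bar>X (t (Suc i)) \<omega>\<bar> - \<bar>X (t i) \<omega>\<bar>)"
        by (simp add: mult_ac)
    qed
    finally show "0 \<le> (\<integral>\<omega>. ?m i \<omega> * (\<bar>X (t (Suc i)) \<omega>\<bar> - \<bar>X (t i) \<omega>\<bar>) \<partial>M)" .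
  qed
  have sum_int: "integrable M (\<lambda>\<omega>. \<Sum>i<n. ?m i \<omega> * (\<bar>X (t (Suc i)) \<omega>\<bar> - \<bar>X (t i) \<omega>\<bar>))"
    by (rule Bochner_Integration.integrable_sum) (use int in auto)
  have XT: "integrable M (\<lambda>\<omega>. (X T \<omega>)\<^sup>2)" using square_integrableD(2)[OF sq[of n]] t(3) by simp
  have mi: "integrable M (\<lambda>\<omega>. (?m n \<omega>)\<^sup>2)" using square_integrableD(2)[OF msq[of n]] by simp
  have "(\<integral>\<omega>. (?m n \<omega>)\<^sup>2 \<partial>M)
      \<le> (\<integral>\<omega>. (?m n \<omega>)\<^sup>2 \<partial>M) + 4 * (\<Sum>i<n. \<integral>\<omega>. ?m i \<omega> * (\<bar>X (t (Suc i)) \<omega>\<bar> - \<bar>X (t i) \<omega>\<bar>) \<partial>M)"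
    by (simp, rule sum_nonneg) (use pos in simp)
  also have "\<dots> = (\<integral>\<omega>. (?m n \<omega>)\<^sup>2 + 4 * (\<Sum>i<n. ?m i \<omega> * (\<bar>X (t (Suc i)) \<omega>\<bar> - \<bar>X (t i) \<omega>\<bar>)) \<partial>M)"
    using mi sum_int int by (simp add: Bochner_Integration.integral_sum)
  also have "\<dots> \<le> (\<integral>\<omega>. 4 * (X T \<omega>)\<^sup>2 \<partial>M)"
  proof (rule integral_mono)
    fix \<omega>
    show "(?m n \<omega>)\<^sup>2 + 4 * (\<Sum>i<n. ?m i \<omega> * (\<bar>X (t (Suc i)) \<omega>\<bar> - \<bar>X (t i) \<omega>\<bar>)) \<le> 4 * (X T \<omega>)\<^sup>2"
      using pathwise_doob[of "\<lambda>i. \<bar>X (t i) \<omega>\<bar>" n] t(3) by simp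
  qed (use mi sum_int XT in auto)
  also have "\<dots> = 4 * (l2_norm M (X T))\<^sup>2" by (simp add: l2_norm_power2)
  finally have "(\<integral>\<omega>. (?m n \<omega>)\<^sup>2 \<partial>M) \<le> 4 * (l2_norm M (X T))\<^sup>2" .
  then show "(\<integral>\<^sup>+\<omega>. ennreal ((?m n \<omega>)\<^sup>2) \<partial>M) \<le> ennreal (4 * (l2_norm M (X T))\<^sup>2)"
    by (subst nn_integral_eq_integral[OF mi]) (auto intro!: ennreal_leI)
qed

lemma grid_approx:
  assumes "s \<in> {0..T}"
  shows "\<exists>k. (\<forall>n. k n \<le> Suc n) \<and> (\<lambda>n. real (k n) * (T / real (Suc n))) \<longlonglongrightarrow> s"
proof -
  define k where "k n = nat \<lfloor>s * real (Suc n) / T\<rfloor>" for n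
  have k: "real (k n) \<le> s * real (Suc n) / T" "s * real (Suc n) / T - 1 \<le> real (k n)" for n
  proof -
    have "0 \<le> s * real (Suc n) / T" using assms by simp
    then show "real (k n) \<le> s * real (Suc n) / T" "s * real (Suc n) / T - 1 \<le> real (k n)"
      unfolding k_def by linarith+
  qed
  have "k n \<le> Suc n" for n
  proof -
    have "s * real (Suc n) / T \<le> real (Suc n)" using assms T_pos by (simp add: divide_le_eq mult_right_mono)
    then show ?thesis using k(1)[of n] by linarith
  qed
  moreover have "(\<lambda>n. real (k n) * (T / real (Suc n))) \<longlonglongrightarrow> s"
  proof (rule tendsto_sandwich)
    have "(\<lambda>n. s - T / real (Suc n)) \<longlonglongrightarrow> s - 0"
      by (intro tendsto_intros LIMSEQ_Suc[of "\<lambda>n. T / real n"] lim_const_over_n)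
    then show "(\<lambda>n. s - T / real (Suc n)) \<longlonglongrightarrow> s" by simp
    have "s - T / real (Suc n) \<le> real (k n) * (T / real (Suc n))" "real (k n) * (T / real (Suc n)) \<le> s" for n
    proof -
      have "(s * real (Suc n) / T - 1) * (T / real (Suc n)) \<le> real (k n) * (T / real (Suc n))"
        by (rule mult_right_mono[OF k(2)]) (use T_pos in simp)
      also have "(s * real (Suc n) / T - 1) * (T / real (Suc n)) = s - T / real (Suc n)"
        using T_pos by (simp add: left_diff_distrib diff_divide_distrib del: of_nat_Suc)
      finally show "s - T / real (Suc n) \<le> real (k n) * (T / real (Suc n))" .
      have "real (k n) * (T / real (Suc n)) \<le> (s * real (Suc n) / T) * (T / real (Suc n))"
        by (rule mult_right_mono[OF k(1)]) (use T_pos in simp)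
      also have "\<dots> = s" using T_pos by (simp del: of_nat_Suc)
      finally show "real (k n) * (T / real (Suc n)) \<le> s" .
    qed
    then show "\<forall>\<^sub>F n in sequentially. s - T / real (Suc n) \<le> real (k n) * (T / real (Suc n))"
      "\<forall>\<^sub>F n in sequentially. real (k n) * (T / real (Suc n)) \<le> s" by auto
  qed simp
  ultimately show ?thesis by blast
qed

text \<open>A measurable majorant stands in for the uncountable supremum. Uniform grids with
  \<open>n + 1\<close> cells are not nested, so the majorant is a liminf of discrete maxima: it
  dominates every \<open>X s\<close> by continuity along grid points tending to \<open>s\<close>,
  and Fatou preserves the bound.\<close>

lemma doob_majorant:
  assumes X: "square_martingale X" and cont: "AE \<omega> in M. continuous_on {0..T} (\<lambda>t. X t \<omega>)"
  obtains D :: "'a \<Rightarrow> ennreal" where "D \<in> borel_measurable M"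
    "AE \<omega> in M. \<forall>t\<in>{0..T}. ennreal (\<bar>X t \<omega>\<bar>\<^sup>2) \<le> D \<omega>"
    "(\<integral>\<^sup>+\<omega>. D \<omega> \<partial>M) \<le> ennreal (4 * (l2_norm M (X T))\<^sup>2)"
proof -
  define t where "t n i = real i * (T / real (Suc n))" for n i
  have tT: "t n i \<in> {0..T}" if "i \<le> Suc n" for n i
  proof -
    have "t n i \<le> real (Suc n) * (T / real (Suc n))"
      unfolding t_def by (rule mult_right_mono) (use that T_pos in auto)
    then show ?thesis using T_pos by (simp add: t_def del: of_nat_Suc)
  qed
  define A where "A n \<omega> = running_max (\<lambda>i. \<bar>X (t n i) \<omega>\<bar>) (Suc n)" for n \<omega>
  have tmono: "t n i \<le> t n (Suc i)" for n i
    unfolding t_def by (rule mult_right_mono) (use T_pos in auto)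
  have tend: "t n (Suc n) = T" for n using T_pos by (simp add: t_def del: of_nat_Suc)
  have A: "A n \<in> borel_measurable M" "(\<integral>\<^sup>+\<omega>. ennreal ((A n \<omega>)\<^sup>2) \<partial>M) \<le> ennreal (4 * (l2_norm M (X T))\<^sup>2)" for n
    using doob_discrete[OF X, of "Suc n" "t n", OF tT tmono tend] unfolding A_def by auto
  have "(\<lambda>\<omega>. liminf (\<lambda>n. ennreal ((A n \<omega>)\<^sup>2))) \<in> borel_measurable M"
    using A(1) by measurable
  moreover have "AE \<omega> in M. \<forall>t\<in>{0..T}. ennreal (\<bar>X t \<omega>\<bar>\<^sup>2) \<le> liminf (\<lambda>n. ennreal ((A n \<omega>)\<^sup>2))"
    using cont
  proof eventually_elim
    case (elim \<omega>)
    show ?case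
    proof
      fix s assume s: "s \<in> {0..T}"
      obtain k where k: "\<And>n. k n \<le> Suc n" "(\<lambda>n. t n (k n)) \<longlonglongrightarrow> s"
        using grid_approx[OF s] unfolding t_def by blast
      have "(\<lambda>n. X (t n (k n)) \<omega>) \<longlonglongrightarrow> X s \<omega>"
        by (rule continuous_on_tendsto_compose[OF elim k(2) s]) (use tT k(1) in auto)
      then have "(\<lambda>n. ennreal (\<bar>X (t n (k n)) \<omega>\<bar>\<^sup>2)) \<longlonglongrightarrow> ennreal (\<bar>X s \<omega>\<bar>\<^sup>2)"
        by (intro tendsto_ennrealI tendsto_power tendsto_rabs)
      from lim_imp_Liminf[OF _ this] have "ennreal (\<bar>X s \<omega>\<bar>\<^sup>2) = liminf (\<lambda>n. ennreal (\<bar>X (t n (k n)) \<omega>\<bar>\<^sup>2))"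
        by simp
      also have "\<dots> \<le> liminf (\<lambda>n. ennreal ((A n \<omega>)\<^sup>2))"
      proof (rule Liminf_mono, rule always_eventually, rule)
        fix n
        have "\<bar>X (t n (k n)) \<omega>\<bar> \<le> A n \<omega>"
          unfolding A_def by (rule running_max_ge[OF k(1), of "\<lambda>i. \<bar>X (t n i) \<omega>\<bar>"])
        then show "ennreal (\<bar>X (t n (k n)) \<omega>\<bar>\<^sup>2) \<le> ennreal ((A n \<omega>)\<^sup>2)"
          by (intro ennreal_leI power_mono) auto
      qed
      finally show "ennreal (\<bar>X s \<omega>\<bar>\<^sup>2) \<le> liminf (\<lambda>n. ennreal ((A n \<omega>)\<^sup>2))" .
    qed
  qed
  moreover have "(\<integral>\<^sup>+\<omega>. liminf (\<lambda>n. ennreal ((A n \<omega>)\<^sup>2)) \<partial>M) \<le> ennreal (4 * (l2_norm M (X T))\<^sup>2)"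
  proof -
    have "(\<integral>\<^sup>+\<omega>. liminf (\<lambda>n. ennreal ((A n \<omega>)\<^sup>2)) \<partial>M) \<le> liminf (\<lambda>n. \<integral>\<^sup>+\<omega>. ennreal ((A n \<omega>)\<^sup>2) \<partial>M)"
      by (rule nn_integral_liminf) (use A(1) in measurable)
    also have "\<dots> \<le> ennreal (4 * (l2_norm M (X T))\<^sup>2)"
      by (rule Liminf_le) (use A(2) in auto)
    finally show ?thesis .
  qed
  ultimately show thesis by (rule that)
qed

lemma doob_continuous:
  assumes X: "square_martingale X" and cont: "AE \<omega> in M. continuous_on {0..T} (\<lambda>t. X t \<omega>)"
  shows "(\<integral>\<^sup>+\<omega>. (SUP t\<in>{0..T}. ennreal (\<bar>X t \<omega>\<bar>\<^sup>2)) \<partial>M) \<le> ennreal (4 * (l2_norm M (X T))\<^sup>2)"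
proof (rule doob_majorant[OF assms])
  fix D :: "'a \<Rightarrow> ennreal"
  assume D: "AE \<omega> in M. \<forall>t\<in>{0..T}. ennreal (\<bar>X t \<omega>\<bar>\<^sup>2) \<le> D \<omega>"
    "(\<integral>\<^sup>+\<omega>. D \<omega> \<partial>M) \<le> ennreal (4 * (l2_norm M (X T))\<^sup>2)"
  have "(\<integral>\<^sup>+\<omega>. (SUP t\<in>{0..T}. ennreal (\<bar>X t \<omega>\<bar>\<^sup>2)) \<partial>M) \<le> (\<integral>\<^sup>+\<omega>. D \<omega> \<partial>M)"
    by (rule nn_integral_mono_AE) (use D(1) in eventually_elim, auto intro!: SUP_least)
  then show ?thesis using D(2) by (rule order_trans)
qed

lemma square_martingale_l2_norm_mono:
  assumes "square_martingale X" "t \<in> {0..T}"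
  shows "l2_norm M (X t) \<le> l2_norm M (X T)"
proof (rule power2_le_imp_le)
  have T: "T \<in> {0..T}" using T_pos by simp
  note sq = square_martingaleD(2)[OF assms(1)]
  have "(\<integral>\<omega>. X t \<omega> * (X T \<omega> - X t \<omega>) \<partial>M) = 0"
    using square_martingaleD(3)[OF assms(1), of t T "X t"] square_martingaleD(1,2)[OF assms] assms(2) by simp
  then show "(l2_norm M (X t))\<^sup>2 \<le> (l2_norm M (X T))\<^sup>2"
    using l2_norm_add_power2[OF sq[OF assms(2)] square_integrable_diff[OF sq[OF T] sq[OF assms(2)]]]
    by simp
qed simp

section \<open>The Ito integral\<close>

lemma T_in: "T \<in> {0..T}" using T_pos by simp

lemma nn_integral_lborel_L: "(\<integral>\<^sup>+s\<in>{0..T}. g s \<partial>lborel) = (\<integral>\<^sup>+s. g s \<partial>L)"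
  by (subst nn_integral_restrict_space) auto

lemma nn_integral_iterated:
  assumes "h \<in> borel_measurable Q"
  shows "(\<integral>\<^sup>+\<omega>. (\<integral>\<^sup>+s\<in>{0..T}. ennreal ((norm (h (\<omega>, s)))\<^sup>2) \<partial>lborel) \<partial>M) = (\<integral>\<^sup>+x. ennreal ((norm (h x))\<^sup>2) \<partial>Q)"
  unfolding nn_integral_lborel_L using assms by (subst Lm.nn_integral_fst[symmetric]) auto

lemma H2_iff:
  "Z \<in> H2 M F T \<longleftrightarrow> (\<lambda>(\<omega>, t). Z t \<omega>) \<in> borel_measurable Pred \<and> square_integrable Q (\<lambda>(\<omega>, t). Z t \<omega>)"
proof (cases "(\<lambda>(\<omega>, t). Z t \<omega>) \<in> borel_measurable Pred")
  case True
  have m: "(\<lambda>(\<omega>, t). Z t \<omega>) \<in> borel_measurable Q" by (rule measurable_from_subalg[OF subalgebra_Pred True])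
  have "(\<integral>\<^sup>+\<omega>. (\<integral>\<^sup>+s\<in>{0..T}. ennreal ((norm (Z s \<omega>))\<^sup>2) \<partial>lborel) \<partial>M) = (\<integral>\<^sup>+x. ennreal ((norm (case x of (\<omega>, t) \<Rightarrow> Z t \<omega>))\<^sup>2) \<partial>Q)"
    using nn_integral_iterated[OF m] by simp
  then show ?thesis
    unfolding H2_def square_integrable_iff_nn_integral using True m by simp
qed (simp add: H2_def)

lemma ennreal_l2_tendsto_iff:
  assumes "\<And>k. square_integrable N (f k)"
  shows "(\<lambda>k. \<integral>\<^sup>+x. ennreal ((norm (f k x))\<^sup>2) \<partial>N) \<longlonglongrightarrow> 0 \<longleftrightarrow> (\<lambda>k. l2_norm N (f k)) \<longlonglongrightarrow> 0"
proof -
  have "(\<lambda>k. \<integral>\<^sup>+x. ennreal ((norm (f k x))\<^sup>2) \<partial>N) \<longlonglongrightarrow> 0 \<longleftrightarrow> (\<lambda>k. (l2_norm N (f k))\<^sup>2) \<longlonglongrightarrow> 0"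
    unfolding nn_integral_l2_norm[OF assms] by (subst ennreal_0[symmetric], subst tendsto_ennreal_iff) auto
  also have "\<dots> \<longleftrightarrow> (\<lambda>k. l2_norm N (f k)) \<longlonglongrightarrow> 0"
  proof
    assume "(\<lambda>k. (l2_norm N (f k))\<^sup>2) \<longlonglongrightarrow> 0"
    then show "(\<lambda>k. l2_norm N (f k)) \<longlonglongrightarrow> 0" using tendsto_real_sqrt by fastforce
  next
    assume "(\<lambda>k. l2_norm N (f k)) \<longlonglongrightarrow> 0"
    then show "(\<lambda>k. (l2_norm N (f k))\<^sup>2) \<longlonglongrightarrow> 0" using tendsto_power by fastforce
  qed
  finally show ?thesis .
qed

text \<open>The approximation clause of \<open>has_ito_integral\<close> in terms of
  \<open>simple_ito\<close> and real-valued L2 norms. Square integrability of \<open>X t\<close> is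
  included so that these norms are meaningful.\<close>

definition ito_approx ::
  "(nat \<Rightarrow> real \<Rightarrow> 'a \<Rightarrow> real ^ 'd) \<Rightarrow> (nat \<Rightarrow> real \<Rightarrow> 'a \<Rightarrow> real) \<Rightarrow> (real \<Rightarrow> 'a \<Rightarrow> real ^ 'd) \<Rightarrow> (real \<Rightarrow> 'a \<Rightarrow> real) \<Rightarrow> bool" where
  "ito_approx Zk Xk Z X \<longleftrightarrow> (\<forall>k. simple_ito (Zk k) (Xk k)) \<and>
     (\<lambda>k. l2_norm Q (\<lambda>(\<omega>, s). Zk k s \<omega> - Z s \<omega>)) \<longlonglongrightarrow> 0 \<and>
     (\<forall>t\<in>{0..T}. square_integrable M (X t) \<and> (\<lambda>k. l2_norm M (\<lambda>\<omega>. Xk k t \<omega> - X t \<omega>)) \<longlonglongrightarrow> 0)"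

lemma has_ito_integral_iff:
  assumes Z: "Z \<in> H2 M F T"
  shows "has_ito_integral M F T B Z X \<longleftrightarrow>
    adapted_process F T X \<and> continuous_process M T X \<and> (\<exists>Zk Xk. ito_approx Zk Xk Z X)"
proof -
  have ZQ: "square_integrable Q (\<lambda>(\<omega>, s). Z s \<omega>)" using Z by (simp add: H2_iff)
  have sqd: "square_integrable Q (\<lambda>(\<omega>, s). Z' s \<omega> - Z s \<omega>)" if "simple_ito Z' X'" for Z' X'
    using square_integrable_diff[OF simple_ito_predictable(2)[OF that] ZQ] by (simp add: case_prod_unfold)
  have eqQ: "(\<integral>\<^sup>+\<omega>. (\<integral>\<^sup>+s\<in>{0..T}. ennreal ((norm (Z' s \<omega> - Z s \<omega>))\<^sup>2) \<partial>lborel) \<partial>M)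
      = (\<integral>\<^sup>+x. ennreal ((norm ((\<lambda>(\<omega>, s). Z' s \<omega> - Z s \<omega>) x))\<^sup>2) \<partial>Q)" if "simple_ito Z' X'" for Z' X'
    using nn_integral_iterated[OF square_integrableD(1)[OF sqd[OF that]]] by simp
  show ?thesis
  proof (intro iffI conjI; (elim conjE)?)
    assume h: "has_ito_integral M F T B Z X"
    then show ad: "adapted_process F T X" and "continuous_process M T X"
      by (auto simp: has_ito_integral_def)
    from h obtain n \<tau> \<phi> where 1: "\<And>k. simple_integrand M F T (n k) (\<tau> k) (\<phi> k)"
      and 2: "(\<lambda>k. \<integral>\<^sup>+\<omega>. (\<integral>\<^sup>+s\<in>{0..T}.
            ennreal ((norm (simple_process (n k) (\<tau> k) (\<phi> k) s \<omega> - Z s \<omega>))\<^sup>2) \<partial>lborel) \<partial>M) \<longlonglongrightarrow> 0"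
      and 3: "\<And>t. t \<in> {0..T} \<Longrightarrow>
          (\<lambda>k. \<integral>\<^sup>+\<omega>. ennreal (\<bar>simple_ito_integral B (n k) (\<tau> k) (\<phi> k) t \<omega> - X t \<omega>\<bar>\<^sup>2) \<partial>M) \<longlonglongrightarrow> 0"
      unfolding has_ito_integral_def by blast
    let ?Z = "\<lambda>k. simple_process (n k) (\<tau> k) (\<phi> k)" and ?X = "\<lambda>k. simple_ito_integral B (n k) (\<tau> k) (\<phi> k)"
    have si: "simple_ito (?Z k) (?X k)" for k using 1 by (auto simp: simple_ito_def)
    have "square_integrable M (X t) \<and> (\<lambda>k. l2_norm M (\<lambda>\<omega>. ?X k t \<omega> - X t \<omega>)) \<longlonglongrightarrow> 0" if t: "t \<in> {0..T}" for t
    proof -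
      have "X t \<in> borel_measurable (F t)" using ad t by (auto simp: adapted_process_def)
      then have Xm: "X t \<in> borel_measurable M" by (rule measurable_F_imp) (use t in simp)
      have sX: "square_integrable M (?X k t)" for k by (rule simple_ito_square_integrable[OF si t])
      \<comment> \<open>\<open>has_ito_integral\<close> does not assert that \<open>X t\<close> is
        square integrable; it follows because some square-integrable approximant lies at finite
        distance from it.\<close>
      have "eventually (\<lambda>k. (\<integral>\<^sup>+\<omega>. ennreal (\<bar>?X k t \<omega> - X t \<omega>\<bar>\<^sup>2) \<partial>M) < 1) sequentially"
        by (rule order_tendstoD(2)[OF 3[OF t]]) simp
      then obtain k where "(\<integral>\<^sup>+\<omega>. ennreal (\<bar>?X k t \<omega> - X t \<omega>\<bar>\<^sup>2) \<partial>M) < 1"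
        by (auto simp: eventually_sequentially)
      then have "square_integrable M (\<lambda>\<omega>. ?X k t \<omega> - X t \<omega>)"
        unfolding square_integrable_iff_nn_integral using Xm square_integrableD(1)[OF sX[of k]]
        by (auto intro: less_trans)
      from square_integrable_diff[OF sX[of k] this] have "square_integrable M (X t)" by simp
      moreover have "(\<lambda>k. l2_norm M (\<lambda>\<omega>. ?X k t \<omega> - X t \<omega>)) \<longlonglongrightarrow> 0"
        using 3[OF t] ennreal_l2_tendsto_iff[of M "\<lambda>k \<omega>. ?X k t \<omega> - X t \<omega>", OF square_integrable_diff[OF sX calculation]] by simp
      ultimately show ?thesis by simp
    qed
    moreover have "(\<lambda>k. l2_norm Q (\<lambda>(\<omega>, s). ?Z k s \<omega> - Z s \<omega>)) \<longlonglongrightarrow> 0"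
      using 2 unfolding eqQ[OF si] ennreal_l2_tendsto_iff[OF sqd[OF si]] .
    ultimately show "\<exists>Zk Xk. ito_approx Zk Xk Z X"
      unfolding ito_approx_def using si by (intro exI[of _ ?Z] exI[of _ ?X]) auto
  next
    assume ad: "adapted_process F T X" and cont: "continuous_process M T X" and "\<exists>Zk Xk. ito_approx Zk Xk Z X"
    then obtain Zk Xk where a: "ito_approx Zk Xk Z X" by blast
    then have si: "simple_ito (Zk k) (Xk k)" for k by (simp add: ito_approx_def)
    then obtain n \<tau> \<phi> where 1: "\<And>k. simple_integrand M F T (n k) (\<tau> k) (\<phi> k)"
      "\<And>k. Zk k = simple_process (n k) (\<tau> k) (\<phi> k)" "\<And>k. Xk k = simple_ito_integral B (n k) (\<tau> k) (\<phi> k)"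
      unfolding simple_ito_def by metis
    have 2: "(\<lambda>k. \<integral>\<^sup>+\<omega>. (\<integral>\<^sup>+s\<in>{0..T}. ennreal ((norm (Zk k s \<omega> - Z s \<omega>))\<^sup>2) \<partial>lborel) \<partial>M) \<longlonglongrightarrow> 0"
      unfolding eqQ[OF si] ennreal_l2_tendsto_iff[OF sqd[OF si]] using a by (simp add: ito_approx_def)
    have 3: "(\<lambda>k. \<integral>\<^sup>+\<omega>. ennreal (\<bar>Xk k t \<omega> - X t \<omega>\<bar>\<^sup>2) \<partial>M) \<longlonglongrightarrow> 0" if t: "t \<in> {0..T}" for t
      using a t ennreal_l2_tendsto_iff[of M "\<lambda>k \<omega>. Xk k t \<omega> - X t \<omega>",
          OF square_integrable_diff[OF simple_ito_square_integrable[OF si t]]]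
      by (simp add: ito_approx_def)
    show "has_ito_integral M F T B Z X"
      unfolding has_ito_integral_def using ad cont 1(1) 2 3 unfolding 1(2,3) by blast
  qed
qed

text \<open>All properties pass from the approximating simple integrals: orthogonality and the
  truncated isometry by L2 convergence at each time, the bound on the supremum by Doob's inequality
  for the limit.\<close>

lemma has_ito_integralD:
  assumes Z: "Z \<in> H2 M F T" and h: "has_ito_integral M F T B Z X"
  shows "\<And>t. t \<in> {0..T} \<Longrightarrow> X t \<in> borel_measurable (F t)" "\<And>\<omega>. \<omega> \<in> space M \<Longrightarrow> continuous_on {0..T} (\<lambda>t. X t \<omega>)"
    "square_martingale X" "AE \<omega> in M. X 0 \<omega> = 0" "X \<in> S2 M F T"
    "\<And>t. t \<in> {0..T} \<Longrightarrow> l2_norm M (\<lambda>\<omega>. X T \<omega> - X t \<omega>) = l2_norm Q (\<lambda>(\<omega>, s). indicat_real {t<..} s *\<^sub>R Z s \<omega>)"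
proof -
  have ad: "adapted_process F T X" and cont: "continuous_process M T X" using h by (auto simp: has_ito_integral_def)
  then show m: "\<And>t. t \<in> {0..T} \<Longrightarrow> X t \<in> borel_measurable (F t)"
    and c: "\<And>\<omega>. \<omega> \<in> space M \<Longrightarrow> continuous_on {0..T} (\<lambda>t. X t \<omega>)"
    by (auto simp: adapted_process_def continuous_process_def)
  from h obtain Zk Xk where a: "ito_approx Zk Xk Z X" unfolding has_ito_integral_iff[OF Z] by blast
  have si: "simple_ito (Zk k) (Xk k)" for k using a by (simp add: ito_approx_def)
  have sq: "square_integrable M (X t)" and lim: "(\<lambda>k. l2_norm M (\<lambda>\<omega>. Xk k t \<omega> - X t \<omega>)) \<longlonglongrightarrow> 0"
    if "t \<in> {0..T}" for t using a that by (auto simp: ito_approx_def)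
  have sqk: "square_integrable M (Xk k t)" if "t \<in> {0..T}" for k t
    by (rule simple_ito_square_integrable[OF si that])
  have limd: "(\<lambda>k. l2_norm M (\<lambda>\<omega>. (Xk k T \<omega> - Xk k t \<omega>) - (X T \<omega> - X t \<omega>))) \<longlonglongrightarrow> 0" if t: "t \<in> {0..T}" for t
  proof (rule Lim_null_comparison)
    show "(\<lambda>k. l2_norm M (\<lambda>\<omega>. Xk k T \<omega> - X T \<omega>) + l2_norm M (\<lambda>\<omega>. Xk k t \<omega> - X t \<omega>)) \<longlonglongrightarrow> 0"
      using tendsto_add[OF lim[OF T_in] lim[OF t]] by simp
    have "l2_norm M (\<lambda>\<omega>. (Xk k T \<omega> - Xk k t \<omega>) - (X T \<omega> - X t \<omega>))
        \<le> l2_norm M (\<lambda>\<omega>. Xk k T \<omega> - X T \<omega>) + l2_norm M (\<lambda>\<omega>. Xk k t \<omega> - X t \<omega>)" for k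
      using l2_norm_triangle[OF square_integrable_diff[OF sqk[OF T_in] sq[OF T_in]]
          square_integrable_uminus[OF square_integrable_diff[OF sqk[OF t] sq[OF t]]], of k k]
      by (simp add: algebra_simps l2_norm_minus_commute[of M "X t"])
    then show "\<forall>\<^sub>F k in sequentially. norm (l2_norm M (\<lambda>\<omega>. (Xk k T \<omega> - Xk k t \<omega>) - (X T \<omega> - X t \<omega>)))
        \<le> l2_norm M (\<lambda>\<omega>. Xk k T \<omega> - X T \<omega>) + l2_norm M (\<lambda>\<omega>. Xk k t \<omega> - X t \<omega>)" by simp
  qed
  show mart: "square_martingale X"
    unfolding square_martingale_def
  proof (intro conjI ballI allI impI)
    fix t and G :: "'a \<Rightarrow> real" assume t: "t \<in> {0..T}" and G: "G \<in> borel_measurable (F t)" "square_integrable M G"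
    have "(\<lambda>k. \<integral>\<omega>. G \<omega> \<bullet> (Xk k T \<omega> - Xk k t \<omega>) \<partial>M) \<longlonglongrightarrow> (\<integral>\<omega>. G \<omega> \<bullet> (X T \<omega> - X t \<omega>) \<partial>M)"
      by (rule tendsto_integral_inner[OF _ _ G(2) limd[OF t]]) (intro square_integrable_diff sq sqk t T_in)+
    moreover have "(\<integral>\<omega>. G \<omega> \<bullet> (Xk k T \<omega> - Xk k t \<omega>) \<partial>M) = 0" for k
      using simple_ito_orthogonal[OF si t G] by simp
    ultimately show "(\<integral>\<omega>. G \<omega> * (X T \<omega> - X t \<omega>) \<partial>M) = 0"
      by (simp add: LIMSEQ_const_iff)
  qed (use sq m in auto)
  have 0: "0 \<in> {0..T}" using T_pos by simp
  have "l2_norm M (\<lambda>\<omega>. Xk k 0 \<omega> - X 0 \<omega>) = l2_norm M (X 0)" for k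
    using simple_ito_0[OF si] by simp
  then have "l2_norm M (X 0) = 0" using lim[OF 0] by (simp add: LIMSEQ_const_iff)
  then show "AE \<omega> in M. X 0 \<omega> = 0" using l2_norm_eq_0_iff[OF sq[OF 0]] by simp
  show "X \<in> S2 M F T"
    unfolding S2_def using ad cont le_less_trans[OF doob_continuous[OF mart]] c by auto
  fix t assume t: "t \<in> {0..T}"
  have "(\<lambda>k. l2_norm M (\<lambda>\<omega>. Xk k T \<omega> - Xk k t \<omega>)) \<longlonglongrightarrow> l2_norm M (\<lambda>\<omega>. X T \<omega> - X t \<omega>)"
    by (rule tendsto_l2_norm[OF _ _ limd[OF t]]) (intro square_integrable_diff sq sqk t T_in)+
  moreover have "l2_norm M (\<lambda>\<omega>. Xk k T \<omega> - Xk k t \<omega>) = l2_norm Q (\<lambda>(\<omega>, s). indicat_real {t<..} s *\<^sub>R Zk k s \<omega>)" for k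
    using simple_ito_isometry(2)[OF simple_ito_truncate[OF si t]] t by (simp add: min_absorb1)
  moreover have "(\<lambda>k. l2_norm Q (\<lambda>(\<omega>, s). indicat_real {t<..} s *\<^sub>R Zk k s \<omega>)) \<longlonglongrightarrow> l2_norm Q (\<lambda>(\<omega>, s). indicat_real {t<..} s *\<^sub>R Z s \<omega>)"
  proof -
    have [measurable]: "(\<lambda>x. indicat_real {t<..} (snd x)) \<in> borel_measurable Q"
      by (rule measurable_compose[OF measurable_snd]) (intro measurable_restrict_space1, measurable)
    have ZQ: "square_integrable Q (\<lambda>(\<omega>, s). Z s \<omega>)" using Z by (simp add: H2_iff)
    have trunc: "square_integrable Q (\<lambda>(\<omega>, s). indicat_real {t<..} s *\<^sub>R V s \<omega>)"
      if "square_integrable Q (\<lambda>(\<omega>, s). V s \<omega>)" for V :: "real \<Rightarrow> 'a \<Rightarrow> real ^ 'd"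
      using square_integrable_mult_bounded[OF that, of "\<lambda>x. indicat_real {t<..} (snd x)" 1]
      by (simp add: case_prod_unfold)
    have dQ: "square_integrable Q (\<lambda>(\<omega>, s). Zk k s \<omega> - Z s \<omega>)" for k
      using square_integrable_diff[OF simple_ito_predictable(2)[OF si[of k]] ZQ] by (simp add: case_prod_unfold)
    show ?thesis
    proof (rule tendsto_l2_norm)
      show "square_integrable Q (\<lambda>(\<omega>, s). indicat_real {t<..} s *\<^sub>R Zk k s \<omega>)" for k
        by (rule trunc[OF simple_ito_predictable(2)[OF si]])
      show "square_integrable Q (\<lambda>(\<omega>, s). indicat_real {t<..} s *\<^sub>R Z s \<omega>)" by (rule trunc[OF ZQ])
      show "(\<lambda>k. l2_norm Q (\<lambda>x. (case x of (\<omega>, s) \<Rightarrow> indicat_real {t<..} s *\<^sub>R Zk k s \<omega>) - (case x of (\<omega>, s) \<Rightarrow> indicat_real {t<..} s *\<^sub>R Z s \<omega>))) \<longlonglongrightarrow> 0"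
      proof (rule Lim_null_comparison)
        show "(\<lambda>k. l2_norm Q (\<lambda>(\<omega>, s). Zk k s \<omega> - Z s \<omega>)) \<longlonglongrightarrow> 0" using a by (simp add: ito_approx_def)
        have "l2_norm Q (\<lambda>x. (case x of (\<omega>, s) \<Rightarrow> indicat_real {t<..} s *\<^sub>R Zk k s \<omega>) - (case x of (\<omega>, s) \<Rightarrow> indicat_real {t<..} s *\<^sub>R Z s \<omega>))
           \<le> l2_norm Q (\<lambda>(\<omega>, s). Zk k s \<omega> - Z s \<omega>)" for k
          by (rule square_integrable_bound(2)[OF dQ])
            (use square_integrableD(1)[OF trunc[OF ZQ]] square_integrableD(1)[OF trunc[OF simple_ito_predictable(2)[OF si[of k]]]]
              in \<open>auto simp: indicator_def\<close>)
        then show "\<forall>\<^sub>F k in sequentially. norm (l2_norm Q (\<lambda>x. (case x of (\<omega>, s) \<Rightarrow> indicat_real {t<..} s *\<^sub>R Zk k s \<omega>) - (case x of (\<omega>, s) \<Rightarrow> indicat_real {t<..} s *\<^sub>R Z s \<omega>)))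
           \<le> l2_norm Q (\<lambda>(\<omega>, s). Zk k s \<omega> - Z s \<omega>)" by simp
      qed
    qed
  qed
  ultimately show "l2_norm M (\<lambda>\<omega>. X T \<omega> - X t \<omega>) = l2_norm Q (\<lambda>(\<omega>, s). indicat_real {t<..} s *\<^sub>R Z s \<omega>)"
    using LIMSEQ_unique by simp
qed

lemma H2_diff:
  assumes "Z \<in> H2 M F T" "Z' \<in> H2 M F T"
  shows "(\<lambda>s \<omega>. Z s \<omega> - Z' s \<omega>) \<in> H2 M F T"
  using assms square_integrable_diff[of Q "\<lambda>(\<omega>, t). Z t \<omega>" "\<lambda>(\<omega>, t). Z' t \<omega>"]
    borel_measurable_diff[of "\<lambda>(\<omega>, t). Z t \<omega>" Pred "\<lambda>(\<omega>, t). Z' t \<omega>"]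
  unfolding H2_iff by (simp add: case_prod_unfold)

text \<open>Differences of two solutions are again driven by an Ito integral, and the stability
  estimates are applied to these differences.\<close>

lemma has_ito_integral_diff:
  assumes Z: "Z \<in> H2 M F T" "has_ito_integral M F T B Z X"
    and Z': "Z' \<in> H2 M F T" "has_ito_integral M F T B Z' X'"
  shows "has_ito_integral M F T B (\<lambda>s \<omega>. Z s \<omega> - Z' s \<omega>) (\<lambda>t \<omega>. X t \<omega> - X' t \<omega>)"
  unfolding has_ito_integral_iff[OF H2_diff[OF Z(1) Z'(1)]]
proof (intro conjI)
  show "adapted_process F T (\<lambda>t \<omega>. X t \<omega> - X' t \<omega>)"
    unfolding adapted_process_def
    using has_ito_integralD(1)[OF Z] has_ito_integralD(1)[OF Z'] by (auto intro: borel_measurable_diff)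
  show "continuous_process M T (\<lambda>t \<omega>. X t \<omega> - X' t \<omega>)"
    unfolding continuous_process_def
    using has_ito_integralD(2)[OF Z] has_ito_integralD(2)[OF Z'] by (auto intro: continuous_on_diff)
  obtain Zk Xk where a: "ito_approx Zk Xk Z X" using Z(2) unfolding has_ito_integral_iff[OF Z(1)] by blast
  obtain Zk' Xk' where a': "ito_approx Zk' Xk' Z' X'" using Z'(2) unfolding has_ito_integral_iff[OF Z'(1)] by blast
  have si: "simple_ito (Zk k) (Xk k)" "simple_ito (Zk' k) (Xk' k)" for k
    using a a' by (auto simp: ito_approx_def)
  have l2d: "l2_norm N (\<lambda>x. (f x - f' x) - (g x - g' x)) \<le> l2_norm N (\<lambda>x. f x - g x) + l2_norm N (\<lambda>x. f' x - g' x)"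
    if "square_integrable N f" "square_integrable N f'" "square_integrable N g" "square_integrable N g'"
    for N :: "'q measure" and f f' g g' :: "'q \<Rightarrow> 'e::euclidean_space"
    using l2_norm_triangle[OF square_integrable_diff[OF that(1,3)] square_integrable_uminus[OF square_integrable_diff[OF that(2,4)]]]
    by (simp add: algebra_simps l2_norm_minus_commute[of N g'])
  have ZQ: "square_integrable Q (\<lambda>(\<omega>, s). Z s \<omega>)" "square_integrable Q (\<lambda>(\<omega>, s). Z' s \<omega>)"
    using Z(1) Z'(1) by (auto simp: H2_iff)
  have "ito_approx (\<lambda>k s \<omega>. Zk k s \<omega> - Zk' k s \<omega>) (\<lambda>k t \<omega>. Xk k t \<omega> - Xk' k t \<omega>)
      (\<lambda>s \<omega>. Z s \<omega> - Z' s \<omega>) (\<lambda>t \<omega>. X t \<omega> - X' t \<omega>)"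
    unfolding ito_approx_def
  proof (intro conjI allI ballI)
    fix k show "simple_ito (\<lambda>s \<omega>. Zk k s \<omega> - Zk' k s \<omega>) (\<lambda>t \<omega>. Xk k t \<omega> - Xk' k t \<omega>)"
      by (rule simple_ito_diff[OF si])
  next
    show "(\<lambda>k. l2_norm Q (\<lambda>(\<omega>, s). Zk k s \<omega> - Zk' k s \<omega> - (Z s \<omega> - Z' s \<omega>))) \<longlonglongrightarrow> 0"
    proof (rule Lim_null_comparison)
      show "(\<lambda>k. l2_norm Q (\<lambda>(\<omega>, s). Zk k s \<omega> - Z s \<omega>) + l2_norm Q (\<lambda>(\<omega>, s). Zk' k s \<omega> - Z' s \<omega>)) \<longlonglongrightarrow> 0"
        using a a' tendsto_add[of "\<lambda>k. l2_norm Q (\<lambda>(\<omega>, s). Zk k s \<omega> - Z s \<omega>)" 0 _ "\<lambda>k. l2_norm Q (\<lambda>(\<omega>, s). Zk' k s \<omega> - Z' s \<omega>)" 0]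
        by (simp add: ito_approx_def)
      show "\<forall>\<^sub>F k in sequentially. norm (l2_norm Q (\<lambda>(\<omega>, s). Zk k s \<omega> - Zk' k s \<omega> - (Z s \<omega> - Z' s \<omega>)))
         \<le> l2_norm Q (\<lambda>(\<omega>, s). Zk k s \<omega> - Z s \<omega>) + l2_norm Q (\<lambda>(\<omega>, s). Zk' k s \<omega> - Z' s \<omega>)"
        using l2d[OF simple_ito_predictable(2)[OF si(1)] simple_ito_predictable(2)[OF si(2)] ZQ]
        by (simp add: case_prod_unfold)
    qed
  next
    fix t assume t: "t \<in> {0..T}"
    have sq: "square_integrable M (X t)" "square_integrable M (X' t)" using a a' t by (auto simp: ito_approx_def)
    then show "square_integrable M (\<lambda>\<omega>. X t \<omega> - X' t \<omega>)" by (rule square_integrable_diff)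
    show "(\<lambda>k. l2_norm M (\<lambda>\<omega>. Xk k t \<omega> - Xk' k t \<omega> - (X t \<omega> - X' t \<omega>))) \<longlonglongrightarrow> 0"
    proof (rule Lim_null_comparison)
      show "(\<lambda>k. l2_norm M (\<lambda>\<omega>. Xk k t \<omega> - X t \<omega>) + l2_norm M (\<lambda>\<omega>. Xk' k t \<omega> - X' t \<omega>)) \<longlonglongrightarrow> 0"
        using a a' t tendsto_add[of "\<lambda>k. l2_norm M (\<lambda>\<omega>. Xk k t \<omega> - X t \<omega>)" 0 _ "\<lambda>k. l2_norm M (\<lambda>\<omega>. Xk' k t \<omega> - X' t \<omega>)" 0]
        by (simp add: ito_approx_def)
      show "\<forall>\<^sub>F k in sequentially. norm (l2_norm M (\<lambda>\<omega>. Xk k t \<omega> - Xk' k t \<omega> - (X t \<omega> - X' t \<omega>)))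
         \<le> l2_norm M (\<lambda>\<omega>. Xk k t \<omega> - X t \<omega>) + l2_norm M (\<lambda>\<omega>. Xk' k t \<omega> - X' t \<omega>)"
        using l2d[OF simple_ito_square_integrable[OF si(1) t] simple_ito_square_integrable[OF si(2) t] sq] by simp
    qed
  qed
  then show "\<exists>Zk Xk. ito_approx Zk Xk (\<lambda>s \<omega>. Z s \<omega> - Z' s \<omega>) (\<lambda>t \<omega>. X t \<omega> - X' t \<omega>)" by blast
qed

text \<open>Only the terminal values are assumed to converge fast. The isometry turns this into
  convergence of integrands in L2 over \<open>Pred\<close>, and Doob's inequality into almost sure
  uniform convergence of paths, whose limit is the continuous version.\<close>

lemma ito_integral_exists:
  assumes si: "\<And>k. simple_ito (Zk k) (Xk k)" and C: "C \<ge> 0"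
    and le: "\<And>k. l2_norm M (\<lambda>\<omega>. Xk (Suc k) T \<omega> - Xk k T \<omega>) \<le> C * (1/2) ^ k"
  obtains Z X where "Z \<in> H2 M F T" "has_ito_integral M F T B Z X"
    "(\<lambda>k. l2_norm M (\<lambda>\<omega>. Xk k T \<omega> - X T \<omega>)) \<longlonglongrightarrow> 0"
proof -
  have sid: "simple_ito (\<lambda>s \<omega>. Zk (Suc k) s \<omega> - Zk k s \<omega>) (\<lambda>t \<omega>. Xk (Suc k) t \<omega> - Xk k t \<omega>)" for k
    by (rule simple_ito_diff[OF si si])
  have leQ: "l2_norm Q (\<lambda>x. (case x of (\<omega>, s) \<Rightarrow> Zk (Suc k) s \<omega>) - (case x of (\<omega>, s) \<Rightarrow> Zk k s \<omega>)) \<le> C * (1/2) ^ k" for k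
    using le[of k] simple_ito_isometry(2)[OF sid[of k]] by (simp add: case_prod_unfold)
  obtain g where g: "g \<in> borel_measurable Pred" "square_integrable Q g"
    "(\<lambda>k. l2_norm Q (\<lambda>x. (case x of (\<omega>, s) \<Rightarrow> Zk k s \<omega>) - g x)) \<longlonglongrightarrow> 0"
    using Riesz_Fischer[OF subalgebra_Pred simple_ito_predictable(1)[OF si] simple_ito_predictable(2)[OF si] C leQ] by blast
  define Z where "Z = (\<lambda>s \<omega>. g (\<omega>, s))"
  have Z: "Z \<in> H2 M F T" using g by (simp add: H2_iff Z_def)
  have limZ: "(\<lambda>k. l2_norm Q (\<lambda>(\<omega>, s). Zk k s \<omega> - Z s \<omega>)) \<longlonglongrightarrow> 0"
    using g(3) by (simp add: Z_def case_prod_unfold)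
  have leT: "l2_norm M (\<lambda>\<omega>. Xk (Suc k) t \<omega> - Xk k t \<omega>) \<le> C * (1/2) ^ k" if "t \<in> {0..T}" for k t
    using square_martingale_l2_norm_mono[OF simple_ito_square_martingale[OF sid] that, of k] le[of k] by simp
  \<comment> \<open>\<open>D\<close> is a Doob majorant of the k-th difference of paths; its
    integral is at most 4 times the squared terminal norm, hence of order
    \<open>(1/4) ^ k\<close>.\<close>
  define P where "P k D \<longleftrightarrow> D \<in> borel_measurable M \<and> (AE \<omega> in M. \<forall>t\<in>{0..T}. ennreal (\<bar>Xk (Suc k) t \<omega> - Xk k t \<omega>\<bar>\<^sup>2) \<le> D \<omega>)
    \<and> (\<integral>\<^sup>+\<omega>. D \<omega> \<partial>M) \<le> ennreal (4 * C\<^sup>2 * (1/4) ^ k)" for k and D :: "'a \<Rightarrow> ennreal"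
  have "\<exists>D. P k D" for k
  proof (rule doob_majorant[OF simple_ito_square_martingale[OF sid[of k]] simple_ito_continuous[OF sid[of k]]])
    fix D assume D: "D \<in> borel_measurable M" "AE \<omega> in M. \<forall>t\<in>{0..T}. ennreal (\<bar>Xk (Suc k) t \<omega> - Xk k t \<omega>\<bar>\<^sup>2) \<le> D \<omega>"
      "(\<integral>\<^sup>+\<omega>. D \<omega> \<partial>M) \<le> ennreal (4 * (l2_norm M (\<lambda>\<omega>. Xk (Suc k) T \<omega> - Xk k T \<omega>))\<^sup>2)"
    have "(l2_norm M (\<lambda>\<omega>. Xk (Suc k) T \<omega> - Xk k T \<omega>))\<^sup>2 \<le> (C * (1/2) ^ k)\<^sup>2"
      by (rule power_mono[OF le]) simp
    also have "\<dots> = C\<^sup>2 * (1/4) ^ k"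
      by (simp add: power_mult_distrib power_divide power2_eq_square power_mult_distrib[symmetric])
    finally have "(\<integral>\<^sup>+\<omega>. D \<omega> \<partial>M) \<le> ennreal (4 * C\<^sup>2 * (1/4) ^ k)"
      by (intro order_trans[OF D(3)] ennreal_leI) simp
    then show ?thesis using D by (auto simp: P_def)
  qed
  then obtain D where "\<And>k. P k (D k)" by metis
  then have D: "\<And>k. D k \<in> borel_measurable M"
    "\<And>k. AE \<omega> in M. \<forall>t\<in>{0..T}. ennreal (\<bar>Xk (Suc k) t \<omega> - Xk k t \<omega>\<bar>\<^sup>2) \<le> D k \<omega>"
    "\<And>k. (\<integral>\<^sup>+\<omega>. D k \<omega> \<partial>M) \<le> ennreal (4 * C\<^sup>2 * (1/4) ^ k)" unfolding P_def by blast+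
  \<comment> \<open>The paths on which successive differences are uniformly summable in t; almost
    all paths have this property.\<close>
  define good where "good \<omega> \<longleftrightarrow> (\<forall>k. continuous_on {0..T} (\<lambda>t. Xk k t \<omega>)) \<and>
     (\<exists>E\<ge>0. \<forall>k. \<forall>t\<in>{0..T}. \<bar>Xk (Suc k) t \<omega> - Xk k t \<omega>\<bar> \<le> sqrt (E * (1/2) ^ k))" for \<omega>
  have good: "AE \<omega> in M. good \<omega>"
  proof -
    have 1: "AE \<omega> in M. \<forall>k. continuous_on {0..T} (\<lambda>t. Xk k t \<omega>)"
      unfolding AE_all_countable using simple_ito_continuous[OF si] by blast
    have 2: "AE \<omega> in M. \<forall>k. \<forall>t\<in>{0..T}. ennreal (\<bar>Xk (Suc k) t \<omega> - Xk k t \<omega>\<bar>\<^sup>2) \<le> D k \<omega>"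
      unfolding AE_all_countable using D(2) by blast
    have 3: "AE \<omega> in M. \<exists>E\<ge>0. \<forall>k. D k \<omega> \<le> ennreal (E * (1/2) ^ k)"
      by (rule nn_integral_fast_Cauchy[OF D(1,3)]) simp
    show ?thesis using 1 2 3
    proof eventually_elim
      case (elim \<omega>)
      obtain E where E: "E \<ge> 0" "\<And>k. D k \<omega> \<le> ennreal (E * (1/2) ^ k)" using elim(3) by blast
      have "\<bar>Xk (Suc k) t \<omega> - Xk k t \<omega>\<bar> \<le> sqrt (E * (1/2) ^ k)" if "t \<in> {0..T}" for k t
      proof -
        have "ennreal (\<bar>Xk (Suc k) t \<omega> - Xk k t \<omega>\<bar>\<^sup>2) \<le> ennreal (E * (1/2) ^ k)"
          using elim(2) that E(2)[of k] order_trans by blast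
        then have "\<bar>Xk (Suc k) t \<omega> - Xk k t \<omega>\<bar>\<^sup>2 \<le> E * (1/2) ^ k" using E(1) by (subst (asm) ennreal_le_iff) auto
        then show ?thesis by (rule real_le_rsqrt)
      qed
      then show ?case unfolding good_def using elim(1) E(1) by blast
    qed
  qed
  \<comment> \<open>The value 0 on the exceptional set makes every path continuous, as
    \<open>continuous_process\<close> demands; adaptedness survives because the exceptional set is
    null.\<close>
  define X where "X t \<omega> = (if good \<omega> then lim (\<lambda>k. Xk k t \<omega>) else 0)" for t \<omega>
  have unif: "uniform_limit {0..T} (\<lambda>k t. Xk k t \<omega>) (\<lambda>t. X t \<omega>) sequentially" if gd: "good \<omega>" for \<omega>
  proof -
    obtain E where E: "E \<ge> 0" "\<And>k t. t \<in> {0..T} \<Longrightarrow> \<bar>Xk (Suc k) t \<omega> - Xk k t \<omega>\<bar> \<le> sqrt (E * (1/2) ^ k)"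
      using gd unfolding good_def by blast
    have "uniform_limit {0..T} (\<lambda>n t. \<Sum>k<n. Xk (Suc k) t \<omega> - Xk k t \<omega>) (\<lambda>t. \<Sum>k. Xk (Suc k) t \<omega> - Xk k t \<omega>) sequentially"
      by (rule Weierstrass_m_test[OF _ summable_sqrt_geometric[of E]]) (use E(2) in auto)
    then have "uniform_limit {0..T} (\<lambda>n t. (\<Sum>k<n. Xk (Suc k) t \<omega> - Xk k t \<omega>) + Xk 0 t \<omega>)
       (\<lambda>t. (\<Sum>k. Xk (Suc k) t \<omega> - Xk k t \<omega>) + Xk 0 t \<omega>) sequentially"
      by (intro uniform_limit_intros)
    then have u: "uniform_limit {0..T} (\<lambda>n t. Xk n t \<omega>) (\<lambda>t. (\<Sum>k. Xk (Suc k) t \<omega> - Xk k t \<omega>) + Xk 0 t \<omega>) sequentially"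
      by (simp add: sum_lessThan_telescope[of "\<lambda>k. Xk k _ \<omega>"])
    have "X t \<omega> = (\<Sum>k. Xk (Suc k) t \<omega> - Xk k t \<omega>) + Xk 0 t \<omega>" if "t \<in> {0..T}" for t
      unfolding X_def using gd tendsto_uniform_limitI[OF u that] by (simp add: limI)
    then show ?thesis using u by (subst uniform_limit_cong'[of _ _ _ _ "\<lambda>t. (\<Sum>k. Xk (Suc k) t \<omega> - Xk k t \<omega>) + Xk 0 t \<omega>"]) auto
  qed
  have lim: "(\<lambda>k. Xk k t \<omega>) \<longlonglongrightarrow> X t \<omega>" if "good \<omega>" "t \<in> {0..T}" for \<omega> t
    by (rule tendsto_uniform_limitI[OF unif[OF that(1)] that(2)])
  have ad: "adapted_process F T X"
    unfolding adapted_process_def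
  proof
    fix t assume t: "t \<in> {0..T}"
    have "(\<lambda>\<omega>. lim (\<lambda>k. Xk k t \<omega>)) \<in> borel_measurable (F t)"
      by (rule borel_measurable_lim_metric) (rule simple_ito_adapted[OF si t])
    then show "X t \<in> borel_measurable (F t)"
    proof (rule measurable_F_cong_AE)
      show "AE \<omega> in M. lim (\<lambda>k. Xk k t \<omega>) = X t \<omega>" using good by eventually_elim (simp add: X_def)
    qed simp
  qed
  have cont: "continuous_process M T X"
    unfolding continuous_process_def
  proof
    fix \<omega> assume "\<omega> \<in> space M"
    show "continuous_on {0..T} (\<lambda>t. X t \<omega>)"
    proof (cases "good \<omega>")
      case True
      show ?thesis
        by (rule uniform_limit_theorem[OF _ unif[OF True]]) (use True in \<open>auto simp: good_def\<close>)
    qed (simp add: X_def)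
  qed
  have L2: "square_integrable M (X t) \<and> (\<lambda>k. l2_norm M (\<lambda>\<omega>. Xk k t \<omega> - X t \<omega>)) \<longlonglongrightarrow> 0" if t: "t \<in> {0..T}" for t
  proof -
    have sq: "square_integrable M (Xk k t)" for k by (rule simple_ito_square_integrable[OF si t])
    have sub: "subalgebra M M" by (simp add: subalgebra_def)
    obtain h where h: "h \<in> borel_measurable M" "square_integrable M h" "AE \<omega> in M. (\<lambda>k. Xk k t \<omega>) \<longlonglongrightarrow> h \<omega>"
      "(\<lambda>k. l2_norm M (\<lambda>\<omega>. Xk k t \<omega> - h \<omega>)) \<longlonglongrightarrow> 0"
      using Riesz_Fischer[OF sub square_integrableD(1)[OF sq] sq C leT[OF t]] by blast
    have ae: "AE \<omega> in M. h \<omega> = X t \<omega>"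
      using h(3) good by eventually_elim (use lim t LIMSEQ_unique in blast)
    have "X t \<in> borel_measurable (F t)" using ad t by (auto simp: adapted_process_def)
    then have Xm: "X t \<in> borel_measurable M" by (rule measurable_F_imp) (use t in simp)
    have X: "square_integrable M (X t)" by (rule square_integrable_cong_AE(1)[OF h(2) Xm ae])
    have "l2_norm M (\<lambda>\<omega>. Xk k t \<omega> - X t \<omega>) = l2_norm M (\<lambda>\<omega>. Xk k t \<omega> - h \<omega>)" for k
      by (rule square_integrable_cong_AE(2)[OF square_integrable_diff[OF sq h(2)]])
        (use ae square_integrableD(1)[OF sq] Xm in auto)
    then show ?thesis using X h(4) by simp
  qed
  have "has_ito_integral M F T B Z X"
    unfolding has_ito_integral_iff[OF Z] ito_approx_def using ad cont si limZ L2 by blast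
  with Z show thesis using that L2[OF T_in] by blast
qed

end

section \<open>Martingale representation\<close>

lemma l2_norm_dominated_convergence:
  fixes f :: "nat \<Rightarrow> 'a \<Rightarrow> 'b::euclidean_space"
  assumes "\<And>n. f n \<in> borel_measurable M" "h \<in> borel_measurable M" "square_integrable M g"
    and lim: "AE x in M. (\<lambda>n. f n x) \<longlonglongrightarrow> h x" and bd: "\<And>n. AE x in M. norm (f n x) \<le> norm (g x)"
  shows "square_integrable M h" "\<And>n. square_integrable M (f n)" "(\<lambda>n. l2_norm M (\<lambda>x. f n x - h x)) \<longlonglongrightarrow> 0"
proof -
  have hb: "AE x in M. norm (h x) \<le> norm (g x)"
  proof -
    have "AE x in M. \<forall>n. norm (f n x) \<le> norm (g x)" using bd by (simp add: AE_all_countable)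
    then show ?thesis using lim
    proof eventually_elim
      case (elim x)
      show ?case by (rule tendsto_upperbound[OF tendsto_norm[OF elim(2)]]) (use elim(1) in auto)
    qed
  qed
  show "square_integrable M h" by (rule square_integrable_bound(1)[OF assms(3,2) hb])
  show "square_integrable M (f n)" for n by (rule square_integrable_bound(1)[OF assms(3,1) bd])
  have "(\<lambda>n. \<integral>x. (norm (f n x - h x))\<^sup>2 \<partial>M) \<longlonglongrightarrow> (\<integral>x. 0 \<partial>M)"
  proof (rule integral_dominated_convergence)
    show "integrable M (\<lambda>x. 4 * (norm (g x))\<^sup>2)" using square_integrableD(2)[OF assms(3)] by simp
    show "AE x in M. (\<lambda>n. (norm (f n x - h x))\<^sup>2) \<longlonglongrightarrow> 0"
      using lim
    proof eventually_elim
      case (elim x)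
      have "(\<lambda>n. (norm (f n x - h x))\<^sup>2) \<longlonglongrightarrow> (norm (h x - h x))\<^sup>2" by (intro tendsto_intros elim)
      then show ?case by simp
    qed
    fix n
    show "AE x in M. norm ((norm (f n x - h x))\<^sup>2) \<le> 4 * (norm (g x))\<^sup>2"
      using bd[of n] hb
    proof eventually_elim
      case (elim x)
      have "norm (f n x - h x) \<le> 2 * norm (g x)" using norm_triangle_ineq4[of "f n x" "h x"] elim by linarith
      then have "(norm (f n x - h x))\<^sup>2 \<le> (2 * norm (g x))\<^sup>2" by (rule power_mono) simp
      then show ?case by (simp add: power_mult_distrib)
    qed
  qed (use assms in auto)
  then have "(\<lambda>n. (l2_norm M (\<lambda>x. f n x - h x))\<^sup>2) \<longlonglongrightarrow> 0" by (simp add: l2_norm_power2)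
  from tendsto_real_sqrt[OF this] show "(\<lambda>n. l2_norm M (\<lambda>x. f n x - h x)) \<longlonglongrightarrow> 0" by simp
qed

text \<open>The error splits into the Taylor remainder of \<open>iexp w\<close>, at most
  \<open>w\<^sup>2 / 2\<close> in norm, and the effect of the factor \<open>exp y\<close>;
  \<open>w ^ 4 / 2\<close> is twice the square of the former.\<close>

lemma norm_iexp_remainder:
  fixes w y :: real
  assumes "0 \<le> y"
  shows "(norm (iexp w * exp y - 1 - \<i> * w))\<^sup>2 \<le> w ^ 4 / 2 + 2 * (exp y - 1)\<^sup>2"
proof -
  have eq: "iexp w * exp y - 1 - \<i> * w = (iexp w - (1 + \<i> * w)) + iexp w * (exp y - 1)"
    by (simp add: algebra_simps)
  have 1: "norm (iexp w - (1 + \<i> * w)) \<le> w\<^sup>2 / 2"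
    using iexp_approx1[of w 1] by (simp add: numeral_2_eq_2)
  have "norm (iexp w * (complex_of_real (exp y) - 1)) = \<bar>exp y - 1\<bar>"
    using norm_of_real[of "exp y - 1", where 'a=complex] by (simp add: norm_mult)
  then have "(norm (iexp w * exp y - 1 - \<i> * w))\<^sup>2 \<le> 2 * (norm (iexp w - (1 + \<i> * w)))\<^sup>2 + 2 * (exp y - 1)\<^sup>2"
    unfolding eq using norm_add_squared_le[of "iexp w - (1 + \<i> * w)" "iexp w * (exp y - 1)"]
    by simp
  also have "(norm (iexp w - (1 + \<i> * w)))\<^sup>2 \<le> (w\<^sup>2 / 2)\<^sup>2"
    by (rule power_mono[OF 1]) simp
  finally show ?thesis by (simp add: power_divide)
qed

context brownian
begin

text \<open>Approximability by constants plus simple integrals, not yet a representation. The class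
  is a closed linear subspace of L2, which suits monotone class arguments; the integral itself is
  extracted at the end by completeness.\<close>

definition representable :: "('a \<Rightarrow> real) \<Rightarrow> bool" where
  "representable \<eta> \<longleftrightarrow> \<eta> \<in> borel_measurable (F T) \<and> square_integrable M \<eta> \<and>
     (\<forall>e>0. \<exists>c Z X. simple_ito Z X \<and> l2_norm M (\<lambda>\<omega>. \<eta> \<omega> - (c + X T \<omega>)) < e)"

lemma representableD:
  assumes "representable \<eta>"
  shows "\<eta> \<in> borel_measurable (F T)" "square_integrable M \<eta>" "\<eta> \<in> borel_measurable M"
  using assms square_integrableD(1) by (auto simp: representable_def)

lemma affine_ito_square_integrable:
  "simple_ito Z X \<Longrightarrow> square_integrable M (\<lambda>\<omega>. c + X T \<omega>)"
  by (intro square_integrable_add square_integrable_const simple_ito_isometry(1))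

lemma representable_closed:
  assumes "\<eta> \<in> borel_measurable (F T)" "square_integrable M \<eta>"
    and "\<And>e. e > 0 \<Longrightarrow> \<exists>\<eta>'. representable \<eta>' \<and> l2_norm M (\<lambda>\<omega>. \<eta> \<omega> - \<eta>' \<omega>) < e"
  shows "representable \<eta>"
  unfolding representable_def
proof (intro conjI allI impI assms(1,2))
  fix e :: real assume e: "e > 0"
  obtain \<eta>' where h: "representable \<eta>'" "l2_norm M (\<lambda>\<omega>. \<eta> \<omega> - \<eta>' \<omega>) < e / 2" using assms(3)[of "e/2"] e by auto
  obtain c Z X where X: "simple_ito Z X" "l2_norm M (\<lambda>\<omega>. \<eta>' \<omega> - (c + X T \<omega>)) < e / 2"
    using h(1) e unfolding representable_def by (meson half_gt_zero)
  have "l2_norm M (\<lambda>\<omega>. \<eta> \<omega> - (c + X T \<omega>)) < e"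
    using l2_norm_dist_triangle[OF assms(2) representableD(2)[OF h(1)] affine_ito_square_integrable[OF X(1)], of c] h(2) X(2)
    by linarith
  then show "\<exists>c Z X. simple_ito Z X \<and> l2_norm M (\<lambda>\<omega>. \<eta> \<omega> - (c + X T \<omega>)) < e" using X(1) by blast
qed

lemma representable_limit:
  assumes "\<And>n. representable (f n)" "\<eta> \<in> borel_measurable (F T)" "square_integrable M \<eta>"
    and "(\<lambda>n. l2_norm M (\<lambda>\<omega>. f n \<omega> - \<eta> \<omega>)) \<longlonglongrightarrow> 0"
  shows "representable \<eta>"
proof (rule representable_closed[OF assms(2,3)])
  fix e :: real assume "e > 0"
  then have "\<forall>\<^sub>F n in sequentially. l2_norm M (\<lambda>\<omega>. f n \<omega> - \<eta> \<omega>) < e"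
    by (rule order_tendstoD(2)[OF assms(4)])
  then obtain n where "l2_norm M (\<lambda>\<omega>. f n \<omega> - \<eta> \<omega>) < e" by (auto simp: eventually_sequentially)
  then show "\<exists>\<eta>'. representable \<eta>' \<and> l2_norm M (\<lambda>\<omega>. \<eta> \<omega> - \<eta>' \<omega>) < e"
    using assms(1) l2_norm_minus_commute[of M \<eta> "f n"] by (intro exI[of _ "f n"]) simp
qed

lemma representable_cong_AE:
  assumes "representable \<eta>" "AE \<omega> in M. \<eta> \<omega> = \<eta>' \<omega>"
  shows "representable \<eta>'"
proof -
  have m: "\<eta>' \<in> borel_measurable (F T)"
    by (rule measurable_F_cong_AE[OF representableD(1)[OF assms(1)] assms(2)]) simp
  have mM: "\<eta>' \<in> borel_measurable M" by (rule measurable_F_imp[OF m]) simp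
  have sq: "square_integrable M \<eta>'"
    by (rule square_integrable_cong_AE(1)[OF representableD(2)[OF assms(1)] mM assms(2)])
  show ?thesis
  proof (rule representable_limit[of "\<lambda>_. \<eta>", OF assms(1) m sq])
    have "l2_norm M (\<lambda>\<omega>. \<eta> \<omega> - \<eta>' \<omega>) = 0"
      using l2_norm_eq_0_iff[OF square_integrable_diff[OF representableD(2)[OF assms(1)] sq]] assms(2) by simp
    then show "(\<lambda>n. l2_norm M (\<lambda>\<omega>. \<eta> \<omega> - \<eta>' \<omega>)) \<longlonglongrightarrow> 0" by simp
  qed
qed

lemma representable_add:
  assumes "representable \<eta>" "representable \<eta>'"
  shows "representable (\<lambda>\<omega>. \<eta> \<omega> + \<eta>' \<omega>)"
  unfolding representable_def
proof (intro conjI allI impI)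
  show "(\<lambda>\<omega>. \<eta> \<omega> + \<eta>' \<omega>) \<in> borel_measurable (F T)"
    using assms by (intro borel_measurable_add representableD)
  show "square_integrable M (\<lambda>\<omega>. \<eta> \<omega> + \<eta>' \<omega>)" using assms by (intro square_integrable_add representableD)
  fix e :: real assume e: "e > 0"
  obtain c Z X where X: "simple_ito Z X" "l2_norm M (\<lambda>\<omega>. \<eta> \<omega> - (c + X T \<omega>)) < e / 2"
    using assms(1) e unfolding representable_def by (meson half_gt_zero)
  obtain c' Z' X' where X': "simple_ito Z' X'" "l2_norm M (\<lambda>\<omega>. \<eta>' \<omega> - (c' + X' T \<omega>)) < e / 2"
    using assms(2) e unfolding representable_def by (meson half_gt_zero)
  have "l2_norm M (\<lambda>\<omega>. (\<eta> \<omega> - (c + X T \<omega>)) + (\<eta>' \<omega> - (c' + X' T \<omega>))) < e"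
    using l2_norm_triangle[OF square_integrable_diff[OF representableD(2)[OF assms(1)] affine_ito_square_integrable[OF X(1)]]
        square_integrable_diff[OF representableD(2)[OF assms(2)] affine_ito_square_integrable[OF X'(1)]], of c c'] X(2) X'(2)
    by linarith
  then have "l2_norm M (\<lambda>\<omega>. \<eta> \<omega> + \<eta>' \<omega> - ((c + c') + (X T \<omega> + X' T \<omega>))) < e" by (simp add: algebra_simps)
  then show "\<exists>c Z X. simple_ito Z X \<and> l2_norm M (\<lambda>\<omega>. \<eta> \<omega> + \<eta>' \<omega> - (c + X T \<omega>)) < e"
    using simple_ito_add[OF X(1) X'(1)] by (intro exI[of _ "c + c'"] exI conjI)
qed

lemma representable_cmult:
  assumes "representable \<eta>"
  shows "representable (\<lambda>\<omega>. a * \<eta> \<omega>)"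
  unfolding representable_def
proof (intro conjI allI impI)
  show "(\<lambda>\<omega>. a * \<eta> \<omega>) \<in> borel_measurable (F T)"
    using representableD(1)[OF assms] by measurable
  show "square_integrable M (\<lambda>\<omega>. a * \<eta> \<omega>)" by (rule square_integrable_cmult(1)[OF representableD(2)[OF assms]])
  fix e :: real assume e: "e > 0"
  then have "e / (\<bar>a\<bar> + 1) > 0" by (simp add: add_nonneg_pos)
  then obtain c Z X where X: "simple_ito Z X" "l2_norm M (\<lambda>\<omega>. \<eta> \<omega> - (c + X T \<omega>)) < e / (\<bar>a\<bar> + 1)"
    using assms unfolding representable_def by meson
  have "l2_norm M (\<lambda>\<omega>. a * (\<eta> \<omega> - (c + X T \<omega>))) = \<bar>a\<bar> * l2_norm M (\<lambda>\<omega>. \<eta> \<omega> - (c + X T \<omega>))"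
    by (rule square_integrable_cmult(2)[OF square_integrable_diff[OF representableD(2)[OF assms] affine_ito_square_integrable[OF X(1)]]])
  also have "\<dots> \<le> \<bar>a\<bar> * (e / (\<bar>a\<bar> + 1))" using X(2) by (intro mult_left_mono) auto
  also have "\<dots> < e" using e by (simp add: field_simps add_nonneg_pos)
  finally have "l2_norm M (\<lambda>\<omega>. a * \<eta> \<omega> - (a * c + a * X T \<omega>)) < e" by (simp add: algebra_simps)
  then show "\<exists>c Z X. simple_ito Z X \<and> l2_norm M (\<lambda>\<omega>. a * \<eta> \<omega> - (c + X T \<omega>)) < e"
    using simple_ito_scale[OF X(1), of a] by (intro exI[of _ "a * c"] exI conjI)
qed

lemma representable_const: "representable (\<lambda>\<omega>. c)"
  unfolding representable_def using simple_ito_zero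
  by (auto intro!: exI[of _ c] exI[of _ "\<lambda>t \<omega>. 0"] simp: l2_norm_def)

lemma representable_simple_ito: "simple_ito Z X \<Longrightarrow> representable (X T)"
  unfolding representable_def using simple_ito_adapted[OF _ T_in] simple_ito_isometry(1)
  by (auto intro!: exI[of _ 0] exI[of _ X] simp: l2_norm_def)

lemma representable_sum:
  assumes "\<And>i. i \<in> I \<Longrightarrow> representable (f i)" "finite I"
  shows "representable (\<lambda>\<omega>. \<Sum>i\<in>I. f i \<omega>)"
  using assms(2,1) by induction (auto intro: representable_const representable_add)

text \<open>Integrands and integrals are real, but exponentials multiply well only over the complex
  numbers; the class is tested on real and imaginary parts.\<close>

definition complex_representable :: "('a \<Rightarrow> complex) \<Rightarrow> bool" where
  "complex_representable \<zeta> \<longleftrightarrow> representable (\<lambda>\<omega>. Re (\<zeta> \<omega>)) \<and> representable (\<lambda>\<omega>. Im (\<zeta> \<omega>))"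

lemma complex_representable_add:
  "complex_representable f \<Longrightarrow> complex_representable g \<Longrightarrow> complex_representable (\<lambda>\<omega>. f \<omega> + g \<omega>)"
  by (auto simp: complex_representable_def intro: representable_add)

lemma complex_representable_cmult:
  assumes "complex_representable f" shows "complex_representable (\<lambda>\<omega>. c * f \<omega>)"
proof -
  have 1: "representable (\<lambda>\<omega>. Re c * Re (f \<omega>) + (- Im c) * Im (f \<omega>))"
    "representable (\<lambda>\<omega>. Re c * Im (f \<omega>) + Im c * Re (f \<omega>))"
    using assms unfolding complex_representable_def by (intro representable_add representable_cmult; simp)+
  then show ?thesis by (simp add: complex_representable_def)
qed

lemma complex_representable_of_real: "representable f \<Longrightarrow> complex_representable (\<lambda>\<omega>. of_real (f \<omega>))"
  by (simp add: complex_representable_def representable_const)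

lemma complex_representable_sum:
  assumes "\<And>i. i \<in> I \<Longrightarrow> complex_representable (f i)" "finite I"
  shows "complex_representable (\<lambda>\<omega>. \<Sum>i\<in>I. f i \<omega>)"
  using assms by (auto simp: complex_representable_def intro!: representable_sum)

lemma complex_representable_cong_AE:
  assumes "complex_representable f" "AE \<omega> in M. f \<omega> = g \<omega>"
  shows "complex_representable g"
  using assms unfolding complex_representable_def by (auto intro: representable_cong_AE)

lemma complex_representable_limit:
  assumes f: "\<And>n. complex_representable (f n)" and h: "h \<in> borel_measurable (F T)" "square_integrable M h"
    and lim: "(\<lambda>n. l2_norm M (\<lambda>\<omega>. f n \<omega> - h \<omega>)) \<longlonglongrightarrow> 0"
  shows "complex_representable h"
proof -
  have Re: "representable (\<lambda>\<omega>. Re (f n \<omega>))" and Im: "representable (\<lambda>\<omega>. Im (f n \<omega>))" for n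
    using f by (auto simp: complex_representable_def)
  have fm: "f n \<in> borel_measurable M" for n
    unfolding borel_measurable_complex_iff using Re Im representableD(3) by blast
  have fsq: "square_integrable M (f n)" for n
  proof -
    have "square_integrable M (\<lambda>\<omega>. complex_of_real (Re (f n \<omega>)) + \<i> * complex_of_real (Im (f n \<omega>)))"
      by (rule square_integrable_add)
        (use representableD(2,3)[OF Re[of n]] representableD(2,3)[OF Im[of n]] fm
          in \<open>auto simp: square_integrable_def norm_mult\<close>)
    then show ?thesis by (simp add: complex_eq[symmetric])
  qed
  note dsq = square_integrable_diff[OF fsq h(2)]
  have hm: "h \<in> borel_measurable M" by (rule measurable_F_imp[OF h(1)]) simp
  have part: "representable (\<lambda>\<omega>. p (h \<omega>))" if p: "\<And>n. representable (\<lambda>\<omega>. p (f n \<omega>))" and "bounded_linear p" "\<And>z. \<bar>p z\<bar> \<le> norm z"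
    for p :: "complex \<Rightarrow> real"
  proof (rule representable_limit[of "\<lambda>n \<omega>. p (f n \<omega>)"])
    have pm: "p \<in> borel_measurable borel"
      by (rule borel_measurable_continuous_onI[OF linear_continuous_on[OF that(2)]])
    show "(\<lambda>\<omega>. p (h \<omega>)) \<in> borel_measurable (F T)" by (rule measurable_compose[OF h(1) pm])
    show "square_integrable M (\<lambda>\<omega>. p (h \<omega>))"
      by (rule square_integrable_bound(1)[OF h(2)]) (use measurable_compose[OF hm pm] that(3) in auto)
    have "l2_norm M (\<lambda>\<omega>. p (f n \<omega>) - p (h \<omega>)) \<le> l2_norm M (\<lambda>\<omega>. f n \<omega> - h \<omega>)" for n
    proof (rule square_integrable_bound(2)[OF dsq])
      show "(\<lambda>\<omega>. p (f n \<omega>) - p (h \<omega>)) \<in> borel_measurable M"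
        using measurable_compose[OF hm pm] measurable_compose[OF fm pm] by measurable
      show "AE \<omega> in M. norm (p (f n \<omega>) - p (h \<omega>)) \<le> norm (f n \<omega> - h \<omega>)"
        using that(3)[of "f n _ - h _"] by (simp add: linear_diff[OF bounded_linear.linear[OF that(2)]])
    qed
    then show "(\<lambda>n. l2_norm M (\<lambda>\<omega>. p (f n \<omega>) - p (h \<omega>))) \<longlonglongrightarrow> 0"
      by (intro Lim_null_comparison[OF _ lim]) simp
  qed (rule p)
  show ?thesis unfolding complex_representable_def
    using part[OF Re bounded_linear_Re abs_Re_le_cmod] part[OF Im bounded_linear_Im abs_Im_le_cmod] by blast
qed

section \<open>Exponentials of Brownian increments\<close>

text \<open>A term consisting of a bounded past factor times a centred function of the next
  increment is orthogonal to the past, so squared norms add. Consequently n remainders of squared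
  norm 1/n^2 sum to squared norm 1/n, where the triangle inequality would give no decay.\<close>

lemma orthogonal_step:
  fixes S H :: "'a \<Rightarrow> complex" and h :: "real ^ 'd \<Rightarrow> complex"
  assumes s: "0 \<le> s" "s < t" "t \<le> T" and S: "S \<in> borel_measurable (F s)" "square_integrable M S"
    and H: "H \<in> borel_measurable (F s)" "\<And>\<omega>. \<omega> \<in> space M \<Longrightarrow> norm (H \<omega>) \<le> C"
    and h: "h \<in> borel_measurable borel" "square_integrable M (\<lambda>\<omega>. h (B t \<omega> - B s \<omega>))"
      "(\<integral>\<omega>. h (B t \<omega> - B s \<omega>) \<partial>M) = 0" "(\<integral>\<omega>. (norm (h (B t \<omega> - B s \<omega>)))\<^sup>2 \<partial>M) \<le> \<rho>"
  shows "square_integrable M (\<lambda>\<omega>. S \<omega> + H \<omega> * h (B t \<omega> - B s \<omega>))"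
    "(l2_norm M (\<lambda>\<omega>. S \<omega> + H \<omega> * h (B t \<omega> - B s \<omega>)))\<^sup>2 \<le> (l2_norm M S)\<^sup>2 + C\<^sup>2 * \<rho>"
proof -
  let ?R = "\<lambda>\<omega>. h (B t \<omega> - B s \<omega>)"
  have C: "norm (H \<omega>) \<le> \<bar>C\<bar>" if "\<omega> \<in> space M" for \<omega> using H(2)[OF that] by simp
  have HM: "H \<in> borel_measurable M" by (rule measurable_F_imp[OF H(1)]) (use s in simp)
  have Rm: "?R \<in> borel_measurable M" using square_integrableD(1)[OF h(2)] .
  have HRm: "(\<lambda>\<omega>. H \<omega> * ?R \<omega>) \<in> borel_measurable M" using HM Rm by measurable
  have HRb: "AE \<omega> in M. norm (H \<omega> * ?R \<omega>) \<le> norm (C *\<^sub>R ?R \<omega>)"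
    using C by (auto simp: norm_mult intro!: mult_right_mono)
  have HR: "square_integrable M (\<lambda>\<omega>. H \<omega> * ?R \<omega>)"
    by (rule square_integrable_bound(1)[OF square_integrable_scaleR(1)[OF h(2)] HRm HRb])
  show "square_integrable M (\<lambda>\<omega>. S \<omega> + H \<omega> * ?R \<omega>)" by (rule square_integrable_add[OF S(2) HR])
  have "l2_norm M (\<lambda>\<omega>. H \<omega> * ?R \<omega>) \<le> \<bar>C\<bar> * l2_norm M ?R"
    using square_integrable_bound(2)[OF square_integrable_scaleR(1)[OF h(2)] HRm HRb] square_integrable_scaleR(2)[OF h(2)]
    by simp
  then have "(l2_norm M (\<lambda>\<omega>. H \<omega> * ?R \<omega>))\<^sup>2 \<le> (\<bar>C\<bar> * l2_norm M ?R)\<^sup>2" by (rule power_mono) simp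
  also have "\<dots> = C\<^sup>2 * (\<integral>\<omega>. (norm (?R \<omega>))\<^sup>2 \<partial>M)" by (simp add: power_mult_distrib l2_norm_power2)
  also have "\<dots> \<le> C\<^sup>2 * \<rho>" using h(4) by (rule mult_left_mono) simp
  finally have le: "(l2_norm M (\<lambda>\<omega>. H \<omega> * ?R \<omega>))\<^sup>2 \<le> C\<^sup>2 * \<rho>" .
  have cnj: "cnj \<in> borel_measurable borel"
    by (intro borel_measurable_continuous_onI continuous_on_cnj continuous_on_id)
  have Gm: "(\<lambda>\<omega>. S \<omega> * cnj (H \<omega>)) \<in> borel_measurable (F s)"
    using S(1) measurable_compose[OF H(1) cnj] by (rule borel_measurable_times)
  have GM: "(\<lambda>\<omega>. S \<omega> * cnj (H \<omega>)) \<in> borel_measurable M" by (rule measurable_F_imp[OF Gm]) (use s in simp)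
  have "square_integrable M (\<lambda>\<omega>. S \<omega> * cnj (H \<omega>))"
    by (rule square_integrable_bound(1)[OF square_integrable_scaleR(1)[OF S(2), of C] GM])
      (use C in \<open>auto simp: norm_mult mult.commute intro!: mult_right_mono\<close>)
  then have Gi: "integrable M (\<lambda>\<omega>. S \<omega> * cnj (H \<omega>))" by (rule square_integrable_integrable)
  have hc: "(\<lambda>x. cnj (h x)) \<in> borel_measurable borel" by (rule measurable_compose[OF h(1) cnj])
  have Ri: "integrable M ?R" by (rule square_integrable_integrable[OF h(2)])
  have Rci: "integrable M (\<lambda>\<omega>. cnj (?R \<omega>))" using Ri by simp
  note E = expectation_mult_increment[OF s Gm hc Gi Rci]
  \<comment> \<open>The real inner product of complex numbers is the real part of one times the
    conjugate of the other; in this form the past factor and the increment separate.\<close>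
  have "(\<integral>\<omega>. S \<omega> \<bullet> (H \<omega> * ?R \<omega>) \<partial>M) = (\<integral>\<omega>. Re (S \<omega> * cnj (H \<omega>) * cnj (?R \<omega>)) \<partial>M)"
    by (rule Bochner_Integration.integral_cong) (auto simp: inner_complex_def algebra_simps)
  also have "\<dots> = Re (\<integral>\<omega>. S \<omega> * cnj (H \<omega>) * cnj (?R \<omega>) \<partial>M)" by (rule integral_Re[OF E(1)])
  also have "\<dots> = 0" unfolding E(2) using h(3) by simp
  finally have "(\<integral>\<omega>. S \<omega> \<bullet> (H \<omega> * ?R \<omega>) \<partial>M) = 0" .
  then show "(l2_norm M (\<lambda>\<omega>. S \<omega> + H \<omega> * ?R \<omega>))\<^sup>2 \<le> (l2_norm M S)\<^sup>2 + C\<^sup>2 * \<rho>"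
    using l2_norm_add_power2[OF S(2) HR] le by simp
qed

text \<open>The factor \<open>exp y\<close> is the reciprocal of the mean of the exponential, so
  \<open>h\<close> is centred. The term \<open>6 * y\<^sup>2\<close> is half the fourth moment
  \<open>3 * (2 * y)\<^sup>2\<close>, as \<open>2 * y\<close> is the variance of the
  projection.\<close>

lemma exp_increment_remainder:
  fixes l :: "real ^ 'd"
  assumes s: "0 \<le> s" "s < t" "t \<le> T"
  defines "y \<equiv> (norm l)\<^sup>2 * (t - s) / 2"
  defines "h \<equiv> \<lambda>x::real^'d. iexp (l \<bullet> x) * exp y - 1 - \<i> * (l \<bullet> x)"
  shows "h \<in> borel_measurable borel" "square_integrable M (\<lambda>\<omega>. h (B t \<omega> - B s \<omega>))"
    "(\<integral>\<omega>. h (B t \<omega> - B s \<omega>) \<partial>M) = 0"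
    "(\<integral>\<omega>. (norm (h (B t \<omega> - B s \<omega>)))\<^sup>2 \<partial>M) \<le> 6 * y\<^sup>2 + 2 * (exp y - 1)\<^sup>2"
proof -
  let ?D = "\<lambda>\<omega>. B t \<omega> - B s \<omega>"
  have y: "0 \<le> y" using s by (simp add: y_def)
  show hm [measurable]: "h \<in> borel_measurable borel" unfolding h_def by measurable
  have Dm [measurable]: "?D \<in> borel_measurable M" using square_integrableD(1)[OF increment_square_integrable[OF s]] .
  have b: "(norm (h x))\<^sup>2 \<le> (l \<bullet> x) ^ 4 / 2 + 2 * (exp y - 1)\<^sup>2" for x
    using norm_iexp_remainder[OF y, of "l \<bullet> x"] by (simp add: h_def)
  have i4: "integrable M (\<lambda>\<omega>. (l \<bullet> ?D \<omega>) ^ 4 / 2 + 2 * (exp y - 1)\<^sup>2)"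
    using increment_moment(1)[OF s, of l 4] by simp
  have i2: "integrable M (\<lambda>\<omega>. (norm (h (?D \<omega>)))\<^sup>2)"
    by (rule Bochner_Integration.integrable_bound[OF i4]) (use b in \<open>auto intro: order_trans[OF b abs_ge_self]\<close>)
  then show "square_integrable M (\<lambda>\<omega>. h (?D \<omega>))" by (simp add: square_integrable_def)
  have "(\<integral>\<omega>. (norm (h (?D \<omega>)))\<^sup>2 \<partial>M) \<le> (\<integral>\<omega>. (l \<bullet> ?D \<omega>) ^ 4 / 2 + 2 * (exp y - 1)\<^sup>2 \<partial>M)"
    by (rule integral_mono[OF i2 i4 b])
  also have "\<dots> = (\<integral>\<omega>. (l \<bullet> ?D \<omega>) ^ 4 \<partial>M) / 2 + 2 * (exp y - 1)\<^sup>2"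
    using increment_moment(1)[OF s, of l 4] by (simp add: prob_space)
  also have "\<dots> = 6 * y\<^sup>2 + 2 * (exp y - 1)\<^sup>2"
    unfolding increment_moment(4)[OF s] by (simp add: y_def power_divide)
  finally show "(\<integral>\<omega>. (norm (h (?D \<omega>)))\<^sup>2 \<partial>M) \<le> 6 * y\<^sup>2 + 2 * (exp y - 1)\<^sup>2" .
  have j1: "integrable M (\<lambda>\<omega>. iexp (l \<bullet> ?D \<omega>))" by (rule integrable_const_bound[of _ 1]) auto
  have j2: "integrable M (\<lambda>\<omega>. complex_of_real (l \<bullet> ?D \<omega>))" using increment_moment(1)[OF s, of l 1] by simp
  have "(\<integral>\<omega>. h (?D \<omega>) \<partial>M) = (\<integral>\<omega>. iexp (l \<bullet> ?D \<omega>) \<partial>M) * exp y - 1 - \<i> * complex_of_real (\<integral>\<omega>. l \<bullet> ?D \<omega> \<partial>M)"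
    unfolding h_def using j1 j2 by (simp add: prob_space)
  also have "\<dots> = complex_of_real (exp (- y) * exp y) - 1"
    unfolding char_increment[OF s] increment_moment(2)[OF s] by (simp add: y_def mult.commute)
  also have "\<dots> = 0" by (simp add: exp_minus_inverse mult.commute)
  finally show "(\<integral>\<omega>. h (?D \<omega>) \<partial>M) = 0" .
qed

text \<open>The real and imaginary parts are simple integrals over the single cell from s to t, with
  coefficients \<open>- Im H\<close> and \<open>Re H\<close> times \<open>l\<close>.\<close>

lemma complex_representable_increment:
  assumes s: "0 \<le> s" "s < t" "t \<le> T" and H: "H \<in> borel_measurable (F s)" "\<And>\<omega>. \<omega> \<in> space M \<Longrightarrow> norm (H \<omega>) \<le> C"
  shows "complex_representable (\<lambda>\<omega>. H \<omega> * (\<i> * (l \<bullet> (B t \<omega> - B s \<omega>))))"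
proof -
  have rep: "representable (\<lambda>\<omega>. p \<omega> * (l \<bullet> (B t \<omega> - B s \<omega>)))"
    if p: "p \<in> borel_measurable (F s)" "\<And>\<omega>. \<omega> \<in> space M \<Longrightarrow> \<bar>p \<omega>\<bar> \<le> C" for p
  proof -
    have "representable (\<lambda>\<omega>. (p \<omega> *\<^sub>R l) \<bullet> (B (min t T) \<omega> - B (min s T) \<omega>))"
      by (rule representable_simple_ito[OF simple_ito_elem[OF s, of _ "C * norm l"]])
        (use p in \<open>auto intro!: mult_right_mono\<close>)
    then show ?thesis using s by (simp add: min_absorb1)
  qed
  have "representable (\<lambda>\<omega>. (- Im (H \<omega>)) * (l \<bullet> (B t \<omega> - B s \<omega>)))"
    "representable (\<lambda>\<omega>. Re (H \<omega>) * (l \<bullet> (B t \<omega> - B s \<omega>)))"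
    by (rule rep; use H abs_Re_le_cmod abs_Im_le_cmod order_trans in \<open>fastforce intro: borel_measurable_uminus\<close>)+
  then show ?thesis by (simp add: complex_representable_def)
qed

text \<open>With n + 1 equal steps, \<open>E n k\<close> is the exponential normalised to a discrete
  martingale. Its increment is \<open>E n k\<close> times \<open>\<i> * (l \<bullet> d n k)\<close>,
  a simple integral after multiplication by \<open>G\<close>, plus \<open>E n k\<close> times the
  centred remainder \<open>h n\<close>. The remainders are orthogonal with squared norms of order
  1/n^2, so their sum vanishes in L2 and only integrals survive.\<close>

lemma complex_representable_mult_exp_increment:
  assumes s: "0 \<le> s" "s < t" "t \<le> T" and G: "G \<in> borel_measurable (F s)" "\<And>\<omega>. \<omega> \<in> space M \<Longrightarrow> norm (G \<omega>) \<le> C"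
    and rep: "complex_representable G"
  shows "complex_representable (\<lambda>\<omega>. G \<omega> * iexp (l \<bullet> (B t \<omega> - B s \<omega>)))"
proof -
  define D where "D = t - s"
  define v where "v = (norm l)\<^sup>2"
  define \<delta> where "\<delta> n = D / real (Suc n)" for n
  define r where "r n k = s + real k * \<delta> n" for n k
  define y where "y n = v * \<delta> n / 2" for n
  define E where "E n k \<omega> = iexp (l \<bullet> (B (r n k) \<omega> - B s \<omega>)) * exp (real k * y n)" for n k \<omega>
  define H where "H n k \<omega> = G \<omega> * E n k \<omega>" for n k \<omega>
  define h where "h n x = iexp (l \<bullet> x) * exp (y n) - 1 - \<i> * (l \<bullet> x)" for n and x :: "real^'d"
  define d where "d n k \<omega> = B (r n (Suc k)) \<omega> - B (r n k) \<omega>" for n k \<omega>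
  define \<rho> where "\<rho> n = 6 * (y n)\<^sup>2 + 2 * (exp (y n) - 1)\<^sup>2" for n
  \<comment> \<open>A bound for all coefficients \<open>H n k\<close>, uniform in the mesh: the
    normalising factor never exceeds its terminal value.\<close>
  define C' where "C' = \<bar>C\<bar> * exp (v * D / 2)"
  have D: "D > 0" using s by (simp add: D_def)
  have \<delta>: "\<delta> n > 0" "real (Suc n) * \<delta> n = D" for n using D by (simp_all add: \<delta>_def del: of_nat_Suc)
  have y0: "y n \<ge> 0" for n using \<delta>(1)[of n] by (simp add: y_def v_def)
  have rn: "r n 0 = s" "r n (Suc n) = t" for n using \<delta>(2)[of n] by (simp_all add: r_def D_def del: of_nat_Suc)
  have r0: "s \<le> r n k" for n k using \<delta>(1)[of n] by (simp add: r_def)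
  have rlt: "r n k < r n (Suc k)" for n k using \<delta>(1)[of n] by (simp add: r_def distrib_right)
  have kD: "real k * \<delta> n \<le> D" if "k \<le> Suc n" for n k
    using mult_right_mono[of "real k" "real (Suc n)" "\<delta> n"] \<delta>[of n] that by (simp del: of_nat_Suc)
  have rT: "r n k \<le> T" if "k \<le> Suc n" for n k
    using kD[OF that] s by (simp add: r_def D_def)
  have rs: "0 \<le> r n k" for n k using r0[of n k] s by linarith
  have Hm: "H n k \<in> borel_measurable (F (r n k))" if "k \<le> Suc n" for n k
  proof -
    have [measurable]: "G \<in> borel_measurable (F (r n k))" by (rule measurable_F_mono[OF G(1) r0])
    have [measurable]: "B (r n k) \<in> borel_measurable (F (r n k))" "B s \<in> borel_measurable (F (r n k))"
      using rs r0 s by (auto intro!: B_measurable_F)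
    show ?thesis unfolding H_def E_def by measurable
  qed
  have Hb: "norm (H n k \<omega>) \<le> C'" if "k \<le> Suc n" "\<omega> \<in> space M" for n k \<omega>
  proof -
    have "real k * y n = v * (real k * \<delta> n) / 2" by (simp add: y_def)
    also have "\<dots> \<le> v * D / 2" using kD[OF that(1)] by (simp add: v_def mult_left_mono)
    finally have e: "exp (real k * y n) \<le> exp (v * D / 2)" by simp
    have "norm (H n k \<omega>) = norm (G \<omega>) * exp (real k * y n)"
      by (simp add: H_def E_def norm_mult)
    also have "\<dots> \<le> \<bar>C\<bar> * exp (v * D / 2)" using G(2)[OF that(2)] e by (intro mult_mono) auto
    finally show ?thesis by (simp add: C'_def)
  qed
  have step: "0 \<le> r n k" "r n k < r n (Suc k)" "r n (Suc k) \<le> T" if "k < Suc n" for n k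
    using rs rlt rT[of "Suc k" n] that by auto
  have diff: "r n (Suc k) - r n k = \<delta> n" for n k by (simp add: r_def distrib_right)
  have yn: "y n = (norm l)\<^sup>2 * (r n (Suc k) - r n k) / 2" for n k by (simp add: diff y_def v_def)
  have hk: "h n \<in> borel_measurable borel" "square_integrable M (\<lambda>\<omega>. h n (d n k \<omega>))"
    "(\<integral>\<omega>. h n (d n k \<omega>) \<partial>M) = 0" "(\<integral>\<omega>. (norm (h n (d n k \<omega>)))\<^sup>2 \<partial>M) \<le> \<rho> n" if "k < Suc n" for n k
    using exp_increment_remainder[OF step[OF that], of l, folded yn] unfolding d_def h_def[abs_def] \<rho>_def by auto
  \<comment> \<open>The accumulated remainder. The induction runs over partial sums because
    orthogonality of the next term uses measurability at \<open>r n m\<close>.\<close>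
  define e where "e n m \<omega> = (\<Sum>k<m. H n k \<omega> * h n (d n k \<omega>))" for n m \<omega>
  have e: "e n m \<in> borel_measurable (F (r n m)) \<and> square_integrable M (e n m) \<and> (l2_norm M (e n m))\<^sup>2 \<le> real m * (C'\<^sup>2 * \<rho> n)"
    if "m \<le> Suc n" for n m
    using that
  proof (induction m)
    case 0
    have "e n 0 = (\<lambda>\<omega>. 0)" by (simp add: e_def fun_eq_iff)
    then show ?case by (simp add: l2_norm_def)
  next
    case (Suc m)
    then have m: "m < Suc n" "m \<le> Suc n" by auto
    note IH = Suc.IH[OF m(2)]
    have eq: "e n (Suc m) = (\<lambda>\<omega>. e n m \<omega> + H n m \<omega> * h n (B (r n (Suc m)) \<omega> - B (r n m) \<omega>))"
      by (simp add: e_def d_def fun_eq_iff)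
    have meas: "e n (Suc m) \<in> borel_measurable (F (r n (Suc m)))"
    proof -
      have le: "r n m \<le> r n (Suc m)" using rlt[of n m] by simp
      have [measurable]: "e n m \<in> borel_measurable (F (r n (Suc m)))" "H n m \<in> borel_measurable (F (r n (Suc m)))"
        using measurable_F_mono[OF conjunct1[OF IH] le] measurable_F_mono[OF Hm[OF m(2)] le] by auto
      have [measurable]: "B (r n (Suc m)) \<in> borel_measurable (F (r n (Suc m)))" "B (r n m) \<in> borel_measurable (F (r n (Suc m)))"
        using rs le by (auto intro!: B_measurable_F)
      have [measurable]: "h n \<in> borel_measurable borel" by (rule hk(1)[OF m(1)])
      show ?thesis unfolding eq by measurable
    qed
    note O = orthogonal_step[OF step[OF m(1)] conjunct1[OF IH] conjunct1[OF conjunct2[OF IH]] Hm[OF m(2)] Hb[OF m(2)]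
        hk(1)[OF m(1)] hk(2-4)[OF m(1), unfolded d_def], folded eq]
    have "(l2_norm M (e n (Suc m)))\<^sup>2 \<le> real m * (C'\<^sup>2 * \<rho> n) + C'\<^sup>2 * \<rho> n"
      using O(2) IH by linarith
    then show ?case using meas O(1) by (simp add: algebra_simps)
  qed
  \<comment> \<open>\<open>E n\<close> is telescoped from \<open>E n 0 = 1\<close> to its terminal
    value, which is the same for every n, so the left side can serve as the limit.\<close>
  have tele: "G \<omega> * iexp (l \<bullet> (B t \<omega> - B s \<omega>)) * exp (v * D / 2)
      = (G \<omega> + (\<Sum>k<Suc n. H n k \<omega> * (\<i> * (l \<bullet> d n k \<omega>)))) + e n (Suc n) \<omega>" for n \<omega>
  proof -
    have E0: "E n 0 \<omega> = 1" by (simp add: E_def rn)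
    have ES: "E n (Suc k) \<omega> - E n k \<omega> = E n k \<omega> * (\<i> * (l \<bullet> d n k \<omega>)) + E n k \<omega> * h n (d n k \<omega>)" for k
    proof -
      have "E n (Suc k) \<omega> = E n k \<omega> * (iexp (l \<bullet> d n k \<omega>) * exp (y n))"
      proof -
        have "l \<bullet> (B (r n (Suc k)) \<omega> - B s \<omega>) = l \<bullet> (B (r n k) \<omega> - B s \<omega>) + l \<bullet> d n k \<omega>"
          by (simp add: d_def inner_diff_right)
        moreover have "real (Suc k) * y n = real k * y n + y n" by (simp add: distrib_right)
        ultimately show ?thesis
          unfolding E_def by (simp only: of_real_add distrib_left exp_add of_real_mult mult_ac)
      qed
      then show ?thesis by (simp add: h_def algebra_simps)
    qed
    have "(\<Sum>k<Suc n. E n (Suc k) \<omega> - E n k \<omega>) = E n (Suc n) \<omega> - E n 0 \<omega>"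
      by (rule sum_lessThan_telescope)
    then have "E n (Suc n) \<omega> = 1 + (\<Sum>k<Suc n. E n (Suc k) \<omega> - E n k \<omega>)"
      unfolding E0 eq_diff_eq by (metis add.commute)
    also have "\<dots> = 1 + (\<Sum>k<Suc n. E n k \<omega> * (\<i> * (l \<bullet> d n k \<omega>))) + (\<Sum>k<Suc n. E n k \<omega> * h n (d n k \<omega>))"
      by (simp only: ES sum.distrib add.assoc)
    finally have "G \<omega> * E n (Suc n) \<omega>
      = G \<omega> * (1 + (\<Sum>k<Suc n. E n k \<omega> * (\<i> * (l \<bullet> d n k \<omega>))) + (\<Sum>k<Suc n. E n k \<omega> * h n (d n k \<omega>)))" by (simp only:)
    also have "\<dots> = (G \<omega> + (\<Sum>k<Suc n. H n k \<omega> * (\<i> * (l \<bullet> d n k \<omega>)))) + e n (Suc n) \<omega>"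
      unfolding e_def H_def distrib_left sum_distrib_left by (simp only: mult.assoc mult_1_right)
    finally have "G \<omega> * E n (Suc n) \<omega> = (G \<omega> + (\<Sum>k<Suc n. H n k \<omega> * (\<i> * (l \<bullet> d n k \<omega>)))) + e n (Suc n) \<omega>" .
    moreover have "E n (Suc n) \<omega> = iexp (l \<bullet> (B t \<omega> - B s \<omega>)) * exp (v * D / 2)"
    proof -
      have "real (Suc n) * y n = v * D / 2" using \<delta>(2)[of n] by (simp add: y_def del: of_nat_Suc)
      then show ?thesis by (simp add: E_def rn del: of_nat_Suc)
    qed
    ultimately show ?thesis by (simp add: mult.assoc)
  qed
  define f where "f n \<omega> = G \<omega> + (\<Sum>k<Suc n. H n k \<omega> * (\<i> * (l \<bullet> d n k \<omega>)))" for n \<omega>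
  define g where "g \<omega> = G \<omega> * iexp (l \<bullet> (B t \<omega> - B s \<omega>)) * exp (v * D / 2)" for \<omega>
  have frep: "complex_representable (f n)" for n
    unfolding f_def
  proof (intro complex_representable_add rep complex_representable_sum)
    fix k assume "k \<in> {..<Suc n}"
    then have k: "k < Suc n" "k \<le> Suc n" by auto
    show "complex_representable (\<lambda>\<omega>. H n k \<omega> * (\<i> * (l \<bullet> d n k \<omega>)))"
      unfolding d_def by (rule complex_representable_increment[OF step[OF k(1)] Hm[OF k(2)] Hb[OF k(2)]])
  qed simp
  have gm: "g \<in> borel_measurable (F T)"
  proof -
    have [measurable]: "G \<in> borel_measurable (F T)" by (rule measurable_F_mono[OF G(1)]) (use s in simp)
    have [measurable]: "B t \<in> borel_measurable (F T)" "B s \<in> borel_measurable (F T)"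
      using s by (auto intro!: B_measurable_F)
    show ?thesis unfolding g_def by measurable
  qed
  have gsq: "square_integrable M g"
    by (rule square_integrable_bounded[where C=C', OF measurable_F_imp[OF gm]])
      (use G(2) in \<open>auto simp: g_def norm_mult C'_def intro!: mult_right_mono intro: order_trans[OF _ abs_ge_self]\<close>)
  have l2: "l2_norm M (\<lambda>\<omega>. f n \<omega> - g \<omega>) \<le> sqrt (real (Suc n) * (C'\<^sup>2 * \<rho> n))" for n
  proof -
    have "(\<lambda>\<omega>. f n \<omega> - g \<omega>) = (\<lambda>\<omega>. - e n (Suc n) \<omega>)"
      by (simp add: fun_eq_iff g_def tele[of _ n] f_def)
    then have "l2_norm M (\<lambda>\<omega>. f n \<omega> - g \<omega>) = l2_norm M (e n (Suc n))" by simp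
    then show ?thesis using e[of "Suc n" n] by (simp add: real_le_rsqrt)
  qed
  \<comment> \<open>\<open>\<rho> n\<close> is quadratic in the step:
    \<open>y n = (v/2) * \<delta> n\<close>, and \<open>exp y - 1 \<le> y * exp y\<close> with
    \<open>y n\<close> at most \<open>v * D / 2\<close>.\<close>
  define \<kappa> where "\<kappa> = 6 * (v/2)\<^sup>2 + 2 * ((v/2) * exp (v * D / 2))\<^sup>2"
  have \<rho>le: "\<rho> n \<le> \<kappa> * (\<delta> n)\<^sup>2" for n
  proof -
    have "\<delta> n \<le> D" using kD[of 1 n] by simp
    then have yD: "y n \<le> v * D / 2" by (simp add: y_def v_def mult_left_mono)
    have "exp (y n) - 1 \<le> y n * exp (y n)"
    proof -
      have "1 + (- y n) \<le> exp (- y n)" by (rule exp_ge_add_one_self)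
      then have "(1 - y n) * exp (y n) \<le> exp (- y n) * exp (y n)" by (intro mult_right_mono) auto
      also have "\<dots> = 1" by (simp add: exp_minus_inverse mult.commute)
      finally show ?thesis by (simp add: algebra_simps)
    qed
    also have "\<dots> \<le> y n * exp (v * D / 2)" using yD y0 by (intro mult_left_mono) auto
    finally have "(exp (y n) - 1)\<^sup>2 \<le> (y n * exp (v * D / 2))\<^sup>2" using y0 by (intro power_mono) auto
    also have "\<dots> = ((v/2) * exp (v * D / 2))\<^sup>2 * (\<delta> n)\<^sup>2" by (simp add: y_def power_mult_distrib power_divide)
    finally show ?thesis unfolding \<rho>_def \<kappa>_def by (simp add: y_def power_mult_distrib power_divide algebra_simps)
  qed
  have lim: "(\<lambda>n. l2_norm M (\<lambda>\<omega>. f n \<omega> - g \<omega>)) \<longlonglongrightarrow> 0"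
  proof (rule Lim_null_comparison)
    have "(\<lambda>n. sqrt ((C'\<^sup>2 * \<kappa> * D\<^sup>2) / real (Suc n))) \<longlonglongrightarrow> sqrt 0"
      by (intro tendsto_real_sqrt LIMSEQ_Suc[of "\<lambda>n. (C'\<^sup>2 * \<kappa> * D\<^sup>2) / real n"] lim_const_over_n)
    then show "(\<lambda>n. sqrt ((C'\<^sup>2 * \<kappa> * D\<^sup>2) / real (Suc n))) \<longlonglongrightarrow> 0" by simp
    have le: "sqrt (real (Suc n) * (C'\<^sup>2 * \<rho> n)) \<le> sqrt ((C'\<^sup>2 * \<kappa> * D\<^sup>2) / real (Suc n))" for n
    proof -
      have "real (Suc n) * (C'\<^sup>2 * \<rho> n) \<le> real (Suc n) * (C'\<^sup>2 * (\<kappa> * (\<delta> n)\<^sup>2))"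
        by (intro mult_left_mono \<rho>le) auto
      also have "\<dots> = (C'\<^sup>2 * \<kappa> * D\<^sup>2) / real (Suc n)"
        by (simp add: \<delta>_def power_divide power2_eq_square field_simps del: of_nat_Suc)
      finally show ?thesis by (rule real_sqrt_le_mono)
    qed
    show "\<forall>\<^sub>F n in sequentially. norm (l2_norm M (\<lambda>\<omega>. f n \<omega> - g \<omega>)) \<le> sqrt ((C'\<^sup>2 * \<kappa> * D\<^sup>2) / real (Suc n))"
      using order_trans[OF l2 le] by (simp del: of_nat_Suc)
  qed
  have "complex_representable g" by (rule complex_representable_limit[OF frep gm gsq lim])
  \<comment> \<open>The normalisation is deterministic at the terminal time and is undone by a
    scalar.\<close>
  then have "complex_representable (\<lambda>\<omega>. complex_of_real (exp (- (v * D / 2))) * g \<omega>)" by (rule complex_representable_cmult)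
  moreover have "complex_of_real (exp (- (v * D / 2))) * g \<omega> = G \<omega> * iexp (l \<bullet> (B t \<omega> - B s \<omega>))" for \<omega>
  proof -
    have "complex_of_real (exp (- (v * D / 2))) * complex_of_real (exp (v * D / 2)) = 1"
      unfolding of_real_mult[symmetric] exp_add[symmetric] by simp
    then show ?thesis by (simp add: g_def mult_ac)
  qed
  ultimately show ?thesis by simp
qed

text \<open>Induction on the largest time b: with a the preceding time,
  \<open>\<mu> b \<bullet> B b\<close> splits into \<open>\<mu> b \<bullet> B a\<close>, which is
  absorbed into the coefficient at a, and an increment after a. The coefficients must be arbitrary
  in the induction because the one at a changes.\<close>

lemma complex_representable_exp:
  assumes "finite S" "S \<subseteq> {0..T}"
  shows "complex_representable (\<lambda>\<omega>. iexp (\<Sum>s\<in>S. \<mu> s \<bullet> B s \<omega>))"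
  using assms
proof (induction S arbitrary: \<mu> rule: finite_linorder_max_induct)
  case empty
  then show ?case using complex_representable_of_real[OF representable_const[of 1]] by simp
next
  case (insert b A)
  have A: "finite A" "A \<subseteq> {0..T}" "b \<in> {0..T}" "b \<notin> A" using insert by auto
  \<comment> \<open>For the smallest time the increment is taken from 0, where the Brownian motion
    vanishes almost surely; thus \<open>G\<close> is then almost surely 1.\<close>
  define a where "a = (if A = {} then 0 else Max A)"
  have a: "0 \<le> a" "\<And>s. s \<in> A \<Longrightarrow> s \<le> a" "a \<le> b" "A \<noteq> {} \<Longrightarrow> a \<in> A \<and> a < b"
    using A insert.hyps Max_in[OF A(1)] by (auto simp: a_def subset_iff)
  define G where "G \<omega> = iexp ((\<Sum>s\<in>A. \<mu> s \<bullet> B s \<omega>) + \<mu> b \<bullet> B a \<omega>)" for \<omega>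
  have Grep: "complex_representable G"
  proof (cases "A = {}")
    case True
    have "AE \<omega> in M. 1 = G \<omega>"
      using BM unfolding standard_brownian_motion_def by (auto simp: G_def True a_def)
    then show ?thesis
      by (rule complex_representable_cong_AE[rotated]) (use complex_representable_of_real[OF representable_const[of 1]] in simp)
  next
    case False
    define \<mu>' where "\<mu>' = \<mu>(a := \<mu> a + \<mu> b)"
    have "(\<Sum>s\<in>A. \<mu>' s \<bullet> B s \<omega>) = (\<Sum>s\<in>A. \<mu> s \<bullet> B s \<omega>) + \<mu> b \<bullet> B a \<omega>" for \<omega>
    proof -
      have aA: "a \<in> A" using a(4) False by simp
      have "(\<Sum>s\<in>A. \<mu>' s \<bullet> B s \<omega>) = \<mu>' a \<bullet> B a \<omega> + (\<Sum>s\<in>A - {a}. \<mu> s \<bullet> B s \<omega>)"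
        by (subst sum.remove[OF A(1) aA]) (simp add: \<mu>'_def)
      also have "\<dots> = (\<Sum>s\<in>A. \<mu> s \<bullet> B s \<omega>) + \<mu> b \<bullet> B a \<omega>"
        by (subst sum.remove[OF A(1) aA, of "\<lambda>s. \<mu> s \<bullet> B s \<omega>"]) (simp add: \<mu>'_def inner_add_left)
      finally show ?thesis .
    qed
    then show ?thesis using insert.IH[OF A(2), of \<mu>'] unfolding G_def by simp
  qed
  have eq: "iexp (\<Sum>s\<in>insert b A. \<mu> s \<bullet> B s \<omega>) = G \<omega> * iexp (\<mu> b \<bullet> (B b \<omega> - B a \<omega>))" for \<omega>
  proof -
    have "(\<Sum>s\<in>insert b A. \<mu> s \<bullet> B s \<omega>) = ((\<Sum>s\<in>A. \<mu> s \<bullet> B s \<omega>) + \<mu> b \<bullet> B a \<omega>) + \<mu> b \<bullet> (B b \<omega> - B a \<omega>)"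
      using A by (simp add: inner_diff_right)
    then show ?thesis unfolding G_def by (simp only: of_real_add distrib_left exp_add)
  qed
  show ?case
  \<comment> \<open>Equality occurs only when the single time is \<open>b = 0\<close>; there is then
    no increment.\<close>
  proof (cases "a = b")
    case True
    then show ?thesis using Grep unfolding eq by simp
  next
    case False
    have "G \<in> borel_measurable (F a)"
    proof -
      have [measurable]: "B s \<in> borel_measurable (F a)" if "s \<in> A" for s
        using a(2)[OF that] A(2) that by (intro B_measurable_F) auto
      have [measurable]: "B a \<in> borel_measurable (F a)" using a(1) by (intro B_measurable_F) auto
      show ?thesis unfolding G_def by measurable
    qed
    then show ?thesis unfolding eq
      by (rule complex_representable_mult_exp_increment[where C=1, rotated 3])
        (use a False A Grep in \<open>auto simp: G_def\<close>)
  qed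
qed

section \<open>From trigonometric functions to the whole augmented algebra\<close>

text \<open>The class of functions for the monotone class argument.\<close>

definition trig_multiplier :: "('a \<Rightarrow> real) \<Rightarrow> bool" where
  "trig_multiplier g \<longleftrightarrow> g \<in> borel_measurable (F T) \<and> (\<exists>C. \<forall>\<omega>\<in>space M. \<bar>g \<omega>\<bar> \<le> C) \<and>
     (\<forall>S \<mu>. finite S \<longrightarrow> S \<subseteq> {0..T} \<longrightarrow>
        complex_representable (\<lambda>\<omega>. of_real (g \<omega>) * iexp (\<Sum>s\<in>S. \<mu> s \<bullet> B s \<omega>)))"

lemma trig_multiplierD:
  assumes "trig_multiplier g"
  shows "g \<in> borel_measurable (F T)" "\<exists>C. \<forall>\<omega>\<in>space M. \<bar>g \<omega>\<bar> \<le> C"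
    "finite S \<Longrightarrow> S \<subseteq> {0..T} \<Longrightarrow> complex_representable (\<lambda>\<omega>. of_real (g \<omega>) * iexp (\<Sum>s\<in>S. \<mu> s \<bullet> B s \<omega>))"
  using assms unfolding trig_multiplier_def by blast+

lemma trig_multiplier_1: "trig_multiplier (\<lambda>\<omega>. 1)"
  unfolding trig_multiplier_def of_real_1 mult_1 using complex_representable_exp by (intro conjI exI[of _ 1]) simp_all

lemma trig_multiplier_add:
  assumes "trig_multiplier f" "trig_multiplier g"
  shows "trig_multiplier (\<lambda>\<omega>. f \<omega> + g \<omega>)"
  unfolding trig_multiplier_def
proof (intro conjI allI impI)
  show "(\<lambda>\<omega>. f \<omega> + g \<omega>) \<in> borel_measurable (F T)"
    using assms by (intro borel_measurable_add) (auto simp: trig_multiplier_def)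
  obtain C D where "\<forall>\<omega>\<in>space M. \<bar>f \<omega>\<bar> \<le> C" "\<forall>\<omega>\<in>space M. \<bar>g \<omega>\<bar> \<le> D"
    using trig_multiplierD(2)[OF assms(1)] trig_multiplierD(2)[OF assms(2)] by blast
  then show "\<exists>C. \<forall>\<omega>\<in>space M. \<bar>f \<omega> + g \<omega>\<bar> \<le> C"
    by (intro exI[of _ "C + D"]) (auto intro!: order_trans[OF abs_triangle_ineq] add_mono)
  fix S \<mu> assume S: "finite S" "S \<subseteq> {0..T}"
  show "complex_representable (\<lambda>\<omega>. of_real (f \<omega> + g \<omega>) * iexp (\<Sum>s\<in>S. \<mu> s \<bullet> B s \<omega>))"
    unfolding of_real_add distrib_right
    by (rule complex_representable_add[OF trig_multiplierD(3)[OF assms(1) S] trig_multiplierD(3)[OF assms(2) S]])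
qed

lemma trig_multiplier_cmult:
  assumes "trig_multiplier g"
  shows "trig_multiplier (\<lambda>\<omega>. c * g \<omega>)"
  unfolding trig_multiplier_def
proof (intro conjI allI impI)
  show "(\<lambda>\<omega>. c * g \<omega>) \<in> borel_measurable (F T)"
    using assms by (intro borel_measurable_times borel_measurable_const) (auto simp: trig_multiplier_def)
  obtain C where "\<forall>\<omega>\<in>space M. \<bar>g \<omega>\<bar> \<le> C"
    using trig_multiplierD(2)[OF assms] by blast
  then show "\<exists>C. \<forall>\<omega>\<in>space M. \<bar>c * g \<omega>\<bar> \<le> C"
    by (intro exI[of _ "\<bar>c\<bar> * C"]) (auto simp: abs_mult intro!: mult_left_mono)
  fix S \<mu> assume S: "finite S" "S \<subseteq> {0..T}"
  show "complex_representable (\<lambda>\<omega>. of_real (c * g \<omega>) * iexp (\<Sum>s\<in>S. \<mu> s \<bullet> B s \<omega>))"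
    unfolding of_real_mult mult.assoc
    by (rule complex_representable_cmult[OF trig_multiplierD(3)[OF assms S]])
qed

lemma measurable_trig:
  assumes "S \<subseteq> {0..T}"
  shows "(\<lambda>\<omega>. iexp (\<Sum>s\<in>S. \<mu> s \<bullet> B s \<omega>)) \<in> borel_measurable (F T)"
proof -
  have [measurable]: "B s \<in> borel_measurable (F T)" if "s \<in> S" for s
    using that assms by (intro B_measurable_F) auto
  show ?thesis by measurable
qed

lemma trig_multiplier_limit:
  assumes f: "\<And>n. trig_multiplier (f n)" and C: "\<And>n \<omega>. \<omega> \<in> space M \<Longrightarrow> \<bar>f n \<omega>\<bar> \<le> C"
    and lim: "AE \<omega> in M. (\<lambda>n. f n \<omega>) \<longlonglongrightarrow> g \<omega>" and g: "g \<in> borel_measurable (F T)"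
    and gC: "\<And>\<omega>. \<omega> \<in> space M \<Longrightarrow> \<bar>g \<omega>\<bar> \<le> C'"
  shows "trig_multiplier g"
  unfolding trig_multiplier_def
proof (intro conjI allI impI)
  fix S \<mu> assume S: "finite S" "S \<subseteq> {0..T}"
  let ?e = "\<lambda>\<omega>. iexp (\<Sum>s\<in>S. \<mu> s \<bullet> B s \<omega>)"
  have e: "?e \<in> borel_measurable (F T)" by (rule measurable_trig[OF S(2)])
  have fF: "f n \<in> borel_measurable (F T)" for n using f by (simp add: trig_multiplier_def)
  have m: "(\<lambda>\<omega>. of_real (p \<omega>) * ?e \<omega>) \<in> borel_measurable (F T)" if "p \<in> borel_measurable (F T)" for p
    using that e by measurable
  have mM: "(\<lambda>\<omega>. of_real (p \<omega>) * ?e \<omega>) \<in> borel_measurable M" if "p \<in> borel_measurable (F T)" for p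
    by (rule measurable_F_imp[OF m[OF that]]) simp
  have L: "AE \<omega> in M. (\<lambda>n. of_real (f n \<omega>) * ?e \<omega>) \<longlonglongrightarrow> of_real (g \<omega>) * ?e \<omega>"
    using lim by eventually_elim (intro tendsto_intros)
  have bd: "AE \<omega> in M. norm (of_real (f n \<omega>) * ?e \<omega>) \<le> norm C" for n
    using C by (auto simp: norm_mult intro: order_trans[OF C abs_ge_self])
  note D = l2_norm_dominated_convergence[OF mM[OF fF] mM[OF g] square_integrable_const L bd]
  show "complex_representable (\<lambda>\<omega>. of_real (g \<omega>) * ?e \<omega>)"
    by (rule complex_representable_limit[OF trig_multiplierD(3)[OF f S] m[OF g] D(1,3)])
qed (use g gC in auto)

lemma trig_multiplier_cong_AE:
  assumes f: "trig_multiplier f" and ae: "AE \<omega> in M. f \<omega> = g \<omega>" and C: "\<And>\<omega>. \<omega> \<in> space M \<Longrightarrow> \<bar>g \<omega>\<bar> \<le> C"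
  shows "trig_multiplier g"
proof -
  have fF: "f \<in> borel_measurable (F T)" using f by (simp add: trig_multiplier_def)
  obtain D where D: "\<forall>\<omega>\<in>space M. \<bar>f \<omega>\<bar> \<le> D" using trig_multiplierD(2)[OF f] by blast
  have g: "g \<in> borel_measurable (F T)" by (rule measurable_F_cong_AE[OF fF ae]) simp
  show ?thesis
    by (rule trig_multiplier_limit[of "\<lambda>_. f", OF f _ _ g C]) (use D ae in auto)
qed

lemma trig_sum_add:
  assumes "finite S" "S \<subseteq> {0..T}" "s \<in> {0..T}"
  obtains S' \<mu>' where "finite S'" "S' \<subseteq> {0..T}" "\<And>\<omega>. (\<Sum>s\<in>S. \<mu> s \<bullet> B s \<omega>) + l \<bullet> B s \<omega> = (\<Sum>s\<in>S'. \<mu>' s \<bullet> B s \<omega>)"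
proof (cases "s \<in> S")
  case True
  have "(\<Sum>r\<in>S. \<mu> r \<bullet> B r \<omega>) + l \<bullet> B s \<omega> = (\<Sum>r\<in>S. (\<mu>(s := \<mu> s + l)) r \<bullet> B r \<omega>)" for \<omega>
    unfolding sum.remove[OF assms(1) True] by (simp add: inner_add_left)
  then show thesis using that assms by blast
next
  case False
  have "(\<Sum>r\<in>S. (\<mu>(s := l)) r \<bullet> B r \<omega>) = (\<Sum>r\<in>S. \<mu> r \<bullet> B r \<omega>)" for \<omega>
    by (rule sum.cong) (use False in auto)
  then have "(\<Sum>r\<in>S. \<mu> r \<bullet> B r \<omega>) + l \<bullet> B s \<omega> = (\<Sum>r\<in>insert s S. (\<mu>(s := l)) r \<bullet> B r \<omega>)" for \<omega>
    using assms(1) False by (simp add: add.commute)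
  then show thesis using that[of "insert s S"] assms by blast
qed

text \<open>Writing \<open>sin\<close> as a difference of two exponentials turns the product into
  two shifts of the frequency at time s, and the class is quantified over all frequencies.\<close>

lemma trig_multiplier_sin:
  assumes g: "trig_multiplier g" and s: "s \<in> {0..T}"
  shows "trig_multiplier (\<lambda>\<omega>. g \<omega> * sin (l \<bullet> B s \<omega>))"
  unfolding trig_multiplier_def
proof (intro conjI allI impI)
  have [measurable]: "B s \<in> borel_measurable (F T)" using s by (intro B_measurable_F) auto
  have [measurable]: "g \<in> borel_measurable (F T)" using g by (simp add: trig_multiplier_def)
  show "(\<lambda>\<omega>. g \<omega> * sin (l \<bullet> B s \<omega>)) \<in> borel_measurable (F T)" by measurable
  obtain C where C: "\<forall>\<omega>\<in>space M. \<bar>g \<omega>\<bar> \<le> C" using trig_multiplierD(2)[OF g] by blast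
  have "\<bar>g \<omega> * sin (l \<bullet> B s \<omega>)\<bar> \<le> C" if "\<omega> \<in> space M" for \<omega>
  proof -
    have "\<bar>g \<omega> * sin (l \<bullet> B s \<omega>)\<bar> \<le> \<bar>g \<omega>\<bar> * 1"
      unfolding abs_mult by (rule mult_left_mono) auto
    then show ?thesis using C that by force
  qed
  then show "\<exists>C. \<forall>\<omega>\<in>space M. \<bar>g \<omega> * sin (l \<bullet> B s \<omega>)\<bar> \<le> C" by blast
  fix S \<mu> assume S: "finite S" "S \<subseteq> {0..T}"
  have rep: "complex_representable (\<lambda>\<omega>. of_real (g \<omega>) * iexp ((\<Sum>s\<in>S. \<mu> s \<bullet> B s \<omega>) + k \<bullet> B s \<omega>))" for k
  proof -
    obtain S' \<mu>' where S': "finite S'" "S' \<subseteq> {0..T}" "\<And>\<omega>. (\<Sum>s\<in>S. \<mu> s \<bullet> B s \<omega>) + k \<bullet> B s \<omega> = (\<Sum>s\<in>S'. \<mu>' s \<bullet> B s \<omega>)"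
      using trig_sum_add[OF S s] by blast
    show ?thesis unfolding S'(3) by (rule trig_multiplierD(3)[OF g S'(1,2)])
  qed
  have "complex_representable (\<lambda>\<omega>. (1 / (2 * \<i>)) * (of_real (g \<omega>) * iexp ((\<Sum>s\<in>S. \<mu> s \<bullet> B s \<omega>) + l \<bullet> B s \<omega>))
      + (- (1 / (2 * \<i>))) * (of_real (g \<omega>) * iexp ((\<Sum>s\<in>S. \<mu> s \<bullet> B s \<omega>) + (- l) \<bullet> B s \<omega>)))"
    by (intro complex_representable_add complex_representable_cmult rep)
  moreover have "(1 / (2 * \<i>)) * (of_real (g \<omega>) * iexp ((\<Sum>s\<in>S. \<mu> s \<bullet> B s \<omega>) + l \<bullet> B s \<omega>))
      + (- (1 / (2 * \<i>))) * (of_real (g \<omega>) * iexp ((\<Sum>s\<in>S. \<mu> s \<bullet> B s \<omega>) + (- l) \<bullet> B s \<omega>))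
    = of_real (g \<omega> * sin (l \<bullet> B s \<omega>)) * iexp (\<Sum>s\<in>S. \<mu> s \<bullet> B s \<omega>)" for \<omega>
  proof -
    define a where "a = (\<Sum>s\<in>S. \<mu> s \<bullet> B s \<omega>)"
    define b where "b = l \<bullet> B s \<omega>"
    have x: "iexp (a + b) = iexp a * iexp b" "iexp (a + - b) = iexp a * iexp (- b)"
      by (simp_all only: of_real_add distrib_left exp_add)
    have sin: "complex_of_real (sin b) = (iexp b - iexp (- b)) / (2 * \<i>)"
      using sin_exp_eq[of "complex_of_real b"] by (simp add: sin_of_real)
    have alg: "(1 / (2 * \<i>)) * (G * (e * p)) + (- (1 / (2 * \<i>))) * (G * (e * q)) = G * ((p - q) / (2 * \<i>)) * e"
      for G e p q :: complex by (simp add: field_simps)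
    show ?thesis
      unfolding inner_minus_left a_def[symmetric] b_def[symmetric] of_real_mult x sin by (rule alg)
  qed
  ultimately show "complex_representable (\<lambda>\<omega>. of_real (g \<omega> * sin (l \<bullet> B s \<omega>)) * iexp (\<Sum>s\<in>S. \<mu> s \<bullet> B s \<omega>))"
    by simp
qed

text \<open>The multiplier \<open>g\<close> is arbitrary in the induction: a product of polynomials
  is handled by absorbing the first factor into \<open>g\<close>.\<close>

lemma trig_multiplier_polynomial:
  assumes "real_polynomial_function p" "trig_multiplier g" "s \<in> {0..T}"
  shows "trig_multiplier (\<lambda>\<omega>. g \<omega> * p (sin (l \<bullet> B s \<omega>)))"
  using assms
proof (induction p arbitrary: g)
  case (linear f)
  have "f x = f 1 * x" for x using linear(1) linear_scale[OF bounded_linear.linear, of f x 1] by (simp add: mult.commute)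
  then have "(\<lambda>\<omega>. g \<omega> * f (sin (l \<bullet> B s \<omega>))) = (\<lambda>\<omega>. f 1 * (g \<omega> * sin (l \<bullet> B s \<omega>)))"
    by (metis mult.left_commute)
  then show ?case using trig_multiplier_cmult[OF trig_multiplier_sin[OF linear(2,3)]] by simp
next
  case (const c)
  then show ?case using trig_multiplier_cmult[of g c] by (simp add: mult.commute)
next
  case (add f1 f2)
  then show ?case using trig_multiplier_add[OF add.IH(1) add.IH(2)] by (simp add: distrib_left)
next
  case (mult f1 f2)
  have "trig_multiplier (\<lambda>\<omega>. (g \<omega> * f1 (sin (l \<bullet> B s \<omega>))) * f2 (sin (l \<bullet> B s \<omega>)))"
    by (rule mult.IH(2)[OF mult.IH(1)]) (use mult.prems in auto)
  then show ?case by (simp add: mult.assoc)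
qed

text \<open>Ramps rising from 0 at \<open>a\<close> to 1 at \<open>a + 1/n\<close> tend to the
  indicator of the open half-line, and Weierstrass replaces the n-th ramp by a polynomial within
  \<open>1 / (n + 1)\<close>. The range \<open>{-1..1}\<close> is that of \<open>sin\<close>, and
  the common bound 2 permits dominated convergence.\<close>

lemma polynomial_approx_indicator:
  fixes a :: real
  obtains p :: "nat \<Rightarrow> real \<Rightarrow> real" where "\<And>n. real_polynomial_function (p n)"
    "\<And>n x. x \<in> {-1..1} \<Longrightarrow> \<bar>p n x\<bar> \<le> 2" "\<And>x. x \<in> {-1..1} \<Longrightarrow> (\<lambda>n. p n x) \<longlonglongrightarrow> indicat_real {a<..} x"
proof -
  define \<phi> where "\<phi> n x = max 0 (min 1 (real n * (x - a)))" for n x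
  have "\<exists>p. real_polynomial_function p \<and> (\<forall>x\<in>{-1..1}. \<bar>\<phi> n x - p x\<bar> < 1 / real (Suc n))" for n
  proof -
    have "continuous_on {-1..1} (\<phi> n)" unfolding \<phi>_def by (intro continuous_intros)
    then obtain q where "real_polynomial_function q" "\<And>x. x \<in> {-1..1} \<Longrightarrow> \<bar>\<phi> n x - q x\<bar> < 1 / real (Suc n)"
      using Stone_Weierstrass_real_polynomial_function[OF compact_Icc, of "-1" 1 "\<phi> n" "1 / real (Suc n)"] by auto
    then show ?thesis by blast
  qed
  then obtain p where p: "\<And>n. real_polynomial_function (p n)"
    "\<And>n x. x \<in> {-1..1} \<Longrightarrow> \<bar>\<phi> n x - p n x\<bar> < 1 / real (Suc n)" by metis
  have \<phi>: "(\<lambda>n. \<phi> n x) \<longlonglongrightarrow> indicat_real {a<..} x" for x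
  proof (cases "a < x")
    case True
    obtain N where N: "1 / (x - a) < real N" using reals_Archimedean2 by blast
    have "\<forall>\<^sub>F n in sequentially. \<phi> n x = indicat_real {a<..} x"
      using eventually_ge_at_top[of N]
    proof eventually_elim
      case (elim n)
      then have "1 / (x - a) \<le> real n" using N by linarith
      then have "1 \<le> real n * (x - a)" using True by (simp add: field_simps)
      then show ?case using True by (simp add: \<phi>_def)
    qed
    then show ?thesis by (rule tendsto_eventually)
  next
    case False
    then have "real n * (x - a) \<le> 0" for n by (intro mult_nonneg_nonpos) auto
    then have "\<phi> n x = 0" for n by (simp add: \<phi>_def min.coboundedI2)
    then show ?thesis using False by simp
  qed
  show thesis
  proof (rule that[of p])
    fix n and x :: real assume x: "x \<in> {-1..1}"
    have "\<bar>\<phi> n x\<bar> \<le> 1" by (simp add: \<phi>_def)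
    moreover have "1 / real (Suc n) \<le> 1" by simp
    ultimately show "\<bar>p n x\<bar> \<le> 2" using p(2)[OF x, of n] by linarith
  next
    fix x :: real assume x: "x \<in> {-1..1}"
    have "(\<lambda>n. \<phi> n x - p n x) \<longlonglongrightarrow> 0"
    proof (rule Lim_null_comparison)
      show "(\<lambda>n. 1 / real (Suc n)) \<longlonglongrightarrow> 0" by (rule LIMSEQ_Suc[OF lim_const_over_n])
      show "\<forall>\<^sub>F n in sequentially. norm (\<phi> n x - p n x) \<le> 1 / real (Suc n)"
        using p(2)[OF x] by (simp add: less_imp_le)
    qed
    from tendsto_diff[OF \<phi>[of x] this] show "(\<lambda>n. p n x) \<longlonglongrightarrow> indicat_real {a<..} x" by simp
  qed (rule p)
qed

lemma trig_multiplier_indicator_sin: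
  assumes g: "trig_multiplier g" and s: "s \<in> {0..T}"
  shows "trig_multiplier (\<lambda>\<omega>. g \<omega> * indicat_real {\<omega>\<in>space M. a < sin (l \<bullet> B s \<omega>)} \<omega>)"
proof -
  obtain p where p: "\<And>n. real_polynomial_function (p n)"
    "\<And>n x. x \<in> {-1..1} \<Longrightarrow> \<bar>p n x\<bar> \<le> 2" "\<And>x. x \<in> {-1..1} \<Longrightarrow> (\<lambda>n. p n x) \<longlonglongrightarrow> indicat_real {a<..} x"
    using polynomial_approx_indicator[of a] by blast
  obtain C where C: "\<forall>\<omega>\<in>space M. \<bar>g \<omega>\<bar> \<le> C" using trig_multiplierD(2)[OF g] by blast
  have [measurable]: "B s \<in> borel_measurable (F T)" using s by (intro B_measurable_F) auto
  have [measurable]: "g \<in> borel_measurable (F T)" using g by (simp add: trig_multiplier_def)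
  have sin: "sin x \<in> {-1..1}" for x :: real by simp
  show ?thesis
  proof (rule trig_multiplier_limit[OF trig_multiplier_polynomial[OF p(1) g s, of _ l]])
    show "\<bar>g \<omega> * p n (sin (l \<bullet> B s \<omega>))\<bar> \<le> \<bar>C\<bar> * 2" if "\<omega> \<in> space M" for n \<omega>
      unfolding abs_mult by (rule mult_mono) (use C that p(2)[OF sin] in \<open>auto intro: order_trans[OF _ abs_ge_self]\<close>)
    show "AE \<omega> in M. (\<lambda>n. g \<omega> * p n (sin (l \<bullet> B s \<omega>))) \<longlonglongrightarrow> g \<omega> * indicat_real {\<omega> \<in> space M. a < sin (l \<bullet> B s \<omega>)} \<omega>"
    proof (rule AE_I2)
      fix \<omega> assume "\<omega> \<in> space M"
      then have "indicat_real {\<omega> \<in> space M. a < sin (l \<bullet> B s \<omega>)} \<omega> = indicat_real {a<..} (sin (l \<bullet> B s \<omega>))"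
        by (simp add: indicator_def)
      then show "(\<lambda>n. g \<omega> * p n (sin (l \<bullet> B s \<omega>))) \<longlonglongrightarrow> g \<omega> * indicat_real {\<omega> \<in> space M. a < sin (l \<bullet> B s \<omega>)} \<omega>"
        using tendsto_mult_left[OF p(3)[OF sin]] by simp
    qed
    have "{\<omega> \<in> space (F T). a < sin (l \<bullet> B s \<omega>)} \<in> sets (F T)" by measurable
    then have [measurable]: "{\<omega> \<in> space M. a < sin (l \<bullet> B s \<omega>)} \<in> sets (F T)" by simp
    show "(\<lambda>\<omega>. g \<omega> * indicat_real {\<omega> \<in> space M. a < sin (l \<bullet> B s \<omega>)} \<omega>) \<in> borel_measurable (F T)" by measurable
    show "\<bar>g \<omega> * indicat_real {\<omega> \<in> space M. a < sin (l \<bullet> B s \<omega>)} \<omega>\<bar> \<le> \<bar>C\<bar>" if "\<omega> \<in> space M" for \<omega>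
      using C that by (auto simp: indicator_def intro: order_trans[OF _ abs_ge_self])
  qed
qed

text \<open>Quantifying over every multiplier \<open>g\<close> makes intersection closure immediate,
  by multiplying twice. The class is therefore an algebra, and disjoint countable unions follow from
  bounded limits.\<close>

definition trig_sets :: "'a set set" where
  "trig_sets = {A \<in> sets (F T). \<forall>g. trig_multiplier g \<longrightarrow> trig_multiplier (\<lambda>\<omega>. g \<omega> * indicat_real A \<omega>)}"

lemma sigma_algebra_trig_sets: "sigma_algebra (space M) trig_sets"
proof -
  have empty: "{} \<in> trig_sets"
    using trig_multiplier_cmult[OF trig_multiplier_1, of 0] by (simp add: trig_sets_def)
  have sub: "A \<subseteq> space M" if "A \<in> trig_sets" for A
    using that sets.sets_into_space[of A "F T"] by (auto simp: trig_sets_def)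
  have compl: "space M - A \<in> trig_sets" if A: "A \<in> trig_sets" for A
    unfolding trig_sets_def
  proof (intro CollectI conjI allI impI)
    have AF: "A \<in> sets (F T)" using A by (simp add: trig_sets_def)
    show "space M - A \<in> sets (F T)"
      using sets.compl_sets[OF AF] by simp
    fix g assume g: "trig_multiplier g"
    obtain C where C: "\<forall>\<omega>\<in>space M. \<bar>g \<omega>\<bar> \<le> C" using trig_multiplierD(2)[OF g] by blast
    have "trig_multiplier (\<lambda>\<omega>. g \<omega> + (-1) * (g \<omega> * indicat_real A \<omega>))"
      using A g by (intro trig_multiplier_add trig_multiplier_cmult) (auto simp: trig_sets_def)
    then show "trig_multiplier (\<lambda>\<omega>. g \<omega> * indicat_real (space M - A) \<omega>)"
      by (rule trig_multiplier_cong_AE[where C="\<bar>C\<bar>"])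
        (use C in \<open>auto simp: indicator_def intro: order_trans[OF _ abs_ge_self]\<close>)
  qed
  have int: "A \<inter> A' \<in> trig_sets" if "A \<in> trig_sets" "A' \<in> trig_sets" for A A'
    using that unfolding trig_sets_def by (auto simp: indicator_inter_arith mult.assoc[symmetric])
  have un: "A \<union> A' \<in> trig_sets" if "A \<in> trig_sets" "A' \<in> trig_sets" for A A'
  proof -
    have "A \<union> A' = space M - ((space M - A) \<inter> (space M - A'))" using sub that by blast
    then show ?thesis using compl int that by metis
  qed
  have alg: "algebra (space M) trig_sets"
    unfolding algebra_iff_Un using empty compl un by (auto dest: subsetD[OF sub])
  show ?thesis
  proof (rule sigma_algebra_disjoint_iff[THEN iffD2], intro conjI allI impI alg)
    fix A :: "nat \<Rightarrow> 'a set" assume A: "range A \<subseteq> trig_sets" "disjoint_family A"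
    have fin: "(\<Union>i<n. A i) \<in> trig_sets" for n
      by (induction n) (use A(1) un empty in \<open>auto simp: lessThan_Suc\<close>)
    show "(\<Union>i. A i) \<in> trig_sets"
      unfolding trig_sets_def
    proof (intro CollectI conjI allI impI)
      show UF: "(\<Union>i. A i) \<in> sets (F T)" using A(1) by (auto simp: trig_sets_def)
      fix g assume g: "trig_multiplier g"
      obtain C where C: "\<forall>\<omega>\<in>space M. \<bar>g \<omega>\<bar> \<le> C" using trig_multiplierD(2)[OF g] by blast
      have [measurable]: "g \<in> borel_measurable (F T)" using g by (simp add: trig_multiplier_def)
      show "trig_multiplier (\<lambda>\<omega>. g \<omega> * indicat_real (\<Union>i. A i) \<omega>)"
      proof (rule trig_multiplier_limit)
        show "trig_multiplier (\<lambda>\<omega>. g \<omega> * indicat_real (\<Union>i<n. A i) \<omega>)" for n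
          using fin[of n] g by (simp add: trig_sets_def)
        show "\<bar>g \<omega> * indicat_real (\<Union>i<n. A i) \<omega>\<bar> \<le> \<bar>C\<bar>" if "\<omega> \<in> space M" for n \<omega>
          using C that by (auto simp: indicator_def intro: order_trans[OF _ abs_ge_self])
        show "\<bar>g \<omega> * indicat_real (\<Union>i. A i) \<omega>\<bar> \<le> \<bar>C\<bar>" if "\<omega> \<in> space M" for \<omega>
          using C that by (auto simp: indicator_def intro: order_trans[OF _ abs_ge_self])
        show "AE \<omega> in M. (\<lambda>n. g \<omega> * indicat_real (\<Union>i<n. A i) \<omega>) \<longlonglongrightarrow> g \<omega> * indicat_real (\<Union>i. A i) \<omega>"
          by (intro AE_I2 tendsto_mult_left LIMSEQ_indicator_UN)
        show "(\<lambda>\<omega>. g \<omega> * indicat_real (\<Union>i. A i) \<omega>) \<in> borel_measurable (F T)"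
          using UF by measurable
      qed
    qed
  qed
qed

text \<open>Each \<open>B s\<close> is measurable for the algebra of these sets: sines of all
  multiples of a coordinate are, and the coordinate is recovered from them. Null sets belong because
  the class is insensitive to almost sure changes.\<close>

lemma sets_F_trig_sets: "sets (F T) \<subseteq> trig_sets"
proof -
  interpret TS: sigma_algebra "space M" trig_sets by (rule sigma_algebra_trig_sets)
  define N where "N = sigma (space M) trig_sets"
  have N: "space N = space M" "sets N = trig_sets"
    unfolding N_def by (auto simp: space_measure_of_conv TS.sets_measure_of_eq)
  have B: "B s \<in> borel_measurable N" if s: "s \<in> {0..T}" for s
    unfolding borel_measurable_euclidean_space[of "B s"]
  proof
    fix i :: "real ^ 'd" assume "i \<in> Basis"
    have sin: "(\<lambda>\<omega>. sin (l \<bullet> B s \<omega>)) \<in> borel_measurable N" for l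
    proof (subst borel_measurable_iff_greater, rule allI)
      fix a
      have [measurable]: "B s \<in> borel_measurable (F T)" using s by (intro B_measurable_F) auto
      have "{\<omega> \<in> space (F T). a < sin (l \<bullet> B s \<omega>)} \<in> sets (F T)" by measurable
      then show "{\<omega> \<in> space N. a < sin (l \<bullet> B s \<omega>)} \<in> sets N"
        unfolding N using trig_multiplier_indicator_sin[OF _ s] by (simp add: trig_sets_def)
    qed
    show "(\<lambda>\<omega>. B s \<omega> \<bullet> i) \<in> borel_measurable N"
    \<comment> \<open>A coordinate x is the limit of \<open>n * sin (x / n)\<close>, by the
      derivative of the sine at 0.\<close>
    proof (rule borel_measurable_LIMSEQ_real)
      show "(\<lambda>\<omega>. real (Suc n) * sin (((1 / real (Suc n)) *\<^sub>R i) \<bullet> B s \<omega>)) \<in> borel_measurable N" for n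
        using sin by measurable
      fix \<omega>
      have "(\<lambda>n. real (Suc n) * sin (((1 / real (Suc n)) *\<^sub>R i) \<bullet> B s \<omega>)) \<longlonglongrightarrow> i \<bullet> B s \<omega>"
      proof -
        have d: "((\<lambda>h. sin (h * (i \<bullet> B s \<omega>)) / h) \<longlongrightarrow> i \<bullet> B s \<omega>) (at 0)"
        proof -
          have "((\<lambda>h. sin (h * (i \<bullet> B s \<omega>))) has_field_derivative (i \<bullet> B s \<omega>)) (at 0)"
            by (auto intro!: derivative_eq_intros)
          then show ?thesis by (simp add: has_field_derivative_iff)
        qed
        have "filterlim (\<lambda>n. 1 / real (Suc n)) (at 0) sequentially"
          unfolding filterlim_at by (auto simp del: of_nat_Suc intro!: LIMSEQ_Suc[OF lim_const_over_n])
        from filterlim_compose[OF d this] show ?thesis by (simp add: mult.commute)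
      qed
      then show "(\<lambda>n. real (Suc n) * sin (((1 / real (Suc n)) *\<^sub>R i) \<bullet> B s \<omega>)) \<longlonglongrightarrow> B s \<omega> \<bullet> i"
        by (simp add: inner_commute)
    qed
  qed
  have nat: "sets (natural_filtration M B T) \<subseteq> trig_sets"
    unfolding sets_natural
  proof (rule TS.sigma_sets_subset, safe)
    fix s and A :: "(real ^ 'd) set" assume "s \<in> {0..T}" "A \<in> sets borel"
    then show "B s -` A \<inter> space M \<in> trig_sets" using measurable_sets[OF B, of s A] by (simp add: N)
  qed
  have null: "null_sets M \<subseteq> trig_sets"
  proof
    fix A assume A: "A \<in> null_sets M"
    show "A \<in> trig_sets"
      unfolding trig_sets_def
    proof (intro CollectI conjI allI impI)
      show "A \<in> sets (F T)" by (rule null_sets_F[OF A])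
      fix g assume g: "trig_multiplier g"
      obtain C where C: "\<forall>\<omega>\<in>space M. \<bar>g \<omega>\<bar> \<le> C" using trig_multiplierD(2)[OF g] by blast
      have "AE \<omega> in M. 0 * 1 = g \<omega> * indicat_real A \<omega>" using AE_not_in[OF A] by eventually_elim simp
      then show "trig_multiplier (\<lambda>\<omega>. g \<omega> * indicat_real A \<omega>)"
        by (rule trig_multiplier_cong_AE[where C="\<bar>C\<bar>", OF trig_multiplier_cmult[OF trig_multiplier_1]])
          (use C in \<open>auto simp: indicator_def intro: order_trans[OF _ abs_ge_self]\<close>)
    qed
  qed
  show ?thesis
    unfolding sets_F by (rule TS.sigma_sets_subset) (use nat null in auto)
qed

lemma representable_indicator:
  assumes "A \<in> sets (F T)"
  shows "representable (indicat_real A)"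
proof -
  have "trig_multiplier (\<lambda>\<omega>. 1 * indicat_real A \<omega>)"
    using assms sets_F_trig_sets trig_multiplier_1 unfolding trig_sets_def by blast
  \<comment> \<open>The empty trigonometric sum has exponential 1, which leaves the indicator
    alone.\<close>
  then have "complex_representable (\<lambda>\<omega>. of_real (1 * indicat_real A \<omega>) * iexp (\<Sum>s\<in>{}. 0 \<bullet> B s \<omega>))"
    unfolding trig_multiplier_def by (elim conjE allE[of _ "{}"] allE[of _ "\<lambda>_. 0"]) simp
  then show ?thesis by (simp add: complex_representable_def)
qed

lemma representable_square_integrable:
  assumes m: "\<eta> \<in> borel_measurable (F T)" and sq: "square_integrable M \<eta>"
  shows "representable \<eta>"
proof -
  obtain S where S: "\<And>i. simple_function (F T) (S i)" "\<And>x. x \<in> space (F T) \<Longrightarrow> (\<lambda>i. S i x) \<longlonglongrightarrow> \<eta> x"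
    "\<And>i x. x \<in> space (F T) \<Longrightarrow> dist (S i x) 0 \<le> 2 * dist (\<eta> x) 0"
    using borel_measurable_implies_sequence_metric[OF m, of 0] by blast
  have rep: "representable (S i)" for i
  proof -
    have sum: "representable (\<lambda>\<omega>. \<Sum>y\<in>S i ` space (F T). y * indicat_real (S i -` {y} \<inter> space (F T)) \<omega>)"
      using simple_functionD[OF S(1)[of i]]
      by (intro representable_sum representable_cmult representable_indicator) auto
    have eq: "S i \<omega> = (\<Sum>y\<in>S i ` space (F T). y * indicat_real (S i -` {y} \<inter> space (F T)) \<omega>)" if "\<omega> \<in> space M" for \<omega>
    proof -
      have "(\<Sum>y\<in>S i ` space (F T). y * indicat_real (S i -` {y} \<inter> space (F T)) \<omega>)
          = (\<Sum>y\<in>S i ` space (F T). if y = S i \<omega> then y else 0)"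
        by (rule sum.cong) (use that in \<open>auto simp: indicator_def\<close>)
      also have "\<dots> = S i \<omega>" using simple_functionD(1)[OF S(1)[of i]] that by (subst sum.delta) auto
      finally show ?thesis by simp
    qed
    show ?thesis by (rule representable_cong_AE[OF sum]) (rule AE_I2, rule eq[symmetric])
  qed
  have lim: "AE x in M. (\<lambda>i. S i x) \<longlonglongrightarrow> \<eta> x" using S(2) by auto
  have bd: "AE x in M. norm (S i x) \<le> norm (2 *\<^sub>R \<eta> x)" for i using S(3) by (auto simp: abs_mult)
  show ?thesis
    by (rule representable_limit[OF rep m sq l2_norm_dominated_convergence(3)[OF representableD(3)[OF rep]
          square_integrableD(1)[OF sq] square_integrable_scaleR(1)[OF sq, of 2] lim bd]])
qed

text \<open>Approximations with error \<open>(1/2) ^ k\<close> make the terminal integrals a fast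
  Cauchy sequence, so the limit integral exists. The unspecified constants \<open>c k\<close> are
  then forced to tend to the mean, because integrals are centred.\<close>

theorem martingale_representation:
  assumes m: "\<eta> \<in> borel_measurable (F T)" and sq: "square_integrable M \<eta>"
  obtains Z X where "Z \<in> H2 M F T" "has_ito_integral M F T B Z X" "AE \<omega> in M. \<eta> \<omega> = expectation \<eta> + X T \<omega>"
proof -
  have "\<exists>c Z X. simple_ito Z X \<and> l2_norm M (\<lambda>\<omega>. \<eta> \<omega> - (c + X T \<omega>)) < (1/2) ^ k" for k :: nat
    using representable_square_integrable[OF assms] unfolding representable_def by simp
  then obtain c Zk Xk where k: "\<And>k. simple_ito (Zk k) (Xk k)"
    "\<And>k. l2_norm M (\<lambda>\<omega>. \<eta> \<omega> - (c k + Xk k T \<omega>)) < (1/2) ^ k" by metis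
  have Xsq: "square_integrable M (Xk k T)" for k by (rule simple_ito_isometry(1)[OF k(1)])
  have X0: "expectation (Xk k T) = 0" for k
    using simple_ito_orthogonal[OF k(1), of 0 "\<lambda>_. 1"] simple_ito_0[OF k(1)] T_pos by simp
  \<comment> \<open>Centred functions are orthogonal to constants, so adding a constant cannot
    decrease the norm; this removes the constants from the Cauchy estimate.\<close>
  have center: "l2_norm M f \<le> l2_norm M (\<lambda>\<omega>. a + f \<omega>)" if "square_integrable M f" "expectation f = 0" for a :: real and f
  proof (rule power2_le_imp_le)
    show "(l2_norm M f)\<^sup>2 \<le> (l2_norm M (\<lambda>\<omega>. a + f \<omega>))\<^sup>2"
      using l2_norm_add_power2[OF square_integrable_const[of a] that(1)] that(2) by (simp add: inner_real_def)
  qed simp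
  have le: "l2_norm M (\<lambda>\<omega>. Xk (Suc k) T \<omega> - Xk k T \<omega>) \<le> 2 * (1/2) ^ k" for k
  proof -
    have "l2_norm M (\<lambda>\<omega>. Xk (Suc k) T \<omega> - Xk k T \<omega>) \<le> l2_norm M (\<lambda>\<omega>. (c (Suc k) - c k) + (Xk (Suc k) T \<omega> - Xk k T \<omega>))"
      by (rule center) (use X0 square_integrable_integrable[OF Xsq] in \<open>auto intro: square_integrable_diff Xsq\<close>)
    also have "\<dots> = l2_norm M (\<lambda>\<omega>. (c (Suc k) + Xk (Suc k) T \<omega>) - (c k + Xk k T \<omega>))" by (simp add: algebra_simps)
    also have "\<dots> \<le> l2_norm M (\<lambda>\<omega>. (c (Suc k) + Xk (Suc k) T \<omega>) - \<eta> \<omega>) + l2_norm M (\<lambda>\<omega>. \<eta> \<omega> - (c k + Xk k T \<omega>))"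
      by (rule l2_norm_dist_triangle) (intro affine_ito_square_integrable[OF k(1)] sq)+
    also have "\<dots> \<le> (1/2) ^ (Suc k) + (1/2) ^ k"
      using k(2)[of "Suc k"] k(2)[of k] l2_norm_minus_commute[of M \<eta>] by (intro add_mono) auto
    also have "\<dots> \<le> 2 * (1/2) ^ k" by simp
    finally show ?thesis .
  qed
  obtain Z X where ZX: "Z \<in> H2 M F T" "has_ito_integral M F T B Z X" "(\<lambda>k. l2_norm M (\<lambda>\<omega>. Xk k T \<omega> - X T \<omega>)) \<longlonglongrightarrow> 0"
    using ito_integral_exists[of Zk Xk 2, OF k(1) _ le] by auto
  have XT: "square_integrable M (X T)" by (rule square_martingaleD(2)[OF has_ito_integralD(3)[OF ZX(1,2)] T_in])
  have ck: "\<bar>expectation \<eta> - c k\<bar> \<le> (1/2) ^ k" for k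
  proof -
    note d = square_integrable_diff[OF sq affine_ito_square_integrable[OF k(1)[of k], of "c k"]]
    have "\<bar>\<integral>\<omega>. 1 \<bullet> (\<eta> \<omega> - (c k + Xk k T \<omega>)) \<partial>M\<bar> \<le> l2_norm M (\<lambda>_. 1::real) * l2_norm M (\<lambda>\<omega>. \<eta> \<omega> - (c k + Xk k T \<omega>))"
      by (rule integral_Cauchy_Schwarz[OF square_integrable_const d])
    also have "l2_norm M (\<lambda>_. 1::real) = 1" by (simp add: l2_norm_def prob_space)
    also have "(\<integral>\<omega>. 1 \<bullet> (\<eta> \<omega> - (c k + Xk k T \<omega>)) \<partial>M) = expectation \<eta> - c k"
      using square_integrable_integrable[OF sq] square_integrable_integrable[OF Xsq[of k]] X0[of k] by (simp add: prob_space)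
    finally show ?thesis using k(2)[of k] by simp
  qed
  have "l2_norm M (\<lambda>\<omega>. \<eta> \<omega> - (expectation \<eta> + X T \<omega>)) \<le> 2 * (1/2) ^ k + l2_norm M (\<lambda>\<omega>. Xk k T \<omega> - X T \<omega>)" for k
  proof -
    have "l2_norm M (\<lambda>\<omega>. \<eta> \<omega> - (expectation \<eta> + X T \<omega>))
        \<le> l2_norm M (\<lambda>\<omega>. \<eta> \<omega> - (c k + Xk k T \<omega>)) + l2_norm M (\<lambda>\<omega>. (c k + Xk k T \<omega>) - (expectation \<eta> + X T \<omega>))"
      by (rule l2_norm_dist_triangle) (intro affine_ito_square_integrable[OF k(1)] sq square_integrable_add square_integrable_const XT)+
    also have "l2_norm M (\<lambda>\<omega>. (c k + Xk k T \<omega>) - (expectation \<eta> + X T \<omega>))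
        = l2_norm M (\<lambda>\<omega>. (c k - expectation \<eta>) + (Xk k T \<omega> - X T \<omega>))" by (simp add: algebra_simps)
    also have "\<dots> \<le> l2_norm M (\<lambda>\<omega>. c k - expectation \<eta>) + l2_norm M (\<lambda>\<omega>. Xk k T \<omega> - X T \<omega>)"
      by (rule l2_norm_triangle) (intro square_integrable_const square_integrable_diff Xsq XT)+
    also have "l2_norm M (\<lambda>\<omega>. c k - expectation \<eta>) = \<bar>expectation \<eta> - c k\<bar>"
      by (simp add: l2_norm_def prob_space abs_minus_commute)
    finally show ?thesis using ck[of k] k(2)[of k] by simp
  qed
  moreover have "(\<lambda>k. 2 * (1/2) ^ k + l2_norm M (\<lambda>\<omega>. Xk k T \<omega> - X T \<omega>)) \<longlonglongrightarrow> 0"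
    by (intro tendsto_add_zero tendsto_mult_right_zero LIMSEQ_power_zero ZX(3)) simp
  ultimately have "l2_norm M (\<lambda>\<omega>. \<eta> \<omega> - (expectation \<eta> + X T \<omega>)) \<le> 0"
    by (intro LIMSEQ_le_const) auto
  then have "l2_norm M (\<lambda>\<omega>. \<eta> \<omega> - (expectation \<eta> + X T \<omega>)) = 0" using l2_norm_nonneg antisym by blast
  then have "AE \<omega> in M. \<eta> \<omega> - (expectation \<eta> + X T \<omega>) = 0"
    by (subst (asm) l2_norm_eq_0_iff) (intro square_integrable_diff sq square_integrable_add square_integrable_const XT, simp)
  then show thesis using that ZX(1,2) by auto
qed

end

section \<open>Deterministic reflection\<close>

text \<open>For \<open>t \<le> s\<close>, the supremum gains between \<open>s\<close> and
  \<open>t\<close> at most the oscillation of \<open>g\<close> on \<open>{t..s}\<close>, so a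
  modulus of uniform continuity of \<open>g\<close> is one for \<open>k\<close>.\<close>

lemma running_sup:
  fixes g :: "real \<Rightarrow> real"
  assumes T: "0 \<le> T" and g: "continuous_on {0..T} g"
  defines "k \<equiv> \<lambda>t. SUP s\<in>{t..T}. g s"
  shows "\<And>s t. 0 \<le> t \<Longrightarrow> t \<le> s \<Longrightarrow> s \<le> T \<Longrightarrow> g s \<le> k t"
    "\<And>t C. 0 \<le> t \<Longrightarrow> t \<le> T \<Longrightarrow> (\<And>s. t \<le> s \<Longrightarrow> s \<le> T \<Longrightarrow> g s \<le> C) \<Longrightarrow> k t \<le> C"
    "\<And>s t. 0 \<le> t \<Longrightarrow> t \<le> s \<Longrightarrow> s \<le> T \<Longrightarrow> k s \<le> k t"
    "k T = g T" "continuous_on {0..T} k"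
proof -
  have bdd: "bdd_above (g ` {t..T})" if "0 \<le> t" for t
    using that by (intro bounded_imp_bdd_above compact_imp_bounded compact_continuous_image continuous_on_subset[OF g]) auto
  show ge: "g s \<le> k t" if "0 \<le> t" "t \<le> s" "s \<le> T" for s t
    unfolding k_def using that by (intro cSUP_upper bdd) auto
  show le: "k t \<le> C" if "0 \<le> t" "t \<le> T" "\<And>s. t \<le> s \<Longrightarrow> s \<le> T \<Longrightarrow> g s \<le> C" for t C
    unfolding k_def using that by (intro cSUP_least) auto
  show mono: "k s \<le> k t" if "0 \<le> t" "t \<le> s" "s \<le> T" for s t
    by (rule le) (use that in \<open>auto intro!: ge\<close>)
  show "k T = g T" by (simp add: k_def)
  show "continuous_on {0..T} k"
  proof (rule uniformly_continuous_imp_continuous)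
    have u: "uniformly_continuous_on {0..T} g" by (rule compact_uniformly_continuous[OF g]) simp
    show "uniformly_continuous_on {0..T} k"
      unfolding uniformly_continuous_on_def
    proof (intro allI impI)
      fix e :: real assume e: "0 < e"
      obtain d where d: "d > 0" "\<And>s t. s \<in> {0..T} \<Longrightarrow> t \<in> {0..T} \<Longrightarrow> dist t s < d \<Longrightarrow> dist (g t) (g s) < e / 2"
        using u e unfolding uniformly_continuous_on_def by (metis half_gt_zero)
      have 1: "k s \<le> k t \<and> k t \<le> k s + e / 2" if st: "0 \<le> t" "t \<le> s" "s \<le> T" "s - t < d" for s t
      proof
        show "k s \<le> k t" using mono st by simp
        show "k t \<le> k s + e / 2"
        proof (rule le)
          fix r assume r: "t \<le> r" "r \<le> T"
          show "g r \<le> k s + e / 2"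
          proof (cases "s \<le> r")
            case True
            then show ?thesis using ge[of s r] r st e by simp
          next
            case False
            then have "dist (g r) (g s) < e / 2" using d(2)[of s r] r st by (simp add: dist_real_def)
            then have "g r - g s < e / 2" using abs_ge_self[of "g r - g s"] unfolding dist_real_def by linarith
            then show ?thesis using ge[of s s] st by linarith
          qed
        qed (use st in auto)
      qed
      have "dist (k t) (k s) < e" if "s \<in> {0..T}" "t \<in> {0..T}" "dist t s < d" for s t
      proof (cases "t \<le> s")
        case True
        then show ?thesis using 1[of t s] that e by (auto simp: dist_real_def)
      next
        case False
        then show ?thesis using 1[of s t] that e by (auto simp: dist_real_def)
      qed
      then show "\<exists>d>0. \<forall>x\<in>{0..T}. \<forall>x'\<in>{0..T}. dist x' x < d \<longrightarrow> dist (k x') (k x) < e"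
        using d(1) by blast
    qed
  qed
qed

text \<open>If \<open>k' t\<close> exceeded \<open>k t + D\<close>, let r be the first time from t
  on with \<open>k' \<le> k + D\<close>. Before r, \<open>h' + k'\<close> lies strictly above
  \<open>h + k\<close>, hence above the obstacle, so \<open>k'\<close> is constant up to r; then
  \<open>k' t = k' r \<le> k r + D \<le> k t + D\<close>. Minimality is used for \<open>k'\<close>
  and the constraint for \<open>k\<close>, so exchanging the roles gives the two-sided
  bound.\<close>

lemma reflection_comparison:
  fixes h h' k k' u :: "real \<Rightarrow> real"
  assumes tT: "t \<in> {0..T}" and k: "continuous_on {0..T} k" "\<And>s r. 0 \<le> s \<Longrightarrow> s \<le> r \<Longrightarrow> r \<le> T \<Longrightarrow> k r \<le> k s" "k T = 0"
    and k': "continuous_on {0..T} k'" "k' T = 0"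
    and obst: "\<And>s. s \<in> {0..T} \<Longrightarrow> u s \<le> h s + k s"
    and flat: "\<And>a b. 0 \<le> a \<Longrightarrow> a \<le> b \<Longrightarrow> b \<le> T \<Longrightarrow> (\<And>s. s \<in> {a..b} \<Longrightarrow> u s < h' s + k' s) \<Longrightarrow> k' a = k' b"
    and D: "\<And>s. s \<in> {t..T} \<Longrightarrow> h s - h' s \<le> D" "0 \<le> D"
  shows "k' t \<le> k t + D"
proof (rule ccontr)
  assume "\<not> k' t \<le> k t + D"
  then have gt: "k' t > k t + D" by simp
  define S where "S = {t..T} \<inter> (\<lambda>s. k' s - k s) -` {..D}"
  have c: "continuous_on {t..T} (\<lambda>s. k' s - k s)"
    using tT by (intro continuous_intros continuous_on_subset[OF k(1)] continuous_on_subset[OF k'(1)]) auto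
  have "closed S" unfolding S_def by (rule continuous_closed_preimage[OF c]) auto
  then have comp: "compact S" unfolding compact_eq_bounded_closed by (auto simp: S_def intro: bounded_subset[of "{t..T}"])
  have "T \<in> S" using k(3) k'(2) D(2) tT by (simp add: S_def)
  then obtain r where r: "r \<in> S" "\<And>s. s \<in> S \<Longrightarrow> r \<le> s" using compact_attains_inf[OF comp] by blast
  have rT: "t \<le> r" "r \<le> T" "k' r \<le> k r + D" using r(1) by (auto simp: S_def)
  have tr: "t < r" using rT gt by (cases "t = r") auto
  have const: "k' t = k' s" if s: "t \<le> s" "s < r" for s
  proof (rule flat)
    fix q assume q: "q \<in> {t..s}"
    then have "q \<notin> S" using r(2)[of q] s by auto
    then have "k' q > k q + D" using q s rT by (auto simp: S_def)
    moreover have "u q \<le> h q + k q" using q s rT tT by (intro obst) auto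
    moreover have "h q - h' q \<le> D" using q s rT by (intro D) auto
    ultimately show "u q < h' q + k' q" by linarith
  qed (use s rT tT in auto)
  define s where "s n = r - (r - t) / real (Suc n)" for n
  have s_lim: "s \<longlonglongrightarrow> r"
  proof -
    have "s \<longlonglongrightarrow> r - 0"
      unfolding s_def by (intro tendsto_intros LIMSEQ_Suc[of "\<lambda>n. (r - t) / real n"] lim_const_over_n)
    then show ?thesis by simp
  qed
  have s: "t \<le> s n" "s n < r" for n
  proof -
    have "(r - t) / real (Suc n) \<le> (r - t) / 1" using tr by (intro divide_left_mono) auto
    then show "t \<le> s n" by (simp add: s_def)
    show "s n < r" using tr by (simp add: s_def)
  qed
  have sT: "s n \<in> {0..T}" for n using s[of n] rT tT by auto
  have "(\<lambda>n. k' (s n)) \<longlonglongrightarrow> k' r"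
    by (rule continuous_on_tendsto_compose[OF k'(1) s_lim]) (use rT tT sT in auto)
  moreover have "k' (s n) = k' t" for n using const[OF s] by simp
  ultimately have "k' t = k' r" by (simp add: LIMSEQ_const_iff)
  also have "\<dots> \<le> k r + D" by (rule rT)
  also have "\<dots> \<le> k t + D" using k(2)[of t r] rT tT by simp
  finally show False using gt by simp
qed

section \<open>The Skorokhod condition as local constancy\<close>

locale increasing_path =
  fixes T :: real and K :: "real \<Rightarrow> real"
  assumes T_nonneg: "0 \<le> T" and K_cont: "continuous_on {0..T} K" and K_mono: "mono_on {0..T} K"
begin

abbreviation clip :: "real \<Rightarrow> real" where "clip t \<equiv> max 0 (min T t)"

abbreviation \<mu> :: "real measure" where "\<mu> \<equiv> interval_measure (\<lambda>t. K (clip t))"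

lemma clip_in: "clip t \<in> {0..T}" using T_nonneg by auto

lemma clip_id: "t \<in> {0..T} \<Longrightarrow> clip t = t" by auto

lemma K_clip_mono: "x \<le> y \<Longrightarrow> K (clip x) \<le> K (clip y)"
  by (rule mono_onD[OF K_mono clip_in clip_in]) auto

lemma emeasure_Ioc: "a \<le> b \<Longrightarrow> emeasure \<mu> {a<..b} = ennreal (K (clip b) - K (clip a))"
proof (rule emeasure_interval_measure_Ioc)
  show "continuous (at_right a) (\<lambda>t. K (clip t))" for a
    by (rule continuous_on_imp_continuous_within[of UNIV])
      (auto intro!: continuous_on_compose2[OF K_cont] continuous_intros clip_in simp: T_nonneg)
qed (auto intro: K_clip_mono)

text \<open>A nonnegative integrand with zero integral vanishes almost everywhere, so the Stieltjes
  measure does not charge \<open>{a<..b}\<close>, and its mass there is \<open>K b - K a\<close>.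
  This converts the integral condition into the form used for comparison.\<close>

lemma flat_imp_constant:
  fixes \<phi> :: "real \<Rightarrow> real"
  assumes \<phi>: "continuous_on {0..T} \<phi>" "\<And>t. t \<in> {0..T} \<Longrightarrow> 0 \<le> \<phi> t"
    and flat: "(LINT t:{0..T}|\<mu>. \<phi> t) = 0" and ab: "0 \<le> a" "a \<le> b" "b \<le> T"
    and pos: "\<And>t. t \<in> {a..b} \<Longrightarrow> 0 < \<phi> t"
  shows "K a = K b"
proof -
  have "compact (\<phi> ` {0..T})" by (rule compact_continuous_image[OF \<phi>(1)]) simp
  then have "\<exists>C. \<forall>t\<in>{0..T}. \<bar>\<phi> t\<bar> \<le> C"
    using compact_imp_bounded[of "\<phi> ` {0..T}"] unfolding bounded_iff by auto
  then obtain C where C: "\<And>t. t \<in> {0..T} \<Longrightarrow> \<bar>\<phi> t\<bar> \<le> C" by blast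
  have meas: "(\<lambda>t. indicat_real {0..T} t *\<^sub>R \<phi> t) \<in> borel_measurable borel"
    using \<phi>(1) borel_measurable_continuous_on_indicator[of "{0..T}" \<phi>] by simp
  \<comment> \<open>The measure is computed on intervals open on the left; starting at -1 includes
    the point 0 without adding mass.\<close>
  have sub: "{0..T} \<subseteq> {-1<..T}" by auto
  have fin: "emeasure \<mu> {0..T} < \<infinity>"
    using le_less_trans[OF emeasure_mono[OF sub, of \<mu>]] emeasure_Ioc[of "-1" T] T_nonneg by simp
  have int: "integrable \<mu> (\<lambda>t. indicat_real {0..T} t *\<^sub>R \<phi> t)"
  proof (rule Bochner_Integration.integrable_bound)
    show "integrable \<mu> (\<lambda>t. indicat_real {0..T} t *\<^sub>R C)"
      using fin by (intro integrable_scaleR_left) (auto simp: integrable_indicator_iff)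
    show "AE t in \<mu>. norm (indicat_real {0..T} t *\<^sub>R \<phi> t) \<le> norm (indicat_real {0..T} t *\<^sub>R C)"
      using C by (auto simp: indicator_def intro: order_trans[OF _ abs_ge_self])
  qed (use meas in simp)
  have "AE t in \<mu>. indicat_real {0..T} t *\<^sub>R \<phi> t = 0"
    using flat integral_nonneg_eq_0_iff_AE[OF int] \<phi>(2) unfolding set_lebesgue_integral_def
    by (auto simp: indicator_def)
  then have "AE t in \<mu>. t \<notin> {a<..b}"
  proof eventually_elim
    case (elim t)
    show ?case using elim pos[of t] ab by (auto simp: indicator_def split: if_splits)
  qed
  then have "emeasure \<mu> {a<..b} = 0" by (subst (asm) AE_iff_measurable[of "{a<..b}"]) auto
  then have "K b - K a \<le> 0" using emeasure_Ioc[OF ab(2)] ab by (simp add: clip_id ennreal_eq_0_iff)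
  moreover have "K a \<le> K b" by (rule mono_onD[OF K_mono]) (use ab in auto)
  ultimately show ?thesis by simp
qed

text \<open>A Lindelof argument: each point with \<open>\<phi> t \<noteq> 0\<close> lies in an
  interval with rational ends on which the clipped path has no increase. There are countably many
  such intervals, all of measure zero.\<close>

lemma locally_constant_imp_flat:
  fixes \<phi> :: "real \<Rightarrow> real"
  assumes loc: "\<And>t. t \<in> {0..T} \<Longrightarrow> \<phi> t \<noteq> 0 \<Longrightarrow> \<exists>d>0. \<forall>s\<in>{0..T}. \<bar>s - t\<bar> < d \<longrightarrow> K s = K t"
  shows "(LINT t:{0..T}|\<mu>. \<phi> t) = 0"
proof -
  define R where "R = {(p, q). p \<in> \<rat> \<and> q \<in> \<rat> \<and> p \<le> q \<and> K (clip p) = K (clip q)}"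
  have "R \<subseteq> \<rat> \<times> \<rat>" by (auto simp: R_def)
  then have count: "countable R" by (rule countable_subset) (intro countable_SIGMA countable_rat)
  have "AE t in \<mu>. \<forall>x\<in>R. t \<notin> {fst x<..snd x}"
  proof (rule AE_ball_countable[OF count, THEN iffD2], rule)
    fix x assume "x \<in> R"
    then have "emeasure \<mu> {fst x<..snd x} = 0" using emeasure_Ioc[of "fst x" "snd x"] by (auto simp: R_def)
    then show "AE t in \<mu>. t \<notin> {fst x<..snd x}" by (subst AE_iff_measurable[of "{fst x<..snd x}"]) auto
  qed
  then have "AE t in \<mu>. indicat_real {0..T} t *\<^sub>R \<phi> t = 0"
  proof eventually_elim
    case (elim t)
    show ?case
    proof (rule ccontr)
      assume "indicat_real {0..T} t *\<^sub>R \<phi> t \<noteq> 0"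
      then have t: "t \<in> {0..T}" "\<phi> t \<noteq> 0" by (auto simp: indicator_def split: if_splits)
      obtain d where d: "d > 0" "\<And>s. s \<in> {0..T} \<Longrightarrow> \<bar>s - t\<bar> < d \<Longrightarrow> K s = K t" using loc[OF t] by blast
      obtain p where p: "p \<in> \<rat>" "t - d < p" "p < t" using Rats_dense_in_real[of "t - d" t] d(1) by auto
      obtain q where q: "q \<in> \<rat>" "t < q" "q < t + d" using Rats_dense_in_real[of t "t + d"] d(1) by auto
      have "K (clip p) = K t" by (rule d(2)[OF clip_in]) (use p t in \<open>auto simp: abs_if max_def min_def\<close>)
      moreover have "K (clip q) = K t" by (rule d(2)[OF clip_in]) (use q t in \<open>auto simp: abs_if max_def min_def\<close>)
      ultimately have "(p, q) \<in> R" using p q by (auto simp: R_def)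
      then show False using elim p q by force
    qed
  qed
  then show ?thesis unfolding set_lebesgue_integral_def by (rule integral_eq_zero_AE)
qed

end

text \<open>Where the constraint is strict, the running supremum is not attained nearby, so it is
  locally constant and \<open>K\<close> does not grow. The terminal condition gives
  \<open>k T = 0\<close>, which makes \<open>K T - K t\<close> equal to the running supremum
  \<open>k t\<close>.\<close>

lemma reflection_exists:
  fixes u h :: "real \<Rightarrow> real"
  assumes T: "0 < T" and u: "continuous_on {0..T} u" and h: "continuous_on {0..T} h" and uT: "u T \<le> h T"
  obtains K where "continuous_on {0..T} K" "mono_on {0..T} K" "K 0 = 0"
    "\<And>t. t \<in> {0..T} \<Longrightarrow> u t \<le> h t + (K T - K t)"
    "(LINT t:{0..T}|interval_measure (\<lambda>t. K (max 0 (min T t))). h t + (K T - K t) - u t) = 0"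
proof -
  define g where "g t = max 0 (u t - h t)" for t
  define k where "k t = (SUP s\<in>{t..T}. g s)" for t
  define K where "K t = k 0 - k t" for t
  have gc: "continuous_on {0..T} g" unfolding g_def by (intro continuous_intros u h)
  note R = running_sup[OF less_imp_le[OF T] gc, folded k_def]
  have kT: "k T = 0" using R(4) uT by (simp add: g_def)
  have k0: "0 \<le> k t" if "t \<in> {0..T}" for t using R(1)[of t t] that by (simp add: g_def)
  have KT: "K T - K t = k t" for t by (simp add: K_def kT)
  have Kc: "continuous_on {0..T} K" unfolding K_def by (intro continuous_intros R(5))
  have Km: "mono_on {0..T} K" unfolding K_def by (rule mono_onI) (use R(3) in auto)
  interpret K: increasing_path T K by standard (use T Kc Km in auto)
  have obst: "u t \<le> h t + (K T - K t)" if "t \<in> {0..T}" for t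
    unfolding KT using R(1)[of t t] that by (simp add: g_def)
  have "(LINT t:{0..T}|K.\<mu>. h t + (K T - K t) - u t) = 0"
  proof (rule K.locally_constant_imp_flat)
    fix t assume t: "t \<in> {0..T}" and "h t + (K T - K t) - u t \<noteq> 0"
    then have pos: "u t - h t < k t" using obst[OF t] by (simp add: KT)
    \<comment> \<open>The gap to the obstacle at t; continuity of \<open>u - h\<close> keeps nearby
      values below \<open>k t\<close>.\<close>
    define e where "e = k t - (u t - h t)"
    have e: "e > 0" using pos by (simp add: e_def)
    have "continuous_on {0..T} (\<lambda>s. u s - h s)" by (intro continuous_intros u h)
    then obtain d where d: "d > 0" "\<And>s. s \<in> {0..T} \<Longrightarrow> dist s t < d \<Longrightarrow> dist (u s - h s) (u t - h t) < e"
      using t e unfolding continuous_on_iff by metis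
    have small: "g s \<le> k t" "k t > 0 \<Longrightarrow> g s < k t" if s: "s \<in> {0..T}" "\<bar>s - t\<bar> < d" for s
    proof -
      have "u s - h s < (u t - h t) + e" using d(2)[OF s(1)] s(2) by (simp add: dist_real_def)
      then have "u s - h s < k t" by (simp add: e_def)
      then show "g s \<le> k t" "k t > 0 \<Longrightarrow> g s < k t" using k0[OF t] by (auto simp: g_def)
    qed
    have "k s = k t" if s: "s \<in> {0..T}" "\<bar>s - t\<bar> < d" for s
    proof (cases "s \<le> t")
      case True
      have "k s \<le> k t"
      proof (rule R(2))
        fix r assume r: "s \<le> r" "r \<le> T"
        show "g r \<le> k t"
        proof (cases "t \<le> r")
          case True
          then show ?thesis using R(1)[of t r] r t by simp
        next
          case False
          then show ?thesis using small(1)[of r] r s t by auto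
        qed
      qed (use s in auto)
      then show ?thesis using R(3)[of s t] s t True by auto
    next
      case False
      show ?thesis
      proof (rule ccontr)
        assume "k s \<noteq> k t"
        then have lt: "k s < k t" using R(3)[of t s] False s t by auto
        have kt: "k t > 0" using lt k0[OF s(1)] by simp
        have "continuous_on {t..s} g" by (rule continuous_on_subset[OF gc]) (use s t in auto)
        then obtain m where m: "m \<in> {t..s}" "\<And>r. r \<in> {t..s} \<Longrightarrow> g r \<le> g m"
          using continuous_attains_sup[of "{t..s}" g] False by auto
        \<comment> \<open>On the compact interval \<open>{t..s}\<close> the supremum is attained and
          hence strictly below \<open>k t\<close>; values after \<open>s\<close> are at most
          \<open>k s\<close>, again strictly below. So \<open>k t\<close> would be smaller than
          itself.\<close>
        have "g m < k t" by (rule small(2)[OF _ _ kt]) (use m s t in auto)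
        then have "max (g m) (k s) < k t" using lt by simp
        moreover have "k t \<le> max (g m) (k s)"
        proof (rule R(2))
          fix r assume r: "t \<le> r" "r \<le> T"
          show "g r \<le> max (g m) (k s)"
          proof (cases "r \<le> s")
            case True
            then show ?thesis using m(2)[of r] r by auto
          next
            case False
            then show ?thesis using R(1)[of s r] r s by auto
          qed
        qed (use t in auto)
        ultimately show False by (metis leD)
      qed
    qed
    then show "\<exists>d>0. \<forall>s\<in>{0..T}. \<bar>s - t\<bar> < d \<longrightarrow> K s = K t" using d(1) by (auto simp: K_def)
  qed
  then show thesis using that[of K] Kc Km obst by (simp add: K_def)
qed

section \<open>Square-integrable processes\<close>

context brownian
begin

lemma S2I:
  assumes "adapted_process F T Y" "continuous_process M T Y" "integrable M D"
    and "AE \<omega> in M. \<forall>t\<in>{0..T}. \<bar>Y t \<omega>\<bar>\<^sup>2 \<le> D \<omega>"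
  shows "Y \<in> S2 M F T"
proof -
  have "(\<integral>\<^sup>+\<omega>. (SUP t\<in>{0..T}. ennreal (\<bar>Y t \<omega>\<bar>\<^sup>2)) \<partial>M) \<le> (\<integral>\<^sup>+\<omega>. ennreal (norm (D \<omega>)) \<partial>M)"
    by (rule nn_integral_mono_AE)
      (use assms(4) in \<open>eventually_elim, auto intro!: SUP_least ennreal_leI intro: order_trans[OF _ abs_ge_self]\<close>)
  also have "\<dots> < \<infinity>" using assms(3) by (simp add: integrable_iff_bounded)
  finally show ?thesis using assms(1,2) by (simp add: S2_def)
qed

text \<open>The supremum in \<open>S2\<close> is replaced by one over a countable dense grid, which
  is measurable, and paths are controlled by it through continuity. The result is a real integrable
  majorant, ready for dominated convergence.\<close>

lemma S2_majorant:
  assumes "Y \<in> S2 M F T"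
  obtains D where "integrable M D" "AE \<omega> in M. \<forall>t\<in>{0..T}. \<bar>Y t \<omega>\<bar>\<^sup>2 \<le> D \<omega>"
proof -
  have ad: "Y t \<in> borel_measurable M" if "t \<in> {0..T}" for t
    by (rule measurable_F_imp[of _ t]) (use assms that in \<open>auto simp: S2_def adapted_process_def\<close>)
  have cont: "\<And>\<omega>. \<omega> \<in> space M \<Longrightarrow> continuous_on {0..T} (\<lambda>t. Y t \<omega>)"
    and fin: "(\<integral>\<^sup>+\<omega>. (SUP t\<in>{0..T}. ennreal (\<bar>Y t \<omega>\<bar>\<^sup>2)) \<partial>M) < \<infinity>"
    using assms by (auto simp: S2_def continuous_process_def)
  define G where "G = (\<lambda>(n, k). real k * (T / real (Suc n))) ` (SIGMA n:UNIV. {..Suc n})"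
  have G: "countable G" unfolding G_def by (intro countable_image countable_SIGMA) auto
  have GT: "G \<subseteq> {0..T}"
  proof -
    have "real k * (T / real (Suc n)) \<le> real (Suc n) * (T / real (Suc n))" if "k \<le> Suc n" for k n
      by (rule mult_right_mono) (use that T_pos in auto)
    then show ?thesis using T_pos by (auto simp: G_def simp del: of_nat_Suc)
  qed
  define W where "W \<omega> = (SUP t\<in>G. ennreal (\<bar>Y t \<omega>\<bar>\<^sup>2))" for \<omega>
  have Wm: "W \<in> borel_measurable M" unfolding W_def
    by (rule borel_measurable_SUP[OF G]) (use ad GT in \<open>auto intro!: measurable_compose[OF _ measurable_ennreal]\<close>)
  have "(\<integral>\<^sup>+\<omega>. W \<omega> \<partial>M) \<le> (\<integral>\<^sup>+\<omega>. (SUP t\<in>{0..T}. ennreal (\<bar>Y t \<omega>\<bar>\<^sup>2)) \<partial>M)"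
    unfolding W_def by (intro nn_integral_mono SUP_subset_mono GT) auto
  then have Wfin: "(\<integral>\<^sup>+\<omega>. W \<omega> \<partial>M) < \<infinity>" using fin by (rule le_less_trans)
  have le: "ennreal (\<bar>Y t \<omega>\<bar>\<^sup>2) \<le> W \<omega>" if w: "\<omega> \<in> space M" and t: "t \<in> {0..T}" for t \<omega>
  proof -
    obtain k where k: "\<forall>n. k n \<le> Suc n" "(\<lambda>n. real (k n) * (T / real (Suc n))) \<longlonglongrightarrow> t"
      using grid_approx[OF t] by blast
    let ?r = "\<lambda>n. real (k n) * (T / real (Suc n))"
    have r: "?r n \<in> G" for n unfolding G_def by (rule image_eqI[of _ _ "(n, k n)"]) (use k(1) in auto)
    have "(\<lambda>n. Y (?r n) \<omega>) \<longlonglongrightarrow> Y t \<omega>"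
      by (rule continuous_on_tendsto_compose[OF cont[OF w] k(2) t], rule always_eventually, rule, rule subsetD[OF GT r])
    then have "(\<lambda>n. ennreal (\<bar>Y (?r n) \<omega>\<bar>\<^sup>2)) \<longlonglongrightarrow> ennreal (\<bar>Y t \<omega>\<bar>\<^sup>2)"
      by (intro tendsto_ennrealI tendsto_power tendsto_rabs)
    then show ?thesis
      by (rule LIMSEQ_le_const2) (intro exI[of _ 0] allI impI, unfold W_def, rule SUP_upper[OF r])
  qed
  have "AE \<omega> in M. W \<omega> \<noteq> \<infinity>" by (rule nn_integral_PInf_AE[OF Wm]) (use Wfin in simp)
  then have ae: "AE \<omega> in M. \<forall>t\<in>{0..T}. \<bar>Y t \<omega>\<bar>\<^sup>2 \<le> enn2real (W \<omega>)"
    using AE_space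
  proof eventually_elim
    case (elim \<omega>)
    then have W: "W \<omega> = ennreal (enn2real (W \<omega>))" by (simp add: top.not_eq_extremum)
    show ?case
    proof
      fix t assume "t \<in> {0..T}"
      then have "ennreal (\<bar>Y t \<omega>\<bar>\<^sup>2) \<le> ennreal (enn2real (W \<omega>))" using le[OF elim(2)] W by simp
      then show "\<bar>Y t \<omega>\<bar>\<^sup>2 \<le> enn2real (W \<omega>)" by (subst (asm) ennreal_le_iff) auto
    qed
  qed
  have "integrable M (\<lambda>\<omega>. enn2real (W \<omega>))"
  proof (rule integrableI_bounded)
    have "(\<integral>\<^sup>+\<omega>. ennreal (norm (enn2real (W \<omega>))) \<partial>M) \<le> (\<integral>\<^sup>+\<omega>. W \<omega> \<partial>M)"
      by (intro nn_integral_mono) (simp add: ennreal_enn2real_if)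
    then show "(\<integral>\<^sup>+\<omega>. ennreal (norm (enn2real (W \<omega>))) \<partial>M) < \<infinity>" using Wfin by (rule le_less_trans)
  qed (use Wm in measurable)
  then show thesis using that ae by blast
qed

lemma S2D:
  assumes Y: "Y \<in> S2 M F T"
  shows "\<And>t. t \<in> {0..T} \<Longrightarrow> Y t \<in> borel_measurable (F t)" "\<And>\<omega>. \<omega> \<in> space M \<Longrightarrow> continuous_on {0..T} (\<lambda>t. Y t \<omega>)"
    "\<And>t. t \<in> {0..T} \<Longrightarrow> square_integrable M (Y t)"
    "(\<lambda>(\<omega>, s). Y s \<omega>) \<in> borel_measurable Prog" "square_integrable Q (\<lambda>(\<omega>, s). Y s \<omega>)"
    "continuous_on {0..T} (\<lambda>t. expectation (Y t))"
proof -
  have ad: "adapted_process F T Y" and cont: "continuous_process M T Y" using Y by (auto simp: S2_def)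
  then show F: "\<And>t. t \<in> {0..T} \<Longrightarrow> Y t \<in> borel_measurable (F t)"
    and c: "\<And>\<omega>. \<omega> \<in> space M \<Longrightarrow> continuous_on {0..T} (\<lambda>t. Y t \<omega>)"
    by (auto simp: adapted_process_def continuous_process_def)
  have YM: "Y t \<in> borel_measurable M" if "t \<in> {0..T}" for t
    by (rule measurable_F_imp[OF F[OF that]]) (use that in simp)
  show P: "(\<lambda>(\<omega>, s). Y s \<omega>) \<in> borel_measurable Prog" by (rule progressive_continuous[OF ad cont])
  have YQ: "(\<lambda>(\<omega>, s). Y s \<omega>) \<in> borel_measurable Q" by (rule measurable_from_subalg[OF subalgebra_Prog P])
  obtain D where D: "integrable M D" "AE \<omega> in M. \<forall>t\<in>{0..T}. \<bar>Y t \<omega>\<bar>\<^sup>2 \<le> D \<omega>" using S2_majorant[OF Y] .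
  have bd: "AE \<omega> in M. \<bar>Y t \<omega>\<bar>\<^sup>2 \<le> D \<omega>" if "t \<in> {0..T}" for t
    using D(2) by eventually_elim (use that in blast)
  show sq: "square_integrable M (Y t)" if t: "t \<in> {0..T}" for t
    unfolding square_integrable_def
  proof (intro conjI YM t)
    show "integrable M (\<lambda>\<omega>. (norm (Y t \<omega>))\<^sup>2)"
      by (rule Bochner_Integration.integrable_bound[OF D(1)])
        (use YM[OF t] bd[OF t] in \<open>auto elim!: eventually_mono\<close>)
  qed
  show "square_integrable Q (\<lambda>(\<omega>, s). Y s \<omega>)"
    unfolding square_integrable_iff_nn_integral
  proof (intro conjI YQ)
    have "(\<integral>\<^sup>+x. ennreal ((norm (case x of (\<omega>, s) \<Rightarrow> Y s \<omega>))\<^sup>2) \<partial>Q) = (\<integral>\<^sup>+s. \<integral>\<^sup>+\<omega>. ennreal (\<bar>Y s \<omega>\<bar>\<^sup>2) \<partial>M \<partial>L)"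
      by (subst Qp.nn_integral_snd[symmetric]) (use YQ in \<open>auto simp: case_prod_unfold\<close>)
    also have "\<dots> \<le> (\<integral>\<^sup>+s. (\<integral>\<^sup>+\<omega>. ennreal (norm (D \<omega>)) \<partial>M) \<partial>L)"
    proof (rule nn_integral_mono)
      fix s assume "s \<in> space L"
      then have s: "s \<in> {0..T}" by (simp add: space_L)
      show "(\<integral>\<^sup>+\<omega>. ennreal (\<bar>Y s \<omega>\<bar>\<^sup>2) \<partial>M) \<le> (\<integral>\<^sup>+\<omega>. ennreal (norm (D \<omega>)) \<partial>M)"
        by (rule nn_integral_mono_AE) (use bd[OF s] in \<open>eventually_elim, auto intro!: ennreal_leI\<close>)
    qed
    also have "\<dots> < \<infinity>"
      using D(1) less_top[THEN iffD1, OF Lm.emeasure_finite]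
      by (simp add: integrable_iff_bounded ennreal_mult_less_top space_L)
    finally show "(\<integral>\<^sup>+x. ennreal ((norm (case x of (\<omega>, s) \<Rightarrow> Y s \<omega>))\<^sup>2) \<partial>Q) < \<infinity>" .
  qed
  show "continuous_on {0..T} (\<lambda>t. expectation (Y t))"
    unfolding continuous_on_sequentially comp_def
  proof (intro ballI allI impI, elim conjE)
    fix t r assume t: "t \<in> {0..T}" and r: "\<forall>n. r n \<in> {0..T}" "r \<longlonglongrightarrow> t"
    show "(\<lambda>n. expectation (Y (r n))) \<longlonglongrightarrow> expectation (Y t)"
    proof (rule integral_dominated_convergence)
      show "Y t \<in> borel_measurable M" "\<And>n. Y (r n) \<in> borel_measurable M" using YM t r by auto
      \<comment> \<open>\<open>D\<close> bounds squares, and \<open>|y| \<le> 1 + y\<^sup>2\<close>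
        turns it into a bound for the values themselves.\<close>
      show "integrable M (\<lambda>\<omega>. 1 + D \<omega>)" using D(1) by simp
      show "AE \<omega> in M. (\<lambda>n. Y (r n) \<omega>) \<longlonglongrightarrow> Y t \<omega>"
        by (rule AE_I2, rule continuous_on_tendsto_compose[OF c r(2) t]) (use r in auto)
      fix n
      show "AE \<omega> in M. norm (Y (r n) \<omega>) \<le> 1 + D \<omega>"
        using bd[OF r(1)[rule_format, of n]]
      proof eventually_elim
        case (elim \<omega>)
        have "\<bar>Y (r n) \<omega>\<bar> \<le> 1 + \<bar>Y (r n) \<omega>\<bar>\<^sup>2"
          using sum_squares_bound[of 1 "\<bar>Y (r n) \<omega>\<bar>"] abs_ge_zero[of "Y (r n) \<omega>"] unfolding one_power2 by linarith
        then show ?case using elim by simp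
      qed
    qed
  qed
qed

section \<open>Time integrals of drivers\<close>

text \<open>The complete space on which the contraction acts. Progressive measurability is part of
  it because it makes time integrals adapted and the drift at time s orthogonal to later martingale
  increments.\<close>

definition driver :: "('a \<times> real \<Rightarrow> real) \<Rightarrow> bool" where
  "driver C \<longleftrightarrow> C \<in> borel_measurable Prog \<and> square_integrable Q C"

definition tail_integral :: "('a \<times> real \<Rightarrow> real) \<Rightarrow> real \<Rightarrow> 'a \<Rightarrow> real" where
  "tail_integral C t \<omega> = (LINT s:{t..T}|lborel. C (\<omega>, s))"

lemma tail_integral_eq:
  assumes "0 \<le> t"
  shows "tail_integral C t \<omega> = (\<integral>s. indicat_real {t..} s * C (\<omega>, s) \<partial>L)"
  unfolding tail_integral_def set_lebesgue_integral_def
  by (subst integral_restrict_space) (use assms in \<open>auto intro!: Bochner_Integration.integral_cong simp: indicator_def\<close>)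

lemma measurable_section_L:
  assumes "C \<in> measurable Q N" "\<omega> \<in> space M"
  shows "(\<lambda>s. C (\<omega>, s)) \<in> measurable L N"
  by (rule measurable_Pair2[OF assms])

lemma driver_good:
  assumes "driver C"
  shows "AE \<omega> in M. integrable L (\<lambda>s. C (\<omega>, s)) \<and> integrable L (\<lambda>s. (C (\<omega>, s))\<^sup>2)"
proof -
  have "integrable Q C" "integrable Q (\<lambda>x. (C x)\<^sup>2)"
    using assms Qm.square_integrable_integrable square_integrableD(2)[of Q C] by (auto simp: driver_def)
  from Qp.AE_integrable_fst'[OF this(1)] Qp.AE_integrable_fst'[OF this(2)]
  show ?thesis by eventually_elim simp
qed

lemma measurable_indicator_L [measurable]: "A \<in> sets borel \<Longrightarrow> (\<lambda>s. indicat_real A s) \<in> borel_measurable L"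
  by (intro measurable_restrict_space1) simp

lemma tail_integral_square_le:
  assumes "integrable L (\<lambda>s. C (\<omega>, s))" "integrable L (\<lambda>s. (C (\<omega>, s))\<^sup>2)" "0 \<le> t"
  shows "(tail_integral C t \<omega>)\<^sup>2 \<le> T * (\<integral>s. (C (\<omega>, s))\<^sup>2 \<partial>L)"
proof -
  have C: "square_integrable L (\<lambda>s. C (\<omega>, s))" using assms by (auto simp: square_integrable_def)
  have ind: "square_integrable L (\<lambda>s. indicat_real {t..} s)"
  proof (rule Lm.square_integrable_bounded[where C=1])
    show "(\<lambda>s. indicat_real {t..} s) \<in> borel_measurable L" by (rule measurable_indicator_L) simp
  qed (simp add: indicator_def)
  have l1: "l2_norm L (\<lambda>s. indicat_real {t..} s) \<le> sqrt T"
  proof -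
    have "l2_norm L (\<lambda>s. indicat_real {t..} s) \<le> l2_norm L (\<lambda>s. 1 :: real)"
      by (rule square_integrable_bound(2)[OF Lm.square_integrable_const square_integrableD(1)[OF ind]]) (auto simp: indicator_def)
    also have "\<dots> = sqrt T" using T_pos by (simp add: l2_norm_def space_L measure_L)
    finally show ?thesis .
  qed
  have "\<bar>tail_integral C t \<omega>\<bar> \<le> l2_norm L (\<lambda>s. indicat_real {t..} s) * l2_norm L (\<lambda>s. C (\<omega>, s))"
    using integral_Cauchy_Schwarz[OF ind C] unfolding tail_integral_eq[OF assms(3)] by simp
  also have "\<dots> \<le> sqrt T * l2_norm L (\<lambda>s. C (\<omega>, s))" by (rule mult_right_mono[OF l1]) simp
  finally have "\<bar>tail_integral C t \<omega>\<bar>\<^sup>2 \<le> (sqrt T * l2_norm L (\<lambda>s. C (\<omega>, s)))\<^sup>2" by (rule power_mono) simp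
  then show ?thesis using T_pos by (simp add: power_mult_distrib l2_norm_power2)
qed

lemma tail_integral_continuous:
  assumes "integrable L (\<lambda>s. C (\<omega>, s))"
  shows "continuous_on {0..T} (\<lambda>t. tail_integral C t \<omega>)"
proof -
  have s: "set_integrable lborel {0..T} (\<lambda>s. C (\<omega>, s))"
    using assms unfolding set_integrable_def by (subst (asm) integrable_restrict_space) auto
  have eq: "tail_integral C t \<omega> = integral {t..T} (\<lambda>s. C (\<omega>, s))" if "t \<in> {0..T}" for t
    unfolding tail_integral_def
    by (rule set_borel_integral_eq_integral(2)[OF set_integrable_subset[OF s]]) (use that in auto)
  have "continuous_on {0..T} (\<lambda>t. integral {t..T} (\<lambda>s. C (\<omega>, s)))"
    by (rule indefinite_integral_continuous_1'[OF set_borel_integral_eq_integral(1)[OF s]])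
  moreover have "continuous_on {0..T} (\<lambda>t. tail_integral C t \<omega>) = continuous_on {0..T} (\<lambda>t. integral {t..T} (\<lambda>s. C (\<omega>, s)))"
    by (rule continuous_on_cong) (simp_all add: eq)
  ultimately show ?thesis by simp
qed

lemma driver_section:
  assumes "driver C" "t \<in> {0..T}"
  shows "C \<in> borel_measurable (F t \<Otimes>\<^sub>M restrict_space lborel {0..t})"
proof -
  have sets: "sets (F t \<Otimes>\<^sub>M restrict_space lborel {0..t}) = sets (F t \<Otimes>\<^sub>M restrict_space borel {0..t})"
    by (rule sets_pair_measure_cong[OF refl sets_restrict_space_cong[OF sets_lborel]])
  have C: "C \<in> borel_measurable Prog" using assms(1) by (simp add: driver_def)
  show ?thesis
    unfolding measurable_cong_sets[OF sets refl] by (rule progressive_section(2)[OF C assms(2)])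
qed

lemma tail_integral_measurable:
  assumes "driver C" "0 \<le> t"
  shows "tail_integral C t \<in> borel_measurable (F T)"
proof -
  have eq: "tail_integral C t \<omega> = (\<integral>s. indicat_real {t..} s * C (\<omega>, s) \<partial>L)" for \<omega>
    by (rule tail_integral_eq[OF assms(2)])
  have m: "C \<in> borel_measurable (F T \<Otimes>\<^sub>M L)"
    by (rule driver_section[OF assms(1) T_in])
  have "(\<lambda>x. indicat_real {t..} (snd x) * C x) \<in> borel_measurable (F T \<Otimes>\<^sub>M L)"
    using m by measurable
  then show ?thesis
    unfolding eq[abs_def] by (intro Lm.borel_measurable_lebesgue_integral) (simp add: case_prod_unfold)
qed

text \<open>The integral from t onwards is known only at \<open>T\<close>, the integral up to t
  already at t; adaptedness of solutions is read off from this one.\<close>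

lemma head_integral_measurable:
  assumes "driver C" "t \<in> {0..T}"
  shows "(\<lambda>\<omega>. \<integral>s. indicat_real {..t} s * C (\<omega>, s) \<partial>L) \<in> borel_measurable (F t)"
proof -
  let ?L = "restrict_space lborel {0..t}"
  interpret Lt: finite_measure ?L
    by (rule finite_measureI) (use assms in \<open>simp add: emeasure_restrict_space space_restrict_space\<close>)
  have eq: "(\<integral>s. indicat_real {..t} s * C (\<omega>, s) \<partial>L) = (\<integral>s. C (\<omega>, s) \<partial>?L)" for \<omega>
  proof -
    have "(\<integral>s. indicat_real {..t} s * C (\<omega>, s) \<partial>L) = (\<integral>s. indicat_real {0..T} s *\<^sub>R (indicat_real {..t} s * C (\<omega>, s)) \<partial>lborel)"
      by (rule integral_restrict_space) simp
    also have "\<dots> = (\<integral>s. indicat_real {0..t} s *\<^sub>R C (\<omega>, s) \<partial>lborel)"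
      by (rule Bochner_Integration.integral_cong) (use assms(2) in \<open>auto simp: indicator_def\<close>)
    also have "\<dots> = (\<integral>s. C (\<omega>, s) \<partial>?L)"
      by (rule integral_restrict_space[symmetric]) simp
    finally show ?thesis .
  qed
  have m: "C \<in> borel_measurable (F t \<Otimes>\<^sub>M ?L)"
    by (rule driver_section[OF assms])
  show ?thesis
    unfolding eq by (intro Lt.borel_measurable_lebesgue_integral) (use m in \<open>simp add: case_prod_unfold\<close>)
qed

lemma tail_integral_square_integrable:
  assumes C: "driver C" and t: "0 \<le> t"
  shows "square_integrable M (tail_integral C t)"
proof -
  have iQ: "integrable Q (\<lambda>x. (C x)\<^sup>2)" using C square_integrableD(2)[of Q C] by (simp add: driver_def)
  have m: "tail_integral C t \<in> borel_measurable M" by (rule measurable_F_imp[OF tail_integral_measurable[OF assms]]) simp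
  have iM: "integrable M (\<lambda>\<omega>. T * (\<integral>s. (C (\<omega>, s))\<^sup>2 \<partial>L))"
    using Qp.integrable_fst'[OF iQ] by simp
  have "integrable M (\<lambda>\<omega>. (norm (tail_integral C t \<omega>))\<^sup>2)"
  proof (rule Bochner_Integration.integrable_bound[OF iM])
    show "AE \<omega> in M. norm ((norm (tail_integral C t \<omega>))\<^sup>2) \<le> norm (T * (\<integral>s. (C (\<omega>, s))\<^sup>2 \<partial>L))"
      using driver_good[OF C] by eventually_elim (auto intro: order_trans[OF tail_integral_square_le[OF _ _ t] abs_ge_self])
  qed (use m in measurable)
  then show ?thesis using m by (simp add: square_integrable_def)
qed

section \<open>The reflected equation with a given driver\<close>

lemma AE_L_neq: "AE s in L. s \<noteq> t"
  by (subst AE_restrict_space_iff) (use AE_lborel_singleton[of t] in \<open>auto elim!: eventually_mono\<close>)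

end

locale reflected_bsde = brownian M T B F
  for M :: "'a measure" and T :: real and B :: "real \<Rightarrow> 'a \<Rightarrow> real ^ 'd::finite" and F :: "real \<Rightarrow> 'a measure" +
  fixes u :: "real \<Rightarrow> real" and \<xi> :: "'a \<Rightarrow> real"
  assumes u_cont: "continuous_on {0..T} u" and \<xi>_meas: "\<xi> \<in> borel_measurable (F T)"
    and \<xi>_sq: "square_integrable M \<xi>" and terminal: "u T \<le> expectation \<xi>"
begin

text \<open>The reflected equation with the generator frozen to a given process \<open>C\<close>.
  The Ito integral \<open>X\<close> is a parameter so that two solutions can be subtracted with
  their integrals.\<close>

definition driven_solution ::
  "('a \<times> real \<Rightarrow> real) \<Rightarrow> (real \<Rightarrow> 'a \<Rightarrow> real) \<Rightarrow> (real \<Rightarrow> 'a \<Rightarrow> real ^ 'd) \<Rightarrow> (real \<Rightarrow> real) \<Rightarrow> (real \<Rightarrow> 'a \<Rightarrow> real) \<Rightarrow> bool" where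
  "driven_solution C Y Z K X \<longleftrightarrow> Y \<in> S2 M F T \<and> Z \<in> H2 M F T \<and> K \<in> A2_D M F T \<and> has_ito_integral M F T B Z X \<and>
     (AE \<omega> in M. \<forall>t\<in>{0..T}. Y t \<omega> = \<xi> \<omega> + tail_integral C t \<omega> - (X T \<omega> - X t \<omega>) + K T - K t) \<and>
     (\<forall>t\<in>{0..T}. u t \<le> expectation (Y t)) \<and> flatness_condition M T u Y K"

lemma tail_integral_T: "tail_integral C T \<omega> = 0"
  unfolding tail_integral_def set_lebesgue_integral_def
proof (rule integral_eq_zero_AE)
  show "AE s in lborel. indicat_real {T..T} s *\<^sub>R C (\<omega>, s) = 0"
    using AE_lborel_singleton[of T] by eventually_elim (auto simp: indicator_def)
qed

lemma head_integral_eq: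
  assumes "integrable L (\<lambda>s. C (\<omega>, s))" "0 \<le> t"
  shows "(\<integral>s. indicat_real {..t} s * C (\<omega>, s) \<partial>L) = tail_integral C 0 \<omega> - tail_integral C t \<omega>"
proof -
  have i: "integrable L (\<lambda>s. indicat_real A s * C (\<omega>, s))" if "A \<in> sets borel" for A
    by (rule Bochner_Integration.integrable_bound[OF assms(1)])
      (use borel_measurable_integrable[OF assms(1)] measurable_indicator_L[OF that] in \<open>auto simp: indicator_def\<close>)
  have "tail_integral C 0 \<omega> - tail_integral C t \<omega> = (\<integral>s. indicat_real {0..} s * C (\<omega>, s) - indicat_real {t..} s * C (\<omega>, s) \<partial>L)"
    unfolding tail_integral_eq[OF assms(2)] tail_integral_eq[OF order_refl] using i by simp
  also have "\<dots> = (\<integral>s. indicat_real {..t} s * C (\<omega>, s) \<partial>L)"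
  proof (rule integral_cong_AE)
    show "AE s in L. indicat_real {0..} s * C (\<omega>, s) - indicat_real {t..} s * C (\<omega>, s) = indicat_real {..t} s * C (\<omega>, s)"
      using AE_L_neq[of t] AE_space by eventually_elim (auto simp: indicator_def space_L)
  qed (use i in \<open>auto intro!: borel_measurable_integrable Bochner_Integration.integrable_diff\<close>)
  finally show ?thesis by simp
qed

text \<open>For deterministic paths adaptedness and square integrability are automatic, the latter
  because a nondecreasing path from 0 is bounded by \<open>K T\<close>.\<close>

lemma A2_D_iff: "K \<in> A2_D M F T \<longleftrightarrow> continuous_on {0..T} K \<and> mono_on {0..T} K \<and> K 0 = 0"
proof -
  obtain \<omega> where w: "\<omega> \<in> space M" using not_empty by blast
  show ?thesis
  proof
    assume "K \<in> A2_D M F T"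
    then show "continuous_on {0..T} K \<and> mono_on {0..T} K \<and> K 0 = 0"
      using w by (auto simp: A2_D_def A2_def S2_def continuous_process_def)
  next
    assume K: "continuous_on {0..T} K \<and> mono_on {0..T} K \<and> K 0 = 0"
    have b: "\<bar>K t\<bar>\<^sup>2 \<le> (K T)\<^sup>2" if t: "t \<in> {0..T}" for t
    proof -
      have "K 0 \<le> K t" "K t \<le> K T"
        using K t T_pos mono_onD[of "{0..T}" K 0 t] mono_onD[of "{0..T}" K t T] by auto
      then have "\<bar>K t\<bar> \<le> \<bar>K T\<bar>" using K by simp
      then show ?thesis by (metis abs_le_square_iff power2_abs)
    qed
    have "(\<lambda>t \<omega>. K t) \<in> S2 M F T"
      by (rule S2I[of _ "\<lambda>_. (K T)\<^sup>2"])
        (use K b in \<open>auto simp: adapted_process_def continuous_process_def\<close>)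
    then show "K \<in> A2_D M F T" using K by (auto simp: A2_D_def A2_def)
  qed
qed

lemma driven_solution_exists:
  assumes C: "driver C"
  shows "\<exists>Y Z K X. driven_solution C Y Z K X"
proof -
  define \<eta> where "\<eta> \<omega> = \<xi> \<omega> + tail_integral C 0 \<omega>" for \<omega>
  have \<eta>m: "\<eta> \<in> borel_measurable (F T)"
    unfolding \<eta>_def using \<xi>_meas tail_integral_measurable[OF C order_refl] by (rule borel_measurable_add)
  have \<eta>s: "square_integrable M \<eta>"
    unfolding \<eta>_def by (rule square_integrable_add[OF \<xi>_sq tail_integral_square_integrable[OF C order_refl]])
  obtain Z X where Z: "Z \<in> H2 M F T" and X: "has_ito_integral M F T B Z X" and rep: "AE \<omega> in M. \<eta> \<omega> = expectation \<eta> + X T \<omega>"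
    using martingale_representation[OF \<eta>m \<eta>s] .
  note XD = has_ito_integralD[OF Z X]
  \<comment> \<open>On these paths the time integral is continuous; elsewhere the solution is set to
    0, so that all its paths are continuous.\<close>
  define good where "good \<omega> \<longleftrightarrow> integrable L (\<lambda>s. C (\<omega>, s)) \<and> integrable L (\<lambda>s. (C (\<omega>, s))\<^sup>2)" for \<omega>
  have good: "AE \<omega> in M. good \<omega>" unfolding good_def by (rule driver_good[OF C])
  \<comment> \<open>Written forward in time, with the drift subtracted up to t, so that adaptedness
    is visible; the representation of \<open>\<eta>\<close> turns it into the backward
    equation.\<close>
  define y where "y t \<omega> = (if good \<omega> then expectation \<eta> + X t \<omega> - (tail_integral C 0 \<omega> - tail_integral C t \<omega>) else 0)" for t \<omega>
  have yF: "y t \<in> borel_measurable (F t)" if t: "t \<in> {0..T}" for t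
  proof -
    have "(\<lambda>\<omega>. expectation \<eta> + X t \<omega> - (\<integral>s. indicat_real {..t} s * C (\<omega>, s) \<partial>L)) \<in> borel_measurable (F t)"
      using XD(1)[OF t] head_integral_measurable[OF C t] by (intro borel_measurable_diff borel_measurable_add borel_measurable_const)
    then show ?thesis
    proof (rule measurable_F_cong_AE)
      show "AE \<omega> in M. expectation \<eta> + X t \<omega> - (\<integral>s. indicat_real {..t} s * C (\<omega>, s) \<partial>L) = y t \<omega>"
        using good by eventually_elim (use t in \<open>simp add: y_def head_integral_eq good_def\<close>)
    qed simp
  qed
  have ycont: "continuous_on {0..T} (\<lambda>t. y t \<omega>)" if "\<omega> \<in> space M" for \<omega>
  proof (cases "good \<omega>")
    case True
    then show ?thesis
      unfolding y_def by (auto intro!: continuous_intros XD(2)[OF that] tail_integral_continuous simp: good_def)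
  qed (simp add: y_def)
  obtain DX where DX: "integrable M DX" "AE \<omega> in M. \<forall>t\<in>{0..T}. \<bar>X t \<omega>\<bar>\<^sup>2 \<le> DX \<omega>" using S2_majorant[OF XD(5)] .
  \<comment> \<open>\<open>(a + b)\<^sup>2 \<le> 2 * a\<^sup>2 + 2 * b\<^sup>2\<close> is used
    twice, which gives the factors 4; the 8 collects the two tail integrals, each bounded by
    Cauchy-Schwarz in time.\<close>
  define D where "D \<omega> = 4 * (expectation \<eta>)\<^sup>2 + 4 * DX \<omega> + 8 * (T * (\<integral>s. (C (\<omega>, s))\<^sup>2 \<partial>L))" for \<omega>
  have iQ: "integrable Q (\<lambda>x. (C x)\<^sup>2)" using C square_integrableD(2)[of Q C] by (simp add: driver_def)
  have Dint: "integrable M D"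
    unfolding D_def
    by (intro Bochner_Integration.integrable_add integrable_mult_right integrable_const DX(1) Qp.integrable_fst'[OF iQ])
  have yD: "AE \<omega> in M. \<forall>t\<in>{0..T}. \<bar>y t \<omega>\<bar>\<^sup>2 \<le> D \<omega>"
    using good DX(2)
  proof eventually_elim
    case (elim \<omega>)
    show ?case
    proof
      fix t assume t: "t \<in> {0..T}"
      have sq: "(a + b)\<^sup>2 \<le> 2 * a\<^sup>2 + 2 * b\<^sup>2" "(a - b)\<^sup>2 \<le> 2 * a\<^sup>2 + 2 * b\<^sup>2" for a b :: real
        using norm_add_squared_le[of a b] norm_add_squared_le[of a "- b"] by simp_all
      have tl: "(tail_integral C r \<omega>)\<^sup>2 \<le> T * (\<integral>s. (C (\<omega>, s))\<^sup>2 \<partial>L)" if "0 \<le> r" for r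
        using elim(1) that by (auto simp: good_def intro: tail_integral_square_le)
      have "\<bar>y t \<omega>\<bar>\<^sup>2 = ((expectation \<eta> + X t \<omega>) - (tail_integral C 0 \<omega> - tail_integral C t \<omega>))\<^sup>2"
        using elim(1) by (simp add: y_def)
      also have "\<dots> \<le> 2 * (expectation \<eta> + X t \<omega>)\<^sup>2 + 2 * (tail_integral C 0 \<omega> - tail_integral C t \<omega>)\<^sup>2" by (rule sq)
      also have "\<dots> \<le> 2 * (2 * (expectation \<eta>)\<^sup>2 + 2 * (X t \<omega>)\<^sup>2) + 2 * (2 * (tail_integral C 0 \<omega>)\<^sup>2 + 2 * (tail_integral C t \<omega>)\<^sup>2)"
        by (intro add_mono mult_left_mono sq) auto
      also have "\<dots> \<le> D \<omega>"
        unfolding D_def using tl[of 0] tl[of t] t elim(2) by (auto dest!: bspec[of _ _ t])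
      finally show "\<bar>y t \<omega>\<bar>\<^sup>2 \<le> D \<omega>" .
    qed
  qed
  have yS2: "y \<in> S2 M F T"
    by (rule S2I[OF _ _ Dint yD]) (use yF ycont in \<open>auto simp: adapted_process_def continuous_process_def\<close>)
  define h where "h t = expectation (y t)" for t
  have hcont: "continuous_on {0..T} h" unfolding h_def by (rule S2D(6)[OF yS2])
  have yeq: "AE \<omega> in M. \<forall>t\<in>{0..T}. y t \<omega> = \<xi> \<omega> + tail_integral C t \<omega> - (X T \<omega> - X t \<omega>)"
    using good rep by eventually_elim (auto simp: y_def \<eta>_def)
  have "AE \<omega> in M. y T \<omega> = \<xi> \<omega>"
    using yeq by eventually_elim (use T_in in \<open>auto simp: tail_integral_T\<close>)
  then have "h T = expectation \<xi>"
    unfolding h_def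
    by (intro integral_cong_AE square_integrableD(1)[OF S2D(3)[OF yS2 T_in]] square_integrableD(1)[OF \<xi>_sq])
  then have "u T \<le> h T" using terminal by simp
  then obtain K where K: "continuous_on {0..T} K" "mono_on {0..T} K" "K 0 = 0"
    "\<And>t. t \<in> {0..T} \<Longrightarrow> u t \<le> h t + (K T - K t)"
    "(LINT t:{0..T}|interval_measure (\<lambda>t. K (max 0 (min T t))). h t + (K T - K t) - u t) = 0"
    using reflection_exists[OF T_pos u_cont hcont] by blast
  \<comment> \<open>A deterministic shift leaves \<open>Z\<close> and the Ito integral unchanged and
    moves the mean by exactly the remaining push.\<close>
  define Y where "Y t \<omega> = y t \<omega> + (K T - K t)" for t \<omega>
  have EY: "expectation (Y t) = h t + (K T - K t)" if "t \<in> {0..T}" for t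
    unfolding Y_def h_def using square_integrable_integrable[OF S2D(3)[OF yS2 that]] by (simp add: prob_space)
  have YS2: "Y \<in> S2 M F T"
  proof (rule S2I[of _ "\<lambda>\<omega>. 2 * D \<omega> + 2 * (K T)\<^sup>2"])
    show "adapted_process F T Y" unfolding adapted_process_def Y_def using yF by simp
    show "continuous_process M T Y" unfolding continuous_process_def Y_def
      by (auto intro!: continuous_intros K(1) ycont)
    show "integrable M (\<lambda>\<omega>. 2 * D \<omega> + 2 * (K T)\<^sup>2)" using Dint by simp
    show "AE \<omega> in M. \<forall>t\<in>{0..T}. \<bar>Y t \<omega>\<bar>\<^sup>2 \<le> 2 * D \<omega> + 2 * (K T)\<^sup>2"
      using yD
    proof eventually_elim
      case (elim \<omega>)
      show ?case
      proof
        fix t assume t: "t \<in> {0..T}"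
        have "K 0 \<le> K t" "K t \<le> K T"
          using t T_pos mono_onD[OF K(2), of 0 t] mono_onD[OF K(2), of t T] by auto
        then have "(K T - K t)\<^sup>2 \<le> (K T)\<^sup>2" using K(3) by (intro power_mono) auto
        moreover have "\<bar>Y t \<omega>\<bar>\<^sup>2 \<le> 2 * \<bar>y t \<omega>\<bar>\<^sup>2 + 2 * (K T - K t)\<^sup>2"
          unfolding Y_def using norm_add_squared_le[of "y t \<omega>" "K T - K t"] by simp
        ultimately show "\<bar>Y t \<omega>\<bar>\<^sup>2 \<le> 2 * D \<omega> + 2 * (K T)\<^sup>2" using elim t by fastforce
      qed
    qed
  qed
  have flat: "flatness_condition M T u Y K"
  proof -
    have "(LINT t:{0..T}|interval_measure (\<lambda>t. K (max 0 (min T t))). expectation (Y t) - u t)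
        = (LINT t:{0..T}|interval_measure (\<lambda>t. K (max 0 (min T t))). h t + (K T - K t) - u t)"
      by (rule set_lebesgue_integral_cong) (auto simp: EY)
    then show ?thesis using K(5) by (simp add: flatness_condition_def)
  qed
  have "driven_solution C Y Z K X"
    unfolding driven_solution_def
  proof (intro conjI YS2 Z X flat)
    show "K \<in> A2_D M F T" using K by (simp add: A2_D_iff)
    show "AE \<omega> in M. \<forall>t\<in>{0..T}. Y t \<omega> = \<xi> \<omega> + tail_integral C t \<omega> - (X T \<omega> - X t \<omega>) + K T - K t"
      using yeq by eventually_elim (auto simp: Y_def)
    show "\<forall>t\<in>{0..T}. u t \<le> expectation (Y t)" using K(4) EY by simp
  qed
  then show ?thesis by blast
qed

end

section \<open>Energy estimates\<close>

context brownian
begin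

lemma id_measurable_L: "(\<lambda>s. s) \<in> borel_measurable L"
  by (intro measurable_restrict_space1) simp

text \<open>The square is a double integral of a symmetric function; the two triangles contribute
  equally and the diagonal is null. This supplies the factor 2 of the energy identity, in place of
  differentiating the square.\<close>

lemma integral_square_tail:
  assumes g: "integrable L g" and t: "0 \<le> t"
  shows "(\<integral>s. indicat_real {t..} s * g s \<partial>L)\<^sup>2
    = 2 * (\<integral>s. indicat_real {t..} s * (g s * (\<integral>r. indicat_real {s..} r * g r \<partial>L)) \<partial>L)"
proof -
  interpret LL: pair_sigma_finite L L ..
  define G where "G s = indicat_real {t..} s * g s" for s
  have cut: "integrable L (\<lambda>s. indicat_real A s * h s)" if "integrable L h" "A \<in> sets borel" for A and h :: "real \<Rightarrow> real"
    by (rule Bochner_Integration.integrable_bound[OF that(1)])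
      (use borel_measurable_integrable[OF that(1)] measurable_indicator_L[OF that(2)] in \<open>auto simp: indicator_def\<close>)
  have G: "integrable L G" unfolding G_def by (rule cut[OF g]) simp
  have Gm [measurable]: "G \<in> borel_measurable L" using G by simp
  define W where "W x = G (fst x) * G (snd x)" for x
  \<comment> \<open>The indicator of one triangle; the complementary one is reflected onto it by
    exchanging the order of integration.\<close>
  define P where "P x = (if fst x \<le> snd x then 1 else 0 :: real)" for x :: "real \<times> real"
  have fm [measurable]: "(\<lambda>x. fst x) \<in> borel_measurable (L \<Otimes>\<^sub>M L)" "(\<lambda>x. snd x) \<in> borel_measurable (L \<Otimes>\<^sub>M L)"
    by (rule measurable_compose[OF measurable_fst id_measurable_L], rule measurable_compose[OF measurable_snd id_measurable_L])
  have Pm [measurable]: "P \<in> borel_measurable (L \<Otimes>\<^sub>M L)" unfolding P_def by measurable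
  have W: "integrable (L \<Otimes>\<^sub>M L) W"
  proof (rule LL.Fubini_integrable)
    show "W \<in> borel_measurable (L \<Otimes>\<^sub>M L)" unfolding W_def by measurable
    show "integrable L (\<lambda>x. LINT y|L. norm (W (x, y)))"
      using G by (simp add: W_def abs_mult)
    show "AE x in L. integrable L (\<lambda>y. W (x, y))" using G by (simp add: W_def)
  qed
  have PW: "integrable (L \<Otimes>\<^sub>M L) (\<lambda>x. P x * W x)"
    by (rule Bochner_Integration.integrable_bound[OF W])
      (use borel_measurable_integrable[OF W] Pm in \<open>auto simp: P_def\<close>)
  have total: "integral\<^sup>L (L \<Otimes>\<^sub>M L) W = (\<integral>s. G s \<partial>L)\<^sup>2"
    using LL.integral_fst'[OF W] by (simp add: W_def power2_eq_square)
  have inner: "G s * (\<integral>r. indicat_real {s..} r * G r \<partial>L) = indicat_real {t..} s * (g s * (\<integral>r. indicat_real {s..} r * g r \<partial>L))" for s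
  proof (cases "t \<le> s")
    case True
    have "(\<integral>r. indicat_real {s..} r * G r \<partial>L) = (\<integral>r. indicat_real {s..} r * g r \<partial>L)"
      by (rule Bochner_Integration.integral_cong) (use True in \<open>auto simp: G_def indicator_def\<close>)
    then show ?thesis using True by (simp add: G_def)
  qed (simp add: G_def)
  have part1: "(\<integral>x. P x * W x \<partial>(L \<Otimes>\<^sub>M L)) = (\<integral>s. G s * (\<integral>r. indicat_real {s..} r * G r \<partial>L) \<partial>L)"
  proof -
    have "(\<integral>x. P x * W x \<partial>(L \<Otimes>\<^sub>M L)) = (\<integral>s. (\<integral>r. P (s, r) * W (s, r) \<partial>L) \<partial>L)"
      using LL.integral_fst'[OF PW] by simp
    also have "\<dots> = (\<integral>s. (\<integral>r. G s * (indicat_real {s..} r * G r) \<partial>L) \<partial>L)"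
      by (intro Bochner_Integration.integral_cong refl) (auto simp: P_def W_def indicator_def)
    finally show ?thesis by simp
  qed
  have part2: "(\<integral>x. W x - P x * W x \<partial>(L \<Otimes>\<^sub>M L)) = (\<integral>s. G s * (\<integral>r. indicat_real {s..} r * G r \<partial>L) \<partial>L)"
  proof -
    have i: "integrable (L \<Otimes>\<^sub>M L) (\<lambda>(s, r). W (s, r) - P (s, r) * W (s, r))"
      using Bochner_Integration.integrable_diff[OF W PW] by (simp add: case_prod_unfold)
    have "(\<integral>x. W x - P x * W x \<partial>(L \<Otimes>\<^sub>M L)) = (\<integral>r. (\<integral>s. W (s, r) - P (s, r) * W (s, r) \<partial>L) \<partial>L)"
      using LL.integral_snd[OF i] by (simp add: case_prod_unfold)
    also have "\<dots> = (\<integral>r. (\<integral>s. G r * (indicat_real {r..} s * G s) \<partial>L) \<partial>L)"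
    proof (rule Bochner_Integration.integral_cong[OF refl], rule integral_cong_AE)
      fix r assume "r \<in> space L"
      show "AE s in L. W (s, r) - P (s, r) * W (s, r) = G r * (indicat_real {r..} s * G s)"
        using AE_L_neq[of r] by eventually_elim (auto simp: W_def P_def indicator_def)
      show "(\<lambda>s. G r * (indicat_real {r..} s * G s)) \<in> borel_measurable L"
        using borel_measurable_integrable[OF cut[OF G, of "{r..}"]] by simp
      have [measurable]: "(\<lambda>s. s) \<in> borel_measurable L" by (rule id_measurable_L)
      show "(\<lambda>s. W (s, r) - P (s, r) * W (s, r)) \<in> borel_measurable L"
        unfolding W_def P_def fst_conv snd_conv by measurable
    qed
    finally show ?thesis by simp
  qed
  have "(\<integral>s. G s \<partial>L)\<^sup>2 = (\<integral>x. P x * W x \<partial>(L \<Otimes>\<^sub>M L)) + (\<integral>x. W x - P x * W x \<partial>(L \<Otimes>\<^sub>M L))"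
    unfolding total[symmetric] using W PW by simp
  then show ?thesis unfolding part1 part2 inner by (simp add: G_def)
qed

lemma AE_Q_snd_neq: "AE x in Q. snd x \<noteq> t"
proof (rule Qp.AE_pair_measure)
  have [measurable]: "(\<lambda>x. snd x) \<in> borel_measurable Q" by (rule measurable_compose[OF measurable_snd id_measurable_L])
  show "{x \<in> space Q. snd x \<noteq> t} \<in> sets Q" by measurable
  show "AE x in M. AE y in L. snd (x, y) \<noteq> t" using AE_L_neq by simp
qed

lemma square_integrable_Q_fst:
  fixes G :: "'a \<Rightarrow> real"
  assumes "square_integrable M G"
  shows "square_integrable Q (\<lambda>x. G (fst x))"
  unfolding square_integrable_iff_nn_integral
proof
  have [measurable]: "G \<in> borel_measurable M" using square_integrableD(1)[OF assms] .
  show "(\<lambda>x. G (fst x)) \<in> borel_measurable Q" by measurable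
  have "(\<integral>\<^sup>+x. ennreal ((norm (G (fst x)))\<^sup>2) \<partial>Q) = (\<integral>\<^sup>+\<omega>. (\<integral>\<^sup>+s. ennreal ((norm (G \<omega>))\<^sup>2) \<partial>L) \<partial>M)"
    by (subst Lm.nn_integral_fst[symmetric]) auto
  also have "\<dots> = (\<integral>\<^sup>+\<omega>. ennreal ((norm (G \<omega>))\<^sup>2) \<partial>M) * emeasure L (space L)"
    by (simp add: nn_integral_multc)
  also have "\<dots> < \<infinity>"
    using assms less_top[THEN iffD1, OF Lm.emeasure_finite[of "space L"]]
    unfolding square_integrable_iff_nn_integral by (simp add: ennreal_mult_less_top)
  finally show "(\<integral>\<^sup>+x. ennreal ((norm (G (fst x)))\<^sup>2) \<partial>Q) < \<infinity>" .
qed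

lemma cut_measurable: "(\<lambda>x. indicat_real {t..} (snd x)) \<in> borel_measurable Q"
  by (rule measurable_compose[OF measurable_snd measurable_indicator_L]) simp

lemma integrable_cut:
  fixes f :: "'a \<times> real \<Rightarrow> real"
  assumes "integrable Q f"
  shows "integrable Q (\<lambda>x. indicat_real {t..} (snd x) * f x)"
  by (rule Bochner_Integration.integrable_bound[OF assms])
    (use borel_measurable_times[OF cut_measurable borel_measurable_integrable[OF assms]] in \<open>auto simp: indicator_def\<close>)

lemma energy_identity:
  assumes D: "driver D" and V: "V \<in> H2 M F T" and N: "has_ito_integral M F T B V N"
    and \<delta>F: "\<And>t. t \<in> {0..T} \<Longrightarrow> \<delta> t \<in> borel_measurable (F t)" and \<delta>M: "\<And>t. t \<in> {0..T} \<Longrightarrow> square_integrable M (\<delta> t)"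
    and \<delta>Q: "square_integrable Q (\<lambda>x. \<delta> (snd x) (fst x))"
    and eq: "AE \<omega> in M. \<forall>t\<in>{0..T}. \<delta> t \<omega> = tail_integral D t \<omega> - (N T \<omega> - N t \<omega>)" and t: "t \<in> {0..T}"
  shows "(l2_norm M (\<delta> t))\<^sup>2 + (\<integral>x. indicat_real {t..} (snd x) * (norm (V (snd x) (fst x)))\<^sup>2 \<partial>Q)
    = 2 * (\<integral>x. indicat_real {t..} (snd x) * (D x * \<delta> (snd x) (fst x)) \<partial>Q)"
proof -
  note ND = has_ito_integralD[OF V N]
  have t0: "0 \<le> t" using t by simp
  have Nsq: "square_integrable M (N s)" if "s \<in> {0..T}" for s by (rule square_martingaleD(2)[OF ND(3) that])
  have DQ: "square_integrable Q D" and DP: "D \<in> borel_measurable Prog" using D by (auto simp: driver_def)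
  have tail_sq: "square_integrable M (tail_integral D t)" by (rule tail_integral_square_integrable[OF D t0])
  have VQ: "integrable Q (\<lambda>x. (norm (V (snd x) (fst x)))\<^sup>2)"
    using square_integrableD(2)[of Q "\<lambda>(\<omega>, t). V t \<omega>"] V by (simp add: H2_iff case_prod_unfold)
  \<comment> \<open>Pythagoras: \<open>\<delta> t\<close> is known at t, the martingale increment
    after t is orthogonal to it, and their sum is the tail integral.\<close>
  have e1: "(l2_norm M (tail_integral D t))\<^sup>2 = (l2_norm M (\<delta> t))\<^sup>2 + (l2_norm M (\<lambda>\<omega>. N T \<omega> - N t \<omega>))\<^sup>2"
  proof -
    have "l2_norm M (tail_integral D t) = l2_norm M (\<lambda>\<omega>. \<delta> t \<omega> + (N T \<omega> - N t \<omega>))"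
    proof (rule square_integrable_cong_AE(2)[OF square_integrable_add[OF \<delta>M[OF t] square_integrable_diff[OF Nsq[OF T_in] Nsq[OF t]]] square_integrableD(1)[OF tail_sq]])
      show "AE \<omega> in M. \<delta> t \<omega> + (N T \<omega> - N t \<omega>) = tail_integral D t \<omega>"
        using eq by eventually_elim (use t in auto)
    qed
    moreover have "(\<integral>\<omega>. \<delta> t \<omega> * (N T \<omega> - N t \<omega>) \<partial>M) = 0"
      by (rule square_martingaleD(3)[OF ND(3) _ _ _ \<delta>F[OF t] \<delta>M[OF t]]) (use t in auto)
    ultimately show ?thesis
      using l2_norm_add_power2[OF \<delta>M[OF t] square_integrable_diff[OF Nsq[OF T_in] Nsq[OF t]]] by simp
  qed
  have e2: "(l2_norm M (\<lambda>\<omega>. N T \<omega> - N t \<omega>))\<^sup>2 = (\<integral>x. indicat_real {t..} (snd x) * (norm (V (snd x) (fst x)))\<^sup>2 \<partial>Q)"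
  proof -
    have "(l2_norm M (\<lambda>\<omega>. N T \<omega> - N t \<omega>))\<^sup>2 = (\<integral>x. indicat_real {t<..} (snd x) * (norm (V (snd x) (fst x)))\<^sup>2 \<partial>Q)"
      unfolding ND(6)[OF t] l2_norm_power2
      by (intro Bochner_Integration.integral_cong) (auto simp: indicator_def)
    also have "\<dots> = (\<integral>x. indicat_real {t..} (snd x) * (norm (V (snd x) (fst x)))\<^sup>2 \<partial>Q)"
    proof (rule integral_cong_AE)
      show "AE x in Q. indicat_real {t<..} (snd x) * (norm (V (snd x) (fst x)))\<^sup>2 = indicat_real {t..} (snd x) * (norm (V (snd x) (fst x)))\<^sup>2"
        using AE_Q_snd_neq[of t] by eventually_elim (auto simp: indicator_def)
      show "(\<lambda>x. indicat_real {t..} (snd x) * (norm (V (snd x) (fst x)))\<^sup>2) \<in> borel_measurable Q"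
        by (rule borel_measurable_integrable[OF integrable_cut[OF VQ]])
      have "(\<lambda>x. indicat_real {t<..} (snd x)) \<in> borel_measurable Q"
        by (rule measurable_compose[OF measurable_snd measurable_indicator_L]) simp
      then show "(\<lambda>x. indicat_real {t<..} (snd x) * (norm (V (snd x) (fst x)))\<^sup>2) \<in> borel_measurable Q"
        by (rule borel_measurable_times[OF _ borel_measurable_integrable[OF VQ]])
    qed
    finally show ?thesis .
  qed
  \<comment> \<open>The equation at time s expresses the inner tail integral as
    \<open>\<delta> s\<close> plus a martingale increment; \<open>R\<close> is the product of
    \<open>D\<close> with that sum, written out.\<close>
  define R where "R x = D x * \<delta> (snd x) (fst x) + D x * (N T (fst x) - N (snd x) (fst x))" for x
  have NQ: "square_integrable Q (\<lambda>x. N T (fst x) - N (snd x) (fst x))"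
    using square_integrable_diff[OF square_integrable_Q_fst[OF Nsq[OF T_in]] S2D(5)[OF ND(5)]] by (simp add: case_prod_unfold)
  have i1: "integrable Q (\<lambda>x. D x * \<delta> (snd x) (fst x))" by (rule square_integrable_mult[OF DQ \<delta>Q])
  have i2: "integrable Q (\<lambda>x. D x * (N T (fst x) - N (snd x) (fst x)))" by (rule square_integrable_mult[OF DQ NQ])
  have Ri: "integrable Q R" unfolding R_def by (rule Bochner_Integration.integrable_add[OF i1 i2])
  note Rc = integrable_cut[OF Ri, of t]
  have e3: "(l2_norm M (tail_integral D t))\<^sup>2 = 2 * (\<integral>x. indicat_real {t..} (snd x) * R x \<partial>Q)"
  proof -
    have "(l2_norm M (tail_integral D t))\<^sup>2 = (\<integral>\<omega>. 2 * (\<integral>s. indicat_real {t..} s * R (\<omega>, s) \<partial>L) \<partial>M)"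
      unfolding l2_norm_power2
    proof (rule integral_cong_AE)
      show "(\<lambda>\<omega>. (norm (tail_integral D t \<omega>))\<^sup>2) \<in> borel_measurable M"
        by (rule borel_measurable_integrable[OF square_integrableD(2)[OF tail_sq]])
      show "(\<lambda>\<omega>. 2 * (\<integral>s. indicat_real {t..} s * R (\<omega>, s) \<partial>L)) \<in> borel_measurable M"
        using borel_measurable_integrable[OF Qp.integrable_fst'[OF Rc]] by simp
      show "AE \<omega> in M. (norm (tail_integral D t \<omega>))\<^sup>2 = 2 * (\<integral>s. indicat_real {t..} s * R (\<omega>, s) \<partial>L)"
        using driver_good[OF D] eq
      proof eventually_elim
        case (elim \<omega>)
        have "(tail_integral D t \<omega>)\<^sup>2 = 2 * (\<integral>s. indicat_real {t..} s * (D (\<omega>, s) * (\<integral>r. indicat_real {s..} r * D (\<omega>, r) \<partial>L)) \<partial>L)"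
          unfolding tail_integral_eq[OF t0] by (rule integral_square_tail[OF conjunct1[OF elim(1)] t0])
        also have "(\<integral>s. indicat_real {t..} s * (D (\<omega>, s) * (\<integral>r. indicat_real {s..} r * D (\<omega>, r) \<partial>L)) \<partial>L)
            = (\<integral>s. indicat_real {t..} s * R (\<omega>, s) \<partial>L)"
        proof (rule Bochner_Integration.integral_cong[OF refl])
          fix s assume "s \<in> space L"
          then have s: "s \<in> {0..T}" by (simp add: space_L)
          then have "(\<integral>r. indicat_real {s..} r * D (\<omega>, r) \<partial>L) = \<delta> s \<omega> + (N T \<omega> - N s \<omega>)"
            using elim(2) tail_integral_eq[of s D \<omega>] by auto
          then show "indicat_real {t..} s * (D (\<omega>, s) * (\<integral>r. indicat_real {s..} r * D (\<omega>, r) \<partial>L)) = indicat_real {t..} s * R (\<omega>, s)"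
            by (simp add: R_def distrib_left)
        qed
        finally show ?case by simp
      qed
    qed
    also have "\<dots> = 2 * (\<integral>x. indicat_real {t..} (snd x) * R x \<partial>Q)"
      using Qp.integral_fst'[OF Rc] by simp
    finally show ?thesis .
  qed
  \<comment> \<open>After Fubini the time s is fixed, and \<open>D\<close> at time s is
    \<open>F s\<close>-measurable, hence orthogonal to the martingale increment after s. It is
    square integrable only for almost every s, which suffices under the time integral.\<close>
  have e4: "(\<integral>x. indicat_real {t..} (snd x) * (D x * (N T (fst x) - N (snd x) (fst x))) \<partial>Q) = 0"
  proof -
    let ?f = "\<lambda>\<omega> s. indicat_real {t..} s * (D (\<omega>, s) * (N T \<omega> - N s \<omega>))"
    have i: "integrable Q (\<lambda>(\<omega>, s). ?f \<omega> s)"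
      using integrable_cut[OF i2, of t] by (simp add: case_prod_unfold)
    have "integrable Q (\<lambda>(\<omega>, s). (D (\<omega>, s))\<^sup>2)"
      using square_integrableD(2)[OF DQ] by (simp add: case_prod_unfold)
    from Qp.AE_integrable_snd[OF this]
    have ae: "AE s in L. integrable M (\<lambda>\<omega>. (D (\<omega>, s))\<^sup>2)" by simp
    have "(\<integral>x. indicat_real {t..} (snd x) * (D x * (N T (fst x) - N (snd x) (fst x))) \<partial>Q) = (\<integral>s. (\<integral>\<omega>. ?f \<omega> s \<partial>M) \<partial>L)"
      using Qp.integral_snd[OF i] by (simp add: case_prod_unfold)
    also have "\<dots> = 0"
    proof (rule integral_eq_zero_AE, use ae AE_space in eventually_elim)
      case (elim s)
      then have s: "s \<in> {0..T}" by (simp add: space_L)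
      have DF: "(\<lambda>\<omega>. D (\<omega>, s)) \<in> borel_measurable (F s)" by (rule progressive_section(1)[OF DP s])
      have "(\<lambda>\<omega>. D (\<omega>, s)) \<in> borel_measurable M" by (rule measurable_F_imp[OF DF]) (use s in simp)
      then have "square_integrable M (\<lambda>\<omega>. D (\<omega>, s))" using elim(1) by (simp add: square_integrable_def)
      then have "(\<integral>\<omega>. D (\<omega>, s) * (N T \<omega> - N s \<omega>) \<partial>M) = 0"
        by (intro square_martingaleD(3)[OF ND(3) _ _ _ DF]) (use s in auto)
      then show ?case by simp
    qed
    finally show ?thesis .
  qed
  have "(\<integral>x. indicat_real {t..} (snd x) * R x \<partial>Q) = (\<integral>x. indicat_real {t..} (snd x) * (D x * \<delta> (snd x) (fst x)) \<partial>Q)"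
    using integrable_cut[OF i1, of t] integrable_cut[OF i2, of t] e4 unfolding R_def distrib_left by simp
  then show ?thesis using e1 e2 e3 by simp
qed

text \<open>Weighted Young inequality for the cross term. The free constant \<open>c\<close> later
  becomes half the exponential rate, so that the \<open>\<delta>\<close> term can be
  absorbed.\<close>

lemma energy_inequality:
  assumes D: "driver D" and V: "V \<in> H2 M F T" and N: "has_ito_integral M F T B V N"
    and \<delta>F: "\<And>t. t \<in> {0..T} \<Longrightarrow> \<delta> t \<in> borel_measurable (F t)" and \<delta>M: "\<And>t. t \<in> {0..T} \<Longrightarrow> square_integrable M (\<delta> t)"
    and \<delta>Q: "square_integrable Q (\<lambda>x. \<delta> (snd x) (fst x))"
    and eq: "AE \<omega> in M. \<forall>t\<in>{0..T}. \<delta> t \<omega> = tail_integral D t \<omega> - (N T \<omega> - N t \<omega>)" and t: "t \<in> {0..T}" and c: "c > 0"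
  shows "(l2_norm M (\<delta> t))\<^sup>2 + (\<integral>x. indicat_real {t..} (snd x) * (norm (V (snd x) (fst x)))\<^sup>2 \<partial>Q)
    \<le> (\<integral>x. indicat_real {t..} (snd x) * (c * (\<delta> (snd x) (fst x))\<^sup>2 + (D x)\<^sup>2 / c) \<partial>Q)"
proof -
  have DQ: "square_integrable Q D" using D by (auto simp: driver_def)
  have i: "integrable Q (\<lambda>x. c * (\<delta> (snd x) (fst x))\<^sup>2 + (D x)\<^sup>2 / c)"
    using square_integrableD(2)[OF DQ] square_integrableD(2)[OF \<delta>Q] by simp
  have "2 * (\<integral>x. indicat_real {t..} (snd x) * (D x * \<delta> (snd x) (fst x)) \<partial>Q)
      = (\<integral>x. 2 * (indicat_real {t..} (snd x) * (D x * \<delta> (snd x) (fst x))) \<partial>Q)" by simp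
  also have "\<dots> \<le> (\<integral>x. indicat_real {t..} (snd x) * (c * (\<delta> (snd x) (fst x))\<^sup>2 + (D x)\<^sup>2 / c) \<partial>Q)"
  proof (rule integral_mono)
    show "integrable Q (\<lambda>x. 2 * (indicat_real {t..} (snd x) * (D x * \<delta> (snd x) (fst x))))"
      using integrable_cut[OF square_integrable_mult[OF DQ \<delta>Q], of t] by simp
    show "integrable Q (\<lambda>x. indicat_real {t..} (snd x) * (c * (\<delta> (snd x) (fst x))\<^sup>2 + (D x)\<^sup>2 / c))"
      by (rule integrable_cut[OF i])
    fix x
    have "2 * (a * b) \<le> c * b\<^sup>2 + a\<^sup>2 / c" for a b :: real
    proof -
      have "0 \<le> (c * b - a)\<^sup>2 / c" using c by simp
      also have "\<dots> = c * b\<^sup>2 + a\<^sup>2 / c - 2 * (a * b)" using c by (simp add: power2_eq_square field_simps)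
      finally show ?thesis by simp
    qed
    then show "2 * (indicat_real {t..} (snd x) * (D x * \<delta> (snd x) (fst x))) \<le> indicat_real {t..} (snd x) * (c * (\<delta> (snd x) (fst x))\<^sup>2 + (D x)\<^sup>2 / c)"
      by (simp add: indicator_def)
  qed
  finally show ?thesis using energy_identity[OF assms(1-8)] by simp
qed

section \<open>Stability in exponentially weighted norms\<close>

text \<open>The weight is put into the measure, not into the norm, so that the L2 results above,
  completeness included, apply verbatim.\<close>

definition weighted :: "real \<Rightarrow> ('a \<times> real) measure" where
  "weighted \<beta> = density Q (\<lambda>x. ennreal (exp (\<beta> * snd x)))"

lemma snd_measurable_Q: "(\<lambda>x. snd x) \<in> borel_measurable Q"
  by (rule measurable_compose[OF measurable_snd id_measurable_L])

lemma weight_measurable: "(\<lambda>x. exp (\<beta> * snd x)) \<in> borel_measurable Q"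
  using snd_measurable_Q by measurable

lemma space_weighted [simp]: "space (weighted \<beta>) = space Q" and sets_weighted [measurable_cong]: "sets (weighted \<beta>) = sets Q"
  by (simp_all add: weighted_def)

lemma measurable_weighted: "f \<in> borel_measurable (weighted \<beta>) \<longleftrightarrow> f \<in> borel_measurable Q"
  by (simp add: measurable_cong_sets[OF sets_weighted refl])

lemma integrable_weighted_iff:
  fixes f :: "'a \<times> real \<Rightarrow> real"
  assumes "f \<in> borel_measurable Q"
  shows "integrable (weighted \<beta>) f \<longleftrightarrow> integrable Q (\<lambda>x. exp (\<beta> * snd x) * f x)"
  unfolding weighted_def using integrable_density[OF assms weight_measurable] by simp

lemma integrable_weight:
  fixes f :: "'a \<times> real \<Rightarrow> real"
  assumes "0 \<le> \<beta>" "integrable Q f"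
  shows "integrable Q (\<lambda>x. exp (\<beta> * snd x) * f x)"
proof (rule Bochner_Integration.integrable_bound)
  show "integrable Q (\<lambda>x. exp (\<beta> * T) * f x)" using assms(2) by simp
  show "(\<lambda>x. exp (\<beta> * snd x) * f x) \<in> borel_measurable Q"
    by (rule borel_measurable_times[OF weight_measurable borel_measurable_integrable[OF assms(2)]])
  show "AE x in Q. norm (exp (\<beta> * snd x) * f x) \<le> norm (exp (\<beta> * T) * f x)"
    using assms(1) by (auto simp: space_Q abs_mult intro!: mult_right_mono mult_left_mono)
qed

text \<open>The weight lies between 1 and \<open>exp (\<beta> * T)\<close>, so the weighted and
  unweighted spaces coincide.\<close>

lemma square_integrable_weighted:
  assumes "0 \<le> \<beta>"
  shows "square_integrable (weighted \<beta>) f \<longleftrightarrow> square_integrable Q f"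
proof
  assume "square_integrable (weighted \<beta>) f"
  then have f: "f \<in> borel_measurable Q" "integrable Q (\<lambda>x. exp (\<beta> * snd x) * (norm (f x))\<^sup>2)"
    unfolding square_integrable_def measurable_weighted by (auto simp: integrable_weighted_iff)
  have "integrable Q (\<lambda>x. (norm (f x))\<^sup>2)"
  proof (rule Bochner_Integration.integrable_bound[OF f(2)])
    show "AE x in Q. norm ((norm (f x))\<^sup>2) \<le> norm (exp (\<beta> * snd x) * (norm (f x))\<^sup>2)"
    proof (rule AE_I2)
      fix x assume "x \<in> space Q"
      then have "1 \<le> exp (\<beta> * snd x)" using assms by (auto simp: space_Q)
      then have "1 * (norm (f x))\<^sup>2 \<le> exp (\<beta> * snd x) * (norm (f x))\<^sup>2" by (rule mult_right_mono) simp
      then show "norm ((norm (f x))\<^sup>2) \<le> norm (exp (\<beta> * snd x) * (norm (f x))\<^sup>2)" by simp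
    qed
  qed (use f in simp)
  then show "square_integrable Q f" using f(1) by (simp add: square_integrable_def)
next
  assume f: "square_integrable Q f"
  then show "square_integrable (weighted \<beta>) f"
    using square_integrableD[OF f] integrable_weight[OF assms square_integrableD(2)[OF f]]
    unfolding square_integrable_def measurable_weighted by (simp add: integrable_weighted_iff)
qed

lemma l2_norm_weighted:
  assumes "f \<in> borel_measurable Q"
  shows "(l2_norm (weighted \<beta>) f)\<^sup>2 = (\<integral>x. exp (\<beta> * snd x) * (norm (f x))\<^sup>2 \<partial>Q)"
  unfolding l2_norm_power2 weighted_def
  by (subst integral_density) (use assms weight_measurable in auto)

lemma AE_weighted: "(AE x in weighted \<beta>. P x) \<longleftrightarrow> (AE x in Q. P x)"
  unfolding weighted_def by (subst AE_density) (use weight_measurable in auto)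

lemma nn_integral_exp:
  assumes "\<beta> > 0" "s \<in> {0..T}"
  shows "(\<integral>\<^sup>+t. ennreal (\<beta> * exp (\<beta> * t)) * indicator {..s} t \<partial>L) = ennreal (exp (\<beta> * s) - 1)"
proof -
  have "(\<integral>\<^sup>+t. ennreal (\<beta> * exp (\<beta> * t)) * indicator {..s} t \<partial>L) = (\<integral>\<^sup>+t. ennreal (\<beta> * exp (\<beta> * t)) * indicator {0..s} t \<partial>lborel)"
    by (subst nn_integral_restrict_space) (use assms in \<open>auto intro!: nn_integral_cong simp: indicator_def\<close>)
  also have "\<dots> = ennreal (exp (\<beta> * s) - exp (\<beta> * 0))"
    by (rule nn_integral_FTC_Icc) (use assms in \<open>auto intro!: derivative_eq_intros\<close>)
  finally show ?thesis by simp
qed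

text \<open>Fubini: for fixed s, integrating \<open>\<beta> * exp (\<beta> * t)\<close> over t up to
  s gives \<open>exp (\<beta> * s) - 1\<close>. Averaging tail estimates over t thus produces the
  exponential weight.\<close>

lemma weighted_tail:
  assumes W [measurable]: "W \<in> borel_measurable Q" and \<beta>: "\<beta> > 0"
  shows "(\<lambda>t. \<integral>\<^sup>+x. indicator {t..} (snd x) * W x \<partial>Q) \<in> borel_measurable L"
    "(\<integral>\<^sup>+t. ennreal (\<beta> * exp (\<beta> * t)) * (\<integral>\<^sup>+x. indicator {t..} (snd x) * W x \<partial>Q) \<partial>L)
      = (\<integral>\<^sup>+x. ennreal (exp (\<beta> * snd x) - 1) * W x \<partial>Q)"
proof -
  interpret QL: pair_sigma_finite Q L ..
  have [measurable]: "(\<lambda>x. snd x) \<in> borel_measurable Q" by (rule snd_measurable_Q)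
  have [measurable]: "(\<lambda>s. s) \<in> borel_measurable L" by (rule id_measurable_L)
  have ind: "indicator {t..} (snd x) = (if t \<le> snd x then 1 else 0 :: ennreal)" for t and x :: "'a \<times> real"
    by (simp add: indicator_def)
  have m1: "(\<lambda>(t, x). indicator {t..} (snd x) * W x) \<in> borel_measurable (L \<Otimes>\<^sub>M Q)"
    unfolding ind by measurable
  show "(\<lambda>t. \<integral>\<^sup>+x. indicator {t..} (snd x) * W x \<partial>Q) \<in> borel_measurable L"
    by (rule sigma_finite_measure.borel_measurable_nn_integral[OF Qm.sigma_finite_measure m1])
  have m2: "(\<lambda>(x, t). ennreal (\<beta> * exp (\<beta> * t)) * (indicator {t..} (snd x) * W x)) \<in> borel_measurable (Q \<Otimes>\<^sub>M L)"
    unfolding ind by measurable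
  have "(\<integral>\<^sup>+t. ennreal (\<beta> * exp (\<beta> * t)) * (\<integral>\<^sup>+x. indicator {t..} (snd x) * W x \<partial>Q) \<partial>L)
      = (\<integral>\<^sup>+t. (\<integral>\<^sup>+x. ennreal (\<beta> * exp (\<beta> * t)) * (indicator {t..} (snd x) * W x) \<partial>Q) \<partial>L)"
  proof (rule nn_integral_cong)
    fix t
    have "(\<lambda>x. indicator {t..} (snd x) * W x) \<in> borel_measurable Q" unfolding ind by measurable
    then show "ennreal (\<beta> * exp (\<beta> * t)) * (\<integral>\<^sup>+x. indicator {t..} (snd x) * W x \<partial>Q)
        = (\<integral>\<^sup>+x. ennreal (\<beta> * exp (\<beta> * t)) * (indicator {t..} (snd x) * W x) \<partial>Q)"
      by (simp add: nn_integral_cmult)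
  qed
  also have "\<dots> = (\<integral>\<^sup>+x. (\<integral>\<^sup>+t. ennreal (\<beta> * exp (\<beta> * t)) * (indicator {t..} (snd x) * W x) \<partial>L) \<partial>Q)"
    using QL.Fubini[OF m2] by simp
  also have "\<dots> = (\<integral>\<^sup>+x. ennreal (exp (\<beta> * snd x) - 1) * W x \<partial>Q)"
  proof (rule nn_integral_cong)
    fix x assume "x \<in> space Q"
    then have x: "snd x \<in> {0..T}" by (auto simp: space_Q)
    have "(\<integral>\<^sup>+t. ennreal (\<beta> * exp (\<beta> * t)) * (indicator {t..} (snd x) * W x) \<partial>L)
        = (\<integral>\<^sup>+t. (ennreal (\<beta> * exp (\<beta> * t)) * indicator {..snd x} t) * W x \<partial>L)"
      by (rule nn_integral_cong) (simp add: indicator_def)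
    also have "\<dots> = (\<integral>\<^sup>+t. ennreal (\<beta> * exp (\<beta> * t)) * indicator {..snd x} t \<partial>L) * W x"
    proof (rule nn_integral_multc)
      have "(\<lambda>t. indicator {..snd x} t :: ennreal) \<in> borel_measurable L" by (intro measurable_restrict_space1) simp
      then show "(\<lambda>t. ennreal (\<beta> * exp (\<beta> * t)) * indicator {..snd x} t) \<in> borel_measurable L" by measurable
    qed
    finally show "(\<integral>\<^sup>+t. ennreal (\<beta> * exp (\<beta> * t)) * (indicator {t..} (snd x) * W x) \<partial>L) = ennreal (exp (\<beta> * snd x) - 1) * W x"
      unfolding nn_integral_exp[OF \<beta> x] .
  qed
  finally show "(\<integral>\<^sup>+t. ennreal (\<beta> * exp (\<beta> * t)) * (\<integral>\<^sup>+x. indicator {t..} (snd x) * W x \<partial>Q) \<partial>L)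
      = (\<integral>\<^sup>+x. ennreal (exp (\<beta> * snd x) - 1) * W x \<partial>Q)" .
qed

text \<open>The estimate at time t is multiplied by \<open>\<beta> * exp (\<beta> * t)\<close> and
  integrated over t, which yields the weight minus 1; the estimate at time 0 supplies the missing 1.
  The term \<open>\<delta> t\<close> itself gains the factor \<open>\<beta>\<close>, the origin of
  every smallness below. Nonnegative integrals are used because Fubini then costs only
  measurability.\<close>

lemma weighted_energy:
  fixes w1 w2 :: "'a \<times> real \<Rightarrow> real"
  assumes \<beta>: "\<beta> > 0" and w: "integrable Q w1" "integrable Q w2" "\<And>x. 0 \<le> w1 x" "\<And>x. 0 \<le> w2 x"
    and \<delta>M: "\<And>t. t \<in> {0..T} \<Longrightarrow> square_integrable M (\<delta> t)" and \<delta>Q: "square_integrable Q (\<lambda>x. \<delta> (snd x) (fst x) :: real)"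
    and le: "\<And>t. t \<in> {0..T} \<Longrightarrow> (l2_norm M (\<delta> t))\<^sup>2 + (\<integral>x. indicat_real {t..} (snd x) * w1 x \<partial>Q) \<le> (\<integral>x. indicat_real {t..} (snd x) * w2 x \<partial>Q)"
  shows "(\<integral>x. exp (\<beta> * snd x) * (\<beta> * (\<delta> (snd x) (fst x))\<^sup>2) \<partial>Q) + (\<integral>x. exp (\<beta> * snd x) * w1 x \<partial>Q)
    \<le> (\<integral>x. exp (\<beta> * snd x) * w2 x \<partial>Q)"
proof -
  have \<beta>0: "0 \<le> \<beta>" using \<beta> by simp
  define W1 where "W1 x = ennreal (w1 x)" for x
  define W2 where "W2 x = ennreal (w2 x)" for x
  have [measurable]: "W1 \<in> borel_measurable Q" "W2 \<in> borel_measurable Q"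
    unfolding W1_def W2_def using borel_measurable_integrable[OF w(1)] borel_measurable_integrable[OF w(2)] by measurable
  have [measurable]: "(\<lambda>x. \<delta> (snd x) (fst x)) \<in> borel_measurable Q" using square_integrableD(1)[OF \<delta>Q] .
  have [measurable]: "(\<lambda>x. snd x) \<in> borel_measurable Q" by (rule snd_measurable_Q)
  have [measurable]: "(\<lambda>s. s) \<in> borel_measurable L" by (rule id_measurable_L)
  define A where "A t = (\<integral>\<^sup>+\<omega>. ennreal ((\<delta> t \<omega>)\<^sup>2) \<partial>M)" for t
  have cut: "(\<integral>\<^sup>+x. indicator {t..} (snd x) * ennreal (v x) \<partial>Q) = ennreal (\<integral>x. indicat_real {t..} (snd x) * v x \<partial>Q)"
    if "integrable Q v" "\<And>x. 0 \<le> v x" for v t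
  proof -
    have "(\<integral>\<^sup>+x. indicator {t..} (snd x) * ennreal (v x) \<partial>Q) = (\<integral>\<^sup>+x. ennreal (indicat_real {t..} (snd x) * v x) \<partial>Q)"
      by (rule nn_integral_cong) (simp add: indicator_def)
    also have "\<dots> = ennreal (\<integral>x. indicat_real {t..} (snd x) * v x \<partial>Q)"
      by (rule nn_integral_eq_integral[OF integrable_cut[OF that(1)]]) (use that(2) in auto)
    finally show ?thesis .
  qed
  have nn: "A t + (\<integral>\<^sup>+x. indicator {t..} (snd x) * W1 x \<partial>Q) \<le> (\<integral>\<^sup>+x. indicator {t..} (snd x) * W2 x \<partial>Q)" if t: "t \<in> {0..T}" for t
  proof -
    have "A t = ennreal ((l2_norm M (\<delta> t))\<^sup>2)" using nn_integral_l2_norm[OF \<delta>M[OF t]] by (simp add: A_def)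
    moreover have "0 \<le> (\<integral>x. indicat_real {t..} (snd x) * w1 x \<partial>Q)"
      using w(3) by (intro Bochner_Integration.integral_nonneg) auto
    ultimately show ?thesis
      unfolding W1_def W2_def cut[OF w(1,3)] cut[OF w(2,4)]
      using le[OF t] by (simp add: ennreal_plus[symmetric] ennreal_leI del: ennreal_plus)
  qed
  have Am: "A \<in> borel_measurable L"
  proof -
    have "(\<lambda>(t, \<omega>). ennreal ((\<delta> t \<omega>)\<^sup>2)) \<in> borel_measurable (L \<Otimes>\<^sub>M M)"
      using measurable_pair_swap[of "\<lambda>x. ennreal ((\<delta> (snd x) (fst x))\<^sup>2)" M L borel] by (simp add: case_prod_unfold)
    from borel_measurable_nn_integral[OF this] show ?thesis unfolding A_def .
  qed
  have em: "(\<lambda>t. ennreal (\<beta> * exp (\<beta> * t))) \<in> borel_measurable L" by measurable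
  have "(\<integral>\<^sup>+t. ennreal (\<beta> * exp (\<beta> * t)) * A t \<partial>L) = (\<integral>\<^sup>+t. (\<integral>\<^sup>+\<omega>. ennreal (exp (\<beta> * t) * (\<beta> * (\<delta> t \<omega>)\<^sup>2)) \<partial>M) \<partial>L)"
  proof (rule nn_integral_cong)
    fix t assume "t \<in> space L"
    then have "\<delta> t \<in> borel_measurable M" using square_integrableD(1)[OF \<delta>M] by (simp add: space_L)
    then show "ennreal (\<beta> * exp (\<beta> * t)) * A t = (\<integral>\<^sup>+\<omega>. ennreal (exp (\<beta> * t) * (\<beta> * (\<delta> t \<omega>)\<^sup>2)) \<partial>M)"
      unfolding A_def using \<beta> by (subst nn_integral_cmult[symmetric]) (auto simp: ennreal_mult[symmetric] mult_ac)
  qed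
  also have "\<dots> = (\<integral>\<^sup>+x. ennreal (exp (\<beta> * snd x) * (\<beta> * (\<delta> (snd x) (fst x))\<^sup>2)) \<partial>Q)"
    by (subst Qp.nn_integral_snd[symmetric]) (auto simp: case_prod_unfold)
  finally have X: "(\<integral>\<^sup>+t. ennreal (\<beta> * exp (\<beta> * t)) * A t \<partial>L) = (\<integral>\<^sup>+x. ennreal (exp (\<beta> * snd x) * (\<beta> * (\<delta> (snd x) (fst x))\<^sup>2)) \<partial>Q)" .
  have I1: "(\<integral>\<^sup>+t. ennreal (\<beta> * exp (\<beta> * t)) * A t \<partial>L) + (\<integral>\<^sup>+x. ennreal (exp (\<beta> * snd x) - 1) * W1 x \<partial>Q)
      \<le> (\<integral>\<^sup>+x. ennreal (exp (\<beta> * snd x) - 1) * W2 x \<partial>Q)"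
  proof -
    have "(\<integral>\<^sup>+t. ennreal (\<beta> * exp (\<beta> * t)) * A t \<partial>L) + (\<integral>\<^sup>+x. ennreal (exp (\<beta> * snd x) - 1) * W1 x \<partial>Q)
        = (\<integral>\<^sup>+t. ennreal (\<beta> * exp (\<beta> * t)) * A t + ennreal (\<beta> * exp (\<beta> * t)) * (\<integral>\<^sup>+x. indicator {t..} (snd x) * W1 x \<partial>Q) \<partial>L)"
      unfolding weighted_tail(2)[OF \<open>W1 \<in> borel_measurable Q\<close> \<beta>, symmetric]
      by (rule nn_integral_add[symmetric])
        (intro borel_measurable_times_ennreal em Am weighted_tail(1)[OF \<open>W1 \<in> borel_measurable Q\<close> \<beta>])+
    also have "\<dots> \<le> (\<integral>\<^sup>+t. ennreal (\<beta> * exp (\<beta> * t)) * (\<integral>\<^sup>+x. indicator {t..} (snd x) * W2 x \<partial>Q) \<partial>L)"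
    proof (rule nn_integral_mono)
      fix t assume "t \<in> space L"
      then have "t \<in> {0..T}" by (simp add: space_L)
      from mult_left_mono[OF nn[OF this], of "ennreal (\<beta> * exp (\<beta> * t))"]
      show "ennreal (\<beta> * exp (\<beta> * t)) * A t + ennreal (\<beta> * exp (\<beta> * t)) * (\<integral>\<^sup>+x. indicator {t..} (snd x) * W1 x \<partial>Q)
          \<le> ennreal (\<beta> * exp (\<beta> * t)) * (\<integral>\<^sup>+x. indicator {t..} (snd x) * W2 x \<partial>Q)"
        by (simp add: distrib_left)
    qed
    also have "\<dots> = (\<integral>\<^sup>+x. ennreal (exp (\<beta> * snd x) - 1) * W2 x \<partial>Q)"
      by (rule weighted_tail(2)[OF _ \<beta>]) measurable
    finally show ?thesis .
  qed
  \<comment> \<open>The estimate at time 0, where the cut-off is the whole of \<open>Q\<close>; the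
    nonnegative term \<open>A 0\<close> is dropped.\<close>
  have I0: "(\<integral>\<^sup>+x. W1 x \<partial>Q) \<le> (\<integral>\<^sup>+x. W2 x \<partial>Q)"
  proof -
    have full: "(\<integral>\<^sup>+x. indicator {0..} (snd x) * W x \<partial>Q) = (\<integral>\<^sup>+x. W x \<partial>Q)" for W
      by (rule nn_integral_cong) (auto simp: space_Q)
    have "(\<integral>\<^sup>+x. W1 x \<partial>Q) \<le> A 0 + (\<integral>\<^sup>+x. W1 x \<partial>Q)" by simp
    also have "\<dots> \<le> (\<integral>\<^sup>+x. W2 x \<partial>Q)" using nn[of 0] T_pos unfolding full by simp
    finally show ?thesis .
  qed
  have comb: "(\<integral>\<^sup>+x. ennreal (exp (\<beta> * snd x) - 1) * W x \<partial>Q) + (\<integral>\<^sup>+x. W x \<partial>Q) = (\<integral>\<^sup>+x. ennreal (exp (\<beta> * snd x)) * W x \<partial>Q)"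
    if [measurable]: "W \<in> borel_measurable Q" for W
  proof -
    have "(\<integral>\<^sup>+x. ennreal (exp (\<beta> * snd x) - 1) * W x \<partial>Q) + (\<integral>\<^sup>+x. W x \<partial>Q) = (\<integral>\<^sup>+x. ennreal (exp (\<beta> * snd x) - 1) * W x + W x \<partial>Q)"
      by (rule nn_integral_add[symmetric]) measurable
    also have "\<dots> = (\<integral>\<^sup>+x. ennreal (exp (\<beta> * snd x)) * W x \<partial>Q)"
    proof (rule nn_integral_cong)
      fix x assume "x \<in> space Q"
      then have "1 \<le> exp (\<beta> * snd x)" using \<beta> by (auto simp: space_Q)
      then have "ennreal (exp (\<beta> * snd x)) = ennreal (exp (\<beta> * snd x) - 1) + 1"
        using ennreal_plus[of "exp (\<beta> * snd x) - 1" 1] by simp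
      then show "ennreal (exp (\<beta> * snd x) - 1) * W x + W x = ennreal (exp (\<beta> * snd x)) * W x"
        by (simp add: distrib_right)
    qed
    finally show ?thesis .
  qed
  have "(\<integral>\<^sup>+t. ennreal (\<beta> * exp (\<beta> * t)) * A t \<partial>L) + (\<integral>\<^sup>+x. ennreal (exp (\<beta> * snd x)) * W1 x \<partial>Q) \<le> (\<integral>\<^sup>+x. ennreal (exp (\<beta> * snd x)) * W2 x \<partial>Q)"
    using add_mono[OF I1 I0] comb[of W1] comb[of W2] by (simp add: add.assoc)
  then have fin: "(\<integral>\<^sup>+x. ennreal (exp (\<beta> * snd x) * (\<beta> * (\<delta> (snd x) (fst x))\<^sup>2)) \<partial>Q) + (\<integral>\<^sup>+x. ennreal (exp (\<beta> * snd x) * w1 x) \<partial>Q)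
      \<le> (\<integral>\<^sup>+x. ennreal (exp (\<beta> * snd x) * w2 x) \<partial>Q)"
    unfolding X W1_def W2_def using w(3,4) by (simp add: ennreal_mult)
  have conv: "(\<integral>\<^sup>+x. ennreal (exp (\<beta> * snd x) * v x) \<partial>Q) = ennreal (\<integral>x. exp (\<beta> * snd x) * v x \<partial>Q)"
    if "integrable Q v" "\<And>x. 0 \<le> v x" for v
    by (rule nn_integral_eq_integral[OF integrable_weight[OF \<beta>0 that(1)]]) (use that(2) in auto)
  have i\<delta>: "integrable Q (\<lambda>x. \<beta> * (\<delta> (snd x) (fst x))\<^sup>2)" using square_integrableD(2)[OF \<delta>Q] by simp
  have \<delta>0: "0 \<le> \<beta> * (\<delta> (snd x) (fst x))\<^sup>2" for x using \<beta>0 by simp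
  have pos: "0 \<le> (\<integral>x. exp (\<beta> * snd x) * v x \<partial>Q)" if "\<And>x. 0 \<le> v x" for v
    using that by (intro Bochner_Integration.integral_nonneg) auto
  show ?thesis
    using fin unfolding conv[OF i\<delta> \<delta>0] conv[OF w(1,3)] conv[OF w(2,4)]
    using pos[OF \<delta>0] pos[OF w(3)] pos[OF w(4)]
    by (simp add: ennreal_plus[symmetric] ennreal_le_iff del: ennreal_plus)
qed

text \<open>With Young constant \<open>\<beta>/2\<close>, half of the gained \<open>\<beta>\<close>
  times the norm of \<open>\<delta>\<close> remains after absorption, which is the first claim. For
  the second, the energy estimate at t is multiplied by \<open>exp (\<beta> * t)\<close>, at most
  the weight at later times; the absorbed \<open>\<delta>\<close> term costs another
  \<open>2/\<beta>\<close>, hence \<open>4/\<beta>\<close>.\<close>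

lemma weighted_stability:
  assumes \<beta>: "\<beta> > 0" and D: "driver D" and V: "V \<in> H2 M F T" and N: "has_ito_integral M F T B V N"
    and \<delta>F: "\<And>t. t \<in> {0..T} \<Longrightarrow> \<delta> t \<in> borel_measurable (F t)" and \<delta>M: "\<And>t. t \<in> {0..T} \<Longrightarrow> square_integrable M (\<delta> t)"
    and \<delta>Q: "square_integrable Q (\<lambda>x. \<delta> (snd x) (fst x))"
    and eq: "AE \<omega> in M. \<forall>t\<in>{0..T}. \<delta> t \<omega> = tail_integral D t \<omega> - (N T \<omega> - N t \<omega>)"
  defines "nD \<equiv> (l2_norm (weighted \<beta>) D)\<^sup>2"
  shows "(\<beta>/2) * (l2_norm (weighted \<beta>) (\<lambda>x. \<delta> (snd x) (fst x)))\<^sup>2 + (l2_norm (weighted \<beta>) (\<lambda>x. V (snd x) (fst x)))\<^sup>2 \<le> (2/\<beta>) * nD"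
    "\<And>t. t \<in> {0..T} \<Longrightarrow> exp (\<beta> * t) * (l2_norm M (\<delta> t))\<^sup>2 \<le> (4/\<beta>) * nD"
proof -
  have \<beta>0: "0 \<le> \<beta>" using \<beta> by simp
  have DQ: "square_integrable Q D" using D by (simp add: driver_def)
  have VQ: "square_integrable Q (\<lambda>x. V (snd x) (fst x))" using V by (simp add: H2_iff case_prod_unfold)
  let ?w2 = "\<lambda>x. (\<beta>/2) * (\<delta> (snd x) (fst x))\<^sup>2 + (D x)\<^sup>2 / (\<beta>/2)"
  have le: "(l2_norm M (\<delta> t))\<^sup>2 + (\<integral>x. indicat_real {t..} (snd x) * (norm (V (snd x) (fst x)))\<^sup>2 \<partial>Q)
      \<le> (\<integral>x. indicat_real {t..} (snd x) * ?w2 x \<partial>Q)" if "t \<in> {0..T}" for t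
    by (rule energy_inequality[OF D V N \<delta>F \<delta>M \<delta>Q eq that]) (use \<beta> in auto)
  have i2: "integrable Q ?w2"
    using square_integrableD(2)[OF DQ] square_integrableD(2)[OF \<delta>Q] by simp
  have p2: "0 \<le> ?w2 x" for x using \<beta> by simp
  define n\<delta> where "n\<delta> = (l2_norm (weighted \<beta>) (\<lambda>x. \<delta> (snd x) (fst x)))\<^sup>2"
  define nV where "nV = (l2_norm (weighted \<beta>) (\<lambda>x. V (snd x) (fst x)))\<^sup>2"
  have n\<delta>: "n\<delta> = (\<integral>x. exp (\<beta> * snd x) * (\<delta> (snd x) (fst x))\<^sup>2 \<partial>Q)"
    unfolding n\<delta>_def l2_norm_weighted[OF square_integrableD(1)[OF \<delta>Q]] by simp
  have nD: "nD = (\<integral>x. exp (\<beta> * snd x) * (D x)\<^sup>2 \<partial>Q)"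
    unfolding nD_def l2_norm_weighted[OF square_integrableD(1)[OF DQ]] by simp
  have nV: "nV = (\<integral>x. exp (\<beta> * snd x) * (norm (V (snd x) (fst x)))\<^sup>2 \<partial>Q)"
    unfolding nV_def l2_norm_weighted[OF square_integrableD(1)[OF VQ]] by simp
  have iD: "integrable Q (\<lambda>x. exp (\<beta> * snd x) * (D x)\<^sup>2)" "integrable Q (\<lambda>x. exp (\<beta> * snd x) * (\<delta> (snd x) (fst x))\<^sup>2)"
    using integrable_weight[OF \<beta>0 square_integrableD(2)[OF DQ]] integrable_weight[OF \<beta>0 square_integrableD(2)[OF \<delta>Q]] by simp_all
  have w2: "(\<integral>x. exp (\<beta> * snd x) * ?w2 x \<partial>Q) = (\<beta>/2) * n\<delta> + (2/\<beta>) * nD"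
  proof -
    have "(\<integral>x. exp (\<beta> * snd x) * ?w2 x \<partial>Q) = (\<integral>x. (\<beta>/2) * (exp (\<beta> * snd x) * (\<delta> (snd x) (fst x))\<^sup>2) + (2/\<beta>) * (exp (\<beta> * snd x) * (D x)\<^sup>2) \<partial>Q)"
      by (simp add: algebra_simps)
    also have "\<dots> = (\<beta>/2) * n\<delta> + (2/\<beta>) * nD" unfolding n\<delta> nD using iD by simp
    finally show ?thesis .
  qed
  have "(\<integral>x. exp (\<beta> * snd x) * (\<beta> * (\<delta> (snd x) (fst x))\<^sup>2) \<partial>Q) + (\<integral>x. exp (\<beta> * snd x) * (norm (V (snd x) (fst x)))\<^sup>2 \<partial>Q)
      \<le> (\<integral>x. exp (\<beta> * snd x) * ?w2 x \<partial>Q)"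
    by (rule weighted_energy[OF \<beta> square_integrableD(2)[OF VQ] i2 _ p2 \<delta>M \<delta>Q le]) auto
  moreover have "(\<integral>x. exp (\<beta> * snd x) * (\<beta> * (\<delta> (snd x) (fst x))\<^sup>2) \<partial>Q) = \<beta> * n\<delta>"
    unfolding n\<delta> by (simp add: mult.left_commute)
  ultimately have main: "\<beta> * n\<delta> + nV \<le> (\<beta>/2) * n\<delta> + (2/\<beta>) * nD" unfolding w2 nV by simp
  then have S1: "(\<beta>/2) * n\<delta> + nV \<le> (2/\<beta>) * nD" by (simp add: field_simps)
  then show "(\<beta>/2) * (l2_norm (weighted \<beta>) (\<lambda>x. \<delta> (snd x) (fst x)))\<^sup>2 + (l2_norm (weighted \<beta>) (\<lambda>x. V (snd x) (fst x)))\<^sup>2 \<le> (2/\<beta>) * nD"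
    by (simp add: n\<delta>_def nV_def)
  fix t assume t: "t \<in> {0..T}"
  have "0 \<le> (\<integral>x. indicat_real {t..} (snd x) * (norm (V (snd x) (fst x)))\<^sup>2 \<partial>Q)" by simp
  then have "(l2_norm M (\<delta> t))\<^sup>2 \<le> (\<integral>x. indicat_real {t..} (snd x) * ?w2 x \<partial>Q)" using le[OF t] by linarith
  then have "exp (\<beta> * t) * (l2_norm M (\<delta> t))\<^sup>2 \<le> exp (\<beta> * t) * (\<integral>x. indicat_real {t..} (snd x) * ?w2 x \<partial>Q)"
    by (rule mult_left_mono) simp
  also have "\<dots> = (\<integral>x. exp (\<beta> * t) * (indicat_real {t..} (snd x) * ?w2 x) \<partial>Q)" by simp
  also have "\<dots> \<le> (\<integral>x. exp (\<beta> * snd x) * ?w2 x \<partial>Q)"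
  proof (rule integral_mono[OF _ integrable_weight[OF \<beta>0 i2]])
    show "integrable Q (\<lambda>x. exp (\<beta> * t) * (indicat_real {t..} (snd x) * ?w2 x))"
      by (rule integrable_mult_right[OF integrable_cut[OF i2]])
    fix x
    show "exp (\<beta> * t) * (indicat_real {t..} (snd x) * ?w2 x) \<le> exp (\<beta> * snd x) * ?w2 x"
      using p2[of x] \<beta>0 by (cases "t \<le> snd x") (auto simp: indicator_def intro!: mult_right_mono mult_left_mono)
  qed
  also have "\<dots> \<le> (4/\<beta>) * nD"
  proof -
    have "0 \<le> nV" by (simp add: nV_def)
    then have "(\<beta>/2) * n\<delta> \<le> (2/\<beta>) * nD" using S1 by linarith
    then show ?thesis unfolding w2 by simp
  qed
  finally show "exp (\<beta> * t) * (l2_norm M (\<delta> t))\<^sup>2 \<le> (4/\<beta>) * nD" .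
qed

section \<open>Existence and uniqueness\<close>

lemma tail_integral_cong:
  assumes C: "driver C" and C': "driver C'" and ae: "AE x in Q. C x = C' x"
  shows "AE \<omega> in M. \<forall>t\<in>{0..T}. tail_integral C t \<omega> = tail_integral C' t \<omega>"
  using Qp.AE_pair[OF ae] AE_space
proof eventually_elim
  case (elim \<omega>)
  have m: "(\<lambda>s. C (\<omega>, s)) \<in> borel_measurable L" "(\<lambda>s. C' (\<omega>, s)) \<in> borel_measurable L"
    using measurable_section_L[OF _ elim(2)] square_integrableD(1)[of Q C] square_integrableD(1)[of Q C'] C C'
    by (auto simp: driver_def)
  show ?case
  proof
    fix t assume "t \<in> {0..T}"
    then have t: "0 \<le> t" by simp
    show "tail_integral C t \<omega> = tail_integral C' t \<omega>"
      unfolding tail_integral_eq[OF t]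
    proof (rule integral_cong_AE)
      show "AE s in L. indicat_real {t..} s * C (\<omega>, s) = indicat_real {t..} s * C' (\<omega>, s)"
        using elim(1) by eventually_elim simp
    qed (intro borel_measurable_times m measurable_indicator_L, simp)+
  qed
qed

lemma AE_Q_fst:
  assumes "AE \<omega> in M. P \<omega>"
  shows "AE x in Q. P (fst x)"
proof -
  obtain N where N: "{\<omega> \<in> space M. \<not> P \<omega>} \<subseteq> N" "N \<in> null_sets M"
    using assms unfolding eventually_ae_filter by auto
  have [measurable]: "N \<in> sets M" using N(2) by auto
  have "AE x in Q. fst x \<notin> N"
  proof (rule Qp.AE_pair_measure)
    show "{x \<in> space Q. fst x \<notin> N} \<in> sets Q" by measurable
    show "AE x in M. AE y in L. fst (x, y) \<notin> N" using AE_not_in[OF N(2)] by eventually_elim simp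
  qed
  then show ?thesis using AE_space
    by eventually_elim (use N(1) in \<open>auto simp: space_Q\<close>)
qed

text \<open>Turns equality for almost every time, as provided by norms over \<open>Q\<close>, into
  equality at every time along continuous paths.\<close>

lemma continuous_AE_zero:
  fixes g :: "real \<Rightarrow> real"
  assumes g: "continuous_on {0..T} g" and ae: "AE s in L. g s = 0" and t: "t \<in> {0..T}"
  shows "g t = 0"
proof (rule ccontr)
  assume "g t \<noteq> 0"
  then obtain d where d: "d > 0" "\<And>s. s \<in> {0..T} \<Longrightarrow> dist s t < d \<Longrightarrow> dist (g s) (g t) < \<bar>g t\<bar>"
    using g t unfolding continuous_on_iff by (metis zero_less_abs_iff)
  define a b where "a = max 0 (t - d)" and "b = min T (t + d)"
  have ab: "a < b" using d(1) t T_pos by (auto simp: a_def b_def)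
  have "AE s in lborel. s \<in> {0..T} \<longrightarrow> g s = 0"
    using ae by (subst (asm) AE_restrict_space_iff) auto
  then have "AE s in lborel. s \<notin> {a<..<b}"
  proof eventually_elim
    case (elim s)
    show ?case
    proof
      assume "s \<in> {a<..<b}"
      then have "s \<in> {0..T}" "dist s t < d" by (auto simp: a_def b_def dist_real_def)
      then show False using d(2)[of s] elim by (simp add: dist_real_def)
    qed
  qed
  then have "emeasure lborel {a<..<b} = 0" by (subst (asm) AE_iff_measurable[of "{a<..<b}"]) auto
  then show False using ab by simp
qed

definition drift :: "('a \<Rightarrow> real \<Rightarrow> real \<Rightarrow> real ^ 'd \<Rightarrow> real) \<Rightarrow> (real \<Rightarrow> 'a \<Rightarrow> real) \<Rightarrow> (real \<Rightarrow> 'a \<Rightarrow> real ^ 'd) \<Rightarrow> 'a \<times> real \<Rightarrow> real" where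
  "drift f Y Z x = f (fst x) (snd x) (Y (snd x) (fst x)) (Z (snd x) (fst x))"

lemma drift_measurable:
  assumes f: "standard_generator M F T f" and Y: "(\<lambda>x. Y (snd x) (fst x)) \<in> borel_measurable Prog"
    and Z: "(\<lambda>x. Z (snd x) (fst x)) \<in> borel_measurable Prog"
  shows "drift f Y Z \<in> borel_measurable Prog"
proof -
  have fm: "(\<lambda>((\<omega>, t), y, z). f \<omega> t y z) \<in> borel_measurable (Prog \<Otimes>\<^sub>M (borel \<Otimes>\<^sub>M borel))"
    using f by (simp add: standard_generator_def)
  have "(\<lambda>x. (x, (Y (snd x) (fst x), Z (snd x) (fst x)))) \<in> measurable Prog (Prog \<Otimes>\<^sub>M (borel \<Otimes>\<^sub>M borel))"
    by (intro measurable_Pair measurable_ident_sets[OF refl] Y Z)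
  from measurable_compose[OF this fm] show ?thesis
    by (simp add: drift_def[abs_def] case_prod_unfold)
qed

text \<open>One constant serves all processes: the exceptional set of paths comes from the generator
  alone. The contraction rate can therefore be fixed before any solution is considered.\<close>

lemma drift_lipschitz:
  assumes f: "standard_generator M F T f"
  shows "\<exists>\<Lambda>\<ge>0. \<forall>Y Z Y' Z'. AE x in Q. \<bar>drift f Y Z x - drift f Y' Z' x\<bar>
       \<le> \<Lambda> * (\<bar>Y (snd x) (fst x) - Y' (snd x) (fst x)\<bar> + norm (Z (snd x) (fst x) - Z' (snd x) (fst x)))"
proof -
  obtain \<Lambda> where \<Lambda>: "0 \<le> \<Lambda>" "AE \<omega> in M. \<forall>t\<in>{0..T}. \<forall>y p z q. \<bar>f \<omega> t y z - f \<omega> t p q\<bar> \<le> \<Lambda> * (\<bar>y - p\<bar> + norm (z - q))"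
    using f unfolding standard_generator_def by blast
  have "AE x in Q. \<bar>drift f Y Z x - drift f Y' Z' x\<bar>
       \<le> \<Lambda> * (\<bar>Y (snd x) (fst x) - Y' (snd x) (fst x)\<bar> + norm (Z (snd x) (fst x) - Z' (snd x) (fst x)))" for Y Z Y' Z'
    using AE_Q_fst[OF \<Lambda>(2)] AE_space by eventually_elim (auto simp: drift_def space_Q)
  then show ?thesis using \<Lambda>(1) by blast
qed

lemma S2_square_integrable_Q: "Y \<in> S2 M F T \<Longrightarrow> square_integrable Q (\<lambda>x. Y (snd x) (fst x))"
  using S2D(5) by (simp add: case_prod_unfold)

lemma H2_square_integrable_Q: "Z \<in> H2 M F T \<Longrightarrow> square_integrable Q (\<lambda>x. Z (snd x) (fst x))"
  by (simp add: H2_iff case_prod_unfold)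

text \<open>Comparison with the zero processes bounds the drift by \<open>f\<close> at 0 plus a
  multiple of \<open>|Y| + |Z|\<close>, all square integrable over \<open>Q\<close>.\<close>

lemma drift_driver:
  assumes f: "standard_generator M F T f" and Y: "Y \<in> S2 M F T" and Z: "Z \<in> H2 M F T"
  shows "driver (drift f Y Z)"
proof -
  have YP: "(\<lambda>x. Y (snd x) (fst x)) \<in> borel_measurable Prog" using S2D(4)[OF Y] by (simp add: case_prod_unfold)
  have ZP: "(\<lambda>x. Z (snd x) (fst x)) \<in> borel_measurable Prog"
  proof (rule measurable_from_subalg[OF subalgebra_Pred_Prog])
    show "(\<lambda>x. Z (snd x) (fst x)) \<in> borel_measurable Pred" using Z by (simp add: H2_iff case_prod_unfold)
  qed
  have m: "drift f Y Z \<in> borel_measurable Prog" by (rule drift_measurable[OF f YP ZP])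
  have m0: "drift f (\<lambda>_ _. 0) (\<lambda>_ _. 0) \<in> borel_measurable Q"
    by (rule measurable_from_subalg[OF subalgebra_Prog drift_measurable[OF f]]) simp_all
  have sq0: "square_integrable Q (drift f (\<lambda>_ _. 0) (\<lambda>_ _. 0))"
    unfolding square_integrable_iff_nn_integral
  proof (intro conjI m0)
    have "(\<integral>\<^sup>+x. ennreal ((norm (drift f (\<lambda>_ _. 0) (\<lambda>_ _. 0) x))\<^sup>2) \<partial>Q)
       = (\<integral>\<^sup>+\<omega>. (\<integral>\<^sup>+t\<in>{0..T}. ennreal (\<bar>f \<omega> t 0 0\<bar>\<^sup>2) \<partial>lborel) \<partial>M)"
      using nn_integral_iterated[OF m0] by (simp add: drift_def)
    then show "(\<integral>\<^sup>+x. ennreal ((norm (drift f (\<lambda>_ _. 0) (\<lambda>_ _. 0) x))\<^sup>2) \<partial>Q) < \<infinity>"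
      using f by (simp add: standard_generator_def)
  qed
  obtain \<Lambda> where \<Lambda>: "0 \<le> \<Lambda>"
    "\<And>Y Z Y' Z'. AE x in Q. \<bar>drift f Y Z x - drift f Y' Z' x\<bar>
       \<le> \<Lambda> * (\<bar>Y (snd x) (fst x) - Y' (snd x) (fst x)\<bar> + norm (Z (snd x) (fst x) - Z' (snd x) (fst x)))"
    using drift_lipschitz[OF f] by blast
  let ?G = "\<lambda>x. \<bar>drift f (\<lambda>_ _. 0) (\<lambda>_ _. 0) x\<bar> + \<Lambda> * (\<bar>Y (snd x) (fst x)\<bar> + norm (Z (snd x) (fst x)))"
  have nsq: "square_integrable Q (\<lambda>x. norm (g x))" if "square_integrable Q g" for g :: "'a \<times> real \<Rightarrow> 'e::euclidean_space"
    using that by (auto simp: square_integrable_def)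
  have G: "square_integrable Q ?G"
    using nsq[OF sq0] nsq[OF S2_square_integrable_Q[OF Y]] nsq[OF H2_square_integrable_Q[OF Z]]
    by (intro square_integrable_add square_integrable_cmult(1)) simp_all
  have "AE x in Q. norm (drift f Y Z x) \<le> norm (?G x)"
    using \<Lambda>(2)[of Y Z "\<lambda>_ _. 0" "\<lambda>_ _. 0"] by eventually_elim (use \<Lambda>(1) in auto)
  then have "square_integrable Q (drift f Y Z)"
    by (rule square_integrable_bound(1)[OF G measurable_from_subalg[OF subalgebra_Prog m]])
  then show ?thesis using m by (simp add: driver_def)
qed

lemma driver_diff: "driver C \<Longrightarrow> driver C' \<Longrightarrow> driver (\<lambda>x. C x - C' x)"
  by (auto simp: driver_def intro: borel_measurable_diff square_integrable_diff)

lemma tail_integral_diff: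
  assumes "driver C" "driver C'"
  shows "AE \<omega> in M. \<forall>t\<in>{0..T}. tail_integral (\<lambda>x. C x - C' x) t \<omega> = tail_integral C t \<omega> - tail_integral C' t \<omega>"
  using driver_good[OF assms(1)] driver_good[OF assms(2)]
proof eventually_elim
  case (elim \<omega>)
  show ?case
  proof
    fix t assume "t \<in> {0..T}"
    then have t: "0 \<le> t" by simp
    have i: "integrable L (\<lambda>s. indicat_real {t..} s * h s)" if "integrable L h" for h :: "real \<Rightarrow> real"
      by (rule Bochner_Integration.integrable_bound[OF that])
        (use borel_measurable_integrable[OF that] measurable_indicator_L[of "{t..}"] in \<open>auto simp: indicator_def\<close>)
    show "tail_integral (\<lambda>x. C x - C' x) t \<omega> = tail_integral C t \<omega> - tail_integral C' t \<omega>"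
      unfolding tail_integral_eq[OF t] right_diff_distrib
      by (rule Bochner_Integration.integral_diff) (use i elim in auto)
  qed
qed

end

context reflected_bsde
begin

lemma driven_solutionD:
  assumes "driven_solution C Y Z K X"
  shows "Y \<in> S2 M F T" "Z \<in> H2 M F T" "continuous_on {0..T} K" "mono_on {0..T} K" "K 0 = 0"
    "has_ito_integral M F T B Z X"
    "AE \<omega> in M. \<forall>t\<in>{0..T}. Y t \<omega> = \<xi> \<omega> + tail_integral C t \<omega> - (X T \<omega> - X t \<omega>) + K T - K t"
    "\<And>t. t \<in> {0..T} \<Longrightarrow> u t \<le> expectation (Y t)" "flatness_condition M T u Y K"
  using assms by (auto simp: driven_solution_def A2_D_iff)

text \<open>The integral flatness condition in the form that \<open>reflection_comparison\<close>
  consumes; the means of \<open>S2\<close> processes are continuous, so the slack is a continuous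
  function.\<close>

lemma driven_solution_flat:
  assumes S: "driven_solution C Y Z K X" and ab: "0 \<le> a" "a \<le> b" "b \<le> T"
    and pos: "\<And>s. s \<in> {a..b} \<Longrightarrow> u s < expectation (Y s)"
  shows "K a = K b"
proof -
  note SD = driven_solutionD[OF S]
  interpret K: increasing_path T K by standard (use T_pos SD in auto)
  show ?thesis
  proof (rule K.flat_imp_constant[of "\<lambda>t. expectation (Y t) - u t"])
    show "continuous_on {0..T} (\<lambda>t. expectation (Y t) - u t)"
      by (intro continuous_intros u_cont S2D(6)[OF SD(1)])
    show "(LINT t:{0..T}|K.\<mu>. expectation (Y t) - u t) = 0"
      using SD(9) by (simp add: flatness_condition_def)
  qed (use SD(8) ab pos in auto)
qed

text \<open>\<open>Y - Y'\<close> is the unreflected difference \<open>\<delta>\<close> plus the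
  deterministic \<open>\<kappa>\<close>. The former is covered by \<open>weighted_stability\<close>.
  The latter is bounded at each time by the later differences of unreflected means, and its weighted
  square is at most \<open>(4/\<beta>) * nD\<close> pointwise. The constant collects
  \<open>8 + 8 * T\<close> from \<open>Y\<close>, using \<open>1 \<le> \<beta>\<close>, and 2 from
  \<open>Z\<close>.\<close>

lemma driven_stability:
  assumes C: "driver C" and C': "driver C'" and S: "driven_solution C Y Z K X" and S': "driven_solution C' Y' Z' K' X'"
    and \<beta>: "1 \<le> \<beta>"
  shows "(l2_norm (weighted \<beta>) (\<lambda>x. Y (snd x) (fst x) - Y' (snd x) (fst x)))\<^sup>2
      + (l2_norm (weighted \<beta>) (\<lambda>x. Z (snd x) (fst x) - Z' (snd x) (fst x)))\<^sup>2
    \<le> (10 + 8 * T) / \<beta> * (l2_norm (weighted \<beta>) (\<lambda>x. C x - C' x))\<^sup>2"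
proof -
  note SD = driven_solutionD[OF S] and SD' = driven_solutionD[OF S']
  have \<beta>0: "\<beta> > 0" using \<beta> by simp
  \<comment> \<open>The push still to come; it decreases to 0 and is the quantity that both the
    equation and the comparison lemma see.\<close>
  define k where "k t = K T - K t" for t
  define k' where "k' t = K' T - K' t" for t
  define \<delta> where "\<delta> t \<omega> = (Y t \<omega> - k t) - (Y' t \<omega> - k' t)" for t \<omega>
  define D where "D x = C x - C' x" for x
  define V where "V s \<omega> = Z s \<omega> - Z' s \<omega>" for s \<omega>
  define N where "N s \<omega> = X s \<omega> - X' s \<omega>" for s \<omega>
  define nD where "nD = (l2_norm (weighted \<beta>) D)\<^sup>2"
  have D_eq: "D = (\<lambda>x. C x - C' x)" by (simp add: D_def fun_eq_iff)
  have Dd: "driver D" unfolding D_eq by (rule driver_diff[OF C C'])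
  have V: "V \<in> H2 M F T" unfolding V_def by (rule H2_diff[OF SD(2) SD'(2)])
  have N: "has_ito_integral M F T B V N"
    unfolding V_def N_def by (rule has_ito_integral_diff[OF SD(2,6) SD'(2,6)])
  have \<delta>F: "\<delta> t \<in> borel_measurable (F t)" if "t \<in> {0..T}" for t
    unfolding \<delta>_def by (intro borel_measurable_diff borel_measurable_const S2D(1)[OF SD(1) that] S2D(1)[OF SD'(1) that])
  have \<delta>M: "square_integrable M (\<delta> t)" if "t \<in> {0..T}" for t
    unfolding \<delta>_def by (intro square_integrable_diff square_integrable_const S2D(3)[OF SD(1) that] S2D(3)[OF SD'(1) that])
  define \<kappa> where "\<kappa> x = k (snd x) - k' (snd x)" for x :: "'a \<times> real"
  have kc: "continuous_on {0..T} k" "continuous_on {0..T} k'"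
    unfolding k_def k'_def by (intro continuous_intros SD(3) SD'(3))+
  have \<kappa>m: "\<kappa> \<in> borel_measurable Q"
  proof -
    have c: "continuous_on {0..T} (\<lambda>t. k t - k' t)" by (intro continuous_intros kc)
    have "(\<lambda>t. k t - k' t) \<in> borel_measurable (restrict_space borel {0..T})"
      by (rule borel_measurable_continuous_on_restrict[OF c])
    then have "(\<lambda>t. k t - k' t) \<in> borel_measurable L"
      by (simp add: measurable_cong_sets[OF sets_restrict_space_cong[OF sets_lborel] refl])
    from measurable_compose[OF measurable_snd this] show ?thesis unfolding \<kappa>_def .
  qed
  have YQ: "square_integrable Q (\<lambda>x. Y (snd x) (fst x) - Y' (snd x) (fst x))"
    by (intro square_integrable_diff S2_square_integrable_Q SD(1) SD'(1))
  have eq: "AE \<omega> in M. \<forall>t\<in>{0..T}. \<delta> t \<omega> = tail_integral D t \<omega> - (N T \<omega> - N t \<omega>)"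
    using SD(7) SD'(7) tail_integral_diff[OF C C'] by eventually_elim (simp add: \<delta>_def D_eq N_def k_def k'_def)
  have kT: "k T = 0" "k' T = 0" by (auto simp: k_def k'_def)
  have kmono: "k r \<le> k s" "k' r \<le> k' s" if "0 \<le> s" "s \<le> r" "r \<le> T" for s r
    using mono_onD[OF SD(4), of s r] mono_onD[OF SD'(4), of s r] that by (auto simp: k_def k'_def)
  have \<kappa>bd: "\<bar>\<kappa> x\<bar> \<le> K T + K' T" if "x \<in> space Q" for x
  proof -
    have s: "snd x \<in> {0..T}" using that by (auto simp: space_Q)
    have "0 \<le> k (snd x)" "k (snd x) \<le> K T" "0 \<le> k' (snd x)" "k' (snd x) \<le> K' T"
      using kmono[of "snd x" T] kmono[of 0 "snd x"] s kT SD(5) SD'(5) by (auto simp: k_def k'_def)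
    then show ?thesis by (auto simp: \<kappa>_def)
  qed
  have \<kappa>Q: "square_integrable Q \<kappa>" by (rule Qm.square_integrable_bounded[OF \<kappa>m]) (use \<kappa>bd in auto)
  have \<delta>eq: "\<delta> (snd x) (fst x) = (Y (snd x) (fst x) - Y' (snd x) (fst x)) - \<kappa> x" for x
    by (simp add: \<delta>_def \<kappa>_def)
  have \<delta>Q: "square_integrable Q (\<lambda>x. \<delta> (snd x) (fst x))"
    unfolding \<delta>eq by (rule square_integrable_diff[OF YQ \<kappa>Q])
  have W: "(\<beta>/2) * (l2_norm (weighted \<beta>) (\<lambda>x. \<delta> (snd x) (fst x)))\<^sup>2 + (l2_norm (weighted \<beta>) (\<lambda>x. V (snd x) (fst x)))\<^sup>2
      \<le> (2/\<beta>) * nD" "\<And>t. t \<in> {0..T} \<Longrightarrow> exp (\<beta> * t) * (l2_norm M (\<delta> t))\<^sup>2 \<le> (4/\<beta>) * nD"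
    unfolding nD_def by (rule weighted_stability[OF \<beta>0 Dd V N _ _ \<delta>Q eq]; use \<delta>F \<delta>M in simp)+
  define h where "h t = expectation (Y t) - k t" for t
  define h' where "h' t = expectation (Y' t) - k' t" for t
  \<comment> \<open>\<open>h\<close> and \<open>h'\<close> are the means without reflection, so
    their difference is the mean of \<open>\<delta> t\<close>, bounded by its L2 norm over a
    probability space.\<close>
  have E\<delta>: "\<bar>h t - h' t\<bar> \<le> l2_norm M (\<delta> t)" if t: "t \<in> {0..T}" for t
  proof -
    have "h t - h' t = expectation (\<delta> t)"
      unfolding \<delta>_def h_def h'_def
      using square_integrable_integrable[OF S2D(3)[OF SD(1) t]] square_integrable_integrable[OF S2D(3)[OF SD'(1) t]]
      by (simp add: prob_space)
    also have "\<bar>\<dots>\<bar> \<le> l2_norm M (\<lambda>_. 1::real) * l2_norm M (\<delta> t)"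
      using integral_Cauchy_Schwarz[OF square_integrable_const[of 1] \<delta>M[OF t]] by simp
    finally show ?thesis by (simp add: l2_norm_def prob_space)
  qed
  \<comment> \<open>The bound is uniform over r after t, because the weight at r exceeds the one at
    t; it is the constant \<open>D\<close> of the comparison from t on.\<close>
  have hb: "\<bar>h r - h' r\<bar> \<le> sqrt (exp (- \<beta> * t) * ((4/\<beta>) * nD))" if t: "0 \<le> t" "t \<le> r" "r \<le> T" for t r
  proof -
    have r: "r \<in> {0..T}" using t by auto
    have "exp (\<beta> * t) * (l2_norm M (\<delta> r))\<^sup>2 \<le> exp (\<beta> * r) * (l2_norm M (\<delta> r))\<^sup>2"
      using t \<beta>0 by (intro mult_right_mono) auto
    also have "\<dots> \<le> (4/\<beta>) * nD" by (rule W(2)[OF r])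
    finally have "exp (- \<beta> * t) * (exp (\<beta> * t) * (l2_norm M (\<delta> r))\<^sup>2) \<le> exp (- \<beta> * t) * ((4/\<beta>) * nD)"
      by (rule mult_left_mono) simp
    then have "(l2_norm M (\<delta> r))\<^sup>2 \<le> exp (- \<beta> * t) * ((4/\<beta>) * nD)"
      by (simp add: mult.assoc[symmetric] exp_add[symmetric])
    then have "l2_norm M (\<delta> r) \<le> sqrt (exp (- \<beta> * t) * ((4/\<beta>) * nD))" by (rule real_le_rsqrt)
    then show ?thesis using E\<delta>[OF r] by linarith
  qed
  have flat: "k a = k b" if "0 \<le> a" "a \<le> b" "b \<le> T" "\<And>s. s \<in> {a..b} \<Longrightarrow> u s < h s + k s" for a b
    using driven_solution_flat[OF S that(1-3)] that(4) by (simp add: k_def h_def)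
  have flat': "k' a = k' b" if "0 \<le> a" "a \<le> b" "b \<le> T" "\<And>s. s \<in> {a..b} \<Longrightarrow> u s < h' s + k' s" for a b
    using driven_solution_flat[OF S' that(1-3)] that(4) by (simp add: k'_def h'_def)
  have nD0: "0 \<le> nD" by (simp add: nD_def)
  have kk: "\<bar>k t - k' t\<bar> \<le> sqrt (exp (- \<beta> * t) * ((4/\<beta>) * nD))" if t: "t \<in> {0..T}" for t
  proof -
    have "k' t \<le> k t + sqrt (exp (- \<beta> * t) * ((4/\<beta>) * nD))"
    proof (rule reflection_comparison[OF t kc(1) kmono(1) kT(1) kc(2) kT(2) _ flat'])
      show "u s \<le> h s + k s" if "s \<in> {0..T}" for s using SD(8)[OF that] by (simp add: h_def)
      show "h s - h' s \<le> sqrt (exp (- \<beta> * t) * ((4/\<beta>) * nD))" if "s \<in> {t..T}" for s using hb[of t s] that t by auto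
    qed (use nD0 \<beta>0 in auto)
    moreover have "k t \<le> k' t + sqrt (exp (- \<beta> * t) * ((4/\<beta>) * nD))"
    proof (rule reflection_comparison[OF t kc(2) kmono(2) kT(2) kc(1) kT(1) _ flat])
      show "u s \<le> h' s + k' s" if "s \<in> {0..T}" for s using SD'(8)[OF that] by (simp add: h'_def)
      show "h' s - h s \<le> sqrt (exp (- \<beta> * t) * ((4/\<beta>) * nD))" if "s \<in> {t..T}" for s using hb[of t s] that t by auto
    qed (use nD0 \<beta>0 in auto)
    ultimately show ?thesis by linarith
  qed
  \<comment> \<open>The factor \<open>exp (- \<beta> * t)\<close> in the bound for
    \<open>\<kappa>\<close> squared cancels the weight exactly, leaving a constant integrated over
    \<open>Q\<close>, whose total mass is \<open>T\<close>.\<close>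
  have n\<kappa>: "(l2_norm (weighted \<beta>) \<kappa>)\<^sup>2 \<le> (4 * T / \<beta>) * nD"
  proof -
    have "(l2_norm (weighted \<beta>) \<kappa>)\<^sup>2 = (\<integral>x. exp (\<beta> * snd x) * (norm (\<kappa> x))\<^sup>2 \<partial>Q)" by (rule l2_norm_weighted[OF \<kappa>m])
    also have "\<dots> \<le> (\<integral>x. (4/\<beta>) * nD \<partial>Q)"
    proof (rule integral_mono)
      show "integrable Q (\<lambda>x. exp (\<beta> * snd x) * (norm (\<kappa> x))\<^sup>2)"
        by (rule integrable_weight[OF _ square_integrableD(2)[OF \<kappa>Q]]) (use \<beta>0 in simp)
      fix x assume "x \<in> space Q"
      then have s: "snd x \<in> {0..T}" by (auto simp: space_Q)
      have "(norm (\<kappa> x))\<^sup>2 \<le> (sqrt (exp (- \<beta> * snd x) * ((4/\<beta>) * nD)))\<^sup>2"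
        using kk[OF s] by (intro power_mono) (auto simp: \<kappa>_def)
      also have "\<dots> = exp (- \<beta> * snd x) * ((4/\<beta>) * nD)" using nD0 \<beta>0 by simp
      finally have "exp (\<beta> * snd x) * (norm (\<kappa> x))\<^sup>2 \<le> exp (\<beta> * snd x) * (exp (- \<beta> * snd x) * ((4/\<beta>) * nD))"
        by (rule mult_left_mono) simp
      also have "\<dots> = (4/\<beta>) * nD" by (simp add: mult.assoc[symmetric] exp_add[symmetric])
      finally show "exp (\<beta> * snd x) * (norm (\<kappa> x))\<^sup>2 \<le> (4/\<beta>) * nD" .
    qed simp
    also have "\<dots> = (4 * T / \<beta>) * nD"
    proof -
      have "measure Q (space Q) = T"
      proof -
        have "emeasure Q (space M \<times> space L) = emeasure M (space M) * emeasure L (space L)"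
          by (rule Lm.emeasure_pair_measure_Times[OF sets.top sets.top])
        also have "\<dots> = ennreal T" using T_pos by (simp add: emeasure_space_1 space_L emeasure_restrict_space)
        finally show ?thesis using T_pos by (simp add: measure_def space_pair_measure)
      qed
      then show ?thesis by simp
    qed
    finally show ?thesis .
  qed
  have n\<delta>: "(l2_norm (weighted \<beta>) (\<lambda>x. \<delta> (snd x) (fst x)))\<^sup>2 \<le> (4 / \<beta>\<^sup>2) * nD"
    and nV: "(l2_norm (weighted \<beta>) (\<lambda>x. V (snd x) (fst x)))\<^sup>2 \<le> (2 / \<beta>) * nD"
  proof -
    have "(\<beta>/2) * (l2_norm (weighted \<beta>) (\<lambda>x. \<delta> (snd x) (fst x)))\<^sup>2 \<le> (2/\<beta>) * nD"
      using W(1) zero_le_power2[of "l2_norm (weighted \<beta>) (\<lambda>x. V (snd x) (fst x))"] by linarith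
    then show "(l2_norm (weighted \<beta>) (\<lambda>x. \<delta> (snd x) (fst x)))\<^sup>2 \<le> (4 / \<beta>\<^sup>2) * nD"
      using \<beta>0 by (simp add: field_simps power2_eq_square)
    have "0 \<le> (\<beta>/2) * (l2_norm (weighted \<beta>) (\<lambda>x. \<delta> (snd x) (fst x)))\<^sup>2" using \<beta>0 by simp
    then show "(l2_norm (weighted \<beta>) (\<lambda>x. V (snd x) (fst x)))\<^sup>2 \<le> (2 / \<beta>) * nD" using W(1) by linarith
  qed
  have sw: "square_integrable (weighted \<beta>) f \<longleftrightarrow> square_integrable Q f" for f :: "'a \<times> real \<Rightarrow> real"
    by (rule square_integrable_weighted) (use \<beta>0 in simp)
  have "l2_norm (weighted \<beta>) (\<lambda>x. Y (snd x) (fst x) - Y' (snd x) (fst x))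
      = l2_norm (weighted \<beta>) (\<lambda>x. \<delta> (snd x) (fst x) + \<kappa> x)" by (simp add: \<delta>eq)
  also have "\<dots> \<le> l2_norm (weighted \<beta>) (\<lambda>x. \<delta> (snd x) (fst x)) + l2_norm (weighted \<beta>) \<kappa>"
    by (rule l2_norm_triangle) (simp_all add: sw \<delta>Q \<kappa>Q)
  finally have "(l2_norm (weighted \<beta>) (\<lambda>x. Y (snd x) (fst x) - Y' (snd x) (fst x)))\<^sup>2
      \<le> (l2_norm (weighted \<beta>) (\<lambda>x. \<delta> (snd x) (fst x)) + l2_norm (weighted \<beta>) \<kappa>)\<^sup>2" by (rule power_mono) simp
  also have "\<dots> \<le> 2 * (l2_norm (weighted \<beta>) (\<lambda>x. \<delta> (snd x) (fst x)))\<^sup>2 + 2 * (l2_norm (weighted \<beta>) \<kappa>)\<^sup>2"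
    using norm_add_squared_le[of "l2_norm (weighted \<beta>) (\<lambda>x. \<delta> (snd x) (fst x))" "l2_norm (weighted \<beta>) \<kappa>"] by simp
  also have "\<dots> \<le> 2 * ((4 / \<beta>\<^sup>2) * nD) + 2 * ((4 * T / \<beta>) * nD)"
    using n\<delta> n\<kappa> by linarith
  finally have nY: "(l2_norm (weighted \<beta>) (\<lambda>x. Y (snd x) (fst x) - Y' (snd x) (fst x)))\<^sup>2
      \<le> (8 / \<beta>\<^sup>2 + 8 * T / \<beta>) * nD" by (simp add: algebra_simps)
  \<comment> \<open>The only place where \<open>1 \<le> \<beta>\<close>, rather than positivity,
    enters the constant.\<close>
  have "8 / \<beta>\<^sup>2 \<le> 8 / \<beta>" using \<beta> by (simp add: field_simps power2_eq_square)
  then have "(8 / \<beta>\<^sup>2 + 8 * T / \<beta>) * nD \<le> (8 / \<beta> + 8 * T / \<beta>) * nD" using nD0 by (intro mult_right_mono) auto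
  moreover have "(8 / \<beta> + 8 * T / \<beta>) * nD + (2 / \<beta>) * nD = (10 + 8 * T) / \<beta> * nD"
    by (simp add: add_divide_distrib algebra_simps)
  ultimately show ?thesis using nY nV unfolding V_def nD_def D_def by linarith
qed

text \<open>A flat solution of the original problem is a solution of the driven equation whose
  driver is its own drift; existence and uniqueness thereby become statements about fixed
  points.\<close>

lemma mean_reflected_iff:
  "mean_reflected_solution M F T B f u \<xi> Y Z K \<and> flatness_condition M T u Y K
    \<longleftrightarrow> (\<exists>X. driven_solution (drift f Y Z) Y Z K X)"
  unfolding mean_reflected_solution_def driven_solution_def tail_integral_def drift_def fst_conv snd_conv by blast

lemma driven_solution_cong:
  assumes "driver C" "driver C'" "AE x in Q. C x = C' x" and S: "driven_solution C Y Z K X"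
  shows "driven_solution C' Y Z K X"
proof -
  have "AE \<omega> in M. \<forall>t\<in>{0..T}. Y t \<omega> = \<xi> \<omega> + tail_integral C' t \<omega> - (X T \<omega> - X t \<omega>) + K T - K t"
    using driven_solutionD(7)[OF S] tail_integral_cong[OF assms(1-3)] by eventually_elim simp
  then show ?thesis using S by (simp add: driven_solution_def)
qed

text \<open>Stated for arbitrary solutions of the two driven equations, so that the same bound gives
  both convergence of the iteration and uniqueness of the fixed point.\<close>

lemma drift_contraction:
  assumes f: "standard_generator M F T f"
  shows "\<exists>\<beta>\<ge>1. \<forall>C Y Z K X C' Y' Z' K' X'.
    driver C \<longrightarrow> driver C' \<longrightarrow> driven_solution C Y Z K X \<longrightarrow> driven_solution C' Y' Z' K' X' \<longrightarrow>
    l2_norm (weighted \<beta>) (\<lambda>x. drift f Y Z x - drift f Y' Z' x) \<le> 1/2 * l2_norm (weighted \<beta>) (\<lambda>x. C x - C' x)"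
proof -
  obtain \<Lambda> where \<Lambda>: "0 \<le> \<Lambda>"
    "\<And>Y Z Y' Z'. AE x in Q. \<bar>drift f Y Z x - drift f Y' Z' x\<bar>
       \<le> \<Lambda> * (\<bar>Y (snd x) (fst x) - Y' (snd x) (fst x)\<bar> + norm (Z (snd x) (fst x) - Z' (snd x) (fst x)))"
    using drift_lipschitz[OF f] by blast
  define c where "c = 10 + 8 * T"
  have c: "0 < c" using T_pos by (simp add: c_def)
  \<comment> \<open>The Lipschitz bound and
    \<open>(a + b)\<^sup>2 \<le> 2 * (a\<^sup>2 + b\<^sup>2)\<close> give the squared factor
    \<open>2 * \<Lambda>\<^sup>2 * c / \<beta>\<close>; this choice makes it at most 1/4, that is,
    1/2 for norms.\<close>
  define \<beta> where "\<beta> = max 1 (8 * \<Lambda>\<^sup>2 * c)"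
  have \<beta>: "1 \<le> \<beta>" "8 * \<Lambda>\<^sup>2 * c \<le> \<beta>" by (simp_all add: \<beta>_def)
  have sw: "square_integrable (weighted \<beta>) h \<longleftrightarrow> square_integrable Q h" for h :: "'a \<times> real \<Rightarrow> 'e::euclidean_space"
    by (rule square_integrable_weighted) (use \<beta> in simp)
  have "l2_norm (weighted \<beta>) (\<lambda>x. drift f Y Z x - drift f Y' Z' x) \<le> 1/2 * l2_norm (weighted \<beta>) (\<lambda>x. C x - C' x)"
    if C: "driver C" "driver C'" and S: "driven_solution C Y Z K X" and S': "driven_solution C' Y' Z' K' X'"
    for C Y Z K X C' Y' Z' K' X'
  proof -
    let ?n = "l2_norm (weighted \<beta>) (\<lambda>x. C x - C' x)"
    define y where "y x = Y (snd x) (fst x) - Y' (snd x) (fst x)" for x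
    define z where "z x = Z (snd x) (fst x) - Z' (snd x) (fst x)" for x
    let ?a = "l2_norm (weighted \<beta>) y" and ?b = "l2_norm (weighted \<beta>) z"
    note SD = driven_solutionD(1,2)[OF S] and SD' = driven_solutionD(1,2)[OF S']
    have y: "square_integrable Q (\<lambda>x. \<bar>y x\<bar>)"
      using square_integrable_diff[OF S2_square_integrable_Q[OF SD(1)] S2_square_integrable_Q[OF SD'(1)]]
      by (auto simp: square_integrable_def y_def[abs_def])
    have z: "square_integrable Q (\<lambda>x. norm (z x))"
      using square_integrable_diff[OF H2_square_integrable_Q[OF SD(2)] H2_square_integrable_Q[OF SD'(2)]]
      by (auto simp: square_integrable_def z_def[abs_def])
    have D: "square_integrable Q (\<lambda>x. drift f Y Z x - drift f Y' Z' x)"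
      using driver_diff[OF drift_driver[OF f SD] drift_driver[OF f SD']] by (simp add: driver_def)
    have G: "square_integrable (weighted \<beta>) (\<lambda>x. \<Lambda> * (\<bar>y x\<bar> + norm (z x)))"
      unfolding sw by (intro square_integrable_cmult(1) square_integrable_add y z)
    have "l2_norm (weighted \<beta>) (\<lambda>x. drift f Y Z x - drift f Y' Z' x) \<le> l2_norm (weighted \<beta>) (\<lambda>x. \<Lambda> * (\<bar>y x\<bar> + norm (z x)))"
    proof (rule square_integrable_bound(2)[OF G])
      show "(\<lambda>x. drift f Y Z x - drift f Y' Z' x) \<in> borel_measurable (weighted \<beta>)"
        using square_integrableD(1)[OF D] by (simp add: measurable_weighted)
      show "AE x in weighted \<beta>. norm (drift f Y Z x - drift f Y' Z' x) \<le> norm (\<Lambda> * (\<bar>y x\<bar> + norm (z x)))"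
        unfolding AE_weighted using \<Lambda>(2)[of Y Z Y' Z'] by eventually_elim (use \<Lambda>(1) in \<open>simp add: y_def z_def\<close>)
    qed
    also have "\<dots> = \<Lambda> * l2_norm (weighted \<beta>) (\<lambda>x. \<bar>y x\<bar> + norm (z x))"
      using square_integrable_cmult(2)[of "weighted \<beta>" "\<lambda>x. \<bar>y x\<bar> + norm (z x)" \<Lambda>] square_integrable_add[OF y z] \<Lambda>(1) by (simp add: sw)
    also have "\<dots> \<le> \<Lambda> * (l2_norm (weighted \<beta>) (\<lambda>x. \<bar>y x\<bar>) + l2_norm (weighted \<beta>) (\<lambda>x. norm (z x)))"
      using \<Lambda>(1) y z by (intro mult_left_mono l2_norm_triangle) (simp_all add: sw)
    also have "\<dots> = \<Lambda> * (?a + ?b)" by (simp add: l2_norm_def)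
    finally have le: "l2_norm (weighted \<beta>) (\<lambda>x. drift f Y Z x - drift f Y' Z' x) \<le> \<Lambda> * (?a + ?b)" .
    have "(?a + ?b)\<^sup>2 \<le> 2 * (?a\<^sup>2 + ?b\<^sup>2)"
      using norm_add_squared_le[of ?a ?b] by simp
    also have "\<dots> \<le> 2 * (c / \<beta> * ?n\<^sup>2)"
      using driven_stability[OF C S S' \<beta>(1)] unfolding y_def[abs_def] z_def[abs_def] c_def by (intro mult_left_mono) simp_all
    finally have "\<Lambda>\<^sup>2 * (?a + ?b)\<^sup>2 \<le> \<Lambda>\<^sup>2 * (2 * (c / \<beta> * ?n\<^sup>2))" by (rule mult_left_mono) simp
    also have "\<dots> = (8 * \<Lambda>\<^sup>2 * c) / \<beta> * (1/4 * ?n\<^sup>2)" by simp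
    also have "\<dots> \<le> 1 * (1/4 * ?n\<^sup>2)"
      using \<beta> by (intro mult_right_mono) (simp_all add: divide_le_eq)
    finally have "(\<Lambda> * (?a + ?b))\<^sup>2 \<le> (1/2 * ?n)\<^sup>2" by (simp only: power_mult_distrib) (simp add: power_divide)
    then have "\<Lambda> * (?a + ?b) \<le> 1/2 * ?n" by (rule power2_le_imp_le) simp
    with le show ?thesis by linarith
  qed
  with \<beta>(1) show ?thesis by blast
qed

text \<open>The Ito increment is centred and \<open>K\<close> is deterministic, so the remaining
  push can be read off from the mean of \<open>Y\<close>. This is how \<open>K\<close> is identified
  in the uniqueness proof.\<close>

lemma driven_solution_expectation:
  assumes C: "driver C" and S: "driven_solution C Y Z K X" and t: "t \<in> {0..T}"
  shows "expectation (Y t) = expectation \<xi> + expectation (tail_integral C t) + (K T - K t)"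
proof -
  note SD = driven_solutionD[OF S]
  note XD = has_ito_integralD[OF SD(2,6)]
  have X: "square_integrable M (X s)" if "s \<in> {0..T}" for s by (rule square_martingaleD(2)[OF XD(3) that])
  define J where "J \<omega> = X T \<omega> - X t \<omega>" for \<omega>
  have J: "integrable M J"
    unfolding J_def by (rule square_integrable_integrable[OF square_integrable_diff[OF X[OF T_in] X[OF t]]])
  have EJ: "expectation J = 0"
    unfolding J_def using square_martingaleD(3)[OF XD(3), of t T "\<lambda>_. 1"] t by simp
  have tl: "square_integrable M (tail_integral C t)" by (rule tail_integral_square_integrable[OF C]) (use t in simp)
  note i = square_integrable_integrable[OF \<xi>_sq] square_integrable_integrable[OF tl] J
  have "expectation (Y t) = expectation (\<lambda>\<omega>. \<xi> \<omega> + tail_integral C t \<omega> - J \<omega> + (K T - K t))"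
  proof (rule integral_cong_AE)
    show "Y t \<in> borel_measurable M" by (rule square_integrableD(1)[OF S2D(3)[OF SD(1) t]])
    show "(\<lambda>\<omega>. \<xi> \<omega> + tail_integral C t \<omega> - J \<omega> + (K T - K t)) \<in> borel_measurable M"
      using i[THEN borel_measurable_integrable] by simp
    show "AE \<omega> in M. Y t \<omega> = \<xi> \<omega> + tail_integral C t \<omega> - J \<omega> + (K T - K t)"
      using SD(7) by eventually_elim (use t in \<open>auto simp: J_def\<close>)
  qed
  also have "\<dots> = expectation \<xi> + expectation (tail_integral C t) - expectation J + (K T - K t)"
    using i by (simp add: prob_space)
  finally show ?thesis using EJ by simp
qed

text \<open>Stability with rate 1 and drivers at distance zero gives equality of \<open>Y\<close>
  and \<open>Z\<close> almost everywhere in \<open>Q\<close>; path continuity upgrades it for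
  \<open>Y\<close>, and means then determine \<open>K\<close>. Allowing drivers that agree only
  almost everywhere is what the fixed point argument provides.\<close>

lemma driven_solution_unique:
  assumes C: "driver C" "driver C'" and ae: "AE x in Q. C x = C' x"
    and S: "driven_solution C Y Z K X" and S': "driven_solution C' Y' Z' K' X'"
  shows "AE \<omega> in M. \<forall>t\<in>{0..T}. Y' t \<omega> = Y t \<omega>" "AE x in Q. Z' (snd x) (fst x) = Z (snd x) (fst x)"
    "\<And>t. t \<in> {0..T} \<Longrightarrow> K' t = K t"
proof -
  note SD = driven_solutionD[OF S] and SD' = driven_solutionD[OF S']
  let ?y = "\<lambda>x. Y (snd x) (fst x) - Y' (snd x) (fst x)" and ?z = "\<lambda>x. Z (snd x) (fst x) - Z' (snd x) (fst x)"
  have y: "square_integrable (weighted 1) ?y"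
    using square_integrable_diff[OF S2_square_integrable_Q[OF SD(1)] S2_square_integrable_Q[OF SD'(1)]]
    by (simp add: square_integrable_weighted)
  have z: "square_integrable (weighted 1) ?z"
    using square_integrable_diff[OF H2_square_integrable_Q[OF SD(2)] H2_square_integrable_Q[OF SD'(2)]]
    by (simp add: square_integrable_weighted)
  have "square_integrable (weighted 1) (\<lambda>x. C x - C' x)"
    using driver_diff[OF C] by (simp add: driver_def square_integrable_weighted)
  moreover have "AE x in weighted 1. C x - C' x = 0" unfolding AE_weighted using ae by eventually_elim simp
  ultimately have "l2_norm (weighted 1) (\<lambda>x. C x - C' x) = 0" by (simp add: l2_norm_eq_0_iff)
  then have "(l2_norm (weighted 1) ?y)\<^sup>2 + (l2_norm (weighted 1) ?z)\<^sup>2 \<le> 0"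
    using driven_stability[OF C S S' order_refl] by simp
  then have "l2_norm (weighted 1) ?y = 0" "l2_norm (weighted 1) ?z = 0"
    by (simp_all add: sum_power2_le_zero_iff)
  then have Yae: "AE x in Q. ?y x = 0" and Zae: "AE x in Q. ?z x = 0"
    using l2_norm_eq_0_iff[OF y] l2_norm_eq_0_iff[OF z] by (simp_all only: AE_weighted)
  show "AE x in Q. Z' (snd x) (fst x) = Z (snd x) (fst x)" using Zae by eventually_elim simp
  \<comment> \<open>For almost every path the sections agree at almost every time, and both paths
    are continuous.\<close>
  show Yeq: "AE \<omega> in M. \<forall>t\<in>{0..T}. Y' t \<omega> = Y t \<omega>"
    using Qp.AE_pair[OF Yae] AE_space
  proof eventually_elim
    case (elim \<omega>)
    have "Y t \<omega> - Y' t \<omega> = 0" if "t \<in> {0..T}" for t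
    proof (rule continuous_AE_zero[OF _ _ that])
      show "continuous_on {0..T} (\<lambda>t. Y t \<omega> - Y' t \<omega>)"
        by (intro continuous_on_diff S2D(2)[OF SD(1) elim(2)] S2D(2)[OF SD'(1) elim(2)])
      show "AE t in L. Y t \<omega> - Y' t \<omega> = 0" using elim(1) by simp
    qed
    then show ?case by simp
  qed
  have kk: "K T - K t = K' T - K' t" if t: "t \<in> {0..T}" for t
  proof -
    have "expectation (Y t) = expectation (Y' t)"
    proof (rule integral_cong_AE)
      show "AE \<omega> in M. Y t \<omega> = Y' t \<omega>" using Yeq by eventually_elim (use t in simp)
    qed (rule square_integrableD(1)[OF S2D(3)[OF SD(1) t]] square_integrableD(1)[OF S2D(3)[OF SD'(1) t]])+
    moreover have "expectation (tail_integral C t) = expectation (tail_integral C' t)"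
    proof (rule integral_cong_AE)
      show "AE \<omega> in M. tail_integral C t \<omega> = tail_integral C' t \<omega>"
        using tail_integral_cong[OF C ae] by eventually_elim (use t in simp)
    qed (use t tail_integral_square_integrable[OF C(1)] tail_integral_square_integrable[OF C(2)] in \<open>auto dest: square_integrableD\<close>)
    ultimately show ?thesis
      using driven_solution_expectation[OF C(1) S t] driven_solution_expectation[OF C(2) S' t] by simp
  qed
  have KT: "K T = K' T" using kk[of 0] SD(5) SD'(5) T_pos by simp
  show "K' t = K t" if "t \<in> {0..T}" for t
    using kk[OF that] unfolding KT by simp
qed

text \<open>Picard iteration on drivers, with solutions chosen arbitrarily. The progressive algebra
  enters \<open>Riesz_Fischer\<close> as the subalgebra of the weighted space, so the limit is again
  a driver.\<close>

lemma fixed_point_exists: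
  assumes f: "standard_generator M F T f"
  shows "\<exists>Y Z K X. driven_solution (drift f Y Z) Y Z K X"
proof -
  obtain YY ZZ KK XX where S: "\<And>C. driver C \<Longrightarrow> driven_solution C (YY C) (ZZ C) (KK C) (XX C)"
    using driven_solution_exists by metis
  obtain \<beta> where \<beta>: "1 \<le> \<beta>" and contr: "\<And>C Y Z K X C' Y' Z' K' X'.
    driver C \<Longrightarrow> driver C' \<Longrightarrow> driven_solution C Y Z K X \<Longrightarrow> driven_solution C' Y' Z' K' X' \<Longrightarrow>
    l2_norm (weighted \<beta>) (\<lambda>x. drift f Y Z x - drift f Y' Z' x) \<le> 1/2 * l2_norm (weighted \<beta>) (\<lambda>x. C x - C' x)"
    using drift_contraction[OF f] by blast
  define \<Phi> where "\<Phi> C = drift f (YY C) (ZZ C)" for C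
  have \<Phi>d: "driver (\<Phi> C)" if "driver C" for C
    unfolding \<Phi>_def by (rule drift_driver[OF f driven_solutionD(1,2)[OF S[OF that]]])
  have \<Phi>c: "l2_norm (weighted \<beta>) (\<lambda>x. \<Phi> C x - \<Phi> C' x) \<le> 1/2 * l2_norm (weighted \<beta>) (\<lambda>x. C x - C' x)"
    if "driver C" "driver C'" for C C'
    unfolding \<Phi>_def by (rule contr[OF that S[OF that(1)] S[OF that(2)]])
  \<comment> \<open>The contraction factor 1/2 makes the iterates fast Cauchy in exactly the form
    that \<open>Riesz_Fischer\<close> takes.\<close>
  define c where "c n = (\<Phi> ^^ n) (\<lambda>_. 0)" for n
  have cS: "c (Suc n) = \<Phi> (c n)" for n by (simp add: c_def)
  have cd: "driver (c n)" for n
    by (induction n) (simp_all add: cS \<Phi>d, simp add: c_def driver_def)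
  have sw: "square_integrable (weighted \<beta>) C" if "driver C" for C
    using that \<beta> by (simp add: square_integrable_weighted driver_def)
  define A where "A = l2_norm (weighted \<beta>) (\<lambda>x. c 1 x - c 0 x)"
  have le: "l2_norm (weighted \<beta>) (\<lambda>x. c (Suc k) x - c k x) \<le> A * (1/2) ^ k" for k
  proof (induction k)
    case (Suc k)
    have "l2_norm (weighted \<beta>) (\<lambda>x. c (Suc (Suc k)) x - c (Suc k) x) \<le> 1/2 * l2_norm (weighted \<beta>) (\<lambda>x. c (Suc k) x - c k x)"
      using \<Phi>c[OF cd[of "Suc k"] cd[of k]] by (simp add: cS)
    also have "\<dots> \<le> 1/2 * (A * (1/2) ^ k)" by (intro mult_left_mono Suc.IH) simp
    finally show ?case by simp
  qed (simp add: A_def)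
  obtain g where gm: "g \<in> borel_measurable Prog" and gs: "square_integrable (weighted \<beta>) g"
    and lim: "(\<lambda>k. l2_norm (weighted \<beta>) (\<lambda>x. c k x - g x)) \<longlonglongrightarrow> 0"
  proof (rule Riesz_Fischer[of "weighted \<beta>" Prog c A])
    show "subalgebra (weighted \<beta>) Prog" using subalgebra_Prog by (simp add: subalgebra_def sets_weighted)
    show "c k \<in> borel_measurable Prog" for k using cd[of k] by (simp add: driver_def)
  qed (use sw cd le in \<open>auto simp: A_def\<close>)
  have gd: "driver g" using gm gs \<beta> by (simp add: driver_def square_integrable_weighted)
  have "l2_norm (weighted \<beta>) (\<lambda>x. g x - \<Phi> g x) \<le> 0"
  proof (rule LIMSEQ_le_const)
    show "(\<lambda>k. l2_norm (weighted \<beta>) (\<lambda>x. c (Suc k) x - g x) + 1/2 * l2_norm (weighted \<beta>) (\<lambda>x. c k x - g x)) \<longlonglongrightarrow> 0"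
      using tendsto_add[OF LIMSEQ_Suc[OF lim] tendsto_mult_left[OF lim, of "1/2"]] by simp
    have "l2_norm (weighted \<beta>) (\<lambda>x. g x - \<Phi> g x)
        \<le> l2_norm (weighted \<beta>) (\<lambda>x. c (Suc k) x - g x) + 1/2 * l2_norm (weighted \<beta>) (\<lambda>x. c k x - g x)" for k
    proof -
      have "l2_norm (weighted \<beta>) (\<lambda>x. g x - \<Phi> g x)
          \<le> l2_norm (weighted \<beta>) (\<lambda>x. g x - c (Suc k) x) + l2_norm (weighted \<beta>) (\<lambda>x. c (Suc k) x - \<Phi> g x)"
        by (rule l2_norm_dist_triangle[OF sw[OF gd] sw[OF cd] sw[OF \<Phi>d[OF gd]]])
      also have "l2_norm (weighted \<beta>) (\<lambda>x. g x - c (Suc k) x) = l2_norm (weighted \<beta>) (\<lambda>x. c (Suc k) x - g x)"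
        by (rule l2_norm_minus_commute)
      finally show ?thesis using \<Phi>c[OF cd[of k] gd] unfolding cS by linarith
    qed
    then show "\<exists>N. \<forall>n\<ge>N. l2_norm (weighted \<beta>) (\<lambda>x. g x - \<Phi> g x)
        \<le> l2_norm (weighted \<beta>) (\<lambda>x. c (Suc n) x - g x) + 1/2 * l2_norm (weighted \<beta>) (\<lambda>x. c n x - g x)" by blast
  qed
  then have "l2_norm (weighted \<beta>) (\<lambda>x. g x - \<Phi> g x) = 0" using l2_norm_nonneg order_antisym by blast
  then have "AE x in weighted \<beta>. g x - \<Phi> g x = 0"
    using l2_norm_eq_0_iff[OF square_integrable_diff[OF sw[OF gd] sw[OF \<Phi>d[OF gd]]]] by simp
  then have "AE x in Q. g x = \<Phi> g x" by (simp add: AE_weighted)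
  \<comment> \<open>The limit \<open>g\<close> equals \<open>\<Phi> g\<close> only almost
    everywhere, so the solution driven by \<open>g\<close> is transferred to the driver
    \<open>\<Phi> g\<close>, which is its own drift.\<close>
  from driven_solution_cong[OF gd \<Phi>d[OF gd] this S[OF gd]]
  show ?thesis unfolding \<Phi>_def by blast
qed

text \<open>For two fixed points the contraction bounds the norm of the difference of drifts by half
  of itself, so it vanishes.\<close>

lemma fixed_point_unique:
  assumes f: "standard_generator M F T f"
    and S: "driven_solution (drift f Y Z) Y Z K X" and S': "driven_solution (drift f Y' Z') Y' Z' K' X'"
  shows "AE x in Q. drift f Y Z x = drift f Y' Z' x"
proof -
  obtain \<beta> where \<beta>: "1 \<le> \<beta>" and contr: "\<And>C Y Z K X C' Y' Z' K' X'.
    driver C \<Longrightarrow> driver C' \<Longrightarrow> driven_solution C Y Z K X \<Longrightarrow> driven_solution C' Y' Z' K' X' \<Longrightarrow>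
    l2_norm (weighted \<beta>) (\<lambda>x. drift f Y Z x - drift f Y' Z' x) \<le> 1/2 * l2_norm (weighted \<beta>) (\<lambda>x. C x - C' x)"
    using drift_contraction[OF f] by blast
  note d = drift_driver[OF f driven_solutionD(1,2)[OF S]] and d' = drift_driver[OF f driven_solutionD(1,2)[OF S']]
  let ?D = "\<lambda>x. drift f Y Z x - drift f Y' Z' x"
  have sq: "square_integrable (weighted \<beta>) ?D"
    using driver_diff[OF d d'] \<beta> by (simp add: square_integrable_weighted driver_def)
  have "l2_norm (weighted \<beta>) ?D = 0"
    using contr[OF d d' S S'] l2_norm_nonneg[of "weighted \<beta>" ?D] by linarith
  then have "AE x in weighted \<beta>. ?D x = 0" using l2_norm_eq_0_iff[OF sq] by simp
  then show ?thesis by (simp add: AE_weighted)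
qed

end

theorem theorem5:
  fixes M :: "'a measure" and T :: real and B :: "real \<Rightarrow> 'a \<Rightarrow> real ^ 'd"
    and F :: "real \<Rightarrow> 'a measure" and f :: "'a \<Rightarrow> real \<Rightarrow> real \<Rightarrow> real ^ 'd \<Rightarrow> real"
    and u :: "real \<Rightarrow> real" and \<xi> :: "'a \<Rightarrow> real"
  assumes "T > 0"
    and "prob_space M" and "complete_measure M"
    and "standard_brownian_motion M T B"
    and "F = augmented_filtration M B"
    and "standard_generator M F T f"
    and "continuous_on {0..T} u"
    and "\<xi> \<in> borel_measurable (F T)" and "integrable M (\<lambda>\<omega>. (\<xi> \<omega>)\<^sup>2)"
    and "integral\<^sup>L M \<xi> \<ge> u T"
  shows "\<exists>Y Z K.
    mean_reflected_solution M F T B f u \<xi> Y Z K \<and> flatness_condition M T u Y K \<and>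
    (\<forall>Y' Z' K'. mean_reflected_solution M F T B f u \<xi> Y' Z' K' \<and> flatness_condition M T u Y' K' \<longrightarrow>
      (AE \<omega> in M. \<forall>t\<in>{0..T}. Y' t \<omega> = Y t \<omega>) \<and>
      (AE (\<omega>, t) in M \<Otimes>\<^sub>M restrict_space lborel {0..T}. Z' t \<omega> = Z t \<omega>) \<and>
      (\<forall>t\<in>{0..T}. K' t = K t))"
proof -
  interpret prob_space M by fact
  interpret brownian M T B F by (intro brownian.intro brownian_axioms.intro) fact+
  interpret reflected_bsde M T B F u \<xi>
  proof (intro reflected_bsde.intro reflected_bsde_axioms.intro)
    show "brownian M T B F" by unfold_locales
    show "square_integrable M \<xi>"
      using measurable_F_imp[OF assms(8) order_refl] assms(9) by (simp add: square_integrable_def)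
  qed fact+
  note f = assms(6)
  obtain Y Z K X where S: "driven_solution (drift f Y Z) Y Z K X" using fixed_point_exists[OF f] by blast
  have "(AE \<omega> in M. \<forall>t\<in>{0..T}. Y' t \<omega> = Y t \<omega>) \<and> (AE (\<omega>, t) in Q. Z' t \<omega> = Z t \<omega>) \<and> (\<forall>t\<in>{0..T}. K' t = K t)"
    if "driven_solution (drift f Y' Z') Y' Z' K' X'" for Y' Z' K' X'
    using driven_solution_unique[OF _ _ fixed_point_unique[OF f S that] S that]
      drift_driver[OF f driven_solutionD(1,2)[OF S]] drift_driver[OF f driven_solutionD(1,2)[OF that]]
    by (simp add: case_prod_unfold)
  moreover have "mean_reflected_solution M F T B f u \<xi> Y Z K \<and> flatness_condition M T u Y K"
    using S mean_reflected_iff by blast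
  ultimately show ?thesis using mean_reflected_iff by blast
qed

end
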